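(* Let $T$ be a nontrivial finite metric tree of length $L=|T|$, diameter $D$, and metric radius $\rho=D/2$. For every $r$ satisfying $$0<r\le L-\rho=L-\frac D2,$$ there is a probability measure $\nu$ on $\mathcal C(T,0)$ such that $E_\nu\le \frac{L}{r}\,U[0,r]$.
   Context: A finite metric tree is the metric realization of a finite combinatorial tree whose edges have positive lengths; it is nontrivial if it is not a single point. $|T|$ is the total edge length, $d_T$ the path metric, and $B_T(v,s)=\{x\in T: d_T(x,v)\le s\}$. The diameter is $\max_{x,y\in T}d_T(x,y)$ and the metric radius is $\min_{v\in T}\max_{x\in T}d_T(v,x)$; for a nontrivial finite metric tree the metric radius equals half the diameter. For $m\ge1$, a tuple $\mathbf r=(r_1,\dots,r_m)\in\mathbb R_{\ge0}^m$ is a cover of $T$ if there are $v_1,\dots,v_m\in T$ with $T\subseteq\bigcup_i B_T(v_i,r_i)$; $\mathcal C_m(T)$ is the set of such tuples, $\mathcal C(T)=\bigsqcup_{m\ge1}\mathcal C_m(T)$ with the disjoint-union Borel structure, and $\mathcal C(T,0)=\{\mathbf r\in\mathcal C(T):\sum_i r_i\le|T|\}$. For a finite Borel measure $\nu$ on $\mathcal C(T)$, $E_\nu(A)=\int|\{i:r_i\in A\}|\,d\nu(\mathbf r)$ for Borel $A\subseteq\mathbb R_{\ge0}$. For positive Borel measures, $\mu\le\mu'$ means $\mu(A)\le\mu'(A)$ for all Borel $A$. $U[0,r]$ is the uniform probability measure on $[0,r]$, viewed as a measure on $\mathbb R_{\ge0}$. *)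

theory Defs
  imports "HOL-Probability.Probability"
begin

record 'v weighted_graph =
  verts :: "'v set"
  edges :: "'v set set"
  len :: "'v set \<Rightarrow> real"

definition connected_graph :: "('v, 'z) weighted_graph_scheme \<Rightarrow> bool" where
  "connected_graph G \<longleftrightarrow>
     (\<forall>u\<in>verts G. \<forall>v\<in>verts G. (\<lambda>a b. {a, b} \<in> edges G)\<^sup>*\<^sup>* u v)"

definition acyclic_graph :: "('v, 'z) weighted_graph_scheme \<Rightarrow> bool" where
  "acyclic_graph G \<longleftrightarrow>
     \<not> (\<exists>p. length p \<ge> 3 \<and> distinct p \<and> successively (\<lambda>a b. {a, b} \<in> edges G) p
          \<and> {last p, hd p} \<in> edges G)"

definition finite_weighted_tree :: "('v, 'z) weighted_graph_scheme \<Rightarrow> bool" where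
  "finite_weighted_tree G \<longleftrightarrow>
     finite (verts G) \<and> verts G \<noteq> {} \<and>
     (\<forall>e\<in>edges G. e \<subseteq> verts G \<and> card e = 2 \<and> 0 < len G e) \<and>
     connected_graph G \<and> acyclic_graph G"

text \<open>
  Points of the metric realization are given by barycentric coordinates: a point is a function on
  vertices supported on a single vertex or on a single edge, with nonnegative values adding up to 1.
  The vertex \<open>v\<close> is the indicator function of \<open>{v}\<close>; the point of the edge \<open>{u, v}\<close> at distance
  \<open>t\<close> from \<open>u\<close> along the edge has \<open>v\<close>-coordinate \<open>t / len {u, v}\<close>.
\<close>

definition cell :: "'v set \<Rightarrow> ('v \<Rightarrow> real) set" where
  "cell \<sigma> = {x. (\<forall>v. 0 \<le> x v) \<and> (\<forall>v. v \<notin> \<sigma> \<longrightarrow> x v = 0) \<and> (\<Sum>v\<in>\<sigma>. x v) = 1}"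

definition points :: "('v, 'z) weighted_graph_scheme \<Rightarrow> ('v \<Rightarrow> real) set" where
  "points G = (\<Union>v\<in>verts G. cell {v}) \<union> (\<Union>e\<in>edges G. cell e)"

text \<open>
  On one edge \<open>e = {u, v}\<close> both \<open>\<bar>x u - y u\<bar>\<close> and \<open>\<bar>x v - y v\<bar>\<close> are the distance divided by
  \<open>len e\<close>, whence the factor 1/2.
\<close>

definition edge_dist ::
    "('v, 'z) weighted_graph_scheme \<Rightarrow> 'v set \<Rightarrow> ('v \<Rightarrow> real) \<Rightarrow> ('v \<Rightarrow> real) \<Rightarrow> real" where
  "edge_dist G e x y = len G e / 2 * (\<Sum>v\<in>e. \<bar>x v - y v\<bar>)"

text \<open>
  \<open>path_of_length G x y s\<close>: there is a polygonal path from \<open>x\<close> to \<open>y\<close> of length \<open>s\<close>, that is, a finite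
  concatenation of segments each of which lies in one closed edge. The path metric is the infimum
  of these lengths.
\<close>

inductive path_of_length ::
    "('v, 'z) weighted_graph_scheme \<Rightarrow> ('v \<Rightarrow> real) \<Rightarrow> ('v \<Rightarrow> real) \<Rightarrow> real \<Rightarrow> bool"
  for G where
  path_refl: "x \<in> points G \<Longrightarrow> path_of_length G x x 0"
| path_step: "\<lbrakk>path_of_length G x y s; e \<in> edges G; y \<in> cell e; z \<in> cell e\<rbrakk>
    \<Longrightarrow> path_of_length G x z (s + edge_dist G e y z)"

definition tdist :: "('v, 'z) weighted_graph_scheme \<Rightarrow> ('v \<Rightarrow> real) \<Rightarrow> ('v \<Rightarrow> real) \<Rightarrow> real" where
  "tdist G x y = Inf {s. path_of_length G x y s}"

definition tball :: "('v, 'z) weighted_graph_scheme \<Rightarrow> ('v \<Rightarrow> real) \<Rightarrow> real \<Rightarrow> ('v \<Rightarrow> real) set" where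
  "tball G v s = {x \<in> points G. tdist G x v \<le> s}"

definition total_length :: "('v, 'z) weighted_graph_scheme \<Rightarrow> real" where
  "total_length G = (\<Sum>e\<in>edges G. len G e)"

text \<open>
  The realization of a finite tree is compact, so the suprema and the infimum below are attained.
\<close>

definition tdiameter :: "('v, 'z) weighted_graph_scheme \<Rightarrow> real" where
  "tdiameter G = (SUP (x, y) \<in> points G \<times> points G. tdist G x y)"

definition metric_radius :: "('v, 'z) weighted_graph_scheme \<Rightarrow> real" where
  "metric_radius G = (INF v\<in>points G. SUP x\<in>points G. tdist G v x)"

text \<open>
  An \<open>m\<close>-tuple is an extensional function on \<open>{..<m}\<close>, and an element of the disjoint union over
  \<open>m\<close> is a pair \<open>(m, r)\<close>.
\<close>

definition covers_of_size :: "('v, 'z) weighted_graph_scheme \<Rightarrow> nat \<Rightarrow> (nat \<Rightarrow> real) set" where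
  "covers_of_size G m =
     {r \<in> {..<m} \<rightarrow>\<^sub>E {0..}.
        \<exists>v. (\<forall>i<m. v i \<in> points G) \<and> points G \<subseteq> (\<Union>i<m. tball G (v i) (r i))}"

definition covers :: "('v, 'z) weighted_graph_scheme \<Rightarrow> (nat \<times> (nat \<Rightarrow> real)) set" where
  "covers G = (SIGMA m:{1..}. covers_of_size G m)"

definition short_covers :: "('v, 'z) weighted_graph_scheme \<Rightarrow> (nat \<times> (nat \<Rightarrow> real)) set" where
  "short_covers G = {(m, r) \<in> covers G. (\<Sum>i<m. r i) \<le> total_length G}"

text \<open>
  A set of covers is measurable iff its part in each \<open>covers_of_size G m\<close> is Borel for the subspace
  structure from the \<open>m\<close>-dimensional product of the reals. The family below is already a
  sigma-algebra; see \<open>sets_cover_space\<close>.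
\<close>

definition cover_space :: "('v, 'z) weighted_graph_scheme \<Rightarrow> (nat \<times> (nat \<Rightarrow> real)) measure" where
  "cover_space G = sigma (covers G)
     {A. A \<subseteq> covers G \<and>
         (\<forall>m\<ge>1. Pair m -` A \<in> sets (restrict_space (\<Pi>\<^sub>M i\<in>{..<m}. borel) (covers_of_size G m)))}"

lemma space_cover_space: "space (cover_space G) = covers G"
  unfolding cover_space_def by (rule space_measure_of) auto

lemma sets_cover_space:
  "sets (cover_space G) =
     {A. A \<subseteq> covers G \<and>
         (\<forall>m\<ge>1. Pair m -` A \<in> sets (restrict_space (\<Pi>\<^sub>M i\<in>{..<m}. borel) (covers_of_size G m)))}"
  (is "_ = ?S")
proof -
  have space: "space (restrict_space (\<Pi>\<^sub>M i\<in>{..<m}. (borel :: real measure)) (covers_of_size G m))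
      = covers_of_size G m" for m
    by (auto simp: space_restrict_space space_PiM covers_of_size_def)
  have "sigma_algebra (covers G) ?S"
    unfolding sigma_algebra_iff2
  proof (intro conjI ballI allI impI)
    fix A assume A: "A \<in> ?S"
    have "Pair m -` (covers G - A) = covers_of_size G m - Pair m -` A" if "m \<ge> 1" for m
      using that by (auto simp: covers_def)
    moreover have "covers_of_size G m - Pair m -` A
        \<in> sets (restrict_space (\<Pi>\<^sub>M i\<in>{..<m}. borel) (covers_of_size G m))" if "m \<ge> 1" for m
      using A that sets.compl_sets[of "Pair m -` A"
          "restrict_space (\<Pi>\<^sub>M i\<in>{..<m}. (borel :: real measure)) (covers_of_size G m)"]
      by (simp add: space)
    ultimately show "covers G - A \<in> ?S" by auto
  next
    fix A :: "nat \<Rightarrow> (nat \<times> (nat \<Rightarrow> real)) set" assume "range A \<subseteq> ?S"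
    then show "(\<Union>i. A i) \<in> ?S" by (auto simp: vimage_UN)
  qed auto
  then show ?thesis
    unfolding cover_space_def
    by (subst sets_measure_of) (auto simp: sigma_algebra.sigma_sets_eq)
qed

definition expected_count :: "(nat \<times> (nat \<Rightarrow> real)) measure \<Rightarrow> real set \<Rightarrow> ennreal" where
  "expected_count \<nu> A = (\<integral>\<^sup>+ (m, r). of_nat (card {i. i < m \<and> r i \<in> A}) \<partial>\<nu>)"

end

theory Submission
  imports Defs
begin

text \<open>
  Let \<open>c = L / r\<^sup>2\<close>. The measure \<open>L / r\<close> times \<open>U[0, r]\<close> has density \<open>c\<close> on \<open>[0, r]\<close>, so a random
  cover is wanted that uses, in expectation, at most \<open>c (\<beta> - \<alpha>)\<close> balls with radius in \<open>(\<alpha>, \<beta>)\<close>.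
  This is a statement about averages, and by linear programming duality it is enough to answer
  every price list: if a ball of radius \<open>t\<close> costs \<open>\<gamma> t\<close>, then some cover costs at most the
  integral of \<open>c \<gamma>\<close> over \<open>[0, r]\<close>. The proof has four parts.

  Discretization. The tree is replaced by the finite set of the points that divide its edges into
  short pieces of almost equal length, with distances counted in pieces. Such a metric is
  determined by few axioms (\<open>tree_metric\<close>). A ball is replaced by a set of diameter at most \<open>b\<close>,
  the size of the ball; in a tree such a set lies in a ball of radius about \<open>b / 2\<close>. Sizes run up
  to \<open>R\<close>, about twice \<open>r\<close>, and the hypothesis \<open>r \<le> L - D / 2\<close> becomes \<open>R \<le> 2 L - D\<close>.

  Price lists. Since a ball may be enlarged, prices may be assumed nondecreasing. Let \<open>G k\<close> be the
  integral of the price \<open>g\<close> over \<open>[0, k]\<close>. Shrinking \<open>R\<close> to the point where \<open>G k / k\<^sup>2\<close> is minimal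
  and rescaling gives \<open>G k \<ge> k\<^sup>2 / 2\<close> for all \<open>k\<close> with equality at \<open>R\<close> (\<open>contact_level\<close>). What
  remains is the heart of the matter, \<open>cheap_tree\<close>: a tree with \<open>L\<close> edges, \<open>L \<ge> R\<close>, has a cover of
  price at most \<open>\<kappa> L\<close>, for each \<open>\<kappa> > 1\<close>. In a minimal counterexample no part can be split off
  cheaply. Single balls and, if no three points have pairwise distances above \<open>R\<close>, pairs of balls
  of varying sizes are cheap on average. Otherwise the tree is a tripod: three long arms meet at a
  vertex \<open>v\<close>, and each is a path with short twigs. A ball that contains one of these paths and
  reaches past \<open>v\<close> to a depth \<open>z\<close> in the other arms, with one ball at the end of each other arm,
  covers everything but some twigs. These are paid for separately, and as \<open>z\<close> varies each vertex
  of a twig is paid for during at most two intervals of length 1. Integrating over the parameter,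
  and adding suitable multiples of the resulting inequalities for the three arms, contradicts the
  bounds on \<open>G\<close> (\<open>tripod.contradiction\<close>).

  Balanced covers. Answering the price lists one by one, always with prices proportional to the
  current excess, yields a finite list of covers whose average counts exceed the target
  arbitrarily little (\<open>average_lists\<close>). Each of the covers can be pruned so that its radii add up
  to at most \<open>L\<close> (\<open>prune\<close>): a ball of size \<open>b\<close> put at the far end of a tree removes a part of
  length more than \<open>b / 2\<close>.

  Limit. Refining the discretization gives random covers of the metric tree that satisfy all
  requirements up to an error tending to 0 (\<open>approximate_covers\<close>). The mean number of balls stays
  bounded, so a subsequence converges in distribution, and by Skorohod's theorem even pointwise
  (\<open>limit_measure\<close>). Covers form a closed set because the tree is compact, and the expected counts
  pass to the limit by Fatou's lemma, for open intervals and then for Borel sets.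
\<close>

section \<open>Metrics of finite trees with unit edges\<close>

text \<open>
  The vertex sets of finite trees with edges of length 1 are exactly the finite metric spaces with
  integer distances in which geodesics exist (\<open>d_step\<close>), cycles have even length (\<open>d_even\<close>), and
  the four point condition holds. This description is inherited by subtrees and does not mention
  edges.
\<close>
locale tree_metric =
  fixes V :: "'b set" and d :: "'b \<Rightarrow> 'b \<Rightarrow> nat"
  assumes fin: "finite V" and ne: "V \<noteq> {}"
    and d_0_iff: "\<lbrakk>x \<in> V; y \<in> V\<rbrakk> \<Longrightarrow> d x y = 0 \<longleftrightarrow> x = y"
    and d_sym: "\<lbrakk>x \<in> V; y \<in> V\<rbrakk> \<Longrightarrow> d x y = d y x"
    and d_tri: "\<lbrakk>x \<in> V; y \<in> V; z \<in> V\<rbrakk> \<Longrightarrow> d x z \<le> d x y + d y z"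
    and d_step: "\<lbrakk>x \<in> V; y \<in> V; x \<noteq> y\<rbrakk> \<Longrightarrow> \<exists>z\<in>V. d x z = 1 \<and> d x y = Suc (d z y)"
    and d_even: "\<lbrakk>x \<in> V; y \<in> V; z \<in> V\<rbrakk> \<Longrightarrow> even (d x y + d y z + d x z)"
    and four_point: "\<lbrakk>x \<in> V; y \<in> V; z \<in> V; w \<in> V\<rbrakk>
      \<Longrightarrow> d x y + d z w \<le> max (d x z + d y w) (d x w + d y z)"
begin

text \<open>
  The Gromov product: the length of the common part of the paths from \<open>v\<close> to \<open>x\<close> and to \<open>y\<close>. The
  division by 2 is exact by \<open>d_even\<close>.
\<close>
definition gp :: "'b \<Rightarrow> 'b \<Rightarrow> 'b \<Rightarrow> nat" where
  "gp v x y = (d v x + d v y - d x y) div 2"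

lemma d_self [simp]: "x \<in> V \<Longrightarrow> d x x = 0"
  using d_0_iff by blast

lemma gp_eq:
  assumes "v \<in> V" "x \<in> V" "y \<in> V"
  shows "2 * gp v x y + d x y = d v x + d v y"
proof -
  have "d x y \<le> d v x + d v y" using d_tri[of x v y] d_sym[of x v] assms by simp
  moreover have "even (d v x + d x y + d v y)" using d_even assms by blast
  ultimately show ?thesis unfolding gp_def by presburger
qed

lemma gp_commute: "\<lbrakk>v \<in> V; x \<in> V; y \<in> V\<rbrakk> \<Longrightarrow> gp v x y = gp v y x"
  using d_sym[of x y] by (simp add: gp_def add.commute)

lemma gp_le1: "\<lbrakk>v \<in> V; x \<in> V; y \<in> V\<rbrakk> \<Longrightarrow> gp v x y \<le> d v x"
  using gp_eq[of v x y] d_tri[of v x y] by simp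

lemma gp_le2: "\<lbrakk>v \<in> V; x \<in> V; y \<in> V\<rbrakk> \<Longrightarrow> gp v x y \<le> d v y"
  using gp_le1[of v y x] by (simp add: gp_commute)

text \<open>
  The four point condition says that, for a fixed base point, the Gromov product is an ultrametric
  similarity. All later statements on branches are instances of this inequality.
\<close>
lemma gp_ultra:
  assumes "v \<in> V" "x \<in> V" "y \<in> V" "z \<in> V"
  shows "min (gp v x y) (gp v y z) \<le> gp v x z"
proof -
  have "d x z + d v y \<le> max (d x v + d z y) (d x y + d z v)"
    using four_point[of x z v y] assms by simp
  then show ?thesis
    using gp_eq[of v x y] gp_eq[of v y z] gp_eq[of v x z] assms
      d_sym[of x v] d_sym[of z y] d_sym[of z v] by simp
qed

lemma gp_eq_of_less:
  assumes "v \<in> V" "x \<in> V" "y \<in> V" "z \<in> V" "gp v x y < gp v y z"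
  shows "gp v x z = gp v x y"
proof -
  have "min (gp v x y) (gp v y z) \<le> gp v x z" "min (gp v x z) (gp v z y) \<le> gp v x y"
    using gp_ultra assms by blast+
  then show ?thesis using assms(5) gp_commute[of v z y] assms by (simp add: min_def split: if_splits)
qed

lemma geodesic_point:
  assumes "x \<in> V" "y \<in> V" "q \<le> d x y"
  shows "\<exists>p\<in>V. d x p = q \<and> d p y = d x y - q"
  using assms(3)
proof (induction q)
  case 0 then show ?case using assms by (intro bexI[of _ x]) auto
next
  case (Suc q)
  then obtain p where p: "p \<in> V" "d x p = q" "d p y = d x y - q" by auto
  have "p \<noteq> y" using p Suc.prems assms by auto
  then obtain z where z: "z \<in> V" "d p z = 1" "d p y = Suc (d z y)" using d_step p(1) assms(2) by blast
  have "d x z \<le> d x p + d p z" "d x y \<le> d x z + d z y" using d_tri assms p z by blast+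
  then have "d x z = Suc q" "d z y = d x y - Suc q" using p z by auto
  then show ?case using z by blast
qed

lemma between_gp:
  assumes "v \<in> V" "x \<in> V" "z \<in> V"
  shows "d v z + d z x = d v x \<longleftrightarrow> gp v z x = d v z"
  using gp_eq[of v z x] d_sym[of x z] d_tri[of v z x] assms by auto

text \<open>
  A point on the path from \<open>x\<close> to \<open>y\<close> lies on one of the paths from \<open>v\<close> to \<open>x\<close> and from \<open>v\<close> to
  \<open>y\<close>.
\<close>
lemma between_cases:
  assumes "v \<in> V" "x \<in> V" "y \<in> V" "z \<in> V" "d x z + d z y = d x y"
  shows "d v z + d z x = d v x \<or> d v z + d z y = d v y"
proof -
  have "d v z + d x y \<le> max (d v x + d z y) (d v y + d z x)"
    using four_point[of v z x y] assms by simp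
  moreover have "d v x \<le> d v z + d z x" "d v y \<le> d v z + d z y" using d_tri assms by blast+
  ultimately show ?thesis using assms(5) d_sym[of x z] assms by (simp add: max_def split: if_splits)
qed

text \<open>
  The subtree below \<open>p\<close> in the tree rooted at \<open>v\<close>.
\<close>
definition desc :: "'b \<Rightarrow> 'b \<Rightarrow> 'b set" where
  "desc v p = {y \<in> V. d v y = d v p + d p y}"

lemma desc_subset: "desc v p \<subseteq> V" by (auto simp: desc_def)
lemma finite_desc [simp]: "finite (desc v p)" using desc_subset fin finite_subset by blast
lemma desc_self: "p \<in> V \<Longrightarrow> p \<in> desc v p" by (simp add: desc_def)

lemma desc_iff_gp:
  assumes "v \<in> V" "p \<in> V" "y \<in> V"
  shows "y \<in> desc v p \<longleftrightarrow> gp v p y = d v p"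
  using between_gp[of v y p] assms by (auto simp: desc_def)

lemma desc_trans:
  assumes "v \<in> V" "p \<in> V" "y \<in> desc v p" "z \<in> desc v y"
  shows "z \<in> desc v p"
proof -
  have V: "y \<in> V" "z \<in> V" using assms desc_subset by blast+
  have "d v z = d v y + d y z" "d v y = d v p + d p y" using assms by (auto simp: desc_def)
  moreover have "d p z \<le> d p y + d y z" "d v z \<le> d v p + d p z" using d_tri assms V by blast+
  ultimately show ?thesis using V by (simp add: desc_def)
qed

lemma desc_depth_less:
  assumes "v \<in> V" "p \<in> V" "y \<in> desc v p" "y \<noteq> p"
  shows "d v p < d v y"
proof -
  have "y \<in> V" "d v y = d v p + d p y" using assms by (auto simp: desc_def)
  then show ?thesis using d_0_iff[of p y] assms by auto
qed

text \<open>
  In a tree, convex and connected mean the same.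
\<close>
definition convx :: "'b set \<Rightarrow> bool" where
  "convx S \<longleftrightarrow> (\<forall>x\<in>S. \<forall>y\<in>S. \<forall>z\<in>V. d x z + d z y = d x y \<longrightarrow> z \<in> S)"

lemma convx_V: "convx V" by (simp add: convx_def)

lemma convx_desc:
  assumes v: "v \<in> V" and p: "p \<in> V"
  shows "convx (desc v p)"
  unfolding convx_def
proof (intro ballI impI)
  fix x y z assume x: "x \<in> desc v p" and y: "y \<in> desc v p" and z: "z \<in> V" and xy: "d x z + d z y = d x y"
  have V: "x \<in> V" "y \<in> V" using x y desc_subset by blast+
  have key: "z \<in> desc v p" if x: "x \<in> desc v p" and y: "y \<in> desc v p" and z: "z \<in> V"
    and xy: "d x z + d z y = d x y" and zx: "d v z + d z x = d v x" for x y
  proof (rule ccontr)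
    assume nz: "z \<notin> desc v p"
    have V: "x \<in> V" "y \<in> V" using x y desc_subset by blast+
    have gx: "gp v z x = d v z" using between_gp[of v x z] zx v z V by simp
    have px: "gp v p x = d v p" and py: "gp v p y = d v p" using desc_iff_gp v p x y V by auto
    have zp: "gp v z p = d v z" and less: "d v z < d v p"
    proof -
      have "min (gp v z x) (gp v x p) \<le> gp v z p" using gp_ultra v z V p by blast
      moreover have "gp v z p \<noteq> d v p" using nz desc_iff_gp[of v p z] gp_commute[of v z p] v p z by auto
      moreover have "gp v z p \<le> d v z" "gp v z p \<le> d v p" using gp_le1 gp_le2 v z p by blast+
      ultimately show "gp v z p = d v z" "d v z < d v p"
        using gx px gp_commute[of v x p] v p V by (auto simp: min_def split: if_splits)
    qed
    have "min (gp v z p) (gp v p y) \<le> gp v z y" using gp_ultra v z V p by blast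
    then have "gp v z y = d v z" using zp py less gp_le1[of v z y] v z V by auto
    then have zy: "d v z + d z y = d v y" using between_gp[of v y z] v z V by simp
    have "d x y \<le> d x p + d p y" using d_tri V p by blast
    moreover have "d v x = d v p + d p x" "d v y = d v p + d p y" using x y by (auto simp: desc_def)
    moreover have "d x z = d z x" "d x p = d p x" using d_sym V z p by auto
    ultimately show False using xy zx zy less by simp
  qed
  from between_cases[of v x y z] v V z xy have "d v z + d z x = d v x \<or> d v z + d z y = d v y" by blast
  then show "z \<in> desc v p"
  proof
    assume "d v z + d z x = d v x" then show ?thesis using key[of x y] x y z xy by blast
  next
    assume "d v z + d z y = d v y"
    moreover have "d y z + d z x = d y x"
      using xy d_sym[of x z] d_sym[of z y] d_sym[of x y] V z by simp
    ultimately show ?thesis using key[of y x] x y z by blast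
  qed
qed

lemma convx_minus_desc:
  assumes v: "v \<in> V" and p: "p \<in> V"
  shows "convx (V - desc v p)"
  unfolding convx_def
proof (intro ballI impI)
  fix x y z assume x: "x \<in> V - desc v p" and y: "y \<in> V - desc v p" and z: "z \<in> V" and xy: "d x z + d z y = d x y"
  show "z \<in> V - desc v p"
  proof (rule ccontr)
    assume "\<not> ?thesis"
    then have zp: "z \<in> desc v p" using z by blast
    have tr: "u \<in> desc v p" if "d v z + d z u = d v u" "u \<in> V" for u
      using desc_trans[OF v p zp, of u] that by (simp add: desc_def)
    show False using between_cases[of v x y z] v x y z xy tr by blast
  qed
qed

text \<open>
  A connected set contains the path between any two of its points. Hence the diameter of a
  connected set is less than its cardinality, which is how sets are seen to fit into balls.
\<close>
lemma convx_card:
  assumes "convx S" "S \<subseteq> V" "x \<in> S" "y \<in> S"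
  shows "Suc (d x y) \<le> card S"
proof -
  have V: "x \<in> V" "y \<in> V" using assms by blast+
  have "\<forall>q\<in>{..d x y}. \<exists>p\<in>V. d x p = q \<and> d p y = d x y - q" using geodesic_point V by auto
  then obtain f where f: "\<And>q. q \<le> d x y \<Longrightarrow> f q \<in> V \<and> d x (f q) = q \<and> d (f q) y = d x y - q"
    by (metis atMost_iff)
  have "inj_on f {..d x y}" by (intro inj_onI) (metis atMost_iff f)
  moreover have "f ` {..d x y} \<subseteq> S" using f assms unfolding convx_def by fastforce
  ultimately show ?thesis using card_inj_on_le[of f "{..d x y}" S] finite_subset[OF assms(2) fin] by simp
qed

lemma tree_metric_subset:
  assumes "convx S" "S \<subseteq> V" "S \<noteq> {}"
  shows "tree_metric S d"
proof
  show "finite S" using assms fin finite_subset by blast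
  show "S \<noteq> {}" by fact
  have in_V: "\<And>x. x \<in> S \<Longrightarrow> x \<in> V" using assms by blast
  show "d x y = 0 \<longleftrightarrow> x = y" if "x \<in> S" "y \<in> S" for x y by (rule d_0_iff[OF in_V[OF that(1)] in_V[OF that(2)]])
  show "d x y = d y x" if "x \<in> S" "y \<in> S" for x y by (rule d_sym[OF in_V[OF that(1)] in_V[OF that(2)]])
  show "d x z \<le> d x y + d y z" if "x \<in> S" "y \<in> S" "z \<in> S" for x y z by (rule d_tri[OF in_V[OF that(1)] in_V[OF that(2)] in_V[OF that(3)]])
  show "even (d x y + d y z + d x z)" if "x \<in> S" "y \<in> S" "z \<in> S" for x y z by (rule d_even[OF in_V[OF that(1)] in_V[OF that(2)] in_V[OF that(3)]])
  show "d x y + d z w \<le> max (d x z + d y w) (d x w + d y z)" if "x \<in> S" "y \<in> S" "z \<in> S" "w \<in> S" for x y z w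
    by (rule four_point[OF in_V[OF that(1)] in_V[OF that(2)] in_V[OF that(3)] in_V[OF that(4)]])
  show "\<exists>z\<in>S. d x z = 1 \<and> d x y = Suc (d z y)" if xy: "x \<in> S" "y \<in> S" "x \<noteq> y" for x y
  proof -
    obtain z where "z \<in> V" "d x z = 1" "d x y = Suc (d z y)" using d_step[of x y] xy in_V by blast
    moreover from this have "z \<in> S" using assms(1) xy unfolding convx_def by fastforce
    ultimately show ?thesis by blast
  qed
qed

text \<open>
  With respect to the path from \<open>v\<close> to \<open>x\<close> (the spine) a vertex \<open>y\<close> has the position \<open>gp v y x\<close> of
  its projection and a height above the spine. The lemma bounds the distance of two vertices by
  the walk down to the spine, along the spine, and up again.
\<close>
lemma dist_coord:
  assumes V: "v \<in> V" "x \<in> V" "y \<in> V" "y' \<in> V" and le: "gp v y x \<le> gp v y' x"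
  shows "d y y' + 2 * gp v y x \<le> d v y + d v y'"
proof -
  have "min (gp v y x) (gp v x y') \<le> gp v y y'" using gp_ultra V by blast
  then have "gp v y x \<le> gp v y y'" using le gp_commute[of v x y'] V by simp
  then show ?thesis using gp_eq[of v y y'] V by simp
qed

end

lemma tree_metric_singleton: "tree_metric {a} (\<lambda>_ _. 0)"
  by unfold_locales auto

text \<open>
  Replacing the new leaf \<open>x\<close> by its neighbour \<open>u\<close> (the map \<open>f\<close>) and adding 1 for each occurrence
  of \<open>x\<close> (the function \<open>e\<close>) expresses the new distances between different points by the old ones,
  so each axiom reduces to the same axiom for the old tree, except where arguments coincide.
\<close>
lemma tree_metric_add_leaf:
  assumes "tree_metric V d" and u: "u \<in> V" and x: "x \<notin> V"
    and old: "\<And>a b. a \<in> V \<Longrightarrow> b \<in> V \<Longrightarrow> d' a b = d a b"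
    and new: "\<And>a. a \<in> V \<Longrightarrow> d' x a = Suc (d u a)" "\<And>a. a \<in> V \<Longrightarrow> d' a x = Suc (d u a)"
    and xx: "d' x x = 0"
  shows "tree_metric (insert x V) d'"
proof -
  interpret tree_metric V d by fact
  define f where "f a = (if a = x then u else a)" for a
  define e :: "'a \<Rightarrow> nat" where "e a = (if a = x then 1 else 0)" for a
  have fV: "f a \<in> V" if "a \<in> insert x V" for a using that u x by (auto simp: f_def)
  have self': "d' p p = 0" if "p \<in> insert x V" for p
    using that old xx d_self by (cases "p = x") auto
  have D: "d' a b = d (f a) (f b) + e a + e b" if "a \<in> insert x V" "b \<in> insert x V" "a \<noteq> b" for a b
    using that old[of a b] new[of a] new[of b] x d_sym[of u a] d_sym[of u b] u
    by (cases "a = x"; cases "b = x") (simp_all add: f_def e_def)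
  have D_le: "d' a b \<le> d (f a) (f b) + e a + e b" if "a \<in> insert x V" "b \<in> insert x V" for a b
    using D[OF that] self'[OF that(1)] by (cases "a = b") simp_all
  have sym': "d' p q = d' q p" if "p \<in> insert x V" "q \<in> insert x V" for p q
    using D[OF that] D[OF that(2) that(1)] d_sym[OF fV[OF that(1)] fV[OF that(2)]] by (cases "p = q") simp_all
  have tri': "d' p r \<le> d' p q + d' q r" if "p \<in> insert x V" "q \<in> insert x V" "r \<in> insert x V" for p q r
  proof (cases "p = q \<or> q = r")
    case True then show ?thesis using self'[OF that(1)] self'[OF that(2)] by auto
  next
    case False
    then show ?thesis
      using D[OF that(1,2)] D[OF that(2,3)] D_le[OF that(1,3)] d_tri[OF fV[OF that(1)] fV[OF that(2)] fV[OF that(3)]]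
      by simp
  qed
  show ?thesis
  proof
    show "finite (insert x V)" using fin by simp
    show "insert x V \<noteq> {}" by simp
    show "d' a b = 0 \<longleftrightarrow> a = b" if ab: "a \<in> insert x V" "b \<in> insert x V" for a b
    proof (cases "a = b")
      case True then show ?thesis using self' ab by simp
    next
      case False
      have "d (f a) (f b) + e a + e b \<noteq> 0"
        using False ab d_0_iff[OF fV[OF ab(1)] fV[OF ab(2)]] by (cases "a = x"; cases "b = x") (simp_all add: f_def e_def)
      then show ?thesis using D[OF ab] False by simp
    qed
    show "d' a b = d' b a" if ab: "a \<in> insert x V" "b \<in> insert x V" for a b by (rule sym'[OF ab])
    show "d' a c \<le> d' a b + d' b c" if ab: "a \<in> insert x V" "b \<in> insert x V" "c \<in> insert x V" for a b c
      by (rule tri'[OF ab])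
    show "\<exists>c\<in>insert x V. d' a c = 1 \<and> d' a b = Suc (d' c b)" if ab: "a \<in> insert x V" "b \<in> insert x V" "a \<noteq> b" for a b
    proof (cases "a = x")
      case True
      then have "b \<in> V" using ab by auto
      then show ?thesis using True u new old d_self[OF u] by (intro bexI[of _ u]) auto
    next
      case False
      then have a: "a \<in> V" using ab by auto
      show ?thesis
      proof (cases "b = x")
        case True
        show ?thesis
        proof (cases "a = u")
          case True then show ?thesis using \<open>b = x\<close> new u xx by (intro bexI[of _ x]) auto
        next
          case False
          then obtain z where "z \<in> V" "d a z = 1" "d a u = Suc (d z u)" using d_step[OF a u] by blast
          then show ?thesis using \<open>b = x\<close> a new old u d_sym by (intro bexI[of _ z]) auto
        qed
      next
        case False
        then have "b \<in> V" using ab by auto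
        then show ?thesis using d_step[OF a, of b] ab old a by fastforce
      qed
    qed
    show "even (d' a b + d' b c + d' a c)" if ab: "a \<in> insert x V" "b \<in> insert x V" "c \<in> insert x V" for a b c
    proof -
      consider "a = b" | "b = c" | "a = c" | "a \<noteq> b" "b \<noteq> c" "a \<noteq> c" by blast
      then show ?thesis
      proof cases
        case 1 then show ?thesis using self'[OF ab(1)] by simp
      next
        case 2 then show ?thesis using self'[OF ab(2)] by simp
      next
        case 3 then show ?thesis using self'[OF ab(1)] sym'[OF ab(1,2)] by simp
      next
        case 4
        have "even (d (f a) (f b) + d (f b) (f c) + d (f a) (f c))" using d_even fV ab by blast
        moreover have "d' a b + d' b c + d' a c
            = (d (f a) (f b) + d (f b) (f c) + d (f a) (f c)) + 2 * (e a + e b + e c)"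
          using D[OF ab(1,2)] D[OF ab(2,3)] D[OF ab(1,3)] 4 by simp
        ultimately show ?thesis by simp
      qed
    qed
    show "d' a b + d' c g \<le> max (d' a c + d' b g) (d' a g + d' b c)"
      if ab: "a \<in> insert x V" "b \<in> insert x V" "c \<in> insert x V" "g \<in> insert x V" for a b c g
    proof -
      consider "a = c \<or> a = g \<or> b = c \<or> b = g" | "a \<noteq> c" "a \<noteq> g" "b \<noteq> c" "b \<noteq> g" by blast
      then show ?thesis
      proof cases
        case 1
        then show ?thesis
        proof (elim disjE)
          assume "a = c"
          then show ?thesis using tri'[OF ab(2,1,4)] sym'[OF ab(1,2)] self'[OF ab(1)] by (simp add: max_def)
        next
          assume "a = g"
          then show ?thesis using tri'[OF ab(2,1,3)] sym'[OF ab(1,2)] sym'[OF ab(1,3)] self'[OF ab(1)] by (simp add: max_def)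
        next
          assume "b = c"
          then show ?thesis using tri'[OF ab(1,2,4)] self'[OF ab(2)] by (simp add: max_def)
        next
          assume "b = g"
          then show ?thesis using tri'[OF ab(1,2,3)] sym'[OF ab(2,3)] self'[OF ab(2)] by (simp add: max_def)
        qed
      next
        case 2
        have "d (f a) (f b) + d (f c) (f g) \<le> max (d (f a) (f c) + d (f b) (f g)) (d (f a) (f g) + d (f b) (f c))"
          using four_point fV ab by blast
        then show ?thesis using D_le[OF ab(1,2)] D_le[OF ab(3,4)] D[OF ab(1,3)] D[OF ab(2,4)] D[OF ab(1,4)] D[OF ab(2,3)] 2
          by linarith
      qed
    qed
  qed
qed

section \<open>Cost functions and the cost of a cover\<close>

text \<open>
  Prices normalized so that \<open>R\<close> is a contact level: the integral \<open>G\<close> of the price lies above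
  \<open>k\<^sup>2 / 2\<close> and meets it at \<open>R\<close>. The last assumption then holds for prices that are constant just
  below \<open>R\<close>. The model case is \<open>g k = k\<close>, where a ball costs as much as the longest path that it
  can cover.
\<close>
locale cost_rate =
  fixes g :: "real \<Rightarrow> real" and R :: real
  assumes R_pos: "0 < R"
    and g_nonneg: "\<lbrakk>0 \<le> x; x \<le> R\<rbrakk> \<Longrightarrow> 0 \<le> g x"
    and g_mono: "\<lbrakk>0 \<le> x; x \<le> y; y \<le> R\<rbrakk> \<Longrightarrow> g x \<le> g y"
    and G_ge': "\<lbrakk>0 \<le> k; k \<le> R\<rbrakk> \<Longrightarrow> k\<^sup>2 / 2 \<le> integral {0..k} g"
    and G_R': "integral {0..R} g = R\<^sup>2 / 2"
    and g_R: "g R \<le> R"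
begin

definition G :: "real \<Rightarrow> real" where "G k = integral {0..k} g"

lemma G_ge: "\<lbrakk>0 \<le> k; k \<le> R\<rbrakk> \<Longrightarrow> k\<^sup>2 / 2 \<le> G k"
  and G_R: "G R = R\<^sup>2 / 2"
  using G_ge' G_R' by (simp_all add: G_def)

lemma G_0 [simp]: "G 0 = 0" by (simp add: G_def)

lemma g_integrable: "\<lbrakk>0 \<le> a; b \<le> R\<rbrakk> \<Longrightarrow> g integrable_on {a..b}"
  by (intro integrable_on_mono_on mono_onI) (auto intro: g_mono)

lemma g_has_integral:
  assumes "0 \<le> a" "a \<le> b" "b \<le> R"
  shows "(g has_integral G b - G a) {a..b}"
proof -
  have "integral {0..a} g + integral {a..b} g = integral {0..b} g"
    using assms by (intro Henstock_Kurzweil_Integration.integral_combine g_integrable) auto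
  then show ?thesis using g_integrable[of a b] assms by (simp add: G_def has_integral_integrable_integral)
qed

lemma g_affine_pos:
  assumes m: "0 < m" and "a \<le> b" "0 \<le> c + m * a" "c + m * b \<le> R"
  shows "((\<lambda>t. g (c + m * t)) has_integral (G (c + m * b) - G (c + m * a)) / m) {a..b}"
proof -
  have le: "c + m * a \<le> c + m * b" using assms by (simp add: mult_left_mono)
  have "(g has_integral G (c + m * b) - G (c + m * a)) (cbox (c + m * a) (c + m * b))"
    using g_has_integral[OF assms(3) le assms(4)] by (simp add: box_real)
  from has_integral_affinity'[OF this m, of c]
  have "((\<lambda>t. g (c + m * t)) has_integral (G (c + m * b) - G (c + m * a)) / m) {(m * a) / m..(m * b) / m}"
    by (simp add: box_real add.commute divide_inverse mult.commute)
  then show ?thesis using m by simp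
qed

lemma g_affine_neg:
  assumes m: "0 < m" and "a \<le> b" "c - m * a \<le> R" "0 \<le> c - m * b"
  shows "((\<lambda>t. g (c - m * t)) has_integral (G (c - m * a) - G (c - m * b)) / m) {a..b}"
proof -
  have "((\<lambda>t. g (c + m * t)) has_integral (G (c + m * (- a)) - G (c + m * (- b))) / m) {-b..-a}"
    using assms by (intro g_affine_pos) auto
  then have "((\<lambda>t. g (c + m * (- t))) has_integral (G (c - m * a) - G (c - m * b)) / m) {a..b}"
    by (subst has_integral_reflect_real[symmetric]) auto
  then show ?thesis by simp
qed

lemma g_shift:
  assumes "a \<le> b" "0 \<le> c + a" "c + b \<le> R"
  shows "((\<lambda>t. g (c + t)) has_integral G (c + b) - G (c + a)) {a..b}"
  using g_affine_pos[of 1 a b c] assms by simp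

lemma g_shift_neg:
  assumes "a \<le> b" "c - a \<le> R" "0 \<le> c - b"
  shows "((\<lambda>t. g (c - t)) has_integral G (c - a) - G (c - b)) {a..b}"
  using g_affine_neg[of 1 a b c] assms by simp

lemma G_diff_bounds:
  assumes "0 \<le> a" "a \<le> b" "b \<le> R"
  shows "(b - a) * g a \<le> G b - G a" "G b - G a \<le> (b - a) * g b"
proof -
  have "((\<lambda>_. g a) has_integral (b - a) * g a) {a..b}" "((\<lambda>_. g b) has_integral (b - a) * g b) {a..b}"
    using has_integral_const_real[of "g a" a b] has_integral_const_real[of "g b" a b] assms by auto
  note * = this
  show "(b - a) * g a \<le> G b - G a"
    using assms by (intro has_integral_le[OF *(1) g_has_integral] g_mono) auto
  show "G b - G a \<le> (b - a) * g b"
    using assms by (intro has_integral_le[OF g_has_integral *(2)] g_mono) auto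
qed

text \<open>
  \<open>G k / k\<close> is nondecreasing, since \<open>g\<close> is.
\<close>
lemma G_convex:
  assumes "0 \<le> x" "x \<le> y" "y \<le> R"
  shows "y * G x \<le> x * G y"
proof -
  have 1: "G x \<le> x * g x" using G_diff_bounds(2)[of 0 x] assms by simp
  have 2: "(y - x) * g x \<le> G y - G x" using G_diff_bounds(1)[of x y] assms by simp
  have "(y - x) * G x \<le> (y - x) * (x * g x)" using 1 assms by (intro mult_left_mono) auto
  moreover have "x * ((y - x) * g x) \<le> x * (G y - G x)" using 2 assms by (intro mult_left_mono) auto
  ultimately show ?thesis by (simp add: algebra_simps)
qed

lemma sum_g_le_G:
  assumes "real n \<le> R"
  shows "(\<Sum>k<n. g (real k)) \<le> G (real n)"
  using assms
proof (induction n)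
  case (Suc n)
  then show ?case using G_diff_bounds(1)[of "real n" "real (Suc n)"] by simp
qed simp

end

text \<open>
  The families of covers below are available for parameters above the left end of the interval
  only, and a single point does not change an integral.
\<close>
lemma has_integral_le_greaterThan:
  fixes f c :: "real \<Rightarrow> real"
  assumes "(c has_integral C) {a..b}" "(f has_integral M) {a..b}"
    and le: "\<And>z. a < z \<Longrightarrow> z \<le> b \<Longrightarrow> c z \<le> f z"
  shows "C \<le> M"
proof -
  have "((\<lambda>z. if z = a then f a else c z) has_integral C) {a..b}"
    by (rule has_integral_spike_finite[OF _ _ assms(1), of "{a}"]) auto
  from has_integral_le[OF this assms(2)] show ?thesis using le by fastforce
qed

text \<open>
  As the parameter \<open>z\<close> moves, the price \<open>w y\<close> has to be paid only while \<open>z\<close> is in a window of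
  length 1; so its total contribution to an integral is at most \<open>w y\<close>.
\<close>
lemma has_integral_unit_windows:
  fixes w lo :: "'a \<Rightarrow> real"
  assumes fin: "finite W" and w: "\<And>y. y \<in> W \<Longrightarrow> 0 \<le> w y"
  shows "\<exists>M \<le> (\<Sum>y\<in>W. w y). ((\<lambda>z. \<Sum>y\<in>W. w y * indicat_real {lo y..lo y + 1} z) has_integral M) {a..b}"
proof -
  have "(indicat_real {lo y..lo y + 1} has_integral measure lebesgue ({lo y..lo y + 1} \<inter> {a..b})) {a..b}" for y
    using Equivalence_Lebesgue_Henstock_Integration.integral_indicator[of "{lo y..lo y + 1}" "{a..b}"]
      integrable_on_indicator[of "{lo y..lo y + 1}" "{a..b}"]
    by (simp add: has_integral_integrable_integral)
  then have "((\<lambda>z. w y * indicat_real {lo y..lo y + 1} z) has_integral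
      w y * measure lebesgue ({lo y..lo y + 1} \<inter> {a..b})) {a..b}" for y
    by (rule has_integral_mult_right)
  then have "((\<lambda>z. \<Sum>y\<in>W. w y * indicat_real {lo y..lo y + 1} z) has_integral
      (\<Sum>y\<in>W. w y * measure lebesgue ({lo y..lo y + 1} \<inter> {a..b}))) {a..b}"
    by (intro has_integral_sum fin)
  moreover have "measure lebesgue ({lo y..lo y + 1} \<inter> {a..b}) \<le> 1" for y
  proof -
    have "measure lebesgue ({lo y..lo y + 1} \<inter> {a..b}) \<le> measure lebesgue {lo y..lo y + 1}"
      by (intro measure_mono_fmeasurable) auto
    then show ?thesis by simp
  qed
  then have "w y * measure lebesgue ({lo y..lo y + 1} \<inter> {a..b}) \<le> w y" if "y \<in> W" for y
    using w[OF that] mult_left_mono[of "measure lebesgue ({lo y..lo y + 1} \<inter> {a..b})" 1 "w y"] by simp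
  then have "(\<Sum>y\<in>W. w y * measure lebesgue ({lo y..lo y + 1} \<inter> {a..b})) \<le> (\<Sum>y\<in>W. w y)"
    by (rule sum_mono)
  ultimately show ?thesis by blast
qed

text \<open>
  The sizes \<open>bs\<close> are upper bounds for the diameters of sets, not radii of balls: this avoids
  centres between two vertices. The sets are removed from \<open>S\<close> one after the other, so that proofs
  can go by induction on the list.
\<close>
fun covered :: "('b \<Rightarrow> 'b \<Rightarrow> nat) \<Rightarrow> 'b set \<Rightarrow> real list \<Rightarrow> bool" where
  "covered d S [] \<longleftrightarrow> S = {}"
| "covered d S (b # bs) \<longleftrightarrow> (\<exists>A. (\<forall>x\<in>A. \<forall>y\<in>A. real (d x y) \<le> b) \<and> covered d (S - A) bs)"

lemma covered_mono: "covered d S bs \<Longrightarrow> S' \<subseteq> S \<Longrightarrow> covered d S' bs"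
proof (induction bs arbitrary: S S')
  case (Cons b bs)
  then obtain A where A: "\<forall>x\<in>A. \<forall>y\<in>A. real (d x y) \<le> b" "covered d (S - A) bs" by auto
  have "covered d (S' - A) bs" using Cons.IH[OF A(2), of "S' - A"] Cons.prems by blast
  then show ?case using A by auto
qed simp

lemma covered_append: "covered d S bs \<Longrightarrow> covered d S' cs \<Longrightarrow> covered d (S \<union> S') (bs @ cs)"
proof (induction bs arbitrary: S S')
  case (Cons b bs)
  then obtain A where A: "\<forall>x\<in>A. \<forall>y\<in>A. real (d x y) \<le> b" "covered d (S - A) bs" by auto
  have "covered d (S - A \<union> (S' - A)) (bs @ cs)"
    using Cons.IH[OF A(2)] covered_mono[OF Cons.prems(2), of "S' - A"] by blast
  moreover have "S - A \<union> (S' - A) = S \<union> S' - A" by blast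
  ultimately show ?case using A by auto
qed simp

context cost_rate begin

definition cheap :: "('b \<Rightarrow> 'b \<Rightarrow> nat) \<Rightarrow> 'b set \<Rightarrow> real \<Rightarrow> bool" where
  "cheap d S c \<longleftrightarrow> (\<exists>bs. set bs \<subseteq> {0..R} \<and> covered d S bs \<and> sum_list (map g bs) \<le> c)"

lemma cheap_mono: "cheap d S c \<Longrightarrow> S' \<subseteq> S \<Longrightarrow> c \<le> c' \<Longrightarrow> cheap d S' c'"
  unfolding cheap_def using covered_mono order_trans by blast

lemma cheap_empty: "cheap d {} 0"
  unfolding cheap_def by (intro exI[of _ "[]"]) simp

lemma cheap_Un:
  assumes "cheap d S c" "cheap d S' c'"
  shows "cheap d (S \<union> S') (c + c')"
proof -
  obtain bs bs' where "set bs \<subseteq> {0..R}" "covered d S bs" "sum_list (map g bs) \<le> c"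
    "set bs' \<subseteq> {0..R}" "covered d S' bs'" "sum_list (map g bs') \<le> c'"
    using assms unfolding cheap_def by blast
  then show ?thesis unfolding cheap_def
    by (intro exI[of _ "bs @ bs'"]) (auto intro: covered_append)
qed

lemma cheap_ball:
  assumes "\<And>x y. x \<in> A \<Longrightarrow> y \<in> A \<Longrightarrow> real (d x y) \<le> b" "0 \<le> b" "b \<le> R"
  shows "cheap d A (g b)"
  unfolding cheap_def using assms by (intro exI[of _ "[b]"]) auto

lemma cheap_UN:
  assumes "finite I" "\<And>i. i \<in> I \<Longrightarrow> cheap d (S i) (c i)"
  shows "cheap d (\<Union>i\<in>I. S i) (\<Sum>i\<in>I. c i)"
  using assms
proof (induction I)
  case empty then show ?case by (simp add: cheap_empty)
next
  case (insert i I) then show ?case using cheap_Un[of d "S i" "c i"] by simp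
qed

end

section \<open>Spines, twigs and tripods\<close>

context tree_metric begin

text \<open>
  The height of \<open>y\<close> above the path from \<open>v\<close> to \<open>x\<close>.
\<close>
definition ht :: "'b \<Rightarrow> 'b \<Rightarrow> 'b \<Rightarrow> nat" where
  "ht v x y = d v y - gp v y x"

lemma depth_eq: "\<lbrakk>v \<in> V; x \<in> V; y \<in> V\<rbrakk> \<Longrightarrow> d v y = gp v y x + ht v x y"
  using gp_le1[of v y x] by (simp add: ht_def)

lemma dist_coord_ht:
  assumes V: "v \<in> V" "x \<in> V" "y \<in> V" "y' \<in> V" and le: "gp v y x \<le> gp v y' x"
  shows "d y y' + gp v y x \<le> gp v y' x + ht v x y + ht v x y'"
  using dist_coord[OF V le] depth_eq[of v x y] depth_eq[of v x y'] V by simp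

text \<open>
  On the path from \<open>v\<close> to \<open>y\<close>, the vertices after the one where the spine is left have the same
  projection to the spine as \<open>y\<close>, and their heights grow by 1 in each step.
\<close>
lemma twig_point:
  assumes V: "v \<in> V" "x \<in> V" "y \<in> V" and m: "1 \<le> m" "m \<le> ht v x y"
  shows "\<exists>y0\<in>V. y \<in> desc v y0 \<and> gp v y0 x = gp v y x \<and> ht v x y0 = m"
proof -
  have dy: "d v y = gp v y x + ht v x y" by (rule depth_eq[OF V])
  then obtain y0 where y0: "y0 \<in> V" "d v y0 = gp v y x + m" "d y0 y = d v y - (gp v y x + m)"
    using geodesic_point[OF V(1,3), of "gp v y x + m"] m by auto
  then have des: "y \<in> desc v y0" using V dy m by (simp add: desc_def)
  then have "gp v y0 y = d v y0" using desc_iff_gp V y0 by blast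
  then have "gp v x y < gp v y y0" using y0(1,2) m gp_commute[of v x y] gp_commute[of v y y0] V by simp
  from gp_eq_of_less[OF V(1,2,3) y0(1) this] have "gp v y0 x = gp v y x"
    using gp_commute[of v x y] gp_commute[of v x y0] V y0(1) by simp
  then show ?thesis using des y0 by (auto simp: ht_def)
qed

lemma twig_desc:
  assumes V: "v \<in> V" "x \<in> V" "y0 \<in> V" and m: "1 \<le> ht v x y0" and z: "z \<in> desc v y0"
  shows "gp v z x = gp v y0 x" "ht v x y0 \<le> ht v x z"
proof -
  have zV: "z \<in> V" using z desc_subset by blast
  have "gp v y0 z = d v y0" using desc_iff_gp V z zV by blast
  then have "gp v x y0 < gp v y0 z" using depth_eq[OF V] m gp_commute[of v x y0] V by simp
  from gp_eq_of_less[OF V(1,2,3) zV this] show *: "gp v z x = gp v y0 x"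
    using gp_commute[of v x y0] gp_commute[of v x z] V zV by simp
  have "d v z = d v y0 + d y0 z" using z by (simp add: desc_def)
  then show "ht v x y0 \<le> ht v x z" using * by (simp add: ht_def)
qed

lemma ht_le_card:
  assumes V: "v \<in> V" "x \<in> V" "y \<in> V"
  shows "ht v x y \<le> card {z \<in> V. gp v z x = gp v y x \<and> 1 \<le> ht v x z}"
proof -
  have "\<forall>m\<in>{1..ht v x y}. \<exists>y0\<in>V. gp v y0 x = gp v y x \<and> ht v x y0 = m"
    using twig_point[OF V] by fastforce
  then obtain f where f: "\<And>m. m \<in> {1..ht v x y} \<Longrightarrow> f m \<in> V \<and> gp v (f m) x = gp v y x \<and> ht v x (f m) = m"
    by metis
  have "inj_on f {1..ht v x y}" by (rule inj_onI) (metis f)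
  moreover have "f ` {1..ht v x y} \<subseteq> {z \<in> V. gp v z x = gp v y x \<and> 1 \<le> ht v x z}" using f by auto
  ultimately show ?thesis using card_inj_on_le[of f "{1..ht v x y}"] fin by simp
qed

lemma spine_bij:
  assumes V: "v \<in> V" "x \<in> V"
  shows "bij_betw (d v) {y \<in> V. ht v x y = 0} {..d v x}"
  unfolding bij_betw_def
proof
  have "y = y'" if "y \<in> V" "ht v x y = 0" "y' \<in> V" "ht v x y' = 0" "d v y = d v y'" for y y'
  proof -
    have "gp v y x = d v y" "gp v y' x = d v y'" using depth_eq[of v x] V that by auto
    then have "d y y' = 0" using dist_coord_ht[of v x y y'] V that by simp
    then show ?thesis using d_0_iff that by blast
  qed
  then show "inj_on (d v) {y \<in> V. ht v x y = 0}" by (auto simp: inj_on_def)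
  show "d v ` {y \<in> V. ht v x y = 0} = {..d v x}"
  proof safe
    fix y assume "y \<in> V" "ht v x y = 0"
    then show "d v y \<le> d v x" using depth_eq[of v x y] gp_le2[of v y x] V by simp
  next
    fix m assume "m \<le> d v x"
    then obtain p where p: "p \<in> V" "d v p = m" "d p x = d v x - m" using geodesic_point V by blast
    then have "gp v p x = d v p" using between_gp[of v x p] V \<open>m \<le> d v x\<close> by simp
    then have "p \<in> {y \<in> V. ht v x y = 0}" using p by (simp add: ht_def)
    then show "m \<in> d v ` {y \<in> V. ht v x y = 0}" using p(2) by blast
  qed
qed

end

locale costed_tree = tree_metric V d + cost_rate g R for V :: "'b set" and d g R
begin

text \<open>
  The price of a single ball that contains the subtree below \<open>y\<close>.
\<close>
definition gy :: "'b \<Rightarrow> 'b \<Rightarrow> real" where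
  "gy v y = g (real (card (desc v y)) - 1)"

lemma card_desc_pos: "y \<in> V \<Longrightarrow> 1 \<le> card (desc v y)"
  using desc_self[of y v] card_gt_0_iff[of "desc v y"] by (auto simp: Suc_le_eq)

lemma gy_nonneg:
  assumes "y \<in> V" "real (card (desc v y)) \<le> R + 1" shows "0 \<le> gy v y"
  unfolding gy_def using card_desc_pos[of y v] assms by (intro g_nonneg) auto

lemma cheap_desc:
  assumes "v \<in> V" "y \<in> V" "real (card (desc v y)) \<le> R + 1"
  shows "cheap d (desc v y) (gy v y)"
  unfolding gy_def
proof (rule cheap_ball)
  fix a b assume "a \<in> desc v y" "b \<in> desc v y"
  then show "real (d a b) \<le> real (card (desc v y)) - 1"
    using convx_card[OF convx_desc[OF assms(1,2)] desc_subset] by fastforce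
qed (use assms card_desc_pos[of y v] in auto)

text \<open>
  Let \<open>W\<close> be closed under passing to descendants, and remove its vertices from the root downwards.
  The subtree of a vertex that is removed when \<open>k + 1\<close> vertices are left has at most \<open>k + 1\<close>
  vertices. Hence the prices are bounded by \<open>g 0, g 1, \<dots>\<close>, whose sum is at most \<open>G\<close>.
\<close>
lemma sum_gy_le_G:
  assumes "v \<in> V" "W \<subseteq> V" "\<And>y. y \<in> W \<Longrightarrow> desc v y \<subseteq> W" "real (card W) \<le> R"
  shows "(\<Sum>y\<in>W. gy v y) \<le> G (real (card W))"
proof -
  have finW: "finite W" using assms(2) fin finite_subset by blast
  have "(\<Sum>y\<in>W. gy v y) \<le> (\<Sum>k<card W. g (real k))"
    using finW assms(2-4)
  proof (induction "card W" arbitrary: W)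
    case 0 then show ?case by simp
  next
    case (Suc n)
    then have "W \<noteq> {}" by auto
    then obtain y where y: "y \<in> W" "\<And>z. z \<in> W \<Longrightarrow> d v y \<le> d v z"
      using Suc.prems(1) arg_min_if_finite[of W "d v"] by (metis not_le)
    have yV: "y \<in> V" using y Suc.prems by blast
    let ?W = "W - {y}"
    have c: "card ?W = n" using Suc.hyps(2) y Suc.prems(1) by simp
    have "desc v z \<subseteq> ?W" if "z \<in> ?W" for z
    proof -
      have "z \<in> V" using that Suc.prems by blast
      then have "y \<notin> desc v z" using desc_depth_less[OF assms(1), of z y] y(2)[of z] that by auto
      then show ?thesis using Suc.prems(3)[of z] that by blast
    qed
    then have IH: "(\<Sum>y\<in>?W. gy v y) \<le> (\<Sum>k<n. g (real k))"
      using Suc.hyps(1)[of ?W] c Suc.prems Suc.hyps(2) by auto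
    have "card (desc v y) \<le> card W" using Suc.prems(1,3) y(1) card_mono by blast
    then have "gy v y \<le> g (real n)"
      unfolding gy_def using card_desc_pos[OF yV, of v] Suc.hyps(2) Suc.prems(4) by (intro g_mono) auto
    moreover have "(\<Sum>y\<in>W. gy v y) = gy v y + (\<Sum>y\<in>?W. gy v y)"
      using sum.remove[OF Suc.prems(1) y(1)] by blast
    ultimately show ?case using IH by (simp add: Suc.hyps(2)[symmetric])
  qed
  also have "\<dots> \<le> G (real (card W))" by (rule sum_g_le_G[OF assms(4)])
  finally show ?thesis .
qed

end

datatype arm = Long | Mid | Short

text \<open>
  A minimal counterexample: the tree is not cheap, but its subtrees of length at least \<open>R\<close> are. It
  has a centre \<open>v\<close> and three arms. An arm consists of branches at \<open>v\<close>; \<open>x i\<close> is its deepest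
  vertex. The assumption \<open>R_less\<close> says that already the two shorter arms are too long for a single
  ball. The set \<open>B Short\<close> may consist of several branches.
\<close>
locale tripod = costed_tree V d g R for V :: "'b set" and d g R +
  fixes \<kappa> :: real and v :: 'b and x :: "arm \<Rightarrow> 'b" and B :: "arm \<Rightarrow> 'b set"
  assumes kappa: "1 < \<kappa>"
    and vV: "v \<in> V"
    and V_eq: "V = insert v (B Long \<union> B Mid \<union> B Short)"
    and v_notin: "v \<notin> B i"
    and cross: "\<lbrakk>i \<noteq> j; y \<in> B i; z \<in> B j\<rbrakk> \<Longrightarrow> gp v y z = 0"
    and x_in: "x i \<in> B i"
    and deepest: "y \<in> B i \<Longrightarrow> d v y \<le> d v (x i)"
    and sorted: "d v (x Short) \<le> d v (x Mid)" "d v (x Mid) \<le> d v (x Long)"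
    and R_less: "R < real (d v (x Mid)) + real (d v (x Short))"
    and IH: "\<lbrakk>S \<subset> V; convx S; S \<noteq> {}; R \<le> real (card S) - 1\<rbrakk>
      \<Longrightarrow> cheap d S (\<kappa> * (real (card S) - 1))"
    and not_cheap: "cheap d V c \<Longrightarrow> \<kappa> * (real (card V) - 1) < c"
begin

text \<open>
  For an arm \<open>i\<close>: \<open>h i\<close> is the length of its spine, the path from \<open>v\<close> to \<open>x i\<close>; \<open>W i\<close> is the set
  of its \<open>w i\<close> vertices off the spine (the twigs); \<open>q i y\<close> and \<open>\<delta> i y\<close> are the position of \<open>y\<close>
  along the spine and its height above it. \<open>Q i\<close> is the total price of all subtrees that start at
  a vertex of a twig. It is split at \<open>\<delta> i y = q i y\<close> because the vertices on the two sides have to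
  be paid for during different parameter intervals.
\<close>
definition h :: "arm \<Rightarrow> real" where "h i = real (d v (x i))"
definition n :: "arm \<Rightarrow> real" where "n i = real (card (B i))"
definition W :: "arm \<Rightarrow> 'b set" where "W i = {y \<in> B i. 1 \<le> ht v (x i) y}"
definition w :: "arm \<Rightarrow> real" where "w i = real (card (W i))"
definition q :: "arm \<Rightarrow> 'b \<Rightarrow> real" where "q i y = real (gp v y (x i))"
definition \<delta> :: "arm \<Rightarrow> 'b \<Rightarrow> real" where "\<delta> i y = real (ht v (x i) y)"
definition L :: real where "L = real (card V) - 1"
definition Q :: "arm \<Rightarrow> real" where "Q i = (\<Sum>y\<in>W i. gy v y)"
definition Qlow :: "arm \<Rightarrow> real" where "Qlow i = (\<Sum>y\<in>{y \<in> W i. \<delta> i y \<le> q i y}. gy v y)"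
definition Qhigh :: "arm \<Rightarrow> real" where "Qhigh i = (\<Sum>y\<in>{y \<in> W i. q i y < \<delta> i y}. gy v y)"

lemma B_V: "B i \<subseteq> V"
  by (subst V_eq, cases i) auto
lemma finB: "finite (B i)" using B_V fin finite_subset by blast
lemma x_V: "x i \<in> V" using x_in B_V by blast

lemma disj:
  assumes "i \<noteq> j" shows "B i \<inter> B j = {}"
proof -
  have "False" if y: "y \<in> B i" "y \<in> B j" for y
  proof -
    have yV: "y \<in> V" using y B_V assms by blast
    have "gp v y y = 0" using cross assms y by blast
    then have "d v y = 0" using gp_eq[of v y y] yV vV by simp
    then show False using d_0_iff vV yV y v_notin assms by blast
  qed
  then show ?thesis by blast
qed

lemma h_pos: "0 < h i"
  using d_0_iff[OF vV x_V[of i]] x_in[of i] v_notin[of i] by (auto simp: h_def)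

lemma L_eq: "L = n Long + n Mid + n Short"
proof -
  have d: "B Long \<inter> B Mid = {}" "(B Long \<union> B Mid) \<inter> B Short = {}" using disj[of Long Mid] disj[of Long Short] disj[of Mid Short] by auto
  have "card (B Long \<union> B Mid \<union> B Short) = card (B Long) + card (B Mid) + card (B Short)"
    using d finB[of Long] finB[of Mid] finB[of Short] by (simp add: card_Un_disjoint)
  moreover have "card V = Suc (card (B Long \<union> B Mid \<union> B Short))"
    using V_eq v_notin[of Long] v_notin[of Mid] v_notin[of Short] finB[of Long] finB[of Mid] finB[of Short] by (metis (no_types, lifting) Un_iff card_insert_disjoint finite_UnI insertCI)
  ultimately show ?thesis by (simp add: L_def n_def)
qed

lemma same_arm:
  assumes "y \<in> V" "z \<in> B i" "0 < gp v y z" shows "y \<in> B i"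
proof -
  have zV: "z \<in> V" using B_V assms(2) by blast
  have "y \<noteq> v" using gp_eq[OF vV vV zV] assms(3) vV by auto
  then obtain j where "y \<in> B j" using V_eq assms(1) by auto
  then show ?thesis using cross[of j i y z] assms by (cases "i = j") auto
qed

lemma coord:
  assumes "y \<in> B i"
  shows "real (d v y) = q i y + \<delta> i y" "q i y + \<delta> i y \<le> h i" "0 \<le> q i y" "0 \<le> \<delta> i y"
  using depth_eq[OF vV x_V[of i] subsetD[OF B_V assms]] deepest[OF assms]
  by (simp_all add: q_def \<delta>_def h_def)

lemma dist_coord_arm:
  assumes "y \<in> B i" "y' \<in> B i" "q i y \<le> q i y'"
  shows "real (d y y') \<le> q i y' - q i y + \<delta> i y + \<delta> i y'"
  using dist_coord_ht[OF vV x_V[of i] subsetD[OF B_V assms(1)] subsetD[OF B_V assms(2)]] assms(3)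
  by (simp add: q_def \<delta>_def)

lemma dist_depth:
  assumes "y \<in> V" "y' \<in> V"
  shows "real (d y y') \<le> real (d v y) + real (d v y')"
  using d_tri[of y v y'] d_sym[of y v] assms vV by (metis of_nat_add of_nat_mono)

lemma convx_insert_B:
  shows "convx (insert v (B i))"
  unfolding convx_def
proof (intro ballI impI)
  fix a b z assume ab: "a \<in> insert v (B i)" "b \<in> insert v (B i)" and z: "z \<in> V" "d a z + d z b = d a b"
  have abV: "a \<in> V" "b \<in> V" using ab B_V vV by auto
  show "z \<in> insert v (B i)"
  proof (cases "z = v")
    case False
    then have pos: "0 < d v z" using d_0_iff[OF vV z(1)] by auto
    have key: "z \<in> B i" if c: "c \<in> insert v (B i)" "d v z + d z c = d v c" for c
    proof -
      have cV: "c \<in> V" using c B_V vV by auto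
      have "c \<noteq> v" using c(2) pos vV by auto
      moreover have "0 < gp v z c" using between_gp[OF vV cV z(1)] c(2) pos by simp
      ultimately show ?thesis using same_arm[OF z(1), of c] c(1) by blast
    qed
    show ?thesis using between_cases[OF vV abV z] key ab by blast
  qed simp
qed

lemma convx_minus_B:
  shows "convx (V - B i)"
  unfolding convx_def
proof (intro ballI impI)
  fix a b z assume ab: "a \<in> V - B i" "b \<in> V - B i" and z: "z \<in> V" "d a z + d z b = d a b"
  have abV: "a \<in> V" "b \<in> V" using ab by auto
  have key: False if zB: "z \<in> B i" and c: "c \<in> V - B i" "d v z + d z c = d v c" for c
  proof -
    have pos: "0 < d v z" using d_0_iff[OF vV z(1)] zB v_notin[of i] by auto
    have cV: "c \<in> V" using c by auto
    have "0 < gp v z c" using between_gp[OF vV cV z(1)] c(2) pos by simp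
    then have "0 < gp v c z" using gp_commute[OF vV cV z(1)] by simp
    then show False using same_arm[OF cV zB] c(1) by blast
  qed
  show "z \<in> V - B i" using between_cases[OF vV abV z] key ab z by blast
qed

lemma n_ge_h: "h i \<le> n i"
proof -
  have "Suc (d v (x i)) \<le> card (insert v (B i))"
    using convx_card[OF convx_insert_B] B_V vV x_in by auto
  then show ?thesis using finB v_notin by (simp add: h_def n_def)
qed

lemma n_eq: shows "n i = h i + w i"
proof -
  let ?S = "{y \<in> V. ht v (x i) y = 0}"
  have bij: "bij_betw (d v) ?S {..d v (x i)}" by (rule spine_bij[OF vV x_V[of i]])
  then have c: "card ?S = Suc (d v (x i))" by (simp add: bij_betw_same_card)
  have vS: "v \<in> ?S" using vV by (simp add: ht_def)
  have B: "B i = W i \<union> (?S - {v})"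
  proof
    show "B i \<subseteq> W i \<union> (?S - {v})" using B_V v_notin by (auto simp: W_def)
    have "y \<in> B i" if y: "y \<in> ?S" "y \<noteq> v" for y
    proof -
      have "d v y = gp v y (x i)" using depth_eq[OF vV x_V[of i], of y] y by simp
      moreover have "d v y \<noteq> 0" using d_0_iff[OF vV, of y] y by auto
      ultimately show ?thesis using same_arm[OF _ x_in, of y] y by simp
    qed
    then show "W i \<union> (?S - {v}) \<subseteq> B i" by (auto simp: W_def)
  qed
  have "card (W i \<union> (?S - {v})) = card (W i) + card (?S - {v})"
    using finB fin by (intro card_Un_disjoint) (auto simp: W_def)
  then show ?thesis using B c vS fin by (simp add: n_def h_def w_def)
qed

lemma h_order: "h Short \<le> h Mid" "h Mid \<le> h Long" "R < h Mid + h Short"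
  using sorted R_less by (simp_all add: h_def)

text \<open>
  After removing a part of one arm, the other two arms are still long enough for the induction
  hypothesis.
\<close>
lemma cheap_complement:
  assumes S: "S \<subseteq> B i" "S \<noteq> {}" "convx (V - S)"
  shows "cheap d (V - S) (\<kappa> * (L - real (card S)))"
proof -
  have SV: "S \<subseteq> V" using S B_V by blast
  have c: "real (card (V - S)) = real (card V) - real (card S)"
    using SV fin finite_subset[OF SV fin] by (simp add: card_Diff_subset card_mono of_nat_diff)
  have "real (card S) \<le> n i" using S finB card_mono by (auto simp: n_def)
  moreover have "L - n i > R"
    using L_eq n_ge_h[of Long] n_ge_h[of Mid] n_ge_h[of Short] h_order by (cases i) auto
  ultimately have R: "R \<le> real (card (V - S)) - 1" using c by (simp add: L_def)
  have "cheap d (V - S) (\<kappa> * (real (card (V - S)) - 1))"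
  proof (rule IH)
    show "V - S \<subset> V" using SV S by blast
    show "convx (V - S)" by fact
    show "V - S \<noteq> {}" using vV v_notin S by blast
  qed (rule R)
  then show ?thesis using c by (simp add: L_def algebra_simps)
qed

text \<open>
  An arm of length at least \<open>R\<close> could be split off, since the rest also has length at least \<open>R\<close>
  and the induction hypothesis applies to both parts.
\<close>
lemma n_less: shows "n i < R"
proof (rule ccontr)
  assume nn: "\<not> ?thesis"
  have c: "card (insert v (B i)) = Suc (card (B i))" using finB v_notin by simp
  obtain j where "j \<noteq> i" by (metis arm.distinct(1))
  have "insert v (B i) \<subset> V" using B_V vV x_in[of j] x_V[of j] v_notin[of j] disj[of i j] \<open>j \<noteq> i\<close> by blast
  then have "cheap d (insert v (B i)) (\<kappa> * (real (card (insert v (B i))) - 1))"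
    using c nn convx_insert_B by (intro IH) (auto simp: n_def)
  then have 1: "cheap d (insert v (B i)) (\<kappa> * n i)" using c by (simp add: n_def)
  have 2: "cheap d (V - B i) (\<kappa> * (L - n i))"
    using cheap_complement[OF order_refl _ convx_minus_B] x_in by (auto simp: n_def)
  have "insert v (B i) \<union> (V - B i) = V" using B_V vV by blast
  then have "cheap d V (\<kappa> * L)" using cheap_Un[OF 1 2] by (simp add: algebra_simps)
  then show False using not_cheap by (force simp: L_def)
qed

lemma w_bounds: "0 \<le> w i" "w i < R - h i"
  using n_less[of i] n_eq[of i] by (auto simp: w_def)

lemma W_V: "W i \<subseteq> V" using B_V by (auto simp: W_def)
lemma finW: "finite (W i)" using W_V fin finite_subset by blast

lemma desc_W:
  assumes y: "y \<in> W i" shows "desc v y \<subseteq> W i"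
proof
  fix z assume z: "z \<in> desc v y"
  have yB: "y \<in> B i" and yV: "y \<in> V" using y W_V by (auto simp: W_def)
  have zV: "z \<in> V" using z desc_subset by blast
  have "gp v y z = d v y" using desc_iff_gp vV yV zV z by blast
  moreover have "d v y \<noteq> 0" using d_0_iff[OF vV yV] yB v_notin by auto
  ultimately have "0 < gp v z y" using gp_commute[OF vV yV zV] by simp
  then have "z \<in> B i" using same_arm[OF zV yB] by simp
  moreover have "1 \<le> ht v (x i) z" using twig_desc(2)[OF vV x_V[of i] yV _ z] y by (simp add: W_def)
  ultimately show "z \<in> W i" by (simp add: W_def)
qed

lemma card_desc_W: "y \<in> W i \<Longrightarrow> real (card (desc v y)) \<le> R + 1"
  using card_mono[OF finW desc_W, of y i] w_bounds[of i] h_pos[of i] by (simp add: w_def)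

lemma gy_W: "y \<in> W i \<Longrightarrow> 0 \<le> gy v y"
  using gy_nonneg card_desc_W W_V by blast

lemma Q_le: "Q i \<le> G (w i)"
  unfolding Q_def w_def using w_bounds[of i] h_pos[of i] W_V desc_W
  by (intro sum_gy_le_G vV) (auto simp: w_def)

lemma Q_split: "Q i = Qlow i + Qhigh i"
proof -
  have W: "{y \<in> W i. \<delta> i y \<le> q i y} \<union> {y \<in> W i. q i y < \<delta> i y} = W i" by auto
  have "sum (gy v) ({y \<in> W i. \<delta> i y \<le> q i y} \<union> {y \<in> W i. q i y < \<delta> i y}) = Qlow i + Qhigh i"
    unfolding Qlow_def Qhigh_def using finW[of i] by (intro sum.union_disjoint) auto
  then show ?thesis unfolding Q_def W .
qed

text \<open>
  The twig that carries \<open>y\<close> has a vertex at each height up to that of \<open>y\<close>.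
\<close>
lemma delta_le_w:
  assumes y: "y \<in> B i" shows "\<delta> i y \<le> w i"
proof (cases "ht v (x i) y = 0")
  case True then show ?thesis using w_bounds(1) by (simp add: \<delta>_def)
next
  case False
  have yV: "y \<in> V" using y B_V by blast
  have "\<forall>m\<in>{1..ht v (x i) y}. \<exists>y0\<in>W i. ht v (x i) y0 = m"
  proof
    fix m assume "m \<in> {1..ht v (x i) y}"
    then obtain y0 where y0: "y0 \<in> V" "y \<in> desc v y0" "ht v (x i) y0 = m" "1 \<le> m"
      using twig_point[OF vV x_V[of i] yV, of m] by auto
    have "d v y0 \<noteq> 0" using depth_eq[OF vV x_V[of i] y0(1)] y0 by simp
    then have "0 < gp v y0 y" using desc_iff_gp[OF vV y0(1) yV] y0 by simp
    then have "y0 \<in> B i" using same_arm[OF y0(1) y] by blast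
    then show "\<exists>y0\<in>W i. ht v (x i) y0 = m" using y0 by (auto simp: W_def)
  qed
  then obtain f where f: "\<And>m. m \<in> {1..ht v (x i) y} \<Longrightarrow> f m \<in> W i \<and> ht v (x i) (f m) = m" by metis
  have "inj_on f {1..ht v (x i) y}" by (rule inj_onI) (metis f)
  moreover have "f ` {1..ht v (x i) y} \<subseteq> W i" using f by auto
  ultimately show ?thesis using card_inj_on_le[of f "{1..ht v (x i) y}"] finW by (simp add: \<delta>_def w_def)
qed

text \<open>
  Suppose that only the vertices with height at most \<open>\<theta>\<close>, a function of the position along the
  spine, are covered. Everything above is covered by the subtrees at the vertices of the first
  level above \<open>\<theta>\<close>. A vertex \<open>y\<close> belongs to this level exactly when \<open>\<theta>\<close> is in the window
  \<open>[\<delta> i y - 1, \<delta> i y)\<close>.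
\<close>
lemma cheap_residual:
  assumes \<theta>: "\<And>k. P k \<Longrightarrow> 0 \<le> \<theta> k"
  shows "cheap d {y \<in> B i. P (gp v y (x i)) \<and> \<theta> (gp v y (x i)) < \<delta> i y}
    (\<Sum>y\<in>{y \<in> W i. P (gp v y (x i)) \<and> \<delta> i y - 1 \<le> \<theta> (gp v y (x i)) \<and> \<theta> (gp v y (x i)) < \<delta> i y}. gy v y)"
    (is "cheap d ?S (sum _ ?W)")
proof (rule cheap_mono)
  show "cheap d (\<Union>y\<in>?W. desc v y) (\<Sum>y\<in>?W. gy v y)"
    using finW W_V card_desc_W by (intro cheap_UN cheap_desc vV) auto
  show "?S \<subseteq> (\<Union>y\<in>?W. desc v y)"
  proof
    fix y assume y: "y \<in> ?S"
    have yV: "y \<in> V" using y B_V by blast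
    define m where "m = nat \<lfloor>\<theta> (gp v y (x i))\<rfloor> + 1"
    have th: "0 \<le> \<theta> (gp v y (x i))" "\<theta> (gp v y (x i)) < real (ht v (x i) y)" using y \<theta> by (auto simp: \<delta>_def)
    have m: "real m - 1 \<le> \<theta> (gp v y (x i))" "\<theta> (gp v y (x i)) < real m" "1 \<le> m"
      using th(1) unfolding m_def by linarith+
    have "m \<le> ht v (x i) y" using m th by linarith
    from twig_point[OF vV x_V[of i] yV m(3) this] obtain y0 where
      y0: "y0 \<in> V" "y \<in> desc v y0" "gp v y0 (x i) = gp v y (x i)" "ht v (x i) y0 = m" by blast
    have "d v y0 \<noteq> 0" using depth_eq[OF vV x_V[of i] y0(1)] y0 m by simp
    then have "0 < gp v y0 y" using desc_iff_gp[OF vV y0(1) yV] y0 by simp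
    then have "y0 \<in> B i" using same_arm[OF y0(1)] y by blast
    then have "y0 \<in> ?W" using y0 m y by (simp add: W_def \<delta>_def)
    then show "y \<in> (\<Union>y\<in>?W. desc v y)" using y0 by blast
  qed
qed simp

lemma sum_windows:
  assumes "finite X" "A \<subseteq> X" "\<And>y. y \<in> X \<Longrightarrow> 0 \<le> c y" "\<And>y. y \<in> A \<Longrightarrow> lo y \<le> z \<and> z \<le> lo y + 1"
  shows "sum c A \<le> (\<Sum>y\<in>X. c y * indicat_real {lo y..lo y + 1} z)"
proof -
  have "sum c A = (\<Sum>y\<in>A. c y * indicat_real {lo y..lo y + 1} z)"
    using assms(4) by (intro sum.cong) auto
  also have "\<dots> \<le> (\<Sum>y\<in>X. c y * indicat_real {lo y..lo y + 1} z)"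
    using assms by (intro sum_mono2) auto
  finally show ?thesis .
qed

end

section \<open>Families of covers of a tripod\<close>

context tripod begin

text \<open>
  Upper bounds for the price of the twigs that are left over in the families of covers below. In
  one arm a ball contains the whole spine (\<open>win_in\<close>), and at position \<open>q\<close> it contains the vertices
  of height at most \<open>q + z\<close>. In the other arms this ball ends at depth \<open>z\<close> and a second one begins
  (\<open>win_out\<close>), and together they contain the vertices of height at most \<open>\<bar>q - z\<bar>\<close>. Solving
  \<open>\<delta> - 1 \<le> q + z < \<delta>\<close> and \<open>\<delta> - 1 \<le> \<bar>q - z\<bar> < \<delta>\<close> for \<open>z\<close> yields one window in the first case. In
  the second case it yields one window with \<open>z \<ge> q\<close> and, for vertices with \<open>\<delta> \<le> q\<close>, another one
  with \<open>z < q\<close>.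
\<close>
definition win_in :: "arm \<Rightarrow> real \<Rightarrow> real" where
  "win_in i z = (\<Sum>y\<in>{y \<in> W i. q i y < \<delta> i y}. gy v y * indicat_real {\<delta> i y - 1 - q i y..\<delta> i y - 1 - q i y + 1} z)"

definition win_out :: "arm \<Rightarrow> real \<Rightarrow> real" where
  "win_out i z =
     (\<Sum>y\<in>W i. gy v y * indicat_real {q i y + \<delta> i y - 1..q i y + \<delta> i y - 1 + 1} z)
   + (\<Sum>y\<in>{y \<in> W i. \<delta> i y \<le> q i y}. gy v y * indicat_real {q i y - \<delta> i y..q i y - \<delta> i y + 1} z)"

lemma win_in_integral: "\<exists>M \<le> Qhigh i. (win_in i has_integral M) {a..b}"
  unfolding win_in_def[abs_def] Qhigh_def
  by (rule has_integral_unit_windows) (auto intro: gy_W simp: finW)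

lemma win_out_integral: "\<exists>M \<le> Q i + Qlow i. (win_out i has_integral M) {a..b}"
proof -
  have "\<exists>M \<le> Q i. ((\<lambda>z. \<Sum>y\<in>W i. gy v y * indicat_real {q i y + \<delta> i y - 1..q i y + \<delta> i y - 1 + 1} z) has_integral M) {a..b}"
    unfolding Q_def by (rule has_integral_unit_windows) (auto intro: gy_W simp: finW)
  moreover have "\<exists>M \<le> Qlow i. ((\<lambda>z. \<Sum>y\<in>{y \<in> W i. \<delta> i y \<le> q i y}. gy v y * indicat_real {q i y - \<delta> i y..q i y - \<delta> i y + 1} z) has_integral M) {a..b}"
    unfolding Qlow_def by (rule has_integral_unit_windows) (auto intro: gy_W simp: finW)
  ultimately obtain M1 M2 where "M1 \<le> Q i" "M2 \<le> Qlow i"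
    "((\<lambda>z. \<Sum>y\<in>W i. gy v y * indicat_real {q i y + \<delta> i y - 1..q i y + \<delta> i y - 1 + 1} z) has_integral M1) {a..b}"
    "((\<lambda>z. \<Sum>y\<in>{y \<in> W i. \<delta> i y \<le> q i y}. gy v y * indicat_real {q i y - \<delta> i y..q i y - \<delta> i y + 1} z) has_integral M2) {a..b}"
    by blast
  then show ?thesis unfolding win_out_def[abs_def]
    by (intro exI[of _ "M1 + M2"] conjI has_integral_add) auto
qed

lemma residual_in:
  assumes "0 < z"
  shows "cheap d {y \<in> B i. q i y + z < \<delta> i y} (win_in i z)"
proof (rule cheap_mono)
  let ?A = "{y \<in> W i. True \<and> \<delta> i y - 1 \<le> real (gp v y (x i)) + z \<and> real (gp v y (x i)) + z < \<delta> i y}"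
  show "cheap d {y \<in> B i. True \<and> real (gp v y (x i)) + z < \<delta> i y} (sum (gy v) ?A)"
    by (rule cheap_residual) (use assms in auto)
  show "sum (gy v) ?A \<le> win_in i z" unfolding win_in_def
    by (rule sum_windows) (use assms finW in \<open>auto simp: q_def intro: gy_W\<close>)
qed (auto simp: q_def)

lemma residual_out:
  assumes "0 < z"
  shows "cheap d {y \<in> B i. \<bar>q i y - z\<bar> < \<delta> i y} (win_out i z)"
proof (rule cheap_mono)
  let ?A = "{y \<in> W i. True \<and> \<delta> i y - 1 \<le> \<bar>real (gp v y (x i)) - z\<bar> \<and> \<bar>real (gp v y (x i)) - z\<bar> < \<delta> i y}"
  let ?A1 = "{y \<in> ?A. q i y + \<delta> i y - 1 \<le> z}" and ?A2 = "{y \<in> ?A. z < q i y + \<delta> i y - 1}"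
  show "cheap d {y \<in> B i. True \<and> \<bar>real (gp v y (x i)) - z\<bar> < \<delta> i y} (sum (gy v) ?A)"
    by (rule cheap_residual) auto
  have "sum (gy v) (?A1 \<union> ?A2) = sum (gy v) ?A1 + sum (gy v) ?A2"
    using finW[of i] by (intro sum.union_disjoint) auto
  moreover have "?A1 \<union> ?A2 = ?A" by auto
  ultimately have "sum (gy v) ?A = sum (gy v) ?A1 + sum (gy v) ?A2" by simp
  moreover have "sum (gy v) ?A1 \<le> (\<Sum>y\<in>W i. gy v y * indicat_real {q i y + \<delta> i y - 1..q i y + \<delta> i y - 1 + 1} z)"
    by (rule sum_windows) (use finW in \<open>auto simp: q_def intro: gy_W\<close>)
  moreover have "sum (gy v) ?A2 \<le> (\<Sum>y\<in>{y \<in> W i. \<delta> i y \<le> q i y}. gy v y * indicat_real {q i y - \<delta> i y..q i y - \<delta> i y + 1} z)"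
  proof (rule sum_windows)
    have key: "q i y - \<delta> i y \<le> z \<and> z \<le> q i y - \<delta> i y + 1" if "y \<in> ?A2" for y
      using that unfolding q_def by (auto simp: abs_if split: if_splits)
    have "\<delta> i y \<le> q i y" if y: "y \<in> ?A2" for y
    proof -
      have "\<delta> i y < q i y + 1" using key[OF y] assms by simp
      then show ?thesis by (simp add: q_def \<delta>_def)
    qed
    then show "?A2 \<subseteq> {y \<in> W i. \<delta> i y \<le> q i y}" by auto
    show "q i y - \<delta> i y \<le> z \<and> z \<le> q i y - \<delta> i y + 1" if "y \<in> ?A2" for y by (rule key[OF that])
  qed (use finW in \<open>auto intro: gy_W\<close>)
  ultimately show "sum (gy v) ?A \<le> win_out i z" unfolding win_out_def by simp
qed (auto simp: q_def)

text \<open>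
  The ball of size \<open>l\<close> with the end \<open>x i\<close> of the arm on its boundary reaches height
  \<open>l - (h i - q)\<close> above the position \<open>q\<close> of the spine.
\<close>
lemma arm_ball:
  assumes y: "y \<in> B i" "y' \<in> B i" and l: "\<delta> i y \<le> l - (h i - q i y)" "\<delta> i y' \<le> l - (h i - q i y')"
  shows "real (d y y') \<le> l"
proof -
  have *: "real (d a b) \<le> l" if "a \<in> B i" "b \<in> B i" "\<delta> i a \<le> l - (h i - q i a)" "q i a \<le> q i b" for a b
    using dist_coord_arm[OF that(1,2,4)] that(3) coord(2)[OF that(2)] by linarith
  show ?thesis
  proof (cases "q i y \<le> q i y'")
    case True then show ?thesis using * y l by blast
  next
    case False
    have "d y y' = d y' y" using d_sym y B_V by blast
    then show ?thesis using *[of y' y] y l False by simp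
  qed
qed

text \<open>
  The ball of size \<open>h i - z\<close> between the point of the spine at depth \<open>z\<close> and the end of the arm.
\<close>
lemma outer_ball:
  assumes y: "y \<in> B i" "y' \<in> B i" and l: "\<delta> i y \<le> q i y - z" "\<delta> i y' \<le> q i y' - z"
  shows "real (d y y') \<le> h i - z"
proof -
  have *: "real (d a b) \<le> h i - z" if "a \<in> B i" "b \<in> B i" "\<delta> i a \<le> q i a - z" "q i a \<le> q i b" for a b
    using dist_coord_arm[OF that(1,2,4)] that(3) coord(2)[OF that(2)] by linarith
  show ?thesis
  proof (cases "q i y \<le> q i y'")
    case True then show ?thesis using * y l by blast
  next
    case False
    have "d y y' = d y' y" using d_sym y B_V by blast
    then show ?thesis using *[of y' y] y l False by simp
  qed
qed

lemma arms_cover: "\<lbrakk>i \<noteq> j; j \<noteq> k; i \<noteq> k\<rbrakk> \<Longrightarrow> V \<subseteq> insert v (B i \<union> B j \<union> B k)"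
  by (subst V_eq, cases i; cases j; cases k) auto

text \<open>
  A set \<open>S\<close> at the end of the arm with at least \<open>l\<close> vertices is covered by one ball of size \<open>l\<close>
  and the residual twigs, and the induction hypothesis applies to the rest of the tree. As the
  tree is a counterexample, this must be more expensive than \<open>\<kappa>\<close> times the number of vertices of
  \<open>S\<close>. If \<open>l\<close> reaches the centre, \<open>S\<close> is the whole arm.
\<close>
lemma cut:
  assumes l: "0 < l" "l \<le> R"
  shows "\<kappa> * (if l < h i then l else n i) < g l +
    (\<Sum>y\<in>W i. gy v y * indicat_real {\<delta> i y - 1 + h i - q i y..\<delta> i y - 1 + h i - q i y + 1} l)"
proof -
  define A where "A = {y \<in> B i. \<delta> i y \<le> l - (h i - q i y)}"
  define P where "P k \<longleftrightarrow> h i - real k \<le> l" for k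
  define Res where "Res = {y \<in> B i. P (gp v y (x i)) \<and> l - (h i - real (gp v y (x i))) < \<delta> i y}"
  have A: "cheap d A (g l)" using l arm_ball unfolding A_def by (intro cheap_ball) auto
  let ?W = "{y \<in> W i. P (gp v y (x i)) \<and> \<delta> i y - 1 \<le> l - (h i - real (gp v y (x i)))
      \<and> l - (h i - real (gp v y (x i))) < \<delta> i y}"
  have "cheap d Res (sum (gy v) ?W)" unfolding Res_def by (rule cheap_residual) (simp add: P_def)
  moreover have "sum (gy v) ?W \<le> (\<Sum>y\<in>W i. gy v y * indicat_real {\<delta> i y - 1 + h i - q i y..\<delta> i y - 1 + h i - q i y + 1} l)"
    (is "_ \<le> ?w") by (rule sum_windows) (use finW in \<open>auto simp: q_def intro: gy_W\<close>)
  ultimately have Res: "cheap d Res ?w" by (meson cheap_mono order_refl)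
  obtain S where S: "S \<subseteq> B i" "S \<noteq> {}" "convx (V - S)" "S \<subseteq> A \<union> Res" "(if l < h i then l else n i) \<le> real (card S)"
  proof (cases "l < h i")
    case False
    have "B i \<subseteq> A \<union> Res"
    proof
      fix y assume "y \<in> B i"
      then show "y \<in> A \<union> Res" using False coord(3)[of y i] by (auto simp: A_def Res_def P_def q_def)
    qed
    then show ?thesis using that[of "B i"] convx_minus_B x_in[of i] False by (auto simp: n_def)
  next
    case True
    \<comment> \<open>the subtree below the vertex at distance \<open>\<lfloor>l\<rfloor>\<close> from the end of the arm\<close>
    define m where "m = nat \<lfloor>l\<rfloor>"
    have m: "real m \<le> l" "l < real m + 1" using l unfolding m_def by linarith+
    then have "m < d v (x i)" using True unfolding h_def by linarith
    then obtain p where p: "p \<in> V" "d v p = d v (x i) - m" "d p (x i) = m"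
      using geodesic_point[OF vV x_V[of i], of "d v (x i) - m"] by auto
    have px: "x i \<in> desc v p" using p \<open>m < d v (x i)\<close> x_V[of i] by (simp add: desc_def)
    have gpx: "gp v p (x i) = d v p" using desc_iff_gp[OF vV p(1) x_V[of i]] px by simp
    have pB: "p \<in> B i" using same_arm[OF p(1) x_in[of i]] gpx p(2) \<open>m < d v (x i)\<close> by simp
    have in_B: "y \<in> B i" if "y \<in> desc v p" for y
    proof -
      have yV: "y \<in> V" using that desc_subset by blast
      have "gp v p y = d v p" using desc_iff_gp[OF vV p(1) yV] that by simp
      then have "0 < gp v y p" using gp_commute[OF vV p(1) yV] p(2) \<open>m < d v (x i)\<close> by simp
      then show ?thesis using same_arm[OF yV pB] by blast
    qed
    have "desc v p \<subseteq> A \<union> Res"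
    proof
      fix y assume y: "y \<in> desc v p"
      have yV: "y \<in> V" using y desc_subset by blast
      have "gp v y p = d v p" using desc_iff_gp[OF vV p(1) yV] y gp_commute[OF vV p(1) yV] by simp
      then have "d v p \<le> gp v y (x i)" using gp_ultra[OF vV yV p(1) x_V[of i]] gpx by simp
      then have "h i - real (gp v y (x i)) \<le> l" using p(2) m unfolding h_def by linarith
      then show "y \<in> A \<union> Res" using in_B[OF y] by (auto simp: A_def Res_def P_def q_def)
    qed
    moreover have "l \<le> real (card (desc v p))"
      using convx_card[OF convx_desc[OF vV p(1)] desc_subset desc_self[OF p(1)] px] p(3) m by linarith
    ultimately show ?thesis
      using that[of "desc v p"] in_B convx_minus_desc[OF vV p(1)] px True by auto
  qed
  have "cheap d (V - S) (\<kappa> * (L - real (card S)))" by (rule cheap_complement[OF S(1-3)])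
  from cheap_Un[OF this cheap_Un[OF A Res]]
  have "cheap d V (\<kappa> * (L - real (card S)) + (g l + ?w))"
    by (rule cheap_mono) (use S(4) in auto)
  then have "\<kappa> * real (card S) < g l + ?w" using not_cheap by (force simp: L_def algebra_simps)
  moreover have "\<kappa> * (if l < h i then l else n i) \<le> \<kappa> * real (card S)"
    using S(5) kappa by (intro mult_left_mono) auto
  ultimately show ?thesis by linarith
qed

text \<open>
  A ball of size \<open>h i + z\<close> contains the spine of the arm \<open>i\<close> and all points of the other arms of
  depth at most \<open>z\<close>. The ends of the other two arms are taken care of by a ball each.
\<close>
lemma star:
  assumes d: "i \<noteq> j" "j \<noteq> k" "i \<noteq> k"
    and z: "0 < z" "z \<le> h i" "z \<le> h j" "z \<le> h k" "h i + z \<le> R"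
  shows "\<kappa> * L < g (h i + z) + g (h j - z) + g (h k - z) + win_in i z + win_out j z + win_out k z"
proof -
  have hR: "h j \<le> R" "h k \<le> R" using n_less n_ge_h by (meson less_eq_real_def order_trans)+
  define A where "A = {y \<in> B i. \<delta> i y \<le> q i y + z} \<union> {y \<in> V - B i. real (d v y) \<le> z}"
  have "cheap d A (g (h i + z))"
  proof (rule cheap_ball)
    fix a b assume ab: "a \<in> A" "b \<in> A"
    have abV: "a \<in> V" "b \<in> V" using ab B_V[of i] by (auto simp: A_def)
    have dh: "real (d v y) \<le> h i" if "y \<in> B i" for y using coord(1,2)[OF that] by simp
    show "real (d a b) \<le> h i + z"
    proof (cases "a \<in> B i \<and> b \<in> B i")
      case True
      then show ?thesis using ab by (intro arm_ball[of a i b]) (auto simp: A_def)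
    next
      case False
      then have "real (d v a) + real (d v b) \<le> h i + z"
        using ab dh[of a] dh[of b] z by (auto simp: A_def)
      then show ?thesis using dist_depth[OF abV] by linarith
    qed
  qed (use z h_pos[of i] in auto)
  moreover have out: "cheap d {y \<in> B m. \<delta> m y \<le> q m y - z} (g (h m - z))" if "z \<le> h m" "h m \<le> R" for m
    using outer_ball that z by (intro cheap_ball) auto
  ultimately have "cheap d (A \<union> ({y \<in> B j. \<delta> j y \<le> q j y - z} \<union> ({y \<in> B k. \<delta> k y \<le> q k y - z} \<union>
      ({y \<in> B i. q i y + z < \<delta> i y} \<union> ({y \<in> B j. \<bar>q j y - z\<bar> < \<delta> j y} \<union> {y \<in> B k. \<bar>q k y - z\<bar> < \<delta> k y})))))
      (g (h i + z) + (g (h j - z) + (g (h k - z) + (win_in i z + (win_out j z + win_out k z)))))"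
    using z hR by (intro cheap_Un residual_in residual_out) auto
  then have "cheap d V (g (h i + z) + (g (h j - z) + (g (h k - z) + (win_in i z + (win_out j z + win_out k z)))))"
  proof (rule cheap_mono)
    show "V \<subseteq> A \<union> ({y \<in> B j. \<delta> j y \<le> q j y - z} \<union> ({y \<in> B k. \<delta> k y \<le> q k y - z} \<union>
      ({y \<in> B i. q i y + z < \<delta> i y} \<union> ({y \<in> B j. \<bar>q j y - z\<bar> < \<delta> j y} \<union> {y \<in> B k. \<bar>q k y - z\<bar> < \<delta> k y}))))"
    proof
      fix y assume yV: "y \<in> V"
      have other: "y \<in> A \<or> \<delta> m y \<le> q m y - z \<or> \<bar>q m y - z\<bar> < \<delta> m y" if "y \<in> B m" "m \<noteq> i" for m
      proof -
        have "y \<notin> B i" using disj[OF that(2)] that(1) by blast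
        then show ?thesis using coord(1)[OF that(1)] yV by (auto simp: A_def)
      qed
      consider "y = v" | "y \<in> B i" | "y \<in> B j" | "y \<in> B k" using arms_cover[OF d] yV by blast
      then show "y \<in> A \<union> ({y \<in> B j. \<delta> j y \<le> q j y - z} \<union> ({y \<in> B k. \<delta> k y \<le> q k y - z} \<union>
      ({y \<in> B i. q i y + z < \<delta> i y} \<union> ({y \<in> B j. \<bar>q j y - z\<bar> < \<delta> j y} \<union> {y \<in> B k. \<bar>q k y - z\<bar> < \<delta> k y}))))"
      proof cases
        case 1 then show ?thesis using vV v_notin[of i] z by (auto simp: A_def)
      next
        case 2 then show ?thesis by (auto simp: A_def)
      next
        case 3 then show ?thesis using other[of j] d by blast
      next
        case 4 then show ?thesis using other[of k] d by blast
      qed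
    qed
  qed simp
  then show ?thesis using not_cheap[of "g (h i + z) + (g (h j - z) + (g (h k - z) + (win_in i z + (win_out j z + win_out k z))))"]
    by (simp add: L_def)
qed

text \<open>
  Beyond \<open>z = h i\<close> the family of \<open>star\<close> breaks down, because the arm \<open>i\<close> is then shorter than \<open>z\<close>.
  From there on the ball around \<open>v\<close> is extended only into the arm \<open>j\<close>, and the end of the arm \<open>k\<close>
  beyond depth \<open>h i\<close> gets a ball that does not depend on \<open>z\<close>. Its size is bounded in two ways, by
  the number of vertices of the arm and by the heights of its twigs.
\<close>
lemma static_star:
  assumes d: "i \<noteq> j" "j \<noteq> k" "i \<noteq> k"
    and z: "h i \<le> z" "z \<le> h j" "h i + z \<le> R" and ik: "h i \<le> h k" and wj: "w j \<le> h i"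
  shows "\<kappa> * L < g (h i + z) + g (h j - z) + g (min (n k) (h k - h i + 2 * w k)) + win_out j z"
proof -
  have z0: "0 < z" using h_pos[of i] z by linarith
  have hR: "h j \<le> R" using n_less n_ge_h by (meson less_eq_real_def order_trans)
  define A where "A = {y \<in> V - B j. real (d v y) \<le> h i} \<union> {y \<in> B j. real (d v y) \<le> z}"
  have "cheap d A (g (h i + z))"
  proof (rule cheap_ball)
    fix a b assume ab: "a \<in> A" "b \<in> A"
    have abV: "a \<in> V" "b \<in> V" using ab B_V[of j] by (auto simp: A_def)
    show "real (d a b) \<le> h i + z"
    proof (cases "a \<in> B j \<and> b \<in> B j")
      case False
      then have "real (d v a) + real (d v b) \<le> h i + z"
        using ab z by (auto simp: A_def)
      then show ?thesis using dist_depth[OF abV] by linarith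
    next
      case True
      have *: "real (d a b) \<le> h i + z" if "a \<in> B j" "b \<in> B j" "real (d v b) \<le> z" "q j a \<le> q j b" for a b
        using dist_coord_arm[OF that(1,2,4)] delta_le_w[OF that(1)] wj coord[OF that(1)] coord[OF that(2)] that(3)
        by linarith
      show ?thesis
      proof (cases "q j a \<le> q j b")
        case 1: True then show ?thesis using * True ab by (auto simp: A_def)
      next
        case 1: False
        then have "real (d b a) \<le> h i + z" using *[of b a] True ab by (auto simp: A_def)
        then show ?thesis using d_sym[OF abV] by simp
      qed
    qed
  qed (use z h_pos[of i] in auto)
  moreover have "cheap d {y \<in> B j. \<delta> j y \<le> q j y - z} (g (h j - z))"
    using outer_ball[of _ j _ z] z hR z0 by (intro cheap_ball) auto
  moreover have "cheap d {y \<in> B j. \<bar>q j y - z\<bar> < \<delta> j y} (win_out j z)" by (rule residual_out[OF z0])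
  moreover have "cheap d {y \<in> B k. h i < real (d v y)} (g (min (n k) (h k - h i + 2 * w k)))"
  proof (rule cheap_ball)
    fix a b assume ab: "a \<in> {y \<in> B k. h i < real (d v y)}" "b \<in> {y \<in> B k. h i < real (d v y)}"
    have *: "real (d a b) \<le> h k - h i + 2 * w k"
      if "a \<in> B k" "b \<in> B k" "h i < real (d v a)" "q k a \<le> q k b" for a b
      using dist_coord_arm[OF that(1,2,4)] delta_le_w[OF that(1)] coord[OF that(1)] coord[OF that(2)] that(3)
      by linarith
    have "real (d a b) \<le> h k - h i + 2 * w k"
    proof (cases "q k a \<le> q k b")
      case True then show ?thesis using * ab by blast
    next
      case False
      then have "real (d b a) \<le> h k - h i + 2 * w k" using *[of b a] ab by auto
      moreover have "a \<in> V" "b \<in> V" using ab B_V[of k] by blast+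
      ultimately show ?thesis using d_sym[of a b] by simp
    qed
    moreover have "Suc (d a b) \<le> card (insert v (B k))"
      using ab B_V[of k] vV by (intro convx_card[OF convx_insert_B]) auto
    then have "real (d a b) \<le> n k" using finB[of k] v_notin[of k] by (simp add: n_def)
    ultimately show "real (d a b) \<le> min (n k) (h k - h i + 2 * w k)" by simp
  next
    show "0 \<le> min (n k) (h k - h i + 2 * w k)" using ik w_bounds(1)[of k] by (simp add: n_def)
    show "min (n k) (h k - h i + 2 * w k) \<le> R" using n_less[of k] by linarith
  qed
  ultimately have "cheap d (A \<union> ({y \<in> B j. \<delta> j y \<le> q j y - z} \<union> ({y \<in> B k. h i < real (d v y)} \<union> {y \<in> B j. \<bar>q j y - z\<bar> < \<delta> j y})))
     (g (h i + z) + (g (h j - z) + (g (min (n k) (h k - h i + 2 * w k)) + win_out j z)))"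
    by (intro cheap_Un)
  then have "cheap d V (g (h i + z) + (g (h j - z) + (g (min (n k) (h k - h i + 2 * w k)) + win_out j z)))"
  proof (rule cheap_mono)
    show "V \<subseteq> A \<union> ({y \<in> B j. \<delta> j y \<le> q j y - z} \<union> ({y \<in> B k. h i < real (d v y)} \<union> {y \<in> B j. \<bar>q j y - z\<bar> < \<delta> j y}))"
    proof
      fix y assume yV: "y \<in> V"
      consider "y = v" | "y \<in> B i" | "y \<in> B j" | "y \<in> B k" using arms_cover[OF d] yV by blast
      then show "y \<in> A \<union> ({y \<in> B j. \<delta> j y \<le> q j y - z} \<union> ({y \<in> B k. h i < real (d v y)} \<union> {y \<in> B j. \<bar>q j y - z\<bar> < \<delta> j y}))"
      proof cases
        case 1 then show ?thesis using vV v_notin[of j] h_pos[of i] by (auto simp: A_def)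
      next
        case 2
        then have "y \<notin> B j" using disj[OF d(1)] by blast
        then show ?thesis using 2 yV coord(1,2)[OF 2] by (auto simp: A_def)
      next
        case 3 then show ?thesis using coord(1)[OF 3] yV by (auto simp: A_def)
      next
        case 4
        then have "y \<notin> B j" using disj[OF d(2)] by blast
        then show ?thesis using 4 yV by (auto simp: A_def)
      qed
    qed
  qed simp
  then show ?thesis using not_cheap[of "g (h i + z) + (g (h j - z) + (g (min (n k) (h k - h i + 2 * w k)) + win_out j z))"]
    by (simp add: L_def)
qed

end

section \<open>Averaging over the families of covers\<close>

text \<open>
  The final estimate pays for six times the twig prices \<open>Q\<close> of the middle arm with \<open>w\<close> times a
  combination of the numbers \<open>K i\<close>. The two bounds for \<open>Q\<close> are those for small and large twigs.
\<close>
lemma twig_arith: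
  fixes K1 K2 m w Q :: real
  assumes K: "0 < K1" "K1 \<le> K2" "K1 \<le> m" and w: "0 \<le> w" "w \<le> K2" "w \<le> m"
    and Q: "w \<le> K1 \<Longrightarrow> Q \<le> w * K1" "K1 \<le> w \<Longrightarrow> Q \<le> (w\<^sup>2 + K1\<^sup>2) / 2"
  shows "6 * Q \<le> w * (K1 + 3 * K2 + 2 * m)"
proof (cases "w \<le> K1")
  case True
  have "w * (6 * K1) \<le> w * (K1 + 3 * K2 + 2 * m)" using K w by (intro mult_left_mono) auto
  then show ?thesis using Q(1)[OF True] by simp
next
  case False
  have 1: "0 \<le> w * (K2 - w)" "0 \<le> w * (m - w)" using w by auto
  have 2: "0 \<le> w * (w - K1)" "0 \<le> K1 * (w - K1)" using False w K by auto
  have "Q \<le> (w * w + K1 * K1) / 2" using Q(2) False by (simp add: power2_eq_square)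
  then show ?thesis using 1 2 by (simp add: algebra_simps)
qed

text \<open>
  The contradiction for a short third arm, as an inequality between polynomials: twice the
  difference of the two sides is a sum of terms that are nonnegative by \<open>sq\<close>.
\<close>
lemma static_arith:
  fixes a t R k1 k2 k3 w1 w2 w3 h1 h2 :: real
  assumes eqs: "R = a + 2 * t" "k3 = a + t" "h1 = R - k1" "h2 = R - k2"
    and fin: "(k1 + k2 + 2 * k3) * (h1 + w1 + (h2 + w2) + (t + w3)) + 2 * (k1 * (h1 + w1)) + 2 * (k2 * (h2 + w2))
      < 4 * R\<^sup>2 - ((h2 - k1)\<^sup>2 / 2 + (t - k1)\<^sup>2 / 2 + (h1 - k2)\<^sup>2 / 2 + (t - k2)\<^sup>2 / 2
          + (h1 - k3)\<^sup>2 + (h2 - k3)\<^sup>2 - a * a)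
        + (2 * (a * (w1 + w2)) + 2 * (a * k1)
        + w1 * (3 * k1 + k2 + 2 * t) + w2 * (k1 + 3 * k2 + 2 * t) + w3 * (k1 + k2 + 2 * k3))"
    (is "?l < _ - _ + ?m")
    and sq: "k1 * k1 \<le> t * t" "k2 * k2 \<le> t * t" "a * k1 \<le> a * t"
  shows False
proof -
  have double: "2 * l - 2 * m < 8 * r - (s1 + s2 + s3 + s4 + 2 * s5 + 2 * s6 - 2 * b)"
    if "l < 4 * r - (s1 / 2 + s2 / 2 + s3 / 2 + s4 / 2 + s5 + s6 - b) + m" for l m r s1 s2 s3 s4 s5 s6 b :: real
    using that by linarith
  have "2 * ?l - 2 * ?m = 8 * R\<^sup>2 - ((h2 - k1)\<^sup>2 + (t - k1)\<^sup>2 + (h1 - k2)\<^sup>2 + (t - k2)\<^sup>2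
          + 2 * (h1 - k3)\<^sup>2 + 2 * (h2 - k3)\<^sup>2 - 2 * (a * a))
      + (2 * (t * t) + (a * t - a * k1) + (a * t - a * k1) + (a * t - a * k1) + (a * t - a * k1) - k1 * k1 - k2 * k2)"
    unfolding eqs by algebra
  with double[OF fin] have "2 * (t * t) + (a * t - a * k1) + (a * t - a * k1) + (a * t - a * k1) + (a * t - a * k1) - k1 * k1 - k2 * k2 < 0" by simp
  moreover have False if "2 * A + D + D + D + D - B - C < 0" "0 \<le> D" "B \<le> A" "C \<le> A" for A B C D :: real
    using that by linarith
  moreover have "0 \<le> a * t - a * k1" using sq by simp
  ultimately show False using sq by blast
qed

context tripod begin

abbreviation "h1 \<equiv> h Long" abbreviation "h2 \<equiv> h Mid" abbreviation "h3 \<equiv> h Short"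

text \<open>
  The range of the parameter in the families for the arm \<open>i\<close>: a ball of size \<open>h i + z\<close> is
  admissible for \<open>z\<close> up to \<open>K i\<close>.
\<close>
definition K :: "arm \<Rightarrow> real" where "K i = R - h i"

lemma K_facts:
  "0 < K i" "w i < K i" "K Long \<le> K Mid" "K Mid \<le> K Short" "K Mid < h3" "K Short < h2" "K Long < h3"
  "h i = R - K i" "h i \<le> R" "0 < h i"
  using w_bounds[of i] h_order h_pos[of i] by (auto simp: K_def)

lemma L_pos: "0 < L"
  using L_eq n_ge_h[of Long] n_ge_h[of Mid] n_ge_h[of Short] h_pos[of Long] h_pos[of Mid] h_pos[of Short] by linarith

text \<open>
  The cuts that take the whole arm \<open>i\<close>, with \<open>l = h i + z\<close>, integrated over \<open>z\<close>.
\<close>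
lemma single_int: "\<kappa> * (K i * n i) \<le> G R - G (h i) + Qhigh i"
proof -
  have b: "0 < K i" "h i + K i = R" "0 < h i" using K_facts(1)[of i] h_pos[of i] by (auto simp: K_def)
  obtain M where M: "M \<le> Qhigh i" "(win_in i has_integral M) {0..K i}" using win_in_integral by blast
  have "((\<lambda>z. g (h i + z)) has_integral G (h i + K i) - G (h i + 0)) {0..K i}"
    using b by (intro g_shift) auto
  then have *: "((\<lambda>z. g (h i + z) + win_in i z) has_integral (G R - G (h i)) + M) {0..K i}"
    using M(2) b by (intro has_integral_add) auto
  have "((\<lambda>_. \<kappa> * n i) has_integral (K i - 0) * (\<kappa> * n i)) {0..K i}"
    using has_integral_const_real[of "\<kappa> * n i" 0 "K i"] b by simp
  note c0 = this
  have "(K i - 0) * (\<kappa> * n i) \<le> (G R - G (h i)) + M"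
  proof (rule has_integral_le_greaterThan[OF c0 *])
    fix z assume z: "0 < z" "z \<le> K i"
    have "(\<Sum>y\<in>W i. gy v y * indicat_real {\<delta> i y - 1 + h i - q i y..\<delta> i y - 1 + h i - q i y + 1} (h i + z))
      = (\<Sum>y\<in>{y \<in> W i. q i y < \<delta> i y}. gy v y * indicat_real {\<delta> i y - 1 - q i y..\<delta> i y - 1 - q i y + 1} z)"
      by (rule sum.mono_neutral_cong_right) (use z finW in \<open>auto simp: indicator_def\<close>)
    then show "\<kappa> * n i \<le> g (h i + z) + win_in i z"
      using cut[of "h i + z" i] z b by (simp add: win_in_def)
  qed
  then show ?thesis using M(1) by (simp add: mult_ac)
qed

text \<open>
  An upper bound for \<open>G\<close>, opposite to \<open>G_ge\<close>: cutting off the end of an arm is expensive for all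
  \<open>l\<close> between \<open>k\<close> and \<open>R\<close>, so \<open>g\<close> is large there, and the integral over \<open>[0, R]\<close> is known.
\<close>
lemma cut_int:
  assumes k: "0 \<le> k" "k \<le> h i"
  shows "G k \<le> k\<^sup>2 / 2 + (K i)\<^sup>2 / 2 + Q i - K i * w i"
proof -
  have b: "0 < K i" "h i + K i = R" "0 < h i" "h i \<le> R" using K_facts(1)[of i] h_pos[of i] by (auto simp: K_def)
  let ?w = "\<lambda>l. \<Sum>y\<in>W i. gy v y * indicat_real {\<delta> i y - 1 + h i - q i y..\<delta> i y - 1 + h i - q i y + 1} l"
  have "\<exists>M\<le>\<Sum>y\<in>W i. gy v y. (?w has_integral M) {k..R}"
    by (rule has_integral_unit_windows) (auto intro: gy_W simp: finW)
  then obtain M where M: "M \<le> Q i" "(?w has_integral M) {k..R}" unfolding Q_def by blast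
  have *: "((\<lambda>l. g l + ?w l) has_integral (G R - G k) + M) {k..R}"
    using M(2) k b by (intro has_integral_add g_has_integral) auto
  have i1: "((\<lambda>l. if l < h i then l else n i) has_integral ((h i)\<^sup>2 / 2 - k\<^sup>2 / 2)) {k..h i}"
  proof (rule has_integral_spike_finite[of "{h i}"])
    show "((\<lambda>l. l) has_integral ((h i)\<^sup>2 / 2 - k\<^sup>2 / 2)) {k..h i}"
      using ident_has_integral[of k "h i"] k by (simp add: diff_divide_distrib)
  qed auto
  have i2: "((\<lambda>l. if l < h i then l else n i) has_integral (K i * n i)) {h i..R}"
  proof (rule has_integral_eq)
    show "((\<lambda>_. n i) has_integral (K i * n i)) {h i..R}"
      using has_integral_const_real[of "n i" "h i" R] b by (simp add: K_def)
  qed auto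
  have "((\<lambda>l. if l < h i then l else n i) has_integral ((h i)\<^sup>2 / 2 - k\<^sup>2 / 2) + (K i * n i)) {k..R}"
    by (rule Henstock_Kurzweil_Integration.has_integral_combine[OF k(2) b(4) i1 i2])
  note c0 = this
  have "((h i)\<^sup>2 / 2 - k\<^sup>2 / 2) + (K i * n i) \<le> (G R - G k) + M"
  proof (rule has_integral_le_greaterThan[OF c0 *])
    fix l assume l: "k < l" "l \<le> R"
    have "0 \<le> (if l < h i then l else n i)" using l k by (auto simp: n_def)
    then have "(if l < h i then l else n i) \<le> \<kappa> * (if l < h i then l else n i)"
      using kappa mult_right_mono[of 1 \<kappa> "if l < h i then l else n i"] by simp
    also have "\<dots> \<le> g l + ?w l" using cut[of l i] l k by simp
    finally show "(if l < h i then l else n i) \<le> g l + ?w l" .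
  qed
  moreover have "K i * n i = K i * h i + K i * w i" using n_eq[of i] by (simp add: algebra_simps)
  moreover have "G R = (h i)\<^sup>2 / 2 + K i * h i + (K i)\<^sup>2 / 2"
  proof -
    have "G R = (h i + K i)\<^sup>2 / 2" using G_R b(2) by metis
    then show ?thesis by (simp add: power2_sum add_divide_distrib)
  qed
  ultimately show ?thesis using M(1) by linarith
qed

text \<open>
  \<open>cut_int\<close> at \<open>k = K Long\<close> bounds \<open>G k\<close> in terms of \<open>G (w Long)\<close>, and convexity of \<open>G\<close> bounds
  \<open>G (w Long)\<close> in terms of \<open>G k\<close>. Together they bound \<open>G (w Long)\<close>, so that the twigs of the
  longest arm disappear from \<open>cut_int\<close>.
\<close>
lemma G_w_Long: "G (w Long) \<le> w Long * K Long"
proof -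
  have b: "0 \<le> w Long" "w Long < K Long" "K Long \<le> h1" "K Long \<le> R" "0 < K Long"
    using w_bounds[of Long] K_facts(1,2,9)[of Long] K_facts(7) h_order by (auto simp: K_def)
  let ?w = "w Long" and ?K = "K Long"
  have 1: "G ?K \<le> ?K * ?K + (G ?w - ?w * ?K)"
    using cut_int[of ?K Long] Q_le[of Long] b by (simp add: power2_eq_square mult.commute)
  have "?K * G ?w \<le> ?w * G ?K" using G_convex[of ?w ?K] b by simp
  also have "\<dots> \<le> ?w * (?K * ?K + (G ?w - ?w * ?K))" using 1 b by (intro mult_left_mono) auto
  finally have "(?K - ?w) * (G ?w - ?w * ?K) \<le> 0" by (simp add: algebra_simps)
  then show ?thesis using b by (simp add: mult_le_0_iff)
qed

lemma G_upper:
  assumes "0 \<le> k" "k \<le> h1" shows "G k \<le> k\<^sup>2 / 2 + (K Long)\<^sup>2 / 2"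
  using cut_int[OF assms] Q_le[of Long] G_w_Long by (simp add: mult.commute)

text \<open>
  Since \<open>g\<close> is nondecreasing, \<open>g y\<close> is at most its mean over an interval that starts at \<open>y\<close>. The
  interval is \<open>[y, y + K Long]\<close> or, if that leaves the range of \<open>G_upper\<close>, \<open>[y, R]\<close>.
\<close>
lemma g_upper:
  assumes y: "0 \<le> y" "y \<le> R" shows "g y \<le> y + K Long"
proof -
  let ?K = "K Long"
  have b: "0 < ?K" "h1 = R - ?K" "K Long \<le> h1" using K_facts(1)[of Long] K_facts(7) h_order by (auto simp: K_def)
  consider "y + ?K \<le> h1" | "y = R" | "h1 < y + ?K" "y < R" using y by linarith
  then show ?thesis
  proof cases
    case 1
    have "?K * g y \<le> G (y + ?K) - G y" using G_diff_bounds(1)[of y "y + ?K"] 1 y b by simp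
    also have "\<dots> \<le> (y + ?K)\<^sup>2 / 2 + ?K\<^sup>2 / 2 - y\<^sup>2 / 2"
      using G_upper[of "y + ?K"] G_ge[of y] 1 y b by simp
    also have "\<dots> = ?K * (y + ?K)" by (simp add: power2_eq_square field_simps)
    finally show ?thesis using b by simp
  next
    case 2 then show ?thesis using g_R b by simp
  next
    case 3
    have "(R - y) * g y \<le> G R - G y" using G_diff_bounds(1)[of y R] y by simp
    also have "\<dots> \<le> R\<^sup>2 / 2 - y\<^sup>2 / 2" using G_ge[of y] G_R y by simp
    also have "\<dots> = (R - y) * ((R + y) / 2)" by (simp add: power2_eq_square algebra_simps)
    finally have "g y \<le> (R + y) / 2" using 3 by simp
    then show ?thesis using 3 b by simp
  qed
qed

lemma Q_bounds:
  assumes "w i \<le> h1"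
  shows "w i \<le> K Long \<Longrightarrow> Q i \<le> w i * K Long" "K Long \<le> w i \<Longrightarrow> Q i \<le> ((w i)\<^sup>2 + (K Long)\<^sup>2) / 2"
proof -
  have b: "0 \<le> w i" "K Long \<le> h1" "K Long \<le> R" "0 < K Long"
    using w_bounds[of i] K_facts(1,9)[of Long] K_facts(7) h_order by (auto simp: K_def)
  show "Q i \<le> w i * K Long" if "w i \<le> K Long"
  proof -
    have "G (K Long) \<le> K Long * K Long" using G_upper[of "K Long"] b by (simp add: power2_eq_square)
    then have "w i * G (K Long) \<le> K Long * (w i * K Long)"
      using mult_left_mono[of "G (K Long)" "K Long * K Long" "w i"] b by (simp add: mult_ac)
    then have "K Long * G (w i) \<le> K Long * (w i * K Long)"
      using G_convex[of "w i" "K Long"] b that by linarith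
    then have "G (w i) \<le> w i * K Long" using mult_le_cancel_left_pos[OF b(4)] by blast
    then show ?thesis using Q_le[of i] by simp
  qed
  show "Q i \<le> ((w i)\<^sup>2 + (K Long)\<^sup>2) / 2" if "K Long \<le> w i"
    using Q_le[of i] G_upper[of "w i"] assms b by (simp add: add_divide_distrib)
qed

lemma star_int:
  assumes d: "i \<noteq> j" "j \<noteq> k" "i \<noteq> k"
    and b: "0 \<le> b" "b \<le> h i" "b \<le> h j" "b \<le> h k" "h i + b \<le> R"
  shows "\<kappa> * (b * L) \<le> G (h i + b) - G (h i) + (G (h j) - G (h j - b)) + (G (h k) - G (h k - b))
     + integral {0..b} (win_in i) + integral {0..b} (win_out j) + integral {0..b} (win_out k)"
proof -
  have "(win_in i has_integral integral {0..b} (win_in i)) {0..b}"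
    "(win_out m has_integral integral {0..b} (win_out m)) {0..b}" for m
    using win_in_integral win_out_integral by (metis integral_unique)+
  moreover have "((\<lambda>z. g (h i + z)) has_integral G (h i + b) - G (h i + 0)) {0..b}"
    using b h_pos[of i] by (intro g_shift) auto
  moreover have "((\<lambda>z. g (h j - z)) has_integral G (h j - 0) - G (h j - b)) {0..b}"
    "((\<lambda>z. g (h k - z)) has_integral G (h k - 0) - G (h k - b)) {0..b}"
    using b K_facts(9)[of j] K_facts(9)[of k] by (intro g_shift_neg; simp)+
  ultimately have *: "((\<lambda>z. g (h i + z) + g (h j - z) + g (h k - z) + win_in i z + win_out j z + win_out k z) has_integral
     (G (h i + b) - G (h i + 0)) + (G (h j - 0) - G (h j - b)) + (G (h k - 0) - G (h k - b))
     + integral {0..b} (win_in i) + integral {0..b} (win_out j) + integral {0..b} (win_out k)) {0..b}"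
    by (intro has_integral_add)
  have "((\<lambda>_. \<kappa> * L) has_integral (b - 0) * (\<kappa> * L)) {0..b}"
    using has_integral_const_real[of "\<kappa> * L" 0 b] b by simp
  note c0 = this
  have "(b - 0) * (\<kappa> * L) \<le> (G (h i + b) - G (h i + 0)) + (G (h j - 0) - G (h j - b)) + (G (h k - 0) - G (h k - b))
     + integral {0..b} (win_in i) + integral {0..b} (win_out j) + integral {0..b} (win_out k)"
  proof (rule has_integral_le_greaterThan[OF c0 *])
    fix z assume "0 < z" "z \<le> b"
    then show "\<kappa> * L \<le> g (h i + z) + g (h j - z) + g (h k - z) + win_in i z + win_out j z + win_out k z"
      using star[OF d, of z] b by simp
  qed
  then show ?thesis by (simp add: mult_ac)
qed

lemma static_int:
  assumes d: "Short \<noteq> j" "j \<noteq> k" "Short \<noteq> k" and hK: "h3 \<le> K Short"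
  shows "\<kappa> * ((K Short - h3) * L) \<le> G R - G (2 * h3) + (G (h j - h3) - G (h j - K Short))
    + (K Short - h3) * g (min (n k) (h k - h3 + 2 * w k)) + integral {h3..K Short} (win_out j)"
proof -
  let ?a = "h3" and ?b = "K Short"
  have hs: "h3 \<le> h m" "?b < h m \<or> m = Short" for m using h_order K_facts(6) by (cases m; auto)+
  have sum: "h3 + ?b = R" by (simp add: K_def)
  have wj: "w j \<le> h3" using K_facts(2)[of j] K_facts(5,7) d by (cases j) auto
  have "(win_out j has_integral integral {?a..?b} (win_out j)) {?a..?b}"
    using win_out_integral by (metis integral_unique)
  moreover have "((\<lambda>z. g (h3 + z)) has_integral G (h3 + ?b) - G (h3 + ?a)) {?a..?b}"
    using hK sum h_pos[of Short] by (intro g_shift) auto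
  moreover have "((\<lambda>z. g (h j - z)) has_integral G (h j - ?a) - G (h j - ?b)) {?a..?b}"
    using hK hs[of j] K_facts(9)[of j] h_pos[of Short] d by (intro g_shift_neg) auto
  moreover have "((\<lambda>_. g (min (n k) (h k - h3 + 2 * w k))) has_integral (?b - ?a) * g (min (n k) (h k - h3 + 2 * w k))) {?a..?b}"
    using has_integral_const_real[of "g (min (n k) (h k - h3 + 2 * w k))" ?a ?b] hK by simp
  ultimately have *: "((\<lambda>z. g (h3 + z) + g (h j - z) + g (min (n k) (h k - h3 + 2 * w k)) + win_out j z) has_integral
     (G (h3 + ?b) - G (h3 + ?a)) + (G (h j - ?a) - G (h j - ?b)) + (?b - ?a) * g (min (n k) (h k - h3 + 2 * w k))
     + integral {?a..?b} (win_out j)) {?a..?b}"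
    by (intro has_integral_add)
  have "((\<lambda>_. \<kappa> * L) has_integral (?b - ?a) * (\<kappa> * L)) {?a..?b}"
    using has_integral_const_real[of "\<kappa> * L" ?a ?b] hK by simp
  note c0 = this
  have "(?b - ?a) * (\<kappa> * L) \<le>
     (G (h3 + ?b) - G (h3 + ?a)) + (G (h j - ?a) - G (h j - ?b)) + (?b - ?a) * g (min (n k) (h k - h3 + 2 * w k))
     + integral {?a..?b} (win_out j)"
  proof (rule has_integral_le_greaterThan[OF c0 *])
    fix z assume z: "?a < z" "z \<le> ?b"
    then have "z \<le> h j" using hs(2)[of j] d by auto
    then show "\<kappa> * L \<le> g (h3 + z) + g (h j - z) + g (min (n k) (h k - h3 + 2 * w k)) + win_out j z"
      using static_star[OF d, of z] z sum hs(1)[of k] wj by simp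
  qed
  then show ?thesis using sum by (simp add: mult_ac)
qed

lemma int_in_le: "integral {a..b} (win_in i) \<le> Qhigh i"
  using win_in_integral by (metis integral_unique)
lemma int_out_le: "integral {a..b} (win_out i) \<le> Q i + Qlow i"
  using win_out_integral by (metis integral_unique)
lemma int_out_combine:
  "a \<le> c \<Longrightarrow> c \<le> b \<Longrightarrow> integral {a..c} (win_out i) + integral {c..b} (win_out i) = integral {a..b} (win_out i)"
  using win_out_integral[of i a b] by (intro Henstock_Kurzweil_Integration.integral_combine) auto

text \<open>
  The family of \<open>star\<close> over its full parameter range \<open>[0, K i]\<close>.
\<close>
lemma star_full:
  assumes d: "i \<noteq> j" "j \<noteq> k" "i \<noteq> k" and b: "K i \<le> h i" "K i \<le> h j" "K i \<le> h k"
  shows "\<kappa> * (K i * L) \<le> G R - G (h i) + (G (h j) - G (h j - K i)) + (G (h k) - G (h k - K i))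
     + Qhigh i + (Q j + Qlow j) + (Q k + Qlow k)"
  using star_int[OF d, of "K i"] b K_facts(1)[of i] int_in_le[of 0 "K i" i] int_out_le[of 0 "K i" j] int_out_le[of 0 "K i" k]
  by (simp add: K_def)

text \<open>
  If the third arm is shorter than \<open>K Short\<close>, the parameter range is divided at \<open>h Short\<close> between
  \<open>star\<close> and \<open>static_star\<close>.
\<close>
lemma star_static:
  assumes d: "Short \<noteq> j" "j \<noteq> k" "Short \<noteq> k" and hK: "h3 \<le> K Short"
  shows "\<kappa> * (K Short * L) \<le> G R - G h3 + (G (h j) - G (h j - K Short)) + (G (h k) - G (h k - h3))
     + (K Short - h3) * (h k - h3 + 2 * w k + K Long) + Qhigh Short + (Q j + Qlow j) + (Q k + Qlow k)"
proof -
  let ?m = "min (n k) (h k - h3 + 2 * w k)"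
  have m: "0 \<le> ?m" "?m \<le> R" using n_less[of k] w_bounds(1)[of k] h_order by (auto simp: n_def min_le_iff_disj intro: order_trans split: if_splits) (cases k; simp)
  have "g ?m \<le> ?m + K Long" by (rule g_upper[OF m])
  also have "\<dots> \<le> h k - h3 + 2 * w k + K Long" by simp
  finally have 1: "(K Short - h3) * g ?m \<le> (K Short - h3) * (h k - h3 + 2 * w k + K Long)"
    using hK by (intro mult_left_mono) auto
  have hs: "h3 \<le> h m" for m using h_order by (cases m) auto
  have "\<kappa> * (h3 * L) \<le> G (h3 + h3) - G h3 + (G (h j) - G (h j - h3)) + (G (h k) - G (h k - h3))
     + integral {0..h3} (win_in Short) + integral {0..h3} (win_out j) + integral {0..h3} (win_out k)"
    using hs[of j] hs[of k] hK h_pos[of Short] by (intro star_int[OF d]) (auto simp: K_def)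
  moreover have "\<kappa> * ((K Short - h3) * L) \<le> G R - G (2 * h3) + (G (h j - h3) - G (h j - K Short))
    + (K Short - h3) * g ?m + integral {h3..K Short} (win_out j)" by (rule static_int[OF d hK])
  moreover have "\<kappa> * (K Short * L) = \<kappa> * (h3 * L) + \<kappa> * ((K Short - h3) * L)" by (simp add: algebra_simps)
  moreover have "integral {0..h3} (win_out j) + integral {h3..K Short} (win_out j) = integral {0..K Short} (win_out j)"
    using hK h_pos[of Short] by (intro int_out_combine) auto
  ultimately show ?thesis
    using 1 int_in_le[of 0 h3 Short] int_out_le[of 0 "K Short" j] int_out_le[of 0 h3 k] by simp
qed

text \<open>
  The inequalities \<open>star_full\<close> for the arms 1, 2, 3 (in the order of decreasing length) and
  \<open>single_int\<close> for the arms 1, 2 are added with the coefficients 1, 1, 2, 2, 2; if the third arm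
  is shorter than \<open>K Short\<close>, \<open>star_static\<close> takes the place of \<open>star_full\<close> for it. With these
  coefficients the values \<open>G (h i)\<close> cancel, and only values of \<open>G\<close> remain that are bounded from
  below by \<open>k\<^sup>2 / 2\<close>, besides \<open>G R = R\<^sup>2 / 2\<close> and the twig prices \<open>6 Q\<^sub>1 + 6 Q\<^sub>2 + 4 Q\<^sub>3\<close>. The
  latter are absorbed by the twig vertices in the lengths on the left-hand side, and what is left
  is a false quadratic inequality in the numbers \<open>K i\<close>.
\<close>
lemma contradiction: False
proof -
  let ?K1 = "K Long" and ?K2 = "K Mid" and ?K3 = "K Short"
  let ?w1 = "w Long" and ?w2 = "w Mid" and ?w3 = "w Short"
  have Kp: "0 < ?K1" "0 < ?K2" "0 < ?K3" "?K1 \<le> ?K2" "?K2 \<le> ?K3" "?K2 < h3" "?K3 < h2" using K_facts by auto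
  have h: "h1 = R - ?K1" "h2 = R - ?K2" "h3 = R - ?K3" by (simp_all add: K_def)
  have wK: "?w1 < ?K1" "?w2 < ?K2" "?w3 < ?K3" "0 \<le> ?w1" "0 \<le> ?w2" "0 \<le> ?w3" using K_facts(2) w_bounds by auto
  have wh: "w i \<le> h1" for i using wK Kp h_order by (cases i) auto
  have s1: "\<kappa> * (?K1 * L) \<le> G R - G h1 + (G h2 - G (h2 - ?K1)) + (G h3 - G (h3 - ?K1))
     + Qhigh Long + (Q Mid + Qlow Mid) + (Q Short + Qlow Short)"
    using Kp h_order by (intro star_full) auto
  have s2: "\<kappa> * (?K2 * L) \<le> G R - G h2 + (G h1 - G (h1 - ?K2)) + (G h3 - G (h3 - ?K2))
     + Qhigh Mid + (Q Long + Qlow Long) + (Q Short + Qlow Short)"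
    using Kp h_order by (intro star_full) auto
  have t1: "\<kappa> * (?K1 * n Long) \<le> G R - G h1 + Qhigh Long" by (rule single_int)
  have t2: "\<kappa> * (?K2 * n Mid) \<le> G R - G h2 + Qhigh Mid" by (rule single_int)
  have g2: "(h2 - ?K1)\<^sup>2 / 2 \<le> G (h2 - ?K1)" "(h3 - ?K1)\<^sup>2 / 2 \<le> G (h3 - ?K1)"
    "(h1 - ?K2)\<^sup>2 / 2 \<le> G (h1 - ?K2)" "(h3 - ?K2)\<^sup>2 / 2 \<le> G (h3 - ?K2)"
    "(h1 - ?K3)\<^sup>2 / 2 \<le> G (h1 - ?K3)" "(h2 - ?K3)\<^sup>2 / 2 \<le> G (h2 - ?K3)"
    "(h1 - h3)\<^sup>2 / 2 \<le> G (h1 - h3)" "(h2 - h3)\<^sup>2 / 2 \<le> G (h2 - h3)"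
    using Kp h_order h h_pos[of Long] h_pos[of Mid] h_pos[of Short] by - (rule G_ge; linarith)+
  have Lpos: "0 < L" by (rule L_pos)
  have npos: "0 \<le> n i" for i by (simp add: n_def)
  have pos: "0 < (?K1 + ?K2 + 2 * ?K3) * L + 2 * (?K1 * n Long) + 2 * (?K2 * n Mid)"
    using Kp Lpos npos[of Long] npos[of Mid] by (intro add_pos_nonneg mult_pos_pos) auto
  \<comment> \<open>\<open>\<kappa> > 1\<close> makes the sum of the inequalities strict\<close>
  have str: "(?K1 + ?K2 + 2 * ?K3) * L + 2 * (?K1 * n Long) + 2 * (?K2 * n Mid)
    < \<kappa> * (?K1 * L) + \<kappa> * (?K2 * L) + 2 * (\<kappa> * (?K3 * L)) + 2 * (\<kappa> * (?K1 * n Long)) + 2 * (\<kappa> * (?K2 * n Mid))"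
    using mult_strict_right_mono[OF kappa pos] by (simp add: algebra_simps)
  note Qs = Q_split[of Long] Q_split[of Mid] Q_split[of Short]
  note nn = n_eq[of Long] n_eq[of Mid] n_eq[of Short]
  have sq: "?K1 * ?K1 \<le> ?K3 * ?K3" "?K2 * ?K2 \<le> ?K3 * ?K3" using Kp by (auto intro!: mult_mono)
  have q3: "4 * Q Short \<le> ?w3 * (?K1 + ?K2 + 2 * ?K3)"
  proof (cases "?w3 \<le> ?K1")
    case True
    have "?w3 * (4 * ?K1) \<le> ?w3 * (?K1 + ?K2 + 2 * ?K3)" using Kp wK by (intro mult_left_mono) auto
    then show ?thesis using Q_bounds(1)[OF wh True] by simp
  next
    case False
    have "0 \<le> ?w3 * (?K2 - ?K1)" "0 \<le> ?w3 * (?K3 - ?w3)" using wK Kp by auto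
    moreover have "0 \<le> ?K1 * (?w3 - ?K1)" using False Kp by auto
    moreover have "Q Short \<le> (?w3 * ?w3 + ?K1 * ?K1) / 2" using Q_bounds(2)[OF wh, of Short] False by (simp add: power2_eq_square)
    ultimately show ?thesis by (simp add: algebra_simps)
  qed
  show False
  proof (cases "?K3 \<le> h3")
    case True
    have s3: "\<kappa> * (?K3 * L) \<le> G R - G h3 + (G h1 - G (h1 - ?K3)) + (G h2 - G (h2 - ?K3))
       + Qhigh Short + (Q Long + Qlow Long) + (Q Mid + Qlow Mid)"
      using Kp h_order True by (intro star_full) auto
    have q1: "6 * Q Long \<le> ?w1 * (3 * ?K1 + ?K2 + 2 * ?K3)"
      using Q_bounds(1)[OF wh, of Long] wK Kp mult_left_mono[of "6 * ?K1" "3 * ?K1 + ?K2 + 2 * ?K3" ?w1] by auto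
    have q2: "6 * Q Mid \<le> ?w2 * (?K1 + 3 * ?K2 + 2 * ?K3)"
      using Q_bounds[OF wh, of Mid] wK Kp by (intro twig_arith(1)) auto
    have main: "(?K1 + ?K2 + 2 * ?K3) * L + 2 * (?K1 * n Long) + 2 * (?K2 * n Mid)
      < 8 * G R - (G (h2 - ?K1) + G (h3 - ?K1) + G (h1 - ?K2) + G (h3 - ?K2) + 2 * G (h1 - ?K3) + 2 * G (h2 - ?K3))
        + 6 * Q Long + 6 * Q Mid + 4 * Q Short"
      using s1 s2 s3 t1 t2 str Qs by linarith
    have "(?K1 + ?K2 + 2 * ?K3) * (h1 + ?w1 + (h2 + ?w2) + (h3 + ?w3)) + 2 * (?K1 * (h1 + ?w1)) + 2 * (?K2 * (h2 + ?w2))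
      < 4 * R\<^sup>2 - ((h2 - ?K1)\<^sup>2 / 2 + (h3 - ?K1)\<^sup>2 / 2 + (h1 - ?K2)\<^sup>2 / 2 + (h3 - ?K2)\<^sup>2 / 2 + (h1 - ?K3)\<^sup>2 + (h2 - ?K3)\<^sup>2)
        + ?w1 * (3 * ?K1 + ?K2 + 2 * ?K3) + ?w2 * (?K1 + 3 * ?K2 + 2 * ?K3) + ?w3 * (?K1 + ?K2 + 2 * ?K3)"
      using main[unfolded L_eq nn G_R] g2 q1 q2 q3 by linarith
    then show False using sq unfolding h by (simp add: power2_eq_square algebra_simps add_divide_distrib diff_divide_distrib)
  next
    case False
    define a where "a = ?K3 - h3"
    have a: "0 < a" using False by (simp add: a_def)
    \<comment> \<open>the resting arm \<open>k\<close> is the one with the smaller twigs, so that \<open>2 w k\<close> is at most the sum of both\<close>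
    obtain j k where jk: "Short \<noteq> j" "j \<noteq> k" "Short \<noteq> k" "2 * w k \<le> ?w1 + ?w2"
      "G (h j) + G (h k) = G h1 + G h2" "(Q j + Qlow j) + (Q k + Qlow k) = (Q Long + Qlow Long) + (Q Mid + Qlow Mid)"
      "G (h j - ?K3) + G (h k - h3) - a * (h k - h3) \<ge> (h1 - ?K3)\<^sup>2 / 2 + (h2 - ?K3)\<^sup>2 / 2 - a * a / 2"
    proof (cases "?w1 \<le> ?w2")
      case True
      have "(h1 - h3)\<^sup>2 / 2 - a * (h1 - h3) = (h1 - ?K3)\<^sup>2 / 2 - a * a / 2"
        by (simp add: a_def power2_eq_square field_simps)
      then show ?thesis using that[of Mid Long] True g2 by auto
    next
      case False
      have "(h2 - h3)\<^sup>2 / 2 - a * (h2 - h3) = (h2 - ?K3)\<^sup>2 / 2 - a * a / 2"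
        by (simp add: a_def power2_eq_square field_simps)
      then show ?thesis using that[of Long Mid] False g2 by auto
    qed
    have s3: "\<kappa> * (?K3 * L) \<le> G R - G h3 + (G (h j) - G (h j - ?K3)) + (G (h k) - G (h k - h3))
     + (?K3 - h3) * (h k - h3 + 2 * w k + ?K1) + Qhigh Short + (Q j + Qlow j) + (Q k + Qlow k)"
      using False by (intro star_static jk) auto
    have aw: "a * (2 * w k) \<le> a * (?w1 + ?w2)" using a jk(4) by (intro mult_left_mono) auto
    have "(?K3 - h3) * (h k - h3 + 2 * w k + ?K1) = a * (h k - h3) + a * (2 * w k) + a * ?K1"
      by (simp add: a_def algebra_simps)
    then have s3': "\<kappa> * (?K3 * L) \<le> G R - G h3 + G h1 + G h2 - ((h1 - ?K3)\<^sup>2 / 2 + (h2 - ?K3)\<^sup>2 / 2 - a * a / 2)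
      + a * (?w1 + ?w2) + a * ?K1 + Qhigh Short + (Q Long + Qlow Long) + (Q Mid + Qlow Mid)"
      using s3 jk(5-7) aw by linarith
    have q1: "6 * Q Long \<le> ?w1 * (3 * ?K1 + ?K2 + 2 * h3)"
      using Q_bounds(1)[OF wh, of Long] wK Kp mult_left_mono[of "6 * ?K1" "3 * ?K1 + ?K2 + 2 * h3" ?w1] by auto
    have q2: "6 * Q Mid \<le> ?w2 * (?K1 + 3 * ?K2 + 2 * h3)"
      using Q_bounds[OF wh, of Mid] wK Kp by (intro twig_arith(1)) auto
    have main: "(?K1 + ?K2 + 2 * ?K3) * L + 2 * (?K1 * n Long) + 2 * (?K2 * n Mid)
      < 8 * G R - (G (h2 - ?K1) + G (h3 - ?K1) + G (h1 - ?K2) + G (h3 - ?K2) + (h1 - ?K3)\<^sup>2 + (h2 - ?K3)\<^sup>2 - a * a)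
        + 2 * (a * (?w1 + ?w2)) + 2 * (a * ?K1) + 6 * Q Long + 6 * Q Mid + 4 * Q Short"
      using s1 s2 s3' t1 t2 str Qs by linarith
    have fin: "(?K1 + ?K2 + 2 * ?K3) * (h1 + ?w1 + (h2 + ?w2) + (h3 + ?w3)) + 2 * (?K1 * (h1 + ?w1)) + 2 * (?K2 * (h2 + ?w2))
      < 4 * R\<^sup>2 - ((h2 - ?K1)\<^sup>2 / 2 + (h3 - ?K1)\<^sup>2 / 2 + (h1 - ?K2)\<^sup>2 / 2 + (h3 - ?K2)\<^sup>2 / 2 + (h1 - ?K3)\<^sup>2 + (h2 - ?K3)\<^sup>2 - a * a)
        + (2 * (a * (?w1 + ?w2)) + 2 * (a * ?K1)
        + ?w1 * (3 * ?K1 + ?K2 + 2 * h3) + ?w2 * (?K1 + 3 * ?K2 + 2 * h3) + ?w3 * (?K1 + ?K2 + 2 * ?K3))"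
      using main[unfolded L_eq nn G_R] g2(1-4) q1 q2 q3 by linarith
    have R: "R = a + 2 * h3" "?K3 = a + h3" using h by (auto simp: a_def)
    have sq': "?K1 * ?K1 \<le> h3 * h3" "?K2 * ?K2 \<le> h3 * h3" "a * ?K1 \<le> a * h3"
      using Kp a by (auto intro!: mult_mono)
    show False
      by (rule static_arith[OF R h(1,2) fin sq'])
  qed
qed

end

section \<open>Cheap covers of discrete trees\<close>

lemma finite_ex_max:
  fixes f :: "'a \<Rightarrow> 'b::linorder"
  assumes "finite S" "S \<noteq> {}" shows "\<exists>x\<in>S. \<forall>y\<in>S. f y \<le> f x"
proof -
  have "Max (f ` S) \<in> f ` S" using assms by simp
  then obtain x where "x \<in> S" "Max (f ` S) = f x" by blast
  then show ?thesis using Max_ge[of "f ` S"] assms(1) by (metis finite_imageI imageI)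
qed

text \<open>
  The weight of \<open>GA\<close> in the sum is nonpositive because \<open>u \<le> s\<close>, so \<open>GA\<close> may be replaced by its
  lower bound.
\<close>
lemma two_piece_average:
  fixes GR GA Gr R A r u s :: real
  assumes us: "0 < u" "u \<le> s" "u = R - A" "s = A - r"
    and G: "GR = R\<^sup>2 / 2" "A\<^sup>2 / 2 \<le> GA" "r\<^sup>2 / 2 \<le> Gr"
  shows "(GR - GA) / u + (GA - Gr) / s \<le> A + (R + r) / 2"
proof -
  have s: "0 < s" using us by simp
  have "GA * (1 / s - 1 / u) \<le> A\<^sup>2 / 2 * (1 / s - 1 / u)"
    using us s G(2) by (intro mult_right_mono_neg) (auto simp: field_simps)
  moreover have "r\<^sup>2 / 2 / s \<le> Gr / s" using s G(3) by (intro divide_right_mono) auto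
  ultimately have "(GR - GA) / u + (GA - Gr) / s \<le> (R\<^sup>2 / 2 - A\<^sup>2 / 2) / u + (A\<^sup>2 / 2 - r\<^sup>2 / 2) / s"
    unfolding G(1) by (simp add: diff_divide_distrib algebra_simps)
  also have "R\<^sup>2 / 2 - A\<^sup>2 / 2 = u * ((R + A) / 2)" unfolding us by (simp add: power2_eq_square field_simps)
  also have "A\<^sup>2 / 2 - r\<^sup>2 / 2 = s * ((A + r) / 2)" unfolding us by (simp add: power2_eq_square field_simps)
  also have "u * ((R + A) / 2) / u + s * ((A + r) / 2) / s = A + (R + r) / 2"
  proof -
    have "u * ((R + A) / 2) / u = (R + A) / 2" "s * ((A + r) / 2) / s = (A + r) / 2" using us(1) s by simp_all
    then show ?thesis by (simp only:) (simp add: field_simps)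
  qed
  finally show ?thesis .
qed

context tree_metric begin

lemma path_coords:
  assumes V: "x \<in> V" "y \<in> V" "z \<in> V" and max: "d x z \<le> d x y" "d z y \<le> d x y"
  shows "real (d x z) = real (gp x z y) + real (ht x y z)"
    "real (d z y) = real (d x y) - real (gp x z y) + real (ht x y z)"
    "ht x y z \<le> gp x z y" "gp x z y + ht x y z \<le> d x y"
proof -
  have e: "d x z = gp x z y + ht x y z" using depth_eq[OF V(1,2,3)] .
  have g: "2 * gp x z y + d z y = d x z + d x y" using gp_eq[OF V(1,3,2)] .
  show "real (d x z) = real (gp x z y) + real (ht x y z)" using e by simp
  show "real (d z y) = real (d x y) - real (gp x z y) + real (ht x y z)" using e g by linarith
  show "ht x y z \<le> gp x z y" "gp x z y + ht x y z \<le> d x y" using e g max by linarith+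
qed

lemma card_off_path:
  assumes V: "x \<in> V" "y \<in> V"
  shows "card V = Suc (d x y) + card {z \<in> V. 1 \<le> ht x y z}"
proof -
  have "card {z \<in> V. ht x y z = 0} = Suc (d x y)"
    using bij_betw_same_card[OF spine_bij[OF V]] by simp
  moreover have "card ({z \<in> V. ht x y z = 0} \<union> {z \<in> V. 1 \<le> ht x y z})
      = card {z \<in> V. ht x y z = 0} + card {z \<in> V. 1 \<le> ht x y z}"
    using fin by (intro card_Un_disjoint) auto
  moreover have "{z \<in> V. ht x y z = 0} \<union> {z \<in> V. 1 \<le> ht x y z} = V" by auto
  ultimately show ?thesis by simp
qed

lemma two_twigs_card:
  assumes V: "x \<in> V" "y \<in> V" "z \<in> V" "z' \<in> V" and ne: "gp x z y \<noteq> gp x z' y"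
  shows "ht x y z + ht x y z' \<le> card {u \<in> V. 1 \<le> ht x y u}"
proof -
  let ?A = "\<lambda>z. {u \<in> V. gp x u y = gp x z y \<and> 1 \<le> ht x y u}"
  have "ht x y z + ht x y z' \<le> card (?A z) + card (?A z')"
    using ht_le_card[OF V(1,2,3)] ht_le_card[OF V(1,2,4)] by simp
  also have "\<dots> = card (?A z \<union> ?A z')" using fin ne by (intro card_Un_disjoint[symmetric]) auto
  also have "\<dots> \<le> card {u \<in> V. 1 \<le> ht x y u}" using fin by (intro card_mono) auto
  finally show ?thesis .
qed

lemma one_twig_card:
  assumes V: "x \<in> V" "y \<in> V" "z \<in> V"
  shows "ht x y z \<le> card {u \<in> V. 1 \<le> ht x y u}"
  using ht_le_card[OF V] card_mono[of "{u \<in> V. 1 \<le> ht x y u}" "{u \<in> V. gp x u y = gp x z y \<and> 1 \<le> ht x y u}"] fin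
  by fastforce

text \<open>
  The median of \<open>a\<close>, \<open>b\<close>, \<open>c\<close> is the point of the path from \<open>a\<close> to \<open>b\<close> where the path to \<open>c\<close>
  branches off.
\<close>
lemma median:
  assumes V: "a \<in> V" "b \<in> V" "c \<in> V"
  shows "\<exists>v\<in>V. gp v a b = 0 \<and> gp v a c = 0 \<and> gp v b c = 0"
proof -
  have "gp a b c \<le> d a b" by (rule gp_le1[OF V])
  then obtain v where v: "v \<in> V" "d a v = gp a b c" "d v b = d a b - gp a b c"
    using geodesic_point[OF V(1,2)] by blast
  have "gp a v b = d a v" using between_gp[OF V(1,2) v(1)] v \<open>gp a b c \<le> d a b\<close> by simp
  then have "d a v \<le> gp a v c" using gp_ultra[OF V(1) v(1) V(2,3)] v(2) by simp
  then have "gp a v c = d a v" using gp_le1[OF V(1) v(1) V(3)] by simp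
  then have ac: "d a v + d v c = d a c" using between_gp[OF V(1,3) v(1)] by simp
  have ab: "d a v + d v b = d a b" using v \<open>gp a b c \<le> d a b\<close> by simp
  have bc: "d b c = d v b + d v c" using gp_eq[OF V] ab ac v(2) by simp
  have "d v a = d a v" using d_sym V v by blast
  then have "gp v a b = 0" "gp v a c = 0" "gp v b c = 0" using ab ac bc by (simp_all add: gp_def)
  then show ?thesis using v by blast
qed

lemma convx_branch:
  assumes v: "v \<in> V" and x: "x \<in> V"
  defines "B \<equiv> {y \<in> V. 0 < gp v y x}"
  shows "convx (insert v B)" "convx (V - B)"
proof -
  have up: "z \<in> B \<longleftrightarrow> c \<in> B" if "z \<in> V" "z \<noteq> v" "c \<in> V" "d v z + d z c = d v c" for z c
  proof -
    have "0 < d v z" using d_0_iff[OF v that(1)] that(2) by auto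
    then have zc: "0 < gp v z c" using between_gp[OF v that(3,1)] that(4) by simp
    then have cz: "0 < gp v c z" using gp_commute[OF v that(3,1)] by simp
    show ?thesis using gp_ultra[OF v that(1,3) x] gp_ultra[OF v that(3,1) x] zc cz that
      by (auto simp: B_def min_def split: if_splits)
  qed
  show "convx (insert v B)" unfolding convx_def
  proof (intro ballI impI)
    fix a b z assume ab: "a \<in> insert v B" "b \<in> insert v B" and z: "z \<in> V" "d a z + d z b = d a b"
    have abV: "a \<in> V" "b \<in> V" using ab v by (auto simp: B_def)
    show "z \<in> insert v B"
    proof (cases "z = v")
      case False
      have key: "z \<in> B" if "c \<in> insert v B" "d v z + d z c = d v c" for c
      proof -
        have "c \<noteq> v" using that False z(1) v d_0_iff[OF v z(1)] by auto
        then show ?thesis using up[OF z(1) False _ that(2)] that(1) by (auto simp: B_def)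
      qed
      show ?thesis using between_cases[OF v abV z] key ab by blast
    qed simp
  qed
  show "convx (V - B)" unfolding convx_def
  proof (intro ballI impI)
    fix a b z assume ab: "a \<in> V - B" "b \<in> V - B" and z: "z \<in> V" "d a z + d z b = d a b"
    have abV: "a \<in> V" "b \<in> V" using ab by auto
    have "v \<notin> B" using gp_eq[OF v v x] v by (simp add: B_def)
    then show "z \<in> V - B" using between_cases[OF v abV z] up[OF z(1)] ab z(1) abV by blast
  qed
qed

end

context costed_tree begin

text \<open>
  Let the path from \<open>x\<close> to \<open>y\<close> be a diameter. Every other vertex is within distance \<open>R\<close> of one of
  its ends. For suitable \<open>b\<close> and \<open>b'\<close>, a ball of size \<open>b\<close> at \<open>x\<close> and a ball of size \<open>b'\<close> at \<open>y\<close>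
  cover everything, and the average of the price \<open>g b + g b'\<close> over a segment of such pairs is at
  most \<open>L\<close>. Whether a pair is suitable depends on the highest vertex \<open>zs\<close> above the path; if it is
  higher than half of the number \<open>w\<close> of vertices off the path, all vertices over other positions
  have height at most \<open>w - H\<close>.
\<close>
lemma cheap_thin:
  assumes kappa: "1 < \<kappa>" and xy: "x \<in> V" "y \<in> V" "R < real (d x y)"
    and diam: "\<And>a b. a \<in> V \<Longrightarrow> b \<in> V \<Longrightarrow> d a b \<le> d x y"
    and thin: "\<And>a b c. \<lbrakk>a \<in> V; b \<in> V; c \<in> V\<rbrakk> \<Longrightarrow> real (d a b) \<le> R \<or> real (d b c) \<le> R \<or> real (d a c) \<le> R"
    and zs: "zs \<in> V" "\<And>z. z \<in> V \<Longrightarrow> ht x y z \<le> ht x y zs" "2 * gp x zs y \<le> d x y"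
  shows "cheap d V (\<kappa> * (real (card V) - 1))"
proof (rule ccontr)
  define L where "L = real (card V) - 1"
  define D where "D = real (d x y)"
  define q where "q z = real (gp x z y)" for z
  define e where "e z = real (ht x y z)" for z
  define w where "w = real (card {u \<in> V. 1 \<le> ht x y u})"
  define qs where "qs = q zs"
  define H where "H = e zs"
  assume "\<not> cheap d V (\<kappa> * (real (card V) - 1))"
  then have nc: "\<not> cheap d V (\<kappa> * L)" by (simp add: L_def)
  have co: "real (d x z) = q z + e z" "real (d z y) = D - q z + e z" "e z \<le> q z" "q z + e z \<le> D" "0 \<le> e z"
    if "z \<in> V" for z
    using path_coords[OF xy(1,2) that diam[OF xy(1) that] diam[OF that xy(2)]]
    by (auto simp: q_def e_def D_def)
  have L: "L = D + w" using card_off_path[OF xy(1,2)] by (simp add: L_def D_def w_def)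
  have Hw: "H \<le> w" using one_twig_card[OF xy(1,2) zs(1)] by (simp add: H_def e_def w_def)
  have eH: "e z \<le> H" if "z \<in> V" for z using zs(2)[OF that] by (simp add: e_def H_def)
  have other: "e z \<le> w - H" if "z \<in> V" "q z \<noteq> qs" for z
    using two_twigs_card[OF xy(1,2) that(1) zs(1)] that(2) by (simp add: e_def H_def w_def q_def qs_def)
  have q_half: "2 * qs \<le> D" using zs(3) by (simp add: qs_def q_def D_def)
  have near: "q z + e z \<le> R \<or> D - q z + e z \<le> R" if "z \<in> V" for z
    using thin[OF xy(1,2) that] xy(3) co(1,2)[OF that] d_sym[OF xy(2) that] by auto
  have DR: "R < D" using xy(3) by (simp add: D_def)
  have LD: "D \<le> L" using L by (simp add: w_def)
  have kL: "L < \<kappa> * L" using kappa LD DR R_pos by simp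
  have pair: "\<kappa> * L < g b + g b'" if b: "0 \<le> b" "b \<le> R" "0 \<le> b'" "b' \<le> R"
    and cov: "\<And>z. z \<in> V \<Longrightarrow> q z + e z \<le> b \<or> D - q z + e z \<le> b'" for b b'
  proof -
    have "cheap d {z \<in> V. q z + e z \<le> b} (g b)"
    proof (rule cheap_ball)
      have *: "real (d u z) \<le> b" if "u \<in> V" "z \<in> V" "q u \<le> q z" "q z + e z \<le> b" for u z
        using dist_coord_ht[OF xy(1,2) that(1,2)] that co(3)[OF that(1)] by (simp add: q_def e_def)
      fix u z assume uz: "u \<in> {z \<in> V. q z + e z \<le> b}" "z \<in> {z \<in> V. q z + e z \<le> b}"
      show "real (d u z) \<le> b"
      proof (cases "q u \<le> q z")
        case True then show ?thesis using * uz by blast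
      next
        case False then show ?thesis using *[of z u] uz d_sym[of u z] by auto
      qed
    qed (use b in auto)
    moreover have "cheap d {z \<in> V. D - q z + e z \<le> b'} (g b')"
    proof (rule cheap_ball)
      have *: "real (d u z) \<le> b'" if "u \<in> V" "z \<in> V" "q u \<le> q z" "D - q u + e u \<le> b'" for u z
        using dist_coord_ht[OF xy(1,2) that(1,2)] that co(4)[OF that(2)] by (simp add: q_def e_def)
      fix u z assume uz: "u \<in> {z \<in> V. D - q z + e z \<le> b'}" "z \<in> {z \<in> V. D - q z + e z \<le> b'}"
      show "real (d u z) \<le> b'"
      proof (cases "q u \<le> q z")
        case True then show ?thesis using * uz by blast
      next
        case False then show ?thesis using *[of z u] uz d_sym[of u z] by auto
      qed
    qed (use b in auto)
    ultimately have "cheap d V (g b + g b')"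
      by (rule cheap_mono[OF cheap_Un]) (use cov in auto)
    then show ?thesis using nc by (meson cheap_mono not_le order_refl)
  qed
  show False
  proof (cases "2 * R \<le> L")
    case True
    \<comment> \<open>two balls of size \<open>R\<close> cost at most \<open>2 R \<le> L\<close>\<close>
    have "\<kappa> * L < g R + g R" using R_pos near by (intro pair) auto
    then show False using g_R True kL by linarith
  next
    case LR: False
    show False
    proof (cases "2 * H \<le> w")
      case True
      \<comment> \<open>all twigs are low enough for the pairs \<open>(t, L - t)\<close>\<close>
      define a where "a = L - R"
      have a: "0 \<le> a" "a < R" using LR LD DR by (auto simp: a_def)
      have cov: "q z + e z \<le> t \<or> D - q z + e z \<le> L - t" if "z \<in> V" for z t
        using eH[OF that] True L by linarith
      have "((\<lambda>t. g t) has_integral G R - G a) {a..R}" using a by (intro g_has_integral) auto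
      moreover have "((\<lambda>t. g (L - t)) has_integral G (L - a) - G (L - R)) {a..R}"
        using a by (intro g_shift_neg) (auto simp: a_def)
      ultimately have i: "((\<lambda>t. g t + g (L - t)) has_integral (G R - G a) + (G (L - a) - G (L - R))) {a..R}"
        by (rule has_integral_add)
      have "((\<lambda>_. \<kappa> * L) has_integral (R - a) * (\<kappa> * L)) {a..R}"
        using has_integral_const_real[of "\<kappa> * L" a R] a by simp
      then have "(R - a) * (\<kappa> * L) \<le> (G R - G a) + (G (L - a) - G (L - R))"
      proof (rule has_integral_le_greaterThan[OF _ i])
        fix t assume "a < t" "t \<le> R"
        then show "\<kappa> * L \<le> g t + g (L - t)" using pair[of t "L - t"] cov a by (auto simp: a_def)
      qed
      also have "\<dots> = 2 * (G R - G a)" by (simp add: a_def)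
      also have "\<dots> \<le> R\<^sup>2 - a\<^sup>2" using G_R G_ge[of a] a by simp
      also have "\<dots> = (R - a) * L" by (simp add: a_def power2_eq_square algebra_simps)
      finally show False using a kL by simp
    next
      case False
      \<comment> \<open>the pairs are \<open>(A + (R - A) t, A - s t)\<close>: the ball at \<open>x\<close> always contains the highest twig, and \<open>r\<close> is the
      size for which the bound for the average price is exactly \<open>L\<close>\<close>
      define A where "A = max (qs + H) (L / 2)"
      define r where "r = 2 * L - 2 * A - R"
      have qH: "qs + H \<le> R" using near[OF zs(1)] q_half by (auto simp: qs_def H_def)
      have A: "qs + H \<le> A" "L / 2 \<le> A" "A \<le> R" using qH LR by (auto simp: A_def)
      have A_cases: "A = qs + H \<or> A = L / 2" by (auto simp: A_def max_def)
      have twoA: "2 * A \<le> D + 2 * H"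
      proof -
        show ?thesis using A_cases
        proof
          assume "A = qs + H" then show ?thesis using q_half by simp
        next
          assume "A = L / 2" then show ?thesis using False L by simp
        qed
      qed
      have r0: "0 \<le> r" using A_cases q_half Hw L LD DR unfolding r_def by (elim disjE) simp_all
      have rA: "r \<le> A" "R - A \<le> A - r" using A LR unfolding r_def by linarith+
      define s where "s = A - r"
      have bb: "\<kappa> * L < g (A + (R - A) * t) + g (A - s * t)" if t: "0 \<le> t" "t \<le> 1" for t
      proof (rule pair)
        have 1: "0 \<le> (R - A) * t" "(R - A) * t \<le> R - A" "0 \<le> s * t" "s * t \<le> s"
          using t A rA mult_left_mono[of t 1 "R - A"] mult_left_mono[of t 1 s] by (auto simp: s_def)
        show "0 \<le> A + (R - A) * t" "A + (R - A) * t \<le> R" "0 \<le> A - s * t" "A - s * t \<le> R"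
          using 1 A r0 LD DR R_pos by (auto simp: s_def)
        fix z assume z: "z \<in> V"
        show "q z + e z \<le> A + (R - A) * t \<or> D - q z + e z \<le> A - s * t"
        proof (cases "q z = qs")
          case True
          then show ?thesis using eH[OF z] A 1 by auto
        next
          case False
          have "(s - (R - A)) * t \<le> s - (R - A)"
            using t rA mult_left_mono[of t 1 "s - (R - A)"] by (simp add: s_def)
          then have "2 * L - 2 * A \<le> A + (R - A) * t + (A - s * t)"
            by (simp add: s_def r_def algebra_simps)
          then show ?thesis using other[OF z False] twoA L by linarith
        qed
      qed
      show False
      proof (cases "A = R")
        case True
        have s: "0 < s" using LR True by (simp add: s_def r_def)
        have "((\<lambda>t. g (A - s * t)) has_integral (G (A - s * 0) - G (A - s * 1)) / s) {0..1}"
          using s r0 A by (intro g_affine_neg) (auto simp: s_def)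
        moreover have "((\<lambda>t::real. g R) has_integral g R) {0..1}"
          using has_integral_const_real[of "g R" 0 1] by simp
        ultimately have i: "((\<lambda>t. g R + g (A - s * t)) has_integral g R + (G (A - s * 0) - G (A - s * 1)) / s) {0..1}"
          by (rule has_integral_add[rotated])
        have "((\<lambda>_::real. \<kappa> * L) has_integral \<kappa> * L) {0..1}"
          using has_integral_const_real[of "\<kappa> * L" 0 1] by simp
        then have "\<kappa> * L \<le> g R + (G (A - s * 0) - G (A - s * 1)) / s"
          by (rule has_integral_le_greaterThan[OF _ i]) (use bb True in \<open>auto intro: less_imp_le\<close>)
        also have "\<dots> = g R + (G R - G r) / s" using True by (simp add: s_def)
        also have "\<dots> \<le> R + (R\<^sup>2 / 2 - r\<^sup>2 / 2) / s"
          using g_R G_R G_ge[of r] r0 rA True s by (intro add_mono divide_right_mono) auto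
        also have "R\<^sup>2 / 2 - r\<^sup>2 / 2 = s * ((R + r) / 2)"
          using True by (simp add: s_def power2_eq_square field_simps)
        also have "R + s * ((R + r) / 2) / s = L" using s True by (simp add: r_def field_simps)
        finally show False using kL by simp
      next
        case False
        have u: "0 < R - A" using False A by simp
        have s: "0 < s" using u rA by (simp add: s_def)
        have "((\<lambda>t. g (A + (R - A) * t)) has_integral (G (A + (R - A) * 1) - G (A + (R - A) * 0)) / (R - A)) {0..1}"
          using u A LD DR R_pos by (intro g_affine_pos) auto
        moreover have "((\<lambda>t. g (A - s * t)) has_integral (G (A - s * 0) - G (A - s * 1)) / s) {0..1}"
          using s r0 A by (intro g_affine_neg) (auto simp: s_def)
        ultimately have i: "((\<lambda>t. g (A + (R - A) * t) + g (A - s * t)) has_integral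
            (G (A + (R - A) * 1) - G (A + (R - A) * 0)) / (R - A) + (G (A - s * 0) - G (A - s * 1)) / s) {0..1}"
          by (rule has_integral_add)
        have "((\<lambda>_::real. \<kappa> * L) has_integral \<kappa> * L) {0..1}"
          using has_integral_const_real[of "\<kappa> * L" 0 1] by simp
        then have "\<kappa> * L \<le> (G (A + (R - A) * 1) - G (A + (R - A) * 0)) / (R - A) + (G (A - s * 0) - G (A - s * 1)) / s"
          by (rule has_integral_le_greaterThan[OF _ i]) (use bb in \<open>auto intro: less_imp_le\<close>)
        also have "\<dots> = (G R - G A) / (R - A) + (G A - G r) / s" by (simp add: s_def)
        also have "\<dots> \<le> A + (R + r) / 2"
          using u rA G_R G_ge[of A] G_ge[of r] A r0 LD DR R_pos by (intro two_piece_average) (auto simp: s_def)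
        also have "\<dots> = L" by (simp add: r_def field_simps)
        finally show False using kL by simp
      qed
    qed
  qed
qed

end

text \<open>
  By induction on the number of vertices. If the diameter exceeds \<open>R\<close> and there are three points
  with pairwise distances above \<open>R\<close>, then rooting the tree at their median \<open>v\<close> yields the arms:
  the branch of the deepest vertex, the branch of the deepest vertex outside it, and the rest. If
  the second arm has length at least \<open>R\<close>, the tree splits; otherwise it is a tripod.
\<close>
lemma (in cost_rate) cheap_tree:
  assumes "tree_metric V d" and kappa: "1 < \<kappa>" and R: "R \<le> real (card V) - 1"
  shows "cheap d V (\<kappa> * (real (card V) - 1))"
  using assms(1) R
proof (induction "card V" arbitrary: V rule: less_induct)
  case less
  interpret tree_metric V d by (rule less.prems)
  interpret costed_tree V d g R by unfold_locales
  define L where "L = real (card V) - 1"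
  have LR: "R \<le> L" using less.prems by (simp add: L_def)
  have LkL: "L \<le> \<kappa> * L" using kappa LR R_pos by simp
  have IH: "cheap d S (\<kappa> * (real (card S) - 1))" if "S \<subset> V" "convx S" "S \<noteq> {}" "R \<le> real (card S) - 1" for S
    using less.hyps[of S] that tree_metric_subset[of S] psubset_card_mono[OF fin that(1)] by blast
  show ?case
  proof (rule ccontr)
    assume "\<not> cheap d V (\<kappa> * (real (card V) - 1))"
    then have nc: "\<not> cheap d V (\<kappa> * L)" by (simp add: L_def)
    then have not_cheap: "\<kappa> * L < c" if "cheap d V c" for c
      using that by (meson cheap_mono not_le order_refl)
    have "\<exists>p\<in>V\<times>V. \<forall>p'\<in>V\<times>V. d (fst p') (snd p') \<le> d (fst p) (snd p)"
      using fin ne by (intro finite_ex_max) auto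
    then obtain x y where xy: "x \<in> V" "y \<in> V" and diam: "\<And>a b. a \<in> V \<Longrightarrow> b \<in> V \<Longrightarrow> d a b \<le> d x y" by force
    have big: "R < real (d x y)"
    proof (rule ccontr)
      assume "\<not> ?thesis"
      then have "real (d a b) \<le> R" if "a \<in> V" "b \<in> V" for a b using diam[OF that] by linarith
      then have "cheap d V (g R)" using R_pos by (intro cheap_ball) auto
      then show False using not_cheap g_R LR LkL by fastforce
    qed
    show False
    proof (cases "\<exists>a\<in>V. \<exists>b\<in>V. \<exists>c\<in>V. R < real (d a b) \<and> R < real (d b c) \<and> R < real (d a c)")
      case False
      then have thin: "real (d a b) \<le> R \<or> real (d b c) \<le> R \<or> real (d a c) \<le> R" if "a \<in> V" "b \<in> V" "c \<in> V" for a b c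
        using that by (meson not_le)
      obtain zs where zs: "zs \<in> V" "\<And>z. z \<in> V \<Longrightarrow> ht x y z \<le> ht x y zs"
        using finite_ex_max[OF fin ne, of "ht x y"] by blast
      show False
      proof (cases "2 * gp x zs y \<le> d x y")
        case True
        then show False
          using cheap_thin[OF kappa xy big diam thin zs] nc by (simp add: L_def)
      next
        case 1: False
        have sym: "d y x = d x y" using d_sym xy by blast
        have g': "gp y z x + gp x z y = d x y" and h': "ht y x z = ht x y z" if "z \<in> V" for z
        proof -
          have "2 * gp y z x + d z x = d y z + d y x" "2 * gp x z y + d z y = d x z + d x y"
            using gp_eq xy that by blast+
          moreover have "d z x = d x z" "d z y = d y z" using d_sym xy that by blast+
          ultimately show "gp y z x + gp x z y = d x y" using sym by linarith
          then show "ht y x z = ht x y z"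
            using depth_eq[OF xy(1,2) that] depth_eq[OF xy(2,1) that] \<open>2 * gp y z x + d z x = d y z + d y x\<close>
              \<open>d z x = d x z\<close> sym by linarith
        qed
        have "cheap d V (\<kappa> * (real (card V) - 1))"
          using big diam thin zs 1 g'[OF zs(1)] h' sym
          by (intro cheap_thin[OF kappa xy(2,1), of zs]) auto
        then show False using nc by (simp add: L_def)
      qed
    next
      case True
      then obtain a b c where abc: "a \<in> V" "b \<in> V" "c \<in> V" "R < real (d a b)" "R < real (d b c)" "R < real (d a c)" by blast
      obtain v where v: "v \<in> V" "gp v a b = 0" "gp v a c = 0" "gp v b c = 0" using median[OF abc(1-3)] by blast
      have max_ex: "\<exists>x\<in>S. \<forall>y\<in>S. d v y \<le> d v x" if "S \<subseteq> V" "S \<noteq> {}" for S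
        using finite_subset[OF that(1) fin] that(2) by (rule finite_ex_max)
      obtain x1 where x1: "x1 \<in> V" "\<And>y. y \<in> V \<Longrightarrow> d v y \<le> d v x1" using max_ex[of V] ne by blast
      define B1 where "B1 = {y \<in> V. 0 < gp v y x1}"
      have vB: "gp v v y = 0" if "y \<in> V" for y using gp_eq[OF v(1,1) that] v(1) by simp
      have v1: "v \<in> V - B1" using v(1) vB x1(1) by (simp add: B1_def)
      obtain x2 where x2: "x2 \<in> V - B1" "\<And>y. y \<in> V - B1 \<Longrightarrow> d v y \<le> d v x2" using max_ex[of "V - B1"] v1 by blast
      define B2 where "B2 = {y \<in> V. 0 < gp v y x2}"
      have v2: "v \<in> V - B1 - B2" using v1 vB x2(1) by (simp add: B2_def)
      obtain x3 where x3: "x3 \<in> V - B1 - B2" "\<And>y. y \<in> V - B1 - B2 \<Longrightarrow> d v y \<le> d v x3"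
        using max_ex[of "V - B1 - B2"] v2 by blast
      define B3 where "B3 = V - B1 - B2 - {v}"
      have connect: "0 < gp v p s" if "p \<in> V" "r \<in> V" "s \<in> V" "0 < gp v p r" "0 < gp v r s" for p r s
        using gp_ultra[OF v(1) that(1,2,3)] that(4,5) by simp
      have comm: "gp v p r = gp v r p" if "p \<in> V" "r \<in> V" for p r using gp_commute v(1) that by blast
      have only1: "p \<notin> B1 \<or> p' \<notin> B1" "p \<notin> B2 \<or> p' \<notin> B2" if "p \<in> V" "p' \<in> V" "gp v p p' = 0" for p p'
        using connect[of p x1 p'] connect[of p x2 p'] comm[of p' x1] comm[of p' x2] that x1(1) x2(1)
        by (auto simp: B1_def B2_def)
      have pairs: "R < real (d v x2) + real (d v x3)"
        if "p \<in> V" "p' \<in> V" "gp v p p' = 0" "p \<notin> B1" "p' \<notin> B1" "R < real (d p p')" for p p'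
      proof -
        have "d p p' \<le> d v p + d v p'" using d_tri[OF that(1) v(1) that(2)] d_sym[OF that(1) v(1)] by simp
        moreover have "d v p \<le> d v x2" "d v p' \<le> d v x2" using x2(2) that by auto
        moreover have "d v p \<le> d v x3 \<or> d v p' \<le> d v x3" using only1(2)[OF that(1-3)] x3(2) that by auto
        ultimately show ?thesis using that(6) by linarith
      qed
      have h23: "R < real (d v x2) + real (d v x3)"
        using pairs[of a b] pairs[of a c] pairs[of b c] only1(1)[of a b] only1(1)[of a c] only1(1)[of b c] abc v by blast
      have h12: "d v x2 \<le> d v x1" using x1(2) x2(1) by blast
      have h32: "d v x3 \<le> d v x2" using x2(2) x3(1) by blast
      have x2pos: "x2 \<noteq> v" using h23 h32 R_pos v(1) by auto
      have x1pos: "x1 \<noteq> v" using h23 h32 h12 R_pos v(1) by auto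
      have pos: "0 < gp v p p" if "p \<in> V" "p \<noteq> v" for p
        using gp_eq[OF v(1) that(1,1)] that d_0_iff[OF v(1) that(1)] by auto
      have in1: "x1 \<in> B1" and in2: "x2 \<in> B2" using pos x1 x2 x1pos x2pos by (auto simp: B1_def B2_def)
      show False
      proof (cases "R \<le> real (d v x2)")
        case True
        have c: "convx (insert v B1)" "convx (V - B1)" using convx_branch[OF v(1) x1(1)] by (simp_all add: B1_def)
        have sub: "insert v B1 \<subseteq> V" using v(1) by (auto simp: B1_def)
        have "Suc (d v x1) \<le> card (insert v B1)" "Suc (d v x2) \<le> card (V - B1)"
          using convx_card[OF c(1) sub, of v x1] convx_card[OF c(2), of v x2] in1 x2 v1 by auto
        note big = this
        have "x2 \<notin> insert v B1" using x2 x2pos by auto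
        then have p1: "cheap d (insert v B1) (\<kappa> * (real (card (insert v B1)) - 1))"
          using c(1) big(1) True h12 sub x2(1) by (intro IH) auto
        have p2: "cheap d (V - B1) (\<kappa> * (real (card (V - B1)) - 1))"
          using c(2) big(2) True in1 x1(1) v1 by (intro IH) auto
        have "finite B1" "v \<notin> B1" "B1 \<subseteq> V" using fin v1 by (auto simp: B1_def)
        then have "card (insert v B1) = Suc (card B1)" "card V = card B1 + card (V - B1)"
          using fin card_Diff_subset[of B1 V] card_mono[of V B1] by auto
        then have "\<kappa> * (real (card (insert v B1)) - 1) + \<kappa> * (real (card (V - B1)) - 1) = \<kappa> * L"
          by (simp add: L_def algebra_simps)
        moreover have "insert v B1 \<union> (V - B1) = V" using sub by blast
        ultimately have "cheap d V (\<kappa> * L)" using cheap_Un[OF p1 p2] by simp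
        then show False using nc by blast
      next
        case False
        have x3pos: "x3 \<noteq> v" using h23 False v(1) by auto
        define x :: "arm \<Rightarrow> 'a" where "x i = (case i of Long \<Rightarrow> x1 | Mid \<Rightarrow> x2 | Short \<Rightarrow> x3)" for i
        define B :: "arm \<Rightarrow> 'a set" where "B i = (case i of Long \<Rightarrow> B1 | Mid \<Rightarrow> B2 | Short \<Rightarrow> B3)" for i
        have c12: "gp v y z = 0" if "y \<in> B1" "z \<in> B2" for y z
        proof (rule ccontr)
          assume "gp v y z \<noteq> 0"
          then have "0 < gp v x1 z" using connect[of x1 y z] that x1(1) comm by (auto simp: B1_def B2_def)
          then have "0 < gp v x1 x2" using connect[of x1 z x2] that x1(1) x2(1) by (auto simp: B2_def)
          then show False using x2(1) x1(1) comm by (auto simp: B1_def)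
        qed
        have c13: "gp v y z = 0" if "y \<in> B1" "z \<in> B3" for y z
          using connect[of z y x1] that x1(1) comm[of y z] by (fastforce simp: B1_def B3_def)
        have c23: "gp v y z = 0" if "y \<in> B2" "z \<in> B3" for y z
          using connect[of z y x2] that x2(1) comm[of y z] by (fastforce simp: B2_def B3_def)
        have B_V: "B1 \<subseteq> V" "B2 \<subseteq> V" "B3 \<subseteq> V" by (auto simp: B1_def B2_def B3_def)
        have sub2: "B2 \<subseteq> V - B1"
        proof
          fix y assume y: "y \<in> B2"
          then have "y \<in> V" "y \<noteq> v" using v2 B_V by auto
          then have "0 < gp v y y" by (rule pos)
          then show "y \<in> V - B1" using c12[of y y] y \<open>y \<in> V\<close> by auto
        qed
        have "tripod V d g R \<kappa> v x B"
        proof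
          show "1 < \<kappa>" "v \<in> V" by fact+
          show "V = insert v (B Long \<union> B Mid \<union> B Short)" using v(1) B_V by (auto simp: B_def B3_def)
          show "v \<notin> B i" for i using v2 by (cases i) (auto simp: B_def B3_def)
          show "gp v y z = 0" if "i \<noteq> j" "y \<in> B i" "z \<in> B j" for i j y z
          proof -
            have "gp v z y = 0 \<or> gp v y z = 0"
              using that c12[of y z] c13[of y z] c23[of y z] c12[of z y] c13[of z y] c23[of z y]
              by (cases i; cases j) (simp_all add: B_def)
            moreover have "y \<in> V" "z \<in> V" using that B_V by (cases i; cases j; auto simp: B_def)+
            ultimately show ?thesis using comm[of y z] by auto
          qed
          show "x i \<in> B i" for i using in1 in2 x3(1) x3pos by (cases i) (auto simp: B_def x_def B3_def)
          show "d v y \<le> d v (x i)" if "y \<in> B i" for i y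
            using that x1(2) x2(2) x3(2) B_V sub2 by (cases i) (auto simp: B_def x_def B3_def)
          show "d v (x Short) \<le> d v (x Mid)" "d v (x Mid) \<le> d v (x Long)" using h12 h32 by (auto simp: x_def)
          show "R < real (d v (x Mid)) + real (d v (x Short))" using h23 by (simp add: x_def)
          show "cheap d S (\<kappa> * (real (card S) - 1))" if "S \<subset> V" "convx S" "S \<noteq> {}" "R \<le> real (card S) - 1" for S
            using IH that by blast
          show "\<kappa> * (real (card V) - 1) < c" if "cheap d V c" for c using not_cheap[OF that] by (simp add: L_def)
        qed
        then show False by (rule tripod.contradiction)
      qed
    qed
  qed
qed

text \<open>
  For \<open>R\<close> above the length of the tree there remains the case \<open>D < R\<close>, in which a single ball of
  any size in \<open>[D, R]\<close> covers the tree. Their average price is at most \<open>(R + D) / 2\<close>, and the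
  bound on \<open>R\<close> is what makes this at most \<open>L\<close>.
\<close>
lemma (in cost_rate) cheap_tree_diameter:
  assumes "tree_metric V d" and kappa: "1 < \<kappa>" and D: "\<And>x y. x \<in> V \<Longrightarrow> y \<in> V \<Longrightarrow> real (d x y) \<le> D"
    and R: "R \<le> 2 * (real (card V) - 1) - D"
  shows "cheap d V (\<kappa> * (real (card V) - 1))"
proof (cases "R \<le> real (card V) - 1")
  case True then show ?thesis using cheap_tree assms by blast
next
  case False
  interpret tree_metric V d by fact
  define L where "L = real (card V) - 1"
  obtain x where x: "x \<in> V" using ne by blast
  have D0: "0 \<le> D" using D[OF x x] x by simp
  have L0: "0 < L" using R R_pos D0 by (simp add: L_def)
  have DR: "D < R" using R False by (simp add: L_def)
  show ?thesis
  proof (rule ccontr)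
    assume nc: "\<not> ?thesis"
    have "((\<lambda>_. \<kappa> * L) has_integral (R - D) * (\<kappa> * L)) {D..R}"
      using has_integral_const_real[of "\<kappa> * L" D R] DR by simp
    then have "(R - D) * (\<kappa> * L) \<le> G R - G D"
    proof (rule has_integral_le_greaterThan[OF _ g_has_integral])
      fix t assume t: "D < t" "t \<le> R"
      have "real (d x y) \<le> t" if "x \<in> V" "y \<in> V" for x y using D[OF that] t by simp
      then have "cheap d V (g t)" using t D0 by (intro cheap_ball) auto
      then show "\<kappa> * L \<le> g t" using nc unfolding L_def by (meson cheap_mono nle_le order_refl)
    qed (use D0 DR in auto)
    also have "\<dots> \<le> (R\<^sup>2 - D\<^sup>2) / 2" using G_R G_ge[of D] D0 DR by (simp add: diff_divide_distrib)
    also have "\<dots> = (R - D) * ((R + D) / 2)" by (simp add: power2_eq_square algebra_simps)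
    finally have "\<kappa> * L \<le> (R + D) / 2" using DR by simp
    also have "\<dots> \<le> L" using R by (simp add: L_def)
    also have "L < \<kappa> * L" using kappa L0 by simp
    finally show False by simp
  qed
qed

section \<open>From cheap covers to balanced lists of covers\<close>

lemma covered_le:
  "covered d S bs \<Longrightarrow> list_all2 (\<le>) bs bs' \<Longrightarrow> covered d S bs'"
proof (induction bs arbitrary: S bs')
  case (Cons b bs)
  then obtain b' cs where bs': "bs' = b' # cs" "b \<le> b'" "list_all2 (\<le>) bs cs" by (auto simp: list_all2_Cons1)
  obtain A where A: "\<forall>x\<in>A. \<forall>y\<in>A. real (d x y) \<le> b" "covered d (S - A) bs" using Cons.prems by auto
  have "covered d (S - A) cs" using Cons.IH[OF A(2) bs'(3)] .
  then show ?case using A bs' by (auto intro!: exI[of _ A] intro: order_trans)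
qed simp

lemma covered_short:
  assumes "covered d S bs" "finite S"
  shows "\<exists>bs'. covered d S bs' \<and> mset bs' \<subseteq># mset bs \<and> length bs' \<le> card S"
  using assms
proof (induction bs arbitrary: S)
  case (Cons b bs)
  then obtain A where A: "\<forall>x\<in>A. \<forall>y\<in>A. real (d x y) \<le> b" "covered d (S - A) bs" by auto
  obtain cs where cs: "covered d (S - A) cs" "mset cs \<subseteq># mset bs" "length cs \<le> card (S - A)"
    using Cons.IH[OF A(2)] Cons.prems by auto
  show ?case
  proof (cases "S \<inter> A = {}")
    case True
    then have "S - A = S" by blast
    then show ?thesis using cs by (intro exI[of _ cs]) (auto intro: subset_mset.order_trans)
  next
    case False
    then have "card (S - A) < card S" using Cons.prems(2) by (intro psubset_card_mono) auto
    then show ?thesis using A(1) cs by (intro exI[of _ "b # cs"]) auto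
  qed
qed auto

lemma covered_singletons:
  assumes "finite S" "\<And>x. x \<in> S \<Longrightarrow> d x x = 0"
  shows "covered d S (replicate (card S) 0)"
  using assms
proof (induction "card S" arbitrary: S)
  case 0 then show ?case by simp
next
  case (Suc m)
  then obtain x where x: "x \<in> S" by fastforce
  have "card (S - {x}) = m" using Suc.hyps(2) x Suc.prems(1) by simp
  then have "covered d (S - {x}) (replicate m 0)" using Suc.hyps(1)[of "S - {x}"] Suc.prems by auto
  moreover have "\<forall>a\<in>{x}. \<forall>b\<in>{x}. real (d a b) \<le> 0" using Suc.prems(2)[OF x] by simp
  ultimately show ?case unfolding Suc.hyps(2)[symmetric] by (auto intro!: exI[of _ "{x}"])
qed

lemma sum_list_mset_le:
  fixes f :: "'a \<Rightarrow> real"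
  assumes "mset xs \<subseteq># mset ys" "\<And>y. y \<in> set ys \<Longrightarrow> 0 \<le> f y"
  shows "sum_list (map f xs) \<le> sum_list (map f ys)"
proof -
  obtain M where M: "mset ys = mset xs + M" using assms(1) by (auto simp: mset_subset_eq_exists_conv)
  have "sum_list (map f ys) = sum_list (map f xs) + sum_mset (image_mset f M)"
    by (metis M image_mset_union mset_map sum_mset.union sum_mset_sum_list)
  moreover have "\<forall>y\<in>#M. 0 \<le> f y" using M assms(2) by (metis UnCI set_mset_mset set_mset_union)
  then have "0 \<le> sum_mset (image_mset f M)" by (induction M) auto
  ultimately show ?thesis by simp
qed

text \<open>
  The sizes in \<open>[0, R]\<close> are rounded up to multiples of \<open>R / n\<close>. A price list \<open>\<gamma>\<close> assigns prices to
  these \<open>n\<close> sizes.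
\<close>
locale cells =
  fixes R :: real and n :: nat and \<gamma> :: "nat \<Rightarrow> real"
  assumes R: "0 < R" and n: "1 \<le> n" and nonneg: "\<And>k. k \<in> {1..n} \<Longrightarrow> 0 \<le> \<gamma> k"
begin

text \<open>
  The least price of a ball of at least the given size: \<open>low\<close> for cells, \<open>step\<close> for arbitrary
  sizes.
\<close>
definition low :: "nat \<Rightarrow> real" where "low k = Min (\<gamma> ` {k..n})"
definition idx :: "real \<Rightarrow> nat" where "idx t = max 1 (nat \<lceil>real n * t / R\<rceil>)"
definition step :: "real \<Rightarrow> real" where "step t = low (idx t)"

lemma idx_range: "t \<le> R \<Longrightarrow> idx t \<in> {1..n}"
proof -
  assume t: "t \<le> R"
  have "real n * t \<le> real n * R" using t by (intro mult_left_mono) auto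
  then have "real n * t / R \<le> real n" using R by (simp add: pos_divide_le_eq)
  then show ?thesis using n by (simp add: idx_def ceiling_le_iff nat_le_iff)
qed

lemma idx_mono: "t \<le> t' \<Longrightarrow> idx t \<le> idx t'"
  unfolding idx_def using R
  by (intro max.mono nat_mono ceiling_mono divide_right_mono mult_left_mono) auto

lemma le_idx: "t \<le> real (idx t) * R / real n"
proof -
  have "real n * t / R \<le> real (nat \<lceil>real n * t / R\<rceil>)" by (rule real_nat_ceiling_ge)
  also have "\<dots> \<le> real (idx t)" by (simp add: idx_def)
  finally show ?thesis using R n by (simp add: field_simps)
qed

lemma idx_cell: "1 \<le> k \<Longrightarrow> idx (real k * R / real n) = k"
  using R n by (simp add: idx_def)

lemma low_le: "k \<le> j \<Longrightarrow> j \<le> n \<Longrightarrow> low k \<le> \<gamma> j" by (simp add: low_def)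
lemma low_attained: "k \<in> {1..n} \<Longrightarrow> \<exists>j\<in>{k..n}. low k = \<gamma> j"
  unfolding low_def using Min_in[of "\<gamma> ` {k..n}"] by (metis (no_types, lifting) atLeastAtMost_iff atLeastatMost_empty_iff finite_atLeastAtMost finite_imageI imageE image_is_empty)
lemma low_nonneg: "k \<in> {1..n} \<Longrightarrow> 0 \<le> low k" using low_attained[of k] nonneg by fastforce
lemma low_mono: "k \<le> j \<Longrightarrow> j \<in> {1..n} \<Longrightarrow> low k \<le> low j"
  unfolding low_def by (intro Min_antimono) auto

lemma step_nonneg: "t \<le> R \<Longrightarrow> 0 \<le> step t" using low_nonneg idx_range by (simp add: step_def)
lemma step_mono: "t \<le> t' \<Longrightarrow> t' \<le> R \<Longrightarrow> step t \<le> step t'"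
  using low_mono idx_range idx_mono by (simp add: step_def)

lemma step_integrable: "b \<le> R \<Longrightarrow> step integrable_on {a..b}"
  by (intro integrable_on_mono_on mono_onI) (auto intro: step_mono)

lemma step_integral_bounds:
  assumes "a \<le> b" "b \<le> R"
  shows "(b - a) * step a \<le> integral {a..b} step" "integral {a..b} step \<le> (b - a) * step b"
proof -
  have i: "(step has_integral integral {a..b} step) {a..b}" using step_integrable[OF assms(2)] by (rule integrable_integral)
  have c: "((\<lambda>_. step a) has_integral (b - a) * step a) {a..b}" "((\<lambda>_. step b) has_integral (b - a) * step b) {a..b}"
    using has_integral_const_real[of "step a" a b] has_integral_const_real[of "step b" a b] assms by auto
  show "(b - a) * step a \<le> integral {a..b} step"
    using assms by (intro has_integral_le[OF c(1) i] step_mono) auto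
  show "integral {a..b} step \<le> (b - a) * step b"
    using assms by (intro has_integral_le[OF i c(2)] step_mono) auto
qed

lemma step_integral_add:
  "a \<le> c \<Longrightarrow> c \<le> b \<Longrightarrow> b \<le> R \<Longrightarrow> integral {a..c} step + integral {c..b} step = integral {a..b} step"
  by (intro Henstock_Kurzweil_Integration.integral_combine step_integrable)

lemma step_integral_le: "integral {0..R} step \<le> R / real n * (\<Sum>k=1..n. \<gamma> k)"
proof -
  have "integral {0..real j * R / real n} step \<le> R / real n * (\<Sum>k=1..j. \<gamma> k)" if "j \<le> n" for j
    using that
  proof (induction j)
    case 0 then show ?case by simp
  next
    case (Suc j)
    let ?a = "real j * R / real n" and ?b = "real (Suc j) * R / real n"
    have b: "?b \<le> R" using Suc.prems R n by (simp add: field_simps del: of_nat_Suc)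
    have ab: "0 \<le> ?a" "?a \<le> ?b" using R n by (auto simp: field_simps)
    have "integral {?a..?b} step \<le> (?b - ?a) * step ?b" by (rule step_integral_bounds(2)[OF ab(2) b])
    also have "?b - ?a = R / real n" using n by (simp add: field_simps)
    also have "R / real n * step ?b \<le> R / real n * \<gamma> (Suc j)"
      using low_le[of "Suc j" "Suc j"] Suc.prems idx_cell[of "Suc j"] R
      by (intro mult_left_mono) (auto simp: step_def)
    finally have "integral {?a..?b} step \<le> R / real n * \<gamma> (Suc j)" .
    then show ?case using Suc step_integral_add[OF ab b] by (simp add: algebra_simps)
  qed
  from this[of n] show ?thesis using n by simp
qed

text \<open>
  This gives \<open>step r \<le> r\<close> (after scaling) at a contact level: there the difference quotients from
  the left of the integral, which equal \<open>step r\<close> on the cell of \<open>r\<close>, are at most those of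
  \<open>t\<^sup>2 / 2\<close>.
\<close>
lemma step_left_constant:
  assumes "0 < r"
  shows "\<exists>k. 0 \<le> k \<and> k < r \<and> step k = step r"
proof (cases "real n * r / R \<le> 1")
  case True
  then have "nat \<lceil>real n * r / R\<rceil> \<le> 1" by (simp add: nat_le_iff ceiling_le_iff)
  then have "idx r = 1" "idx 0 = 1" by (simp_all add: idx_def)
  then show ?thesis using assms by (intro exI[of _ 0]) (simp add: step_def)
next
  case False
  define z where "z = real n * r / R"
  define m where "m = \<lceil>z\<rceil>"
  define k where "k = (real_of_int (m - 1) + z) / 2 * R / real n"
  have z: "1 < z" using False by (simp add: z_def)
  have m: "real_of_int m - 1 < z" "z \<le> real_of_int m" "1 < m" using z unfolding m_def by linarith+
  have r: "r = z * R / real n" using R n by (simp add: z_def)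
  have nk: "real n * k / R = (real_of_int (m - 1) + z) / 2" using R n by (simp add: k_def)
  have "\<lceil>real n * k / R\<rceil> = m" unfolding nk using m by (intro ceiling_unique) auto
  then have "idx k = idx r" using m_def z_def by (simp add: idx_def)
  moreover have "k < r" unfolding k_def r using m R n by (intro divide_strict_right_mono mult_strict_right_mono) auto
  moreover have "0 \<le> k" unfolding k_def using m z R by auto
  ultimately show ?thesis by (auto simp: step_def)
qed

text \<open>
  \<open>R0\<close> minimizes \<open>ph t = 2 F t / t\<^sup>2\<close>, where \<open>F\<close> is the integral of the price, and \<open>lam\<close> is the
  minimum. It exists because \<open>ph\<close> is continuous and tends to infinity at 0, as the price is
  bounded below by \<open>low 1 > 0\<close>. Comparison with \<open>t = R\<close> bounds \<open>lam\<close>.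
\<close>
lemma contact_level:
  assumes pos: "0 < low 1"
  obtains R0 lam where "0 < R0" "R0 \<le> R" "0 < lam" "lam \<le> 2 * integral {0..R} step / R\<^sup>2" "cost_rate (\<lambda>t. step t / lam) R0"
proof -
  define F where "F t = integral {0..t} step" for t
  define ph where "ph t = 2 * F t / t\<^sup>2" for t
  have step_ge: "low 1 \<le> step t" if "t \<le> R" for t
    using low_mono[of 1 "idx t"] idx_range[OF that] by (simp add: step_def)
  have F_ge: "t * low 1 \<le> F t" if "0 \<le> t" "t \<le> R" for t
    using step_integral_bounds(1)[of 0 t] step_ge[of 0] that mult_left_mono[of "low 1" "step 0" t] R by (simp add: F_def)
  have FR: "0 < F R" using F_ge[of R] mult_pos_pos[OF R pos] R by linarith
  \<comment> \<open>below \<open>e\<close> the quotient \<open>ph\<close> is at least \<open>ph R\<close>, so the minimum over \<open>{e..R}\<close> is a minimum over all \<open>t\<close>\<close>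
  define e where "e = min R (low 1 * R\<^sup>2 / F R)"
  have e: "0 < e" "e \<le> R" "e \<le> low 1 * R\<^sup>2 / F R" using R pos FR by (auto simp: e_def)
  have cont: "continuous_on {e..R} ph"
  proof -
    have "continuous_on {0..R} F" unfolding F_def
      by (rule indefinite_integral_continuous_1) (rule step_integrable, simp)
    then have "continuous_on {e..R} F" by (rule continuous_on_subset) (use e in auto)
    then show ?thesis unfolding ph_def using e by (intro continuous_intros) auto
  qed
  obtain R0 where R0: "R0 \<in> {e..R}" "\<And>t. t \<in> {e..R} \<Longrightarrow> ph R0 \<le> ph t"
    using continuous_attains_inf[OF compact_Icc _ cont] e by auto
  define lam where "lam = ph R0"
  have R0p: "0 < R0" "R0 \<le> R" using R0 e by auto
  have lamR: "lam \<le> ph R" unfolding lam_def using R0 e by auto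
  have min: "lam \<le> ph t" if t: "0 < t" "t \<le> R" for t
  proof (cases "e \<le> t")
    case True then show ?thesis using R0 t by (auto simp: lam_def)
  next
    case False
    have "t * F R \<le> e * F R" using False FR by (intro mult_right_mono) auto
    also have "\<dots> \<le> low 1 * R\<^sup>2" using e(3) FR by (simp add: pos_le_divide_eq)
    finally have "t * F R \<le> low 1 * R\<^sup>2" .
    then have "F R / R\<^sup>2 \<le> low 1 / t" using t R by (simp add: field_simps)
    also have "low 1 / t = t * low 1 / t\<^sup>2" using t by (simp add: power2_eq_square)
    also have "\<dots> \<le> F t / t\<^sup>2" using F_ge[of t] t by (intro divide_right_mono) auto
    finally have "ph R \<le> ph t" by (simp add: ph_def)
    then show ?thesis using lamR by simp
  qed
  have Fl: "lam * t\<^sup>2 / 2 \<le> F t" if "0 \<le> t" "t \<le> R" for t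
  proof (cases "t = 0")
    case True then show ?thesis by (simp add: F_def)
  next
    case False
    then have "lam \<le> 2 * F t / t\<^sup>2" using min[of t] that by (simp add: ph_def)
    then show ?thesis using False by (simp add: field_simps)
  qed
  have F0: "F R0 = lam * R0\<^sup>2 / 2" using R0p by (simp add: lam_def ph_def)
  have "0 < F R0" using F_ge[of R0] mult_pos_pos[OF R0p(1) pos] R0p by linarith
  then have lam: "0 < lam" using F0 R0p by (simp add: zero_less_mult_iff)
  have int: "integral {0..k} (\<lambda>t. step t / lam) = F k / lam" for k
    by (simp add: F_def)
  have "cost_rate (\<lambda>t. step t / lam) R0"
  proof
    show "0 < R0" by fact
    show "0 \<le> step x / lam" if "x \<le> R0" for x using step_nonneg[of x] that R0p lam by simp
    show "step x / lam \<le> step y / lam" if "x \<le> y" "y \<le> R0" for x y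
      using step_mono[of x y] that R0p lam by (simp add: divide_right_mono)
    show "k\<^sup>2 / 2 \<le> integral {0..k} (\<lambda>t. step t / lam)" if "0 \<le> k" "k \<le> R0" for k
      unfolding int using Fl[of k] that R0p lam by (simp add: field_simps)
    show "integral {0..R0} (\<lambda>t. step t / lam) = R0\<^sup>2 / 2"
      unfolding int using F0 lam by simp
    obtain k where k: "0 \<le> k" "k < R0" "step k = step R0" using step_left_constant[OF R0p(1)] by blast
    have "(R0 - k) * step R0 \<le> integral {k..R0} step" using step_integral_bounds(1)[of k R0] k R0p by simp
    also have "\<dots> = F R0 - F k" using step_integral_add[of 0 k R0] k R0p by (simp add: F_def)
    also have "\<dots> \<le> lam * R0\<^sup>2 / 2 - lam * k\<^sup>2 / 2" using F0 Fl[of k] k R0p by simp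
    also have "\<dots> = (R0 - k) * (lam * (R0 + k) / 2)" by (simp add: power2_eq_square field_simps)
    finally have "step R0 \<le> lam * (R0 + k) / 2" using k by simp
    also have "\<dots> \<le> lam * R0" using k lam by simp
    finally show "step R0 / lam \<le> R0" using lam by (simp add: pos_divide_le_eq mult.commute)
  qed
  then show thesis using that[of R0 lam] R0p lam lamR by (simp add: ph_def F_def)
qed

text \<open>
  Replace each size by the cheapest cell that is at least as large.
\<close>
lemma round_up:
  assumes "covered d S bs" "set bs \<subseteq> {0..R}"
  shows "\<exists>ks. set ks \<subseteq> {1..n} \<and> covered d S (map (\<lambda>k. real k * R / real n) ks) \<and> length ks = length bs
    \<and> sum_list (map \<gamma> ks) \<le> sum_list (map step bs)"
proof -
  have "\<exists>k\<in>{1..n}. t \<le> real k * R / real n \<and> \<gamma> k = step t" if tR: "t \<le> R" for t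
  proof -
    obtain j where j: "j \<in> {idx t..n}" "low (idx t) = \<gamma> j" using low_attained[OF idx_range[OF tR]] by blast
    have "real (idx t) * R / real n \<le> real j * R / real n"
      using j R by (intro divide_right_mono mult_right_mono) auto
    then show ?thesis using j le_idx[of t] idx_range[OF tR] by (intro bexI[of _ j]) (auto simp: step_def)
  qed
  then obtain f where f: "\<And>t. t \<le> R \<Longrightarrow> f t \<in> {1..n} \<and> t \<le> real (f t) * R / real n \<and> \<gamma> (f t) = step t" by metis
  have "covered d S (map (\<lambda>k. real k * R / real n) (map f bs))"
    using f assms(2) by (intro covered_le[OF assms(1)]) (auto simp: list_all2_conv_all_nth subset_iff dest: nth_mem)
  moreover have "map \<gamma> (map f bs) = map step bs" using f assms(2) by auto
  then have "sum_list (map \<gamma> (map f bs)) \<le> sum_list (map step bs)" by (simp only: order_refl)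
  moreover have "set (map f bs) \<subseteq> {1..n}" "length (map f bs) = length bs" using f assms(2) by auto
  ultimately show ?thesis by blast
qed

end

text \<open>
  The answer to a price list \<open>\<gamma>\<close>. The bound is the total price of the balls when each of the \<open>n\<close>
  cells contains \<open>2 L / (R n)\<close> of them, which is the density aimed at. If the lowest price is 0,
  then the cover by single points, rounded up, costs nothing.
\<close>
theorem weighted_cover:
  assumes "tree_metric V d" and kappa: "1 < \<kappa>" and D: "\<And>x y. x \<in> V \<Longrightarrow> y \<in> V \<Longrightarrow> real (d x y) \<le> D"
    and R_pos: "0 < R" and R_le: "R \<le> 2 * (real (card V) - 1) - D" and n: "1 \<le> n"
    and \<gamma>: "\<And>k. k \<in> {1..n} \<Longrightarrow> 0 \<le> \<gamma> k"
  shows "\<exists>ks. set ks \<subseteq> {1..n} \<and> covered d V (map (\<lambda>k. real k * R / real n) ks) \<and> length ks \<le> card V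
    \<and> sum_list (map \<gamma> ks) \<le> \<kappa> * (2 * (real (card V) - 1) / (R * real n)) * (\<Sum>k=1..n. \<gamma> k)"
proof -
  interpret tree_metric V d by fact
  interpret cells R n \<gamma> using R_pos n \<gamma> by unfold_locales auto
  define L where "L = real (card V) - 1"
  have L0: "0 \<le> L" using ne fin by (simp add: L_def Suc_le_eq card_gt_0_iff)
  have S0: "0 \<le> (\<Sum>k=1..n. \<gamma> k)" using \<gamma> by (intro sum_nonneg) auto
  show ?thesis
  proof (cases "low 1 = 0")
    case True
    have "covered d V (replicate (card V) 0)" using fin by (intro covered_singletons) auto
    moreover have "set (replicate (card V) (0::real)) \<subseteq> {0..R}" using R by auto
    ultimately obtain ks where ks: "set ks \<subseteq> {1..n}" "covered d V (map (\<lambda>k. real k * R / real n) ks)"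
      "length ks = card V" "sum_list (map \<gamma> ks) \<le> sum_list (map step (replicate (card V) 0))"
      using round_up[of d V "replicate (card V) 0"] by auto
    have "step 0 = 0" using True by (simp add: step_def idx_def)
    then have "sum_list (map \<gamma> ks) \<le> 0" using ks(4) by (simp add: sum_list_replicate)
    also have "0 \<le> \<kappa> * (2 * L / (R * real n)) * (\<Sum>k=1..n. \<gamma> k)" using kappa L0 R S0 by simp
    finally show ?thesis using ks by (auto simp: L_def)
  next
    case False
    then have "0 < low 1" using low_nonneg[of 1] n by auto
    from contact_level[OF this] obtain R0 lam where g: "0 < R0" "R0 \<le> R" "0 < lam"
      "lam \<le> 2 * integral {0..R} step / R\<^sup>2" "cost_rate (\<lambda>t. step t / lam) R0" by blast
    interpret ga: cost_rate "\<lambda>t. step t / lam" R0 by fact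
    have "ga.cheap d V (\<kappa> * L)"
      unfolding L_def
    proof (rule ga.cheap_tree_diameter[OF assms(1) kappa D])
      show "R0 \<le> 2 * (real (card V) - 1) - D" using g(2) R_le by linarith
    qed
    then obtain bs where bs: "set bs \<subseteq> {0..R0}" "covered d V bs" "sum_list (map (\<lambda>t. step t / lam) bs) \<le> \<kappa> * L"
      unfolding ga.cheap_def by blast
    obtain cs where cs: "covered d V cs" "mset cs \<subseteq># mset bs" "length cs \<le> card V"
      using covered_short[OF bs(2) fin] by blast
    have set_cs: "set cs \<subseteq> set bs" using cs(2) by (metis set_mset_mono set_mset_mset)
    have cs_R: "set cs \<subseteq> {0..R}" using set_cs bs(1) g(2) by force
    from round_up[OF cs(1) cs_R] obtain ks where ks: "set ks \<subseteq> {1..n}" "covered d V (map (\<lambda>k. real k * R / real n) ks)"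
      "length ks = length cs" "sum_list (map \<gamma> ks) \<le> sum_list (map step cs)" by blast
    have "sum_list (map step cs) \<le> sum_list (map step bs)"
      using step_nonneg bs(1) g(2) by (intro sum_list_mset_le[OF cs(2)]) auto
    also have "\<dots> = lam * sum_list (map (\<lambda>t. step t / lam) bs)"
      using g(3) by (simp add: sum_list_const_mult[symmetric])
    also have "\<dots> \<le> lam * (\<kappa> * L)" using bs(3) g(3) by (intro mult_left_mono) auto
    also have "\<dots> \<le> (2 * integral {0..R} step / R\<^sup>2) * (\<kappa> * L)" using g(4) kappa L0 by (intro mult_right_mono) auto
    also have "\<dots> \<le> (2 * (R / real n * (\<Sum>k=1..n. \<gamma> k)) / R\<^sup>2) * (\<kappa> * L)"
      using step_integral_le kappa L0 by (intro mult_right_mono divide_right_mono mult_left_mono) auto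
    also have "\<dots> = \<kappa> * (2 * L / (R * real n)) * (\<Sum>k=1..n. \<gamma> k)"
      using R by (simp add: power2_eq_square field_simps)
    finally show ?thesis using ks cs(3) by (intro exI[of _ ks]) (auto simp: L_def)
  qed
qed

definition count_sum :: "nat list list \<Rightarrow> nat \<Rightarrow> real" where
  "count_sum Ks k = (\<Sum>ks\<leftarrow>Ks. real (count_list ks k))"

lemma sum_list_count:
  fixes f :: "'a \<Rightarrow> real"
  assumes "set xs \<subseteq> X" "finite X"
  shows "sum_list (map f xs) = (\<Sum>x\<in>X. real (count_list xs x) * f x)"
  using assms(1)
proof (induction xs)
  case (Cons a xs)
  have "(\<Sum>x\<in>X. real (count_list (a # xs) x) * f x) = (\<Sum>x\<in>X. (if x = a then f x else 0) + real (count_list xs x) * f x)"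
    by (intro sum.cong) (auto simp: algebra_simps)
  also have "\<dots> = f a + (\<Sum>x\<in>X. real (count_list xs x) * f x)"
    using Cons.prems assms(2) by (simp add: sum.distrib)
  finally show ?case using Cons by simp
qed simp

lemma max0_square_le:
  fixes S x :: real
  shows "(max 0 (S + x))\<^sup>2 \<le> (max 0 S)\<^sup>2 + 2 * max 0 S * x + x\<^sup>2"
proof (cases "0 \<le> S")
  case True
  have "(max 0 (S + x))\<^sup>2 \<le> (S + x)\<^sup>2" by (simp add: max_def)
  then show ?thesis using True by (simp add: power2_sum max_def)
next
  case False
  then have "(max 0 (S + x))\<^sup>2 \<le> \<bar>x\<bar>\<^sup>2" by (intro power_mono) auto
  then show ?thesis using False by simp
qed

text \<open>
  Blackwell's approachability argument. Let \<open>S k\<close> be the current excess of class \<open>k\<close> over the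
  target \<open>c\<close> per cover. If the next cover answers the price list \<open>max 0 (S k)\<close>, the first order
  term in the change of \<open>\<Sum>k. (max 0 (S k))\<^sup>2\<close> is nonpositive. So this sum grows at most linearly
  with the number of covers \<open>t\<close>, and the excess is only of order \<open>sqrt t\<close>.
\<close>
theorem average_lists:
  fixes c :: real and P :: "nat list \<Rightarrow> bool"
  assumes c: "0 \<le> c" and eps: "0 < \<epsilon>"
    and ex: "\<And>\<gamma>::nat \<Rightarrow> real. (\<And>k. k \<in> {1..n} \<Longrightarrow> 0 \<le> \<gamma> k) \<Longrightarrow>
      \<exists>ks. P ks \<and> set ks \<subseteq> {1..n} \<and> length ks \<le> N \<and> sum_list (map \<gamma> ks) \<le> c * (\<Sum>k=1..n. \<gamma> k)"
  shows "\<exists>Ks. Ks \<noteq> [] \<and> (\<forall>ks\<in>set Ks. P ks \<and> set ks \<subseteq> {1..n} \<and> length ks \<le> N)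
    \<and> (\<forall>k\<in>{1..n}. count_sum Ks k \<le> (c + \<epsilon>) * real (length Ks))"
proof -
  \<comment> \<open>a bound for the second order term in each step\<close>
  define B where "B = real n * (real N + c)\<^sup>2"
  define S where "S Ks k = count_sum Ks k - c * real (length Ks)" for Ks k
  have B0: "0 \<le> B" by (simp add: B_def)
  have "\<exists>Ks. length Ks = t \<and> (\<forall>ks\<in>set Ks. P ks \<and> set ks \<subseteq> {1..n} \<and> length ks \<le> N)
      \<and> (\<Sum>k=1..n. (max 0 (S Ks k))\<^sup>2) \<le> real t * B" for t
  proof (induction t)
    case 0 then show ?case by (intro exI[of _ "[]"]) (simp add: S_def count_sum_def)
  next
    case (Suc t)
    then obtain Ks where Ks: "length Ks = t" "\<forall>ks\<in>set Ks. P ks \<and> set ks \<subseteq> {1..n} \<and> length ks \<le> N"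
      "(\<Sum>k=1..n. (max 0 (S Ks k))\<^sup>2) \<le> real t * B" by blast
    obtain ks where ks: "P ks" "set ks \<subseteq> {1..n}" "length ks \<le> N"
      "(\<Sum>k\<leftarrow>ks. max 0 (S Ks k)) \<le> c * (\<Sum>k=1..n. max 0 (S Ks k))"
      using ex[OF max.cobounded1, of "S Ks"] by blast
    define x where "x k = real (count_list ks k) - c" for k
    have Sx: "S (ks # Ks) k = S Ks k + x k" for k by (simp add: S_def count_sum_def x_def algebra_simps)
    have "(\<Sum>k\<leftarrow>ks. max 0 (S Ks k)) = (\<Sum>k=1..n. real (count_list ks k) * max 0 (S Ks k))"
      using ks(2) by (intro sum_list_count) auto
    then have "(\<Sum>k=1..n. max 0 (S Ks k) * x k) \<le> 0"
      using ks(4) by (simp add: x_def algebra_simps sum_subtractf sum_distrib_left)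
    moreover have "(x k)\<^sup>2 \<le> (real N + c)\<^sup>2" for k
    proof -
      have "count_list ks k \<le> N" using count_le_length[of ks k] ks(3) by simp
      then have "\<bar>x k\<bar> \<le> real N + c" using c by (simp add: x_def abs_le_iff)
      then have "\<bar>x k\<bar>\<^sup>2 \<le> (real N + c)\<^sup>2" by (intro power_mono) auto
      then show ?thesis by simp
    qed
    then have "(\<Sum>k=1..n. (x k)\<^sup>2) \<le> B"
      using sum_bounded_above[of "{1..n}" "\<lambda>k. (x k)\<^sup>2" "(real N + c)\<^sup>2"] by (simp add: B_def)
    moreover have "(\<Sum>k=1..n. (max 0 (S (ks # Ks) k))\<^sup>2)
        \<le> (\<Sum>k=1..n. (max 0 (S Ks k))\<^sup>2 + 2 * max 0 (S Ks k) * x k + (x k)\<^sup>2)"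
      unfolding Sx by (intro sum_mono max0_square_le)
    moreover have "\<dots> = (\<Sum>k=1..n. (max 0 (S Ks k))\<^sup>2) + 2 * (\<Sum>k=1..n. max 0 (S Ks k) * x k) + (\<Sum>k=1..n. (x k)\<^sup>2)"
      by (simp add: sum.distrib sum_distrib_left mult.assoc)
    ultimately have "(\<Sum>k=1..n. (max 0 (S (ks # Ks) k))\<^sup>2) \<le> real (Suc t) * B"
      using Ks(3) by (simp add: algebra_simps)
    then show ?case using Ks(1,2) ks(1-3) by (intro exI[of _ "ks # Ks"]) auto
  qed
  note walk = this
  obtain t :: nat where t: "B / \<epsilon>\<^sup>2 < real t" using reals_Archimedean2 by blast
  have t0: "0 < real t" using t B0 eps by (meson divide_nonneg_nonneg le_less_trans zero_le_power2)
  obtain Ks where Ks: "length Ks = t" "\<forall>ks\<in>set Ks. P ks \<and> set ks \<subseteq> {1..n} \<and> length ks \<le> N"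
      "(\<Sum>k=1..n. (max 0 (S Ks k))\<^sup>2) \<le> real t * B" using walk by blast
  have "count_sum Ks k \<le> (c + \<epsilon>) * real (length Ks)" if k: "k \<in> {1..n}" for k
  proof -
    have "(max 0 (S Ks k))\<^sup>2 \<le> (\<Sum>k=1..n. (max 0 (S Ks k))\<^sup>2)" using k by (intro member_le_sum) auto
    also have "\<dots> \<le> real t * B" by (rule Ks(3))
    also have "\<dots> \<le> real t * (\<epsilon>\<^sup>2 * real t)"
    proof (rule mult_left_mono)
      show "B \<le> \<epsilon>\<^sup>2 * real t" using t eps by (simp add: pos_divide_less_eq mult.commute less_imp_le)
    qed simp
    also have "\<dots> = (\<epsilon> * real t)\<^sup>2" by (simp add: power2_eq_square)
    finally have "max 0 (S Ks k) \<le> \<epsilon> * real t" by (rule power2_le_imp_le) (use eps in simp)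
    then show ?thesis using Ks(1) by (simp add: S_def algebra_simps)
  qed
  then have "\<forall>k\<in>{1..n}. count_sum Ks k \<le> (c + \<epsilon>) * real (length Ks)" by blast
  moreover have "Ks \<noteq> []" using Ks(1) t0 by auto
  ultimately show ?thesis using Ks(2) by blast
qed

section \<open>Covers with a small sum of radii\<close>

lemma covered_empty: "(\<And>b. b \<in> set bs \<Longrightarrow> 0 \<le> b) \<Longrightarrow> covered d {} bs"
  by (induction bs) auto

text \<open>
  Root the tree at a vertex \<open>v\<close>, let \<open>x\<close> be a deepest vertex and \<open>p\<close> the vertex at distance
  \<open>\<lfloor>b / 2\<rfloor>\<close> from \<open>x\<close> on the path to \<open>v\<close>. The subtree below \<open>p\<close> has diameter at most \<open>b\<close>, and more
  than \<open>b / 2\<close> vertices. The last ball \<open>c\<close> may be used with its full size, because a tree with \<open>c\<close>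
  edges has diameter at most \<open>c\<close>.
\<close>
lemma greedy:
  assumes "tree_metric V d" "\<And>b. b \<in> set bs \<Longrightarrow> 0 \<le> b" "0 \<le> c"
    and "real (card V) - 1 \<le> sum_list bs / 2 + c"
  shows "covered d V (bs @ [c])"
  using assms
proof (induction bs arbitrary: V)
  case Nil
  interpret tree_metric V d by fact
  have "real (d x y) \<le> c" if "x \<in> V" "y \<in> V" for x y
    using convx_card[OF convx_V order_refl that] Nil by simp
  then show ?case by (auto intro!: exI[of _ V])
next
  case (Cons b bs)
  interpret tree_metric V d by fact
  have b: "0 \<le> b" using Cons.prems by simp
  have rest: "covered d {} (bs @ [c])" using Cons.prems by (intro covered_empty) auto
  obtain v where v: "v \<in> V" using ne by blast
  obtain x where x: "x \<in> V" "\<And>y. y \<in> V \<Longrightarrow> d v y \<le> d v x" using finite_ex_max[OF fin ne, of "d v"] by blast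
  define m where "m = nat \<lfloor>b / 2\<rfloor>"
  have m: "2 * real m \<le> b" "b / 2 \<le> real m + 1" using b unfolding m_def by linarith+
  show ?case
  proof (cases "d v x \<le> m")
    case True
    have "real (d y z) \<le> b" if "y \<in> V" "z \<in> V" for y z
    proof -
      have "d y z \<le> d v y + d v z" using d_tri[OF that(1) v that(2)] d_sym[OF that(1) v] by simp
      then have "d y z \<le> 2 * m" using x(2)[OF that(1)] x(2)[OF that(2)] True by simp
      then have "real (d y z) \<le> 2 * real m" by (metis of_nat_le_iff of_nat_mult of_nat_numeral)
      then show ?thesis using m by simp
    qed
    then show ?thesis using rest by (auto intro!: exI[of _ V])
  next
    case False
    then obtain p where p: "p \<in> V" "d v p = d v x - m" "d p x = m"
      using geodesic_point[OF v x(1), of "d v x - m"] by auto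
    have px: "x \<in> desc v p" using p False x(1) by (simp add: desc_def)
    have diam: "real (d y z) \<le> b" if "y \<in> desc v p" "z \<in> desc v p" for y z
    proof -
      have V: "y \<in> V" "z \<in> V" using that desc_subset by blast+
      have "d p y \<le> m" "d p z \<le> m" using that x(2)[OF V(1)] x(2)[OF V(2)] p False by (auto simp: desc_def)
      moreover have "d y z \<le> d p y + d p z" using d_tri[OF V(1) p(1) V(2)] d_sym[OF V(1) p(1)] by simp
      ultimately have "real (d y z) \<le> 2 * real m" by linarith
      then show ?thesis using m by simp
    qed
    have vn: "v \<in> V - desc v p" using v p False by (auto simp: desc_def)
    have tm: "tree_metric (V - desc v p) d"
      using vn by (intro tree_metric_subset convx_minus_desc v p(1)) auto
    have "real (Suc m) \<le> real (card (desc v p))"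
      unfolding of_nat_le_iff using convx_card[OF convx_desc[OF v p(1)] desc_subset desc_self[OF p(1)] px] p(3) by simp
    moreover have "real (card (V - desc v p)) = real (card V) - real (card (desc v p))"
      using desc_subset fin by (simp add: card_Diff_subset card_mono of_nat_diff)
    ultimately have "real (card (V - desc v p)) - 1 \<le> sum_list bs / 2 + c"
      using Cons.prems(4) m unfolding sum_list.Cons add_divide_distrib by linarith
    then have "covered d (V - desc v p) (bs @ [c])"
      using Cons.prems by (intro Cons.IH[OF tm]) auto
    then show ?thesis using diam by auto
  qed
qed

text \<open>
  Sort the sizes in decreasing order and keep the longest initial part with sum at most \<open>2 L\<close>. If
  \<open>s\<close> is the last size that is kept and \<open>s'\<close> the first one that is dropped, then \<open>s' \<le> s\<close>, so half
  of the sum of the sizes before \<open>s\<close>, plus \<open>s\<close>, is at least half of a sum that exceeds \<open>2 L\<close>. Thus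
  \<open>greedy\<close> applies.
\<close>
lemma prune:
  fixes sz :: "nat \<Rightarrow> real"
  assumes tm: "tree_metric V d" and cov: "covered d V (map sz ks)"
    and mono: "mono sz" and sz: "\<And>k. k \<in> set ks \<Longrightarrow> 0 \<le> sz k" "\<And>k. k \<in> set ks \<Longrightarrow> sz k \<le> 2 * (real (card V) - 1)"
  shows "\<exists>ks'. mset ks' \<subseteq># mset ks \<and> covered d V (map sz ks') \<and> sum_list (map sz ks') \<le> 2 * (real (card V) - 1)"
proof (cases "sum_list (map sz ks) \<le> 2 * (real (card V) - 1)")
  case True then show ?thesis using cov by (intro exI[of _ ks]) auto
next
  case False
  define L where "L = real (card V) - 1"
  define js where "js = rev (sort ks)"
  have mjs: "mset js = mset ks" by (simp add: js_def)
  have set_js: "set js = set ks" using mjs by (metis set_mset_mset)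
  have sum_js: "2 * L < sum_list (map sz js)"
    using False mjs by (metis L_def mset_map not_le sum_mset_sum_list)
  have ks0: "js \<noteq> []"
  proof
    assume "js = []"
    then have "L < 0" using sum_js by simp
    moreover have "0 \<le> L" using tree_metric.fin[OF tm] tree_metric.ne[OF tm] by (simp add: L_def Suc_le_eq card_gt_0_iff)
    ultimately show False by simp
  qed
  define P where "P k \<longleftrightarrow> k \<le> length js \<and> 2 * L < sum_list (map sz (take k js))" for k
  define k where "k = (LEAST k. P k)"
  have "P (length js)" using sum_js by (simp add: P_def)
  then have Pk: "P k" unfolding k_def by (rule LeastI)
  have "\<not> P 0" using tree_metric.fin[OF tm] tree_metric.ne[OF tm] by (simp add: P_def L_def Suc_le_eq card_gt_0_iff)
  moreover have "\<not> P 1"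
  proof -
    obtain a as where js: "js = a # as" using ks0 by (cases js) auto
    then have "a \<in> set ks" unfolding set_js[symmetric] by simp
    then show ?thesis using sz(2)[of a] js by (auto simp: P_def L_def)
  qed
  ultimately have "k \<noteq> 0" "k \<noteq> 1" using Pk by metis+
  then obtain i where k: "k = Suc (Suc i)" by (metis One_nat_def not0_implies_Suc)
  have "\<not> P (Suc i)" unfolding k_def[symmetric] using not_less_Least[of "Suc i" P] k k_def by simp
  then have le: "sum_list (map sz (take (Suc i) js)) \<le> 2 * L" using Pk k by (simp add: P_def)
  have len: "Suc i < length js" using Pk k by (simp add: P_def)
  have "sz (js ! Suc i) \<le> sz (js ! i)"
  proof (rule monoD[OF mono])
    have "sorted (sort ks)" by simp
    then show "js ! Suc i \<le> js ! i" using len by (auto simp: js_def rev_nth intro!: sorted_nth_mono)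
  qed
  moreover have "sum_list (map sz (take k js)) = sum_list (map sz (take i js)) + sz (js ! i) + sz (js ! Suc i)"
    using len unfolding k by (simp add: take_Suc_conv_app_nth)
  ultimately have "L \<le> sum_list (map sz (take i js)) / 2 + sz (js ! i)" using Pk by (simp add: P_def)
  moreover have "js ! i \<in> set ks" "set (take i js) \<subseteq> set ks" using len set_js set_take_subset[of i js] nth_mem[of i js] by auto
  ultimately have "covered d V (map sz (take i js) @ [sz (js ! i)])"
    using sz(1) by (intro greedy[OF tm]) (auto simp: L_def)
  moreover have "map sz (take i js) @ [sz (js ! i)] = map sz (take (Suc i) js)"
    using len by (simp add: take_Suc_conv_app_nth)
  moreover have "mset (take (Suc i) js) \<subseteq># mset ks"
    unfolding mjs[symmetric] by (metis append_take_drop_id mset_append mset_subset_eq_add_left)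
  ultimately show ?thesis using le by (intro exI[of _ "take (Suc i) js"]) (auto simp: L_def)
qed

text \<open>
  Pruning does not increase any count, so it can be applied to the answer to each price list.
\<close>
theorem balanced_covers:
  assumes tm: "tree_metric V d" and kappa: "1 < \<kappa>" and D: "\<And>x y. x \<in> V \<Longrightarrow> y \<in> V \<Longrightarrow> real (d x y) \<le> D"
    and R_pos: "0 < R" and R_le: "R \<le> 2 * (real (card V) - 1) - D" and n: "1 \<le> n" and eps: "0 < \<epsilon>"
  shows "\<exists>Ks. Ks \<noteq> [] \<and> (\<forall>ks\<in>set Ks. set ks \<subseteq> {1..n} \<and> covered d V (map (\<lambda>k. real k * R / real n) ks)
      \<and> sum_list (map (\<lambda>k. real k * R / real n) ks) \<le> 2 * (real (card V) - 1))
    \<and> (\<forall>k\<in>{1..n}. count_sum Ks k \<le> (\<kappa> * (2 * (real (card V) - 1) / (R * real n)) + \<epsilon>) * real (length Ks))"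
proof -
  interpret tree_metric V d by fact
  define L where "L = real (card V) - 1"
  define sz where "sz k = real k * R / real n" for k
  define P where "P ks \<longleftrightarrow> covered d V (map sz ks) \<and> sum_list (map sz ks) \<le> 2 * L" for ks
  define c where "c = \<kappa> * (2 * L / (R * real n))"
  obtain x where x: "x \<in> V" using ne by blast
  have D0: "0 \<le> D" using D[OF x x] x by simp
  have L0: "0 \<le> L" using ne fin by (simp add: L_def Suc_le_eq card_gt_0_iff)
  have ex: "\<exists>ks. P ks \<and> set ks \<subseteq> {1..n} \<and> length ks \<le> card V \<and> sum_list (map \<gamma> ks) \<le> c * (\<Sum>k=1..n. \<gamma> k)"
    if \<gamma>: "\<And>k. k \<in> {1..n} \<Longrightarrow> 0 \<le> \<gamma> k" for \<gamma> :: "nat \<Rightarrow> real"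
  proof -
    have "\<exists>ks. set ks \<subseteq> {1..n} \<and> covered d V (map (\<lambda>k. real k * R / real n) ks) \<and> length ks \<le> card V
      \<and> sum_list (map \<gamma> ks) \<le> \<kappa> * (2 * (real (card V) - 1) / (R * real n)) * (\<Sum>k=1..n. \<gamma> k)"
      by (rule weighted_cover[OF tm kappa D R_pos R_le n \<gamma>])
    then obtain ks where ks: "set ks \<subseteq> {1..n}" "covered d V (map sz ks)" "length ks \<le> card V"
      "sum_list (map \<gamma> ks) \<le> c * (\<Sum>k=1..n. \<gamma> k)"
      unfolding sz_def c_def L_def by blast
    have szk: "0 \<le> sz k" "sz k \<le> 2 * (real (card V) - 1)" if "k \<in> set ks" for k
    proof -
      have "k \<le> n" using that ks(1) by auto
      then have "real k * R \<le> real n * R" using R_pos by (intro mult_right_mono) auto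
      then have "sz k \<le> R" using n by (simp add: sz_def field_simps)
      then show "sz k \<le> 2 * (real (card V) - 1)" using R_le D0 by simp
      show "0 \<le> sz k" using R_pos by (simp add: sz_def)
    qed
    have "mono sz" unfolding sz_def using R_pos
      by (intro monoI divide_right_mono mult_right_mono) auto
    from prune[OF tm ks(2) this szk] obtain ks' where ks': "mset ks' \<subseteq># mset ks" "P ks'"
      by (auto simp: P_def L_def)
    have "set ks' \<subseteq> set ks" using ks'(1) by (metis set_mset_mono set_mset_mset)
    moreover have "length ks' \<le> length ks" using ks'(1) by (metis size_mset size_mset_mono)
    moreover have "sum_list (map \<gamma> ks') \<le> sum_list (map \<gamma> ks)"
      using ks(1) \<gamma> by (intro sum_list_mset_le[OF ks'(1)]) auto
    ultimately show ?thesis using ks ks'(2) by (intro exI[of _ ks']) auto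
  qed
  have c0: "0 \<le> c" using kappa L0 R_pos by (simp add: c_def)
  show ?thesis using average_lists[OF c0 eps ex] unfolding P_def c_def L_def sz_def by blast
qed

context tree_metric begin

text \<open>
  The midpoint of a diameter is a centre, by the four point condition. The extra \<open>1 / 2\<close> is for
  odd diameters.
\<close>
lemma diameter_center:
  assumes A: "A \<subseteq> V" "A \<noteq> {}" and b: "\<And>x y. x \<in> A \<Longrightarrow> y \<in> A \<Longrightarrow> real (d x y) \<le> b"
  shows "\<exists>v\<in>V. \<forall>z\<in>A. real (d z v) \<le> (b + 1) / 2"
proof -
  have "finite (A \<times> A)" "A \<times> A \<noteq> {}" using A fin finite_subset by auto
  from finite_ex_max[OF this, of "\<lambda>p. d (fst p) (snd p)"] obtain x y where
    xy: "x \<in> A" "y \<in> A" and max: "\<And>u w. u \<in> A \<Longrightarrow> w \<in> A \<Longrightarrow> d u w \<le> d x y" by force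
  have V: "x \<in> V" "y \<in> V" using xy A by auto
  obtain v where v: "v \<in> V" "d x v = d x y div 2" "d v y = d x y - d x y div 2"
    using geodesic_point[OF V, of "d x y div 2"] by auto
  have "real (d z v) \<le> (b + 1) / 2" if z: "z \<in> A" for z
  proof -
    have zV: "z \<in> V" using z A by blast
    have "d z v + d x y \<le> max (d z x + d v y) (d z y + d v x)" using four_point[OF zV v(1) V] .
    moreover have "d z x \<le> d x y" "d z y \<le> d x y" using max z xy by auto
    moreover have "d v x = d x v" using d_sym v(1) V by blast
    ultimately have "2 * d z v \<le> d x y + 1" using v(2,3) by linarith
    then have "real (2 * d z v) \<le> real (d x y + 1)" by (simp only: of_nat_le_iff)
    then show ?thesis using b[OF xy] by simp
  qed
  then show ?thesis using v(1) by blast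
qed

end

text \<open>
  A path with \<open>m\<close> new vertices is attached at the old vertex \<open>z 0\<close>, as a sequence of leaves.
\<close>
lemma tree_metric_add_path:
  assumes "tree_metric V d" and u: "z 0 \<in> V" and inj: "inj_on z {1..m}" and new: "\<And>j. j \<in> {1..m} \<Longrightarrow> z j \<notin> V"
  shows "\<exists>d'. tree_metric (V \<union> z ` {1..m}) d' \<and> (\<forall>x\<in>V. \<forall>y\<in>V. d' x y = d x y)
    \<and> (\<forall>x\<in>V. \<forall>j\<le>m. d' x (z j) = d x (z 0) + j) \<and> (\<forall>i\<le>m. \<forall>j\<le>m. i \<le> j \<longrightarrow> d' (z i) (z j) = j - i)"
  using inj new
proof (induction m)
  case 0
  interpret tree_metric V d by fact
  show ?case using assms(1) u by (intro exI[of _ d]) auto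
next
  case (Suc m)
  have "inj_on z {1..m}" using Suc.prems(1) by (rule inj_on_subset) auto
  then obtain d' where d': "tree_metric (V \<union> z ` {1..m}) d'" "\<forall>x\<in>V. \<forall>y\<in>V. d' x y = d x y"
    "\<forall>x\<in>V. \<forall>j\<le>m. d' x (z j) = d x (z 0) + j" "\<forall>i\<le>m. \<forall>j\<le>m. i \<le> j \<longrightarrow> d' (z i) (z j) = j - i"
    using Suc by auto
  let ?V = "V \<union> z ` {1..m}" and ?x = "z (Suc m)"
  interpret d': tree_metric ?V d' by fact
  define d2 where "d2 a b = (if a = ?x then (if b = ?x then 0 else Suc (d' (z m) b))
    else if b = ?x then Suc (d' (z m) a) else d' a b)" for a b
  have zV: "z j \<in> ?V" if "j \<le> m" for j using u that by (cases "j = 0") auto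
  have xnew: "?x \<notin> ?V"
  proof -
    have "?x \<notin> V" using Suc.prems(2) by auto
    moreover have "?x \<notin> z ` {1..m}"
    proof
      assume "?x \<in> z ` {1..m}"
      then obtain j where "j \<in> {1..m}" "?x = z j" by blast
      then show False using inj_onD[OF Suc.prems(1), of "Suc m" j] by auto
    qed
    ultimately show ?thesis by blast
  qed
  have neq: "a \<noteq> ?x" if "a \<in> ?V" for a using xnew that by blast
  have sym: "d' (z m) a = d' a (z m)" if "a \<in> ?V" for a using d'.d_sym[OF zV[OF order_refl] that] .
  have "tree_metric (insert ?x ?V) d2"
    by (rule tree_metric_add_leaf[OF d'(1) zV[OF order_refl] xnew]) (use neq in \<open>auto simp: d2_def\<close>)
  moreover have "insert ?x ?V = V \<union> z ` {1..Suc m}" by (auto simp: atLeastAtMostSuc_conv)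
  moreover have "\<forall>x\<in>V. \<forall>y\<in>V. d2 x y = d x y" using neq d'(2) by (auto simp: d2_def)
  moreover have "\<forall>x\<in>V. \<forall>j\<le>Suc m. d2 x (z j) = d x (z 0) + j"
  proof (intro ballI allI impI)
    fix x j assume x: "x \<in> V" and j: "j \<le> Suc m"
    show "d2 x (z j) = d x (z 0) + j"
    proof (cases "j = Suc m")
      case True then show ?thesis using x neq[of x] d'(3) sym[of x] by (simp add: d2_def)
    next
      case False
      then have "j \<le> m" using j by simp
      then show ?thesis using x neq[of x] neq[OF zV[of j]] d'(3) by (simp add: d2_def)
    qed
  qed
  moreover have "\<forall>i\<le>Suc m. \<forall>j\<le>Suc m. i \<le> j \<longrightarrow> d2 (z i) (z j) = j - i"
  proof (intro allI impI)
    fix i j assume ij: "i \<le> Suc m" "j \<le> Suc m" "i \<le> j"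
    show "d2 (z i) (z j) = j - i"
    proof (cases "j = Suc m")
      case True
      show ?thesis
      proof (cases "i = Suc m")
        case 1: True then show ?thesis using True by (simp add: d2_def)
      next
        case False
        then have i: "i \<le> m" using ij by simp
        then show ?thesis using True neq[OF zV[OF i]] d'(4) sym[OF zV[OF i]] by (simp add: d2_def Suc_diff_le)
      qed
    next
      case False
      then have "i \<le> m" "j \<le> m" using ij by auto
      then show ?thesis using neq[OF zV[of i]] neq[OF zV[of j]] d'(4) ij by (simp add: d2_def)
    qed
  qed
  ultimately show ?case by (intro exI[of _ d2]) simp
qed

section \<open>Discretization of a metric tree\<close>

definition ind :: "'v \<Rightarrow> 'v \<Rightarrow> real" where "ind v = (\<lambda>x. if x = v then 1 else 0)"

text \<open>
  The point that divides the edge from \<open>u\<close> to \<open>w\<close> in the ratio \<open>t : 1 - t\<close>.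
\<close>
definition edge_point :: "'v \<Rightarrow> 'v \<Rightarrow> real \<Rightarrow> 'v \<Rightarrow> real" where
  "edge_point u w t = (\<lambda>x. (1 - t) * ind u x + t * ind w x)"

lemma edge_point_ends [simp]: "edge_point u w 0 = ind u" "edge_point u w 1 = ind w"
  by (auto simp: edge_point_def)

lemma cell_singleton: "cell {v} = {ind v}"
proof -
  have "x = ind v" if "x \<in> cell {v}" for x using that by (auto simp: cell_def ind_def)
  moreover have "ind v \<in> cell {v}" by (auto simp: cell_def ind_def)
  ultimately show ?thesis by blast
qed

lemma cell_pair:
  assumes "u \<noteq> w" shows "cell {u, w} = edge_point u w ` {0..1}"
proof
  show "cell {u, w} \<subseteq> edge_point u w ` {0..1}"
  proof
    fix x assume x: "x \<in> cell {u, w}"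
    then have "x u + x w = 1" "0 \<le> x u" "0 \<le> x w" "\<And>v. v \<noteq> u \<Longrightarrow> v \<noteq> w \<Longrightarrow> x v = 0"
      using assms by (auto simp: cell_def)
    then have "x = edge_point u w (x w)" "x w \<in> {0..1}" using assms by (auto simp: edge_point_def ind_def fun_eq_iff)
    then show "x \<in> edge_point u w ` {0..1}" by blast
  qed
  show "edge_point u w ` {0..1} \<subseteq> cell {u, w}"
    using assms by (auto simp: cell_def edge_point_def ind_def)
qed

lemma edge_dist_between:
  "u \<noteq> w \<Longrightarrow> edge_dist T {u, w} (edge_point u w s) (edge_point u w t) = len T {u, w} * \<bar>s - t\<bar>"
  by (simp add: edge_dist_def edge_point_def ind_def abs_minus_commute)

lemma edge_dist_sym: "edge_dist T e x y = edge_dist T e y x"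
  by (simp add: edge_dist_def abs_minus_commute)

lemma path_trans: "path_of_length T y z t \<Longrightarrow> path_of_length T x y s \<Longrightarrow> path_of_length T x z (s + t)"
proof (induction rule: path_of_length.induct)
  case (path_step a b s' e c)
  then show ?case using path_of_length.path_step[of T x b "s + s'" e c] by (simp add: add.assoc)
qed simp

lemma path_segment:
  assumes "e \<in> edges T" "y \<in> cell e" "z \<in> cell e"
  shows "path_of_length T y z (edge_dist T e y z)"
proof -
  have "y \<in> points T" using assms by (auto simp: points_def)
  then show ?thesis using path_step[OF path_refl assms] by simp
qed

lemma path_sym: "path_of_length T x y s \<Longrightarrow> path_of_length T y x s"
proof (induction rule: path_of_length.induct)
  case (path_refl x) then show ?case by (rule path_of_length.path_refl)
next
  case (path_step x y s e z)
  have "path_of_length T z y (edge_dist T e y z)"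
    using path_segment[OF path_step(2,4,3)] by (simp add: edge_dist_sym)
  from path_trans[OF path_step(5) this] show ?case by (simp add: add.commute)
qed

lemma path_nonneg:
  assumes "\<And>e. e \<in> edges T \<Longrightarrow> 0 < len T e" shows "path_of_length T x y s \<Longrightarrow> 0 \<le> s"
proof (induction rule: path_of_length.induct)
  case (path_step x y s e z)
  then have "0 \<le> edge_dist T e y z" using assms[of e] by (simp add: edge_dist_def sum_nonneg)
  then show ?case using path_step by simp
qed simp

locale metric_tree =
  fixes T :: "('v, 'z) weighted_graph_scheme"
  assumes tree: "finite_weighted_tree T"
begin

lemma fin_verts: "finite (verts T)" and verts_ne: "verts T \<noteq> {}"
  and edge: "e \<in> edges T \<Longrightarrow> e \<subseteq> verts T \<and> card e = 2 \<and> 0 < len T e"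
  using tree unfolding finite_weighted_tree_def by blast+

lemma connected: "u \<in> verts T \<Longrightarrow> v \<in> verts T \<Longrightarrow> (\<lambda>a b. {a, b} \<in> edges T)\<^sup>*\<^sup>* u v"
  using tree unfolding finite_weighted_tree_def connected_graph_def by blast

lemma acyclic: "\<lbrakk>3 \<le> length p; distinct p; successively (\<lambda>a b. {a, b} \<in> edges T) p; {last p, hd p} \<in> edges T\<rbrakk> \<Longrightarrow> False"
  using tree unfolding finite_weighted_tree_def acyclic_graph_def by blast

lemma fin_edges: "finite (edges T)"
  using edge fin_verts by (meson Pow_iff finite_Pow_iff finite_subset subsetI)

lemma edgeD: "{u, w} \<in> edges T \<Longrightarrow> u \<noteq> w \<and> u \<in> verts T \<and> w \<in> verts T \<and> 0 < len T {u, w}"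
  using edge[of "{u, w}"] by (cases "u = w") auto

lemma edgeE: assumes "e \<in> edges T" obtains u w where "e = {u, w}" "u \<noteq> w"
  using edge[OF assms] by (meson card_2_iff)

text \<open>
  The extension of a function on the vertices to all points that is affine on edges. If \<open>\<phi>\<close>
  changes by at most the length of an edge along it, then \<open>pot \<phi>\<close> is 1-Lipschitz, and this gives
  lower bounds for the path metric.
\<close>
definition pot :: "('v \<Rightarrow> real) \<Rightarrow> ('v \<Rightarrow> real) \<Rightarrow> real" where
  "pot \<phi> p = (\<Sum>v\<in>verts T. p v * \<phi> v)"

lemma pot_ind: "u \<in> verts T \<Longrightarrow> pot \<phi> (ind u) = \<phi> u"
  using fin_verts by (simp add: pot_def ind_def if_distrib[of "\<lambda>x. x * _"] cong: if_cong)

lemma pot_edge_point: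
  assumes "u \<in> verts T" "w \<in> verts T"
  shows "pot \<phi> (edge_point u w t) = (1 - t) * \<phi> u + t * \<phi> w"
proof -
  have "pot \<phi> (edge_point u w t) = (1 - t) * pot \<phi> (ind u) + t * pot \<phi> (ind w)"
    unfolding pot_def edge_point_def sum_distrib_left sum.distrib[symmetric]
    by (intro sum.cong refl) (simp add: algebra_simps)
  then show ?thesis using assms by (simp add: pot_ind)
qed

lemma pot_uminus: "pot (\<lambda>v. - \<phi> v) p = - pot \<phi> p"
  by (simp add: pot_def sum_negf)

lemma pot_path:
  assumes lip: "\<And>u w. {u, w} \<in> edges T \<Longrightarrow> \<bar>\<phi> u - \<phi> w\<bar> \<le> len T {u, w}"
  shows "path_of_length T x y s \<Longrightarrow> \<bar>pot \<phi> x - pot \<phi> y\<bar> \<le> s"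
proof (induction rule: path_of_length.induct)
  case (path_step x y s e z)
  obtain u w where e: "e = {u, w}" "u \<noteq> w" using edgeE[OF path_step(2)] by blast
  obtain a b where ab: "y = edge_point u w a" "z = edge_point u w b"
    using path_step(3,4) cell_pair[OF e(2)] e(1) by auto
  have V: "u \<in> verts T" "w \<in> verts T" using edgeD path_step(2) e by blast+
  have "pot \<phi> y - pot \<phi> z = (a - b) * (\<phi> w - \<phi> u)" using V by (simp add: ab pot_edge_point algebra_simps)
  then have "\<bar>pot \<phi> y - pot \<phi> z\<bar> = \<bar>a - b\<bar> * \<bar>\<phi> w - \<phi> u\<bar>" by (simp add: abs_mult)
  also have "\<dots> \<le> \<bar>a - b\<bar> * len T {u, w}"
    using lip[of u w] path_step(2) e by (intro mult_left_mono) (auto simp: abs_minus_commute)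
  also have "\<dots> = edge_dist T e y z" using e ab by (simp add: edge_dist_between mult.commute)
  finally show ?case using path_step by simp
qed simp

text \<open>
  The discretization is built up edge by edge. \<open>built \<sigma> \<tau> U V d\<close> says that \<open>V\<close> with the metric \<open>d\<close>
  subdivides the subtree spanned by \<open>U\<close> into pieces of length between \<open>\<tau>\<close> and \<open>\<sigma>\<close>. The bound \<open>\<tau>\<close>
  is expressed through potentials on this subtree: in contrast to the path metric of the whole
  tree, these can be extended by hand when an edge is added. Points of \<open>V\<close> have no coordinates
  outside \<open>U\<close>, so the points on a new edge are new.
\<close>
definition edges_in :: "'v set \<Rightarrow> 'v set set" where "edges_in U = {e \<in> edges T. e \<subseteq> U}"

definition pieces :: "real \<Rightarrow> 'v set \<Rightarrow> nat" where "pieces \<sigma> e = nat \<lceil>len T e / \<sigma>\<rceil>"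

definition built :: "real \<Rightarrow> real \<Rightarrow> 'v set \<Rightarrow> ('v \<Rightarrow> real) set \<Rightarrow> (('v \<Rightarrow> real) \<Rightarrow> ('v \<Rightarrow> real) \<Rightarrow> nat) \<Rightarrow> bool" where
  "built \<sigma> \<tau> U V d \<longleftrightarrow> U \<subseteq> verts T \<and> U \<noteq> {}
    \<and> (\<forall>u\<in>U. \<forall>u'\<in>U. \<exists>p. p \<noteq> [] \<and> hd p = u \<and> last p = u' \<and> distinct p \<and> set p \<subseteq> U
         \<and> successively (\<lambda>a b. {a, b} \<in> edges T) p)
    \<and> tree_metric V d \<and> ind ` U \<subseteq> V \<and> V \<subseteq> points T \<and> (\<forall>p\<in>V. \<forall>w. w \<notin> U \<longrightarrow> p w = 0)
    \<and> card V = Suc (\<Sum>e\<in>edges_in U. pieces \<sigma> e)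
    \<and> (\<forall>x\<in>V. \<forall>y\<in>V. \<exists>s. s \<le> \<sigma> * real (d x y) \<and> path_of_length T x y s)
    \<and> (\<forall>x\<in>V. \<forall>y\<in>V. \<exists>\<phi>. (\<forall>u w. {u, w} \<in> edges_in U \<longrightarrow> \<bar>\<phi> u - \<phi> w\<bar> \<le> len T {u, w})
         \<and> \<tau> * real (d x y) \<le> \<bar>pot \<phi> x - pot \<phi> y\<bar>)
    \<and> (\<forall>u\<in>U. \<exists>x\<in>V. \<exists>s\<le>\<sigma>. path_of_length T (ind u) x s)
    \<and> (\<forall>e\<in>edges_in U. \<forall>p\<in>cell e. \<exists>x\<in>V. \<exists>s\<le>\<sigma>. path_of_length T p x s)"

text \<open>
  A second edge from \<open>w\<close> into \<open>U\<close> would close a cycle with a path inside \<open>U\<close>.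
\<close>
lemma inner_insert:
  assumes conn: "\<And>u u'. u \<in> U \<Longrightarrow> u' \<in> U \<Longrightarrow> \<exists>p. p \<noteq> [] \<and> hd p = u \<and> last p = u' \<and> distinct p \<and> set p \<subseteq> U
         \<and> successively (\<lambda>a b. {a, b} \<in> edges T) p"
    and u: "u \<in> U" and w: "w \<notin> U" and uw: "{u, w} \<in> edges T"
  shows "edges_in (insert w U) = insert {u, w} (edges_in U)"
proof
  show "insert {u, w} (edges_in U) \<subseteq> edges_in (insert w U)" using u uw by (auto simp: edges_in_def)
  show "edges_in (insert w U) \<subseteq> insert {u, w} (edges_in U)"
  proof
    fix e assume e: "e \<in> edges_in (insert w U)"
    show "e \<in> insert {u, w} (edges_in U)"
    proof (cases "w \<in> e")
      case False then show ?thesis using e by (auto simp: edges_in_def)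
    next
      case True
      obtain a b where ab: "e = {a, b}" "a \<noteq> b" using e edgeE by (auto simp: edges_in_def)
      then obtain u' where u': "e = {w, u'}" "u' \<noteq> w" using True by blast
      then have u'U: "u' \<in> U" "{w, u'} \<in> edges T" using e by (auto simp: edges_in_def)
      have "u' = u"
      proof (rule ccontr)
        assume ne: "u' \<noteq> u"
        obtain p where p: "p \<noteq> []" "hd p = u" "last p = u'" "distinct p" "set p \<subseteq> U"
          "successively (\<lambda>a b. {a, b} \<in> edges T) p" using conn[OF u u'U(1)] by blast
        obtain q where q: "p = u # q" using p(1,2) by (cases p) auto
        have "q \<noteq> []" using p(3) q ne by auto
        show False
        proof (rule acyclic[of "w # p"])
          show "3 \<le> length (w # p)" using q \<open>q \<noteq> []\<close> by (cases q) auto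
          show "distinct (w # p)" using p w by auto
          show "successively (\<lambda>a b. {a, b} \<in> edges T) (w # p)"
            using p(6) q uw by (simp add: insert_commute)
          show "{last (w # p), hd (w # p)} \<in> edges T" using p(1,3) u'U(2) by (simp add: insert_commute)
        qed
      qed
      then show ?thesis using u'(1) by (auto simp: insert_commute)
    qed
  qed
qed

lemma pieces_pos: "0 < \<sigma> \<Longrightarrow> e \<in> edges T \<Longrightarrow> 1 \<le> pieces \<sigma> e"
  using edge[of e] by (simp add: pieces_def Suc_le_eq)

lemma pieces_ge: "0 < \<sigma> \<Longrightarrow> e \<in> edges T \<Longrightarrow> len T e \<le> \<sigma> * real (pieces \<sigma> e)"
  using real_nat_ceiling_ge[of "len T e / \<sigma>"] by (simp add: pieces_def field_simps)

text \<open>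
  The new edge is attached as a path of \<open>m\<close> pieces. A potential for a pair of points is extended
  to \<open>w\<close> so that it keeps growing along the new edge, after a change of sign if the old potential
  decreases towards \<open>u\<close>.
\<close>
lemma built_extend:
  assumes b: "built \<sigma> \<tau> U V d" and u: "u \<in> U" and w: "w \<notin> U" and uw: "{u, w} \<in> edges T"
    and \<sigma>: "0 < \<sigma>" and \<tau>: "0 \<le> \<tau>" "\<tau> * real (pieces \<sigma> {u, w}) \<le> len T {u, w}"
  shows "\<exists>V' d'. built \<sigma> \<tau> (insert w U) V' d'"
proof -
  define m where "m = pieces \<sigma> {u, w}"
  define l where "l = len T {u, w}"
  define z where "z j = edge_point u w (real j / real m)" for j
  have m: "1 \<le> m" using pieces_pos[OF \<sigma> uw] by (simp add: m_def)
  have uw': "u \<noteq> w" "u \<in> verts T" "w \<in> verts T" "0 < l" using edgeD[OF uw] by (auto simp: l_def)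
  have lm: "l / real m \<le> \<sigma>" "\<tau> \<le> l / real m"
    using pieces_ge[OF \<sigma> uw] \<tau> m by (auto simp: l_def m_def field_simps)
  note b' = b[unfolded built_def]
  have U: "U \<subseteq> verts T" "U \<noteq> {}" using b' by blast+
  have conn: "\<And>u u'. u \<in> U \<Longrightarrow> u' \<in> U \<Longrightarrow> \<exists>p. p \<noteq> [] \<and> hd p = u \<and> last p = u' \<and> distinct p \<and> set p \<subseteq> U
         \<and> successively (\<lambda>a b. {a, b} \<in> edges T) p" using b' by blast
  have tm: "tree_metric V d" and indV: "ind ` U \<subseteq> V" and VT: "V \<subseteq> points T" using b' by blast+
  have supp: "\<And>p v. p \<in> V \<Longrightarrow> v \<notin> U \<Longrightarrow> p v = 0" using b' by blast
  have cardV: "card V = Suc (\<Sum>e\<in>edges_in U. pieces \<sigma> e)" using b' by blast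
  have up: "\<And>x y. x \<in> V \<Longrightarrow> y \<in> V \<Longrightarrow> \<exists>s. s \<le> \<sigma> * real (d x y) \<and> path_of_length T x y s" using b' by blast
  have lo: "\<And>x y. x \<in> V \<Longrightarrow> y \<in> V \<Longrightarrow> \<exists>\<phi>. (\<forall>u w. {u, w} \<in> edges_in U \<longrightarrow> \<bar>\<phi> u - \<phi> w\<bar> \<le> len T {u, w})
         \<and> \<tau> * real (d x y) \<le> \<bar>pot \<phi> x - pot \<phi> y\<bar>" using b' by blast
  have nearv: "\<And>u. u \<in> U \<Longrightarrow> \<exists>x\<in>V. \<exists>s\<le>\<sigma>. path_of_length T (ind u) x s" using b' by blast
  have near: "\<And>e p. e \<in> edges_in U \<Longrightarrow> p \<in> cell e \<Longrightarrow> \<exists>x\<in>V. \<exists>s\<le>\<sigma>. path_of_length T p x s" using b' by blast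
  have edges_in': "edges_in (insert w U) = insert {u, w} (edges_in U)" using inner_insert[OF conn u w uw] .
  have new_edge: "{u, w} \<notin> edges_in U" using w by (auto simp: edges_in_def)
  have z0: "z 0 = ind u" by (simp add: z_def)
  have zm: "z m = ind w" using m by (simp add: z_def)
  have z0V: "z 0 \<in> V" using indV u z0 by auto
  have zw: "z j w = real j / real m" for j using uw' by (simp add: z_def edge_point_def ind_def)
  have z_new: "z j \<notin> V" if "j \<in> {1..m}" for j
    using supp[of "z j" w] w zw[of j] that m by auto
  have z_inj: "inj_on z {1..m}"
  proof (rule inj_onI)
    fix i j assume "z i = z j"
    then have "real i / real m = real j / real m" using zw by metis
    then show "i = j" using m by simp
  qed
  have "\<exists>d'. tree_metric (V \<union> z ` {1..m}) d' \<and> (\<forall>x\<in>V. \<forall>y\<in>V. d' x y = d x y)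
    \<and> (\<forall>x\<in>V. \<forall>j\<le>m. d' x (z j) = d x (z 0) + j) \<and> (\<forall>i\<le>m. \<forall>j\<le>m. i \<le> j \<longrightarrow> d' (z i) (z j) = j - i)"
    by (rule tree_metric_add_path[OF tm z0V z_inj z_new])
  then obtain d' where d1: "tree_metric (V \<union> z ` {1..m}) d'" and d2: "\<forall>x\<in>V. \<forall>y\<in>V. d' x y = d x y"
    and d3: "\<forall>x\<in>V. \<forall>j\<le>m. d' x (z j) = d x (z 0) + j"
    and d4: "\<forall>i\<le>m. \<forall>j\<le>m. i \<le> j \<longrightarrow> d' (z i) (z j) = j - i"
    by (elim exE conjE)
  have d': "tree_metric (V \<union> z ` {1..m}) d'" "\<And>x y. x \<in> V \<Longrightarrow> y \<in> V \<Longrightarrow> d' x y = d x y"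
    "\<And>x j. x \<in> V \<Longrightarrow> j \<le> m \<Longrightarrow> d' x (z j) = d x (z 0) + j"
    "\<And>i j. i \<le> m \<Longrightarrow> j \<le> m \<Longrightarrow> i \<le> j \<Longrightarrow> d' (z i) (z j) = j - i"
    using d1 d2 d3 d4 by simp_all
  let ?V = "V \<union> z ` {1..m}"
  interpret new: tree_metric ?V d' by (rule d'(1))
  interpret old: tree_metric V d by (rule tm)
  have z_cell: "z j \<in> cell {u, w}" if "j \<le> m" for j
    unfolding cell_pair[OF uw'(1)] z_def using that m by (intro imageI) (auto simp: divide_le_eq_1)
  have zz: "edge_dist T {u, w} (z i) (z j) = l * \<bar>real i - real j\<bar> / real m" for i j
    unfolding z_def edge_dist_between[OF uw'(1)] l_def[symmetric] diff_divide_distrib[symmetric] by simp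
  have pairs: "P x y" if oo: "\<And>x y. x \<in> V \<Longrightarrow> y \<in> V \<Longrightarrow> P x y"
    and oz: "\<And>x j. x \<in> V \<Longrightarrow> j \<in> {1..m} \<Longrightarrow> P x (z j)"
    and zs: "\<And>i j. i \<in> {1..m} \<Longrightarrow> j \<in> {1..m} \<Longrightarrow> i \<le> j \<Longrightarrow> P (z i) (z j)"
    and sym: "\<And>x y. x \<in> ?V \<Longrightarrow> y \<in> ?V \<Longrightarrow> P x y \<Longrightarrow> P y x" and xy: "x \<in> ?V" "y \<in> ?V" for P x y
  proof -
    have *: "P x (z j)" if xV: "x \<in> ?V" and j: "j \<in> {1..m}" for x j
    proof (cases "x \<in> V")
      case True then show ?thesis using oz j by blast
    next
      case False
      then obtain i where i: "i \<in> {1..m}" "x = z i" using xV by blast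
      show ?thesis
      proof (cases "i \<le> j")
        case True then show ?thesis using zs i j by blast
      next
        case False
        then have "P (z j) (z i)" using zs i j by simp
        then show ?thesis using sym[of "z j" "z i"] i j by blast
      qed
    qed
    show ?thesis
    proof (cases "y \<in> V")
      case True
      show ?thesis
      proof (cases "x \<in> V")
        case False
        then obtain i where i: "i \<in> {1..m}" "x = z i" using xy(1) by blast
        have "P y x" unfolding i(2) using True by (intro * i(1)) auto
        then show ?thesis using sym xy by blast
      qed (use True oo in blast)
    next
      case False
      then obtain j where "j \<in> {1..m}" "y = z j" using xy(2) by blast
      then show ?thesis using * xy(1) by blast
    qed
  qed
  have "built \<sigma> \<tau> (insert w U) ?V d'"
    unfolding built_def
  proof (intro conjI)
    show "insert w U \<subseteq> verts T" "insert w U \<noteq> {}" using U uw' by auto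
    show "\<forall>a\<in>insert w U. \<forall>a'\<in>insert w U. \<exists>p. p \<noteq> [] \<and> hd p = a \<and> last p = a' \<and> distinct p \<and> set p \<subseteq> insert w U
         \<and> successively (\<lambda>a b. {a, b} \<in> edges T) p"
    proof (intro ballI)
      fix a a' assume aa: "a \<in> insert w U" "a' \<in> insert w U"
      show "\<exists>p. p \<noteq> [] \<and> hd p = a \<and> last p = a' \<and> distinct p \<and> set p \<subseteq> insert w U
         \<and> successively (\<lambda>a b. {a, b} \<in> edges T) p"
      proof (cases "a = w")
        case aw: True
        show ?thesis
        proof (cases "a' = w")
          case True then show ?thesis using aw by (intro exI[of _ "[w]"]) auto
        next
          case False
          then have "a' \<in> U" using aa by simp
          from conn[OF u this] obtain p where p: "p \<noteq> []" "hd p = u" "last p = a'" "distinct p" "set p \<subseteq> U"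
            "successively (\<lambda>a b. {a, b} \<in> edges T) p" by blast
          then show ?thesis using aw w uw
            by (intro exI[of _ "w # p"]) (auto simp: successively_Cons insert_commute)
        qed
      next
        case False
        then have aU: "a \<in> U" using aa by simp
        show ?thesis
        proof (cases "a' = w")
          case True
          from conn[OF aU u] obtain p where p: "p \<noteq> []" "hd p = a" "last p = u" "distinct p" "set p \<subseteq> U"
            "successively (\<lambda>a b. {a, b} \<in> edges T) p" by blast
          then show ?thesis using True w uw
            by (intro exI[of _ "p @ [w]"]) (auto simp: successively_append_iff)
        next
          case False
          then have "a' \<in> U" using aa by simp
          from conn[OF aU this] show ?thesis by blast
        qed
      qed
    qed
    show "tree_metric ?V d'" by (rule d'(1))
    have zmV: "z m \<in> ?V" using m by auto
    show "ind ` insert w U \<subseteq> ?V" using indV zm zmV by auto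
    have "cell {u, w} \<subseteq> points T" using uw by (auto simp: points_def)
    then show "?V \<subseteq> points T" using VT z_cell by auto
    show "\<forall>p\<in>?V. \<forall>v. v \<notin> insert w U \<longrightarrow> p v = 0"
      using supp u by (auto simp: z_def edge_point_def ind_def)
    have "card ?V = card V + card (z ` {1..m})"
      using old.fin z_new by (intro card_Un_disjoint) auto
    then show "card ?V = Suc (\<Sum>e\<in>edges_in (insert w U). pieces \<sigma> e)"
      using cardV new_edge fin_edges card_image[OF z_inj] unfolding edges_in' by (simp add: m_def edges_in_def)
    show "\<forall>x\<in>?V. \<forall>y\<in>?V. \<exists>s. s \<le> \<sigma> * real (d' x y) \<and> path_of_length T x y s"
    proof (intro ballI)
      fix x y assume "x \<in> ?V" "y \<in> ?V"
      then show "\<exists>s. s \<le> \<sigma> * real (d' x y) \<and> path_of_length T x y s"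
      proof (rule pairs[rotated 4])
        fix x y assume "x \<in> V" "y \<in> V"
        then show "\<exists>s. s \<le> \<sigma> * real (d' x y) \<and> path_of_length T x y s" using up d'(2) by simp
      next
        fix x j assume x: "x \<in> V" and j: "j \<in> {1..m}"
        obtain s where s: "s \<le> \<sigma> * real (d x (z 0))" "path_of_length T x (z 0) s" using up[OF x z0V] by blast
        have p: "path_of_length T x (z j) (s + edge_dist T {u, w} (z 0) (z j))"
          using j by (intro path_step[OF s(2) uw] z_cell) auto
        have "l / real m * real j \<le> \<sigma> * real j" using lm by (intro mult_right_mono) auto
        then have "s + edge_dist T {u, w} (z 0) (z j) \<le> \<sigma> * real (d' x (z j))"
          using s(1) d'(3)[OF x, of j] j by (simp add: zz algebra_simps)
        then show "\<exists>s. s \<le> \<sigma> * real (d' x (z j)) \<and> path_of_length T x (z j) s" using p by blast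
      next
        fix i j assume ij: "i \<in> {1..m}" "j \<in> {1..m}" "i \<le> j"
        have p: "path_of_length T (z i) (z j) (edge_dist T {u, w} (z i) (z j))"
          using ij by (intro path_segment[OF uw] z_cell) auto
        have "l / real m * real (j - i) \<le> \<sigma> * real (j - i)" using lm by (intro mult_right_mono) auto
        then have "edge_dist T {u, w} (z i) (z j) \<le> \<sigma> * real (d' (z i) (z j))"
          using d'(4)[of i j] ij by (simp add: zz of_nat_diff abs_if)
        then show "\<exists>s. s \<le> \<sigma> * real (d' (z i) (z j)) \<and> path_of_length T (z i) (z j) s" using p by blast
      next
        fix x y assume "x \<in> ?V" "y \<in> ?V" "\<exists>s. s \<le> \<sigma> * real (d' x y) \<and> path_of_length T x y s"
        then show "\<exists>s. s \<le> \<sigma> * real (d' y x) \<and> path_of_length T y x s"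
          using new.d_sym path_sym by metis
      qed
    qed
    show "\<forall>x\<in>?V. \<forall>y\<in>?V. \<exists>\<phi>. (\<forall>a b. {a, b} \<in> edges_in (insert w U) \<longrightarrow> \<bar>\<phi> a - \<phi> b\<bar> \<le> len T {a, b})
         \<and> \<tau> * real (d' x y) \<le> \<bar>pot \<phi> x - pot \<phi> y\<bar>"
    proof (intro ballI)
      have lip: "\<bar>(\<phi>(w := c)) a - (\<phi>(w := c)) b\<bar> \<le> len T {a, b}"
        if old: "\<forall>a b. {a, b} \<in> edges_in U \<longrightarrow> \<bar>\<phi> a - \<phi> b\<bar> \<le> len T {a, b}" and c: "\<bar>c - \<phi> u\<bar> \<le> l"
          and ab: "{a, b} \<in> edges_in (insert w U)" for \<phi> :: "'v \<Rightarrow> real" and c a b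
      proof -
        consider "{a, b} \<in> edges_in U" | "a = u" "b = w" | "a = w" "b = u" using ab unfolding edges_in' by (auto simp: doubleton_eq_iff)
        then show ?thesis
        proof cases
          case 1
          then have "a \<noteq> w" "b \<noteq> w" using w by (auto simp: edges_in_def)
          then show ?thesis using 1 old by simp
        next
          case 2 then show ?thesis using c uw'(1) by (simp add: l_def abs_minus_commute)
        next
          case 3 then show ?thesis using c uw'(1) by (simp add: l_def insert_commute)
        qed
      qed
      have pot_old: "pot (\<phi>(w := c)) x = pot \<phi> x" if "x \<in> V" for \<phi> c x
        unfolding pot_def using supp[OF that w] by (intro sum.cong) auto
      have pot_z: "pot \<phi> (z j) = \<phi> u + real j / real m * (\<phi> w - \<phi> u)" for \<phi> j
        unfolding z_def pot_edge_point[OF uw'(2,3)] by (simp add: algebra_simps diff_divide_distrib)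
      fix x y assume "x \<in> ?V" "y \<in> ?V"
      then show "\<exists>\<phi>. (\<forall>a b. {a, b} \<in> edges_in (insert w U) \<longrightarrow> \<bar>\<phi> a - \<phi> b\<bar> \<le> len T {a, b})
         \<and> \<tau> * real (d' x y) \<le> \<bar>pot \<phi> x - pot \<phi> y\<bar>"
      proof (rule pairs[rotated 4])
        fix x y assume xy: "x \<in> V" "y \<in> V"
        obtain \<phi> where \<phi>: "\<forall>u w. {u, w} \<in> edges_in U \<longrightarrow> \<bar>\<phi> u - \<phi> w\<bar> \<le> len T {u, w}"
          "\<tau> * real (d x y) \<le> \<bar>pot \<phi> x - pot \<phi> y\<bar>" using lo[OF xy] by blast
        show "\<exists>\<phi>. (\<forall>a b. {a, b} \<in> edges_in (insert w U) \<longrightarrow> \<bar>\<phi> a - \<phi> b\<bar> \<le> len T {a, b})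
         \<and> \<tau> * real (d' x y) \<le> \<bar>pot \<phi> x - pot \<phi> y\<bar>"
          using lip[OF \<phi>(1), of "\<phi> u"] uw'(4) \<phi>(2) xy d'(2)[OF xy] pot_old
          by (intro exI[of _ "\<phi>(w := \<phi> u)"]) simp
      next
        fix x j assume x: "x \<in> V" and j: "j \<in> {1..m}"
        obtain \<psi> where \<psi>: "\<forall>u w. {u, w} \<in> edges_in U \<longrightarrow> \<bar>\<psi> u - \<psi> w\<bar> \<le> len T {u, w}"
          "\<tau> * real (d x (z 0)) \<le> \<bar>pot \<psi> x - pot \<psi> (z 0)\<bar>" using lo[OF x z0V] by blast
        define \<phi> where "\<phi> = (if pot \<psi> x \<le> pot \<psi> (z 0) then \<psi> else (\<lambda>v. - \<psi> v))"
        have \<phi>: "\<forall>u w. {u, w} \<in> edges_in U \<longrightarrow> \<bar>\<phi> u - \<phi> w\<bar> \<le> len T {u, w}"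
          "\<tau> * real (d x (z 0)) \<le> pot \<phi> (z 0) - pot \<phi> x"
          using \<psi> by (auto simp: \<phi>_def pot_uminus abs_minus_commute)
        have "pot \<phi> (z 0) = \<phi> u" using pot_z[of \<phi> 0] by simp
        moreover have "pot (\<phi>(w := \<phi> u + l)) (z j) = \<phi> u + real j / real m * l"
          using uw'(1) by (simp add: pot_z)
        moreover have "\<tau> * real j \<le> real j / real m * l"
          using mult_left_mono[OF lm(2), of "real j"] by (simp add: field_simps)
        ultimately have "\<tau> * real (d' x (z j)) \<le> \<bar>pot (\<phi>(w := \<phi> u + l)) x - pot (\<phi>(w := \<phi> u + l)) (z j)\<bar>"
          using \<phi>(2) d'(3)[OF x, of j] j pot_old[OF x] by (simp add: algebra_simps)
        then show "\<exists>\<phi>. (\<forall>a b. {a, b} \<in> edges_in (insert w U) \<longrightarrow> \<bar>\<phi> a - \<phi> b\<bar> \<le> len T {a, b})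
         \<and> \<tau> * real (d' x (z j)) \<le> \<bar>pot \<phi> x - pot \<phi> (z j)\<bar>"
          using lip[OF \<phi>(1), of "\<phi> u + l"] uw'(4) by (intro exI[of _ "\<phi>(w := \<phi> u + l)"]) simp
      next
        fix i j assume ij: "i \<in> {1..m}" "j \<in> {1..m}" "i \<le> j"
        let ?\<phi> = "(\<lambda>_. 0::real)(w := l)"
        have "real j / real m * l - real i / real m * l = real (j - i) * (l / real m)"
          using ij by (simp add: of_nat_diff field_simps)
        moreover have "\<tau> * real (j - i) \<le> real (j - i) * (l / real m)"
          using mult_left_mono[OF lm(2), of "real (j - i)"] by (simp add: mult.commute)
        moreover have "pot ?\<phi> (z i) = real i / real m * l" "pot ?\<phi> (z j) = real j / real m * l"
          using uw'(1) by (simp_all add: pot_z)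
        moreover have "d' (z i) (z j) = j - i" using d'(4)[of i j] ij by simp
        ultimately have "\<tau> * real (d' (z i) (z j)) \<le> \<bar>pot ?\<phi> (z i) - pot ?\<phi> (z j)\<bar>"
          by (simp only:)
        moreover have "\<bar>?\<phi> a - ?\<phi> b\<bar> \<le> len T {a, b}" if "{a, b} \<in> edges_in (insert w U)" for a b
        proof (rule lip)
          show "\<forall>a b. {a, b} \<in> edges_in U \<longrightarrow> \<bar>0 - 0\<bar> \<le> len T {a, b}"
            using edge by (auto simp: edges_in_def intro: less_imp_le)
          show "\<bar>l - 0\<bar> \<le> l" using uw'(4) by simp
        qed (rule that)
        ultimately show "\<exists>\<phi>. (\<forall>a b. {a, b} \<in> edges_in (insert w U) \<longrightarrow> \<bar>\<phi> a - \<phi> b\<bar> \<le> len T {a, b})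
         \<and> \<tau> * real (d' (z i) (z j)) \<le> \<bar>pot \<phi> (z i) - pot \<phi> (z j)\<bar>" by blast
      next
        fix x y assume "x \<in> ?V" "y \<in> ?V" "\<exists>\<phi>. (\<forall>a b. {a, b} \<in> edges_in (insert w U) \<longrightarrow> \<bar>\<phi> a - \<phi> b\<bar> \<le> len T {a, b})
         \<and> \<tau> * real (d' x y) \<le> \<bar>pot \<phi> x - pot \<phi> y\<bar>"
        then show "\<exists>\<phi>. (\<forall>a b. {a, b} \<in> edges_in (insert w U) \<longrightarrow> \<bar>\<phi> a - \<phi> b\<bar> \<le> len T {a, b})
         \<and> \<tau> * real (d' y x) \<le> \<bar>pot \<phi> y - pot \<phi> x\<bar>"
          using new.d_sym by (metis abs_minus_commute)
      qed
    qed
    show "\<forall>v\<in>insert w U. \<exists>x\<in>?V. \<exists>s\<le>\<sigma>. path_of_length T (ind v) x s"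
    proof
      fix v assume "v \<in> insert w U"
      then consider "v = w" | "v \<in> U" by blast
      then show "\<exists>x\<in>?V. \<exists>s\<le>\<sigma>. path_of_length T (ind v) x s"
      proof cases
        case 1
        have "z m \<in> points T" using z_cell[of m] uw by (auto simp: points_def)
        then show ?thesis using 1 zm zmV \<sigma> path_refl by (metis less_imp_le)
      next
        case 2 then show ?thesis using nearv by blast
      qed
    qed
    show "\<forall>e\<in>edges_in (insert w U). \<forall>p\<in>cell e. \<exists>x\<in>?V. \<exists>s\<le>\<sigma>. path_of_length T p x s"
    proof (intro ballI)
      fix e p assume e: "e \<in> edges_in (insert w U)" and p: "p \<in> cell e"
      show "\<exists>x\<in>?V. \<exists>s\<le>\<sigma>. path_of_length T p x s"
      proof (cases "e \<in> edges_in U")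
        case True then show ?thesis using near p by blast
      next
        case False
        then have euw: "e = {u, w}" using e unfolding edges_in' by blast
        then obtain t where t: "p = edge_point u w t" "0 \<le> t" "t \<le> 1" using p cell_pair[OF uw'(1)] by auto
        define j where "j = nat \<lfloor>t * real m\<rfloor>"
        have tm0: "0 \<le> t * real m" "t * real m \<le> real m" using t m by (auto simp: mult_left_le_one_le)
        have j: "real j \<le> t * real m" "t * real m < real j + 1" using tm0 unfolding j_def by linarith+
        have jm: "j \<le> m" using j tm0 by linarith
        have "\<bar>t - real j / real m\<bar> = (t * real m - real j) / real m" using j m by (simp add: field_simps)
        then have "l * \<bar>t - real j / real m\<bar> = (t * real m - real j) * (l / real m)" by simp
        also have "\<dots> \<le> 1 * (l / real m)" using j uw'(4) by (intro mult_right_mono) auto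
        finally have "edge_dist T {u, w} p (z j) \<le> \<sigma>"
          unfolding t(1) z_def edge_dist_between[OF uw'(1)] l_def[symmetric] using lm by simp
        moreover have "path_of_length T p (z j) (edge_dist T {u, w} p (z j))"
          using p euw by (intro path_segment[OF uw] z_cell[OF jm]) auto
        moreover have "z j \<in> ?V" using z0V jm by (cases "j = 0") auto
        ultimately show ?thesis by blast
      qed
    qed
  qed
  then show ?thesis by blast
qed

lemma built_all:
  assumes \<sigma>: "0 < \<sigma>" and \<tau>: "0 \<le> \<tau>" "\<And>e. e \<in> edges T \<Longrightarrow> \<tau> * real (pieces \<sigma> e) \<le> len T e"
  shows "\<exists>V d. built \<sigma> \<tau> (verts T) V d"
proof -
  obtain a where a: "a \<in> verts T" using verts_ne by blast
  have ia: "ind a \<in> points T" using a by (auto simp: points_def cell_singleton)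
  have i0: "edges_in {a} = {}" using edge by (force simp: edges_in_def card_2_iff)
  have "built \<sigma> \<tau> {a} {ind a} (\<lambda>_ _. 0)"
    unfolding built_def i0 using a ia \<sigma> path_refl[OF ia]
    by (auto simp: tree_metric_singleton ind_def[of a] intro!: exI[of _ "[a]"] exI[of _ "0::real"])
  then have start: "\<exists>U V d. built \<sigma> \<tau> U V d" by blast
  have step: "\<exists>V d. built \<sigma> \<tau> (verts T) V d" if "built \<sigma> \<tau> U V d" for U V d
    using that
  proof (induction "card (verts T - U)" arbitrary: U V d rule: less_induct)
    case less
    have U: "U \<subseteq> verts T" "U \<noteq> {}" using less.prems unfolding built_def by blast+
    show ?case
    proof (cases "U = verts T")
      case True then show ?thesis using less.prems by blast
    next
      case False
      then obtain x y where xy: "x \<in> U" "y \<in> verts T" "y \<notin> U" using U by blast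
      have "\<exists>u w. u \<in> U \<and> w \<notin> U \<and> {u, w} \<in> edges T"
      proof (rule ccontr)
        assume no: "\<not> ?thesis"
        have "(\<lambda>a b. {a, b} \<in> edges T)\<^sup>*\<^sup>* x y" using connected xy U by blast
        then have "y \<in> U" by (induction rule: rtranclp_induct) (use xy no in blast)+
        then show False using xy by blast
      qed
      then obtain u w where uw: "u \<in> U" "w \<notin> U" "{u, w} \<in> edges T" by blast
      obtain V' d' where n: "built \<sigma> \<tau> (insert w U) V' d'"
        using built_extend[OF less.prems uw \<sigma> \<tau>(1) \<tau>(2)[OF uw(3)]] by blast
      have "w \<in> verts T" using edgeD[OF uw(3)] by blast
      then have "card (verts T - insert w U) < card (verts T - U)"
        using uw(2) fin_verts by (intro psubset_card_mono) auto
      then show ?thesis using less.hyps n by blast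
    qed
  qed
  show ?thesis using start step by blast
qed

end

section \<open>Distances in the tree and its discretization\<close>

lemma covered_sets:
  "covered d S bs \<Longrightarrow> \<exists>A. S \<subseteq> (\<Union>i<length bs. A i) \<and> (\<forall>i<length bs. \<forall>x\<in>A i. \<forall>y\<in>A i. real (d x y) \<le> bs ! i)"
proof (induction bs arbitrary: S)
  case (Cons b bs)
  then obtain A0 where A0: "\<forall>x\<in>A0. \<forall>y\<in>A0. real (d x y) \<le> b" "covered d (S - A0) bs" by auto
  obtain A where A: "S - A0 \<subseteq> (\<Union>i<length bs. A i)" "\<forall>i<length bs. \<forall>x\<in>A i. \<forall>y\<in>A i. real (d x y) \<le> bs ! i"
    using Cons.IH[OF A0(2)] by blast
  let ?A = "case_nat A0 A"
  have "S \<subseteq> (\<Union>i<Suc (length bs). ?A i)"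
  proof
    fix x assume x: "x \<in> S"
    show "x \<in> (\<Union>i<Suc (length bs). ?A i)"
    proof (cases "x \<in> A0")
      case True then show ?thesis by (intro UN_I[of 0]) auto
    next
      case False
      then obtain i where "i < length bs" "x \<in> A i" using A(1) x by blast
      then show ?thesis by (intro UN_I[of "Suc i"]) auto
    qed
  qed
  moreover have "\<forall>i<Suc (length bs). \<forall>x\<in>?A i. \<forall>y\<in>?A i. real (d x y) \<le> (b # bs) ! i"
    using A0(1) A(2) by (auto simp: nth_Cons split: nat.splits)
  ultimately show ?case by (intro exI[of _ ?A]) simp
qed simp

lemma card_nat_interval:
  fixes S :: "nat set"
  assumes S: "finite S" and l: "0 \<le> l" and close: "\<And>i j. i \<in> S \<Longrightarrow> j \<in> S \<Longrightarrow> real j - real i \<le> l"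
  shows "real (card S) \<le> l + 1"
proof (cases "S = {}")
  case False
  have "S \<subseteq> {Min S..Max S}" using S by auto
  then have "card S \<le> Suc (Max S) - Min S" using card_mono[of "{Min S..Max S}" S] by simp
  moreover have "Min S \<le> Max S" using S False by simp
  moreover have "real (Max S) - real (Min S) \<le> l" using S False by (intro close) auto
  ultimately show ?thesis by linarith
qed (use l in simp)

lemma sum_filter_count:
  assumes "\<And>ks. ks \<in> set Ks \<Longrightarrow> set ks \<subseteq> {1..n}"
  shows "(\<Sum>ks\<leftarrow>Ks. real (length (filter Q ks))) = (\<Sum>k\<in>{k \<in> {1..n}. Q k}. count_sum Ks k)"
  using assms
proof (induction Ks)
  case Nil then show ?case by (simp add: count_sum_def)
next
  case (Cons ks Ks)
  have "real (length (filter Q ks)) = (\<Sum>k\<leftarrow>ks. of_bool (Q k))" by (induction ks) auto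
  also have "\<dots> = (\<Sum>k\<in>{1..n}. real (count_list ks k) * of_bool (Q k))"
    using Cons.prems by (intro sum_list_count) auto
  also have "\<dots> = (\<Sum>k\<in>{k \<in> {1..n}. Q k}. real (count_list ks k))"
    by (rule sum.mono_neutral_cong_right) auto
  finally show ?case using Cons by (simp add: count_sum_def sum.distrib)
qed

context metric_tree begin

lemma edges_in_verts: "edges_in (verts T) = edges T"
  using edge by (auto simp: edges_in_def)

lemma len_pos: "e \<in> edges T \<Longrightarrow> 0 < len T e" using edge by blast

lemma points_cases:
  assumes "p \<in> points T"
  obtains u where "u \<in> verts T" "p = ind u" | e where "e \<in> edges T" "p \<in> cell e"
  using assms by (auto simp: points_def cell_singleton)

lemma points_ne: "points T \<noteq> {}"
  using verts_ne by (auto simp: points_def cell_singleton)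

lemma built_vertsD:
  assumes "built \<sigma> \<tau> (verts T) V d"
  shows "tree_metric V d" "V \<subseteq> points T" "card V = Suc (\<Sum>e\<in>edges T. pieces \<sigma> e)"
    "\<forall>x\<in>V. \<forall>y\<in>V. \<exists>s. s \<le> \<sigma> * real (d x y) \<and> path_of_length T x y s"
    "\<forall>x\<in>V. \<forall>y\<in>V. \<exists>\<phi>. (\<forall>u w. {u, w} \<in> edges T \<longrightarrow> \<bar>\<phi> u - \<phi> w\<bar> \<le> len T {u, w})
         \<and> \<tau> * real (d x y) \<le> \<bar>pot \<phi> x - pot \<phi> y\<bar>"
    "\<forall>u\<in>verts T. \<exists>x\<in>V. \<exists>s\<le>\<sigma>. path_of_length T (ind u) x s"
    "\<forall>e\<in>edges T. \<forall>p\<in>cell e. \<exists>x\<in>V. \<exists>s\<le>\<sigma>. path_of_length T p x s"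
proof -
  note * = assms[unfolded built_def edges_in_verts]
  show "tree_metric V d" using * by (elim conjE)
  show "V \<subseteq> points T" using * by (elim conjE)
  show "card V = Suc (\<Sum>e\<in>edges T. pieces \<sigma> e)" using * by (elim conjE)
  show "\<forall>x\<in>V. \<forall>y\<in>V. \<exists>s. s \<le> \<sigma> * real (d x y) \<and> path_of_length T x y s" using * by (elim conjE)
  show "\<forall>x\<in>V. \<forall>y\<in>V. \<exists>\<phi>. (\<forall>u w. {u, w} \<in> edges T \<longrightarrow> \<bar>\<phi> u - \<phi> w\<bar> \<le> len T {u, w})
         \<and> \<tau> * real (d x y) \<le> \<bar>pot \<phi> x - pot \<phi> y\<bar>" using * by (elim conjE)
  show "\<forall>u\<in>verts T. \<exists>x\<in>V. \<exists>s\<le>\<sigma>. path_of_length T (ind u) x s" using * by (elim conjE)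
  show "\<forall>e\<in>edges T. \<forall>p\<in>cell e. \<exists>x\<in>V. \<exists>s\<le>\<sigma>. path_of_length T p x s" using * by (elim conjE)
qed

lemma built_near:
  assumes "built \<sigma> \<tau> (verts T) V d" "p \<in> points T"
  obtains x s where "x \<in> V" "s \<le> \<sigma>" "path_of_length T p x s"
  using assms(2)
proof (cases rule: points_cases)
  case (1 u)
  then obtain x s where "x \<in> V" "s \<le> \<sigma>" "path_of_length T p x s"
    using bspec[OF built_vertsD(6)[OF assms(1)] 1(1)] by blast
  then show thesis by (rule that)
next
  case (2 e)
  then obtain x s where "x \<in> V" "s \<le> \<sigma>" "path_of_length T p x s"
    using bspec[OF bspec[OF built_vertsD(7)[OF assms(1)] 2(1)] 2(2)] by blast
  then show thesis by (rule that)
qed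

lemma path_exists:
  assumes "p \<in> points T" "q \<in> points T" shows "\<exists>s. path_of_length T p q s"
proof -
  obtain V d where b: "built 1 0 (verts T) V d" using built_all[of 1 0] len_pos by (auto intro: less_imp_le)
  obtain x s where x: "x \<in> V" "path_of_length T p x s" using built_near[OF b assms(1)] by blast
  obtain y t where y: "y \<in> V" "path_of_length T q y t" using built_near[OF b assms(2)] by blast
  obtain u where u: "path_of_length T x y u"
    using bspec[OF bspec[OF built_vertsD(4)[OF b] x(1)] y(1)] by blast
  show ?thesis using path_trans[OF path_sym[OF y(2)] path_trans[OF u x(2)]] by blast
qed

lemma bdd_paths: "bdd_below {s. path_of_length T x y s}"
  using path_nonneg[OF len_pos] by (intro bdd_belowI[of _ 0]) auto

lemma tdist_le: "path_of_length T x y s \<Longrightarrow> tdist T x y \<le> s"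
  unfolding tdist_def by (intro cInf_lower bdd_paths) auto

lemma tdist_nonneg:
  assumes "x \<in> points T" "y \<in> points T" shows "0 \<le> tdist T x y"
  unfolding tdist_def using path_exists[OF assms] path_nonneg[OF len_pos] by (intro cInf_greatest) auto

lemma tdist_approx:
  assumes "x \<in> points T" "y \<in> points T" "0 < e"
  shows "\<exists>s. path_of_length T x y s \<and> s < tdist T x y + e"
  using cInf_lessD[of "{s. path_of_length T x y s}" "tdist T x y + e"] path_exists[OF assms(1,2)] assms(3)
  by (auto simp: tdist_def)

lemma tdist_triangle:
  assumes "x \<in> points T" "y \<in> points T" "z \<in> points T"
  shows "tdist T x z \<le> tdist T x y + tdist T y z"
proof (rule field_le_epsilon)
  fix e :: real assume e: "0 < e"
  obtain s t where s: "path_of_length T x y s" "s < tdist T x y + e / 2"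
    and t: "path_of_length T y z t" "t < tdist T y z + e / 2"
    using tdist_approx[OF assms(1,2), of "e / 2"] tdist_approx[OF assms(2,3), of "e / 2"] e by auto
  have "tdist T x z \<le> s + t" by (rule tdist_le[OF path_trans[OF t(1) s(1)]])
  then show "tdist T x z \<le> tdist T x y + tdist T y z + e" using s t by simp
qed

lemma tdist_sym: "tdist T x y = tdist T y x"
proof -
  have "{s. path_of_length T x y s} = {s. path_of_length T y x s}" using path_sym by blast
  then show ?thesis by (simp add: tdist_def)
qed

lemma pot_le_tdist:
  assumes lip: "\<And>u w. {u, w} \<in> edges T \<Longrightarrow> \<bar>\<phi> u - \<phi> w\<bar> \<le> len T {u, w}"
    and "x \<in> points T" "y \<in> points T"
  shows "\<bar>pot \<phi> x - pot \<phi> y\<bar> \<le> tdist T x y"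
  unfolding tdist_def using path_exists[OF assms(2,3)] pot_path[OF lip] by (intro cInf_greatest) auto

text \<open>
  An approximation of the tree by a discrete tree, up to a factor \<open>1 + \<eta>\<close> and an additive error
  \<open>\<sigma>\<close>.
\<close>
definition discretized where
  "discretized \<eta> \<sigma> V d \<longleftrightarrow> tree_metric V d \<and> V \<subseteq> points T
    \<and> (\<forall>x\<in>V. \<forall>y\<in>V. tdist T x y \<le> \<sigma> * real (d x y) \<and> \<sigma> * real (d x y) \<le> (1 + \<eta>) * tdist T x y)
    \<and> (\<forall>p\<in>points T. \<exists>x\<in>V. tdist T p x \<le> \<sigma>)
    \<and> total_length T \<le> \<sigma> * (real (card V) - 1) \<and> \<sigma> * (real (card V) - 1) \<le> (1 + \<eta>) * total_length T"

text \<open>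
  An edge of length \<open>l\<close> has at most \<open>l / \<sigma> + 1\<close> pieces of length at most \<open>\<sigma>\<close>. As soon as \<open>\<sigma> \<le> \<eta> l\<close>
  this is at most \<open>(1 + \<eta>) l / \<sigma>\<close>.
\<close>
theorem discretize:
  assumes ne: "edges T \<noteq> {}" and \<eta>: "0 < \<eta>"
  shows "\<exists>\<sigma>0>0. \<forall>\<sigma>. 0 < \<sigma> \<and> \<sigma> < \<sigma>0 \<longrightarrow> (\<exists>V d. discretized \<eta> \<sigma> V d)"
proof -
  define l where "l = Min (len T ` edges T)"
  have l: "0 < l" "\<And>e. e \<in> edges T \<Longrightarrow> l \<le> len T e"
    using len_pos ne fin_edges by (auto simp: l_def)
  have "\<exists>V d. discretized \<eta> \<sigma> V d"
    if \<sigma>: "0 < \<sigma>" "\<sigma> < \<eta> * l" for \<sigma>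
  proof -
    define \<tau> where "\<tau> = \<sigma> / (1 + \<eta>)"
    have \<tau>0: "0 \<le> \<tau>" using \<sigma> \<eta> by (simp add: \<tau>_def)
    have pc: "\<sigma> * real (pieces \<sigma> e) \<le> (1 + \<eta>) * len T e" if e: "e \<in> edges T" for e
    proof -
      have "real (pieces \<sigma> e) \<le> len T e / \<sigma> + 1"
      proof -
        have "0 < len T e / \<sigma>" using len_pos[OF e] \<sigma> by simp
        then show ?thesis unfolding pieces_def by linarith
      qed
      then have "\<sigma> * real (pieces \<sigma> e) \<le> len T e + \<sigma>" using \<sigma> by (simp add: field_simps)
      also have "\<sigma> \<le> \<eta> * len T e" using \<sigma> mult_left_mono[OF l(2)[OF e], of \<eta>] \<eta> by linarith
      finally show ?thesis by (simp add: algebra_simps)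
    qed
    have "\<tau> * real (pieces \<sigma> e) \<le> len T e" if "e \<in> edges T" for e
      using pc[OF that] \<eta> by (simp add: \<tau>_def field_simps)
    then obtain V d where b: "built \<sigma> \<tau> (verts T) V d" using built_all[OF \<sigma>(1) \<tau>0] by blast
    note b' = built_vertsD[OF b]
    note tm = b'(1) and VT = b'(2) and c = b'(3)
    have up: "tdist T x y \<le> \<sigma> * real (d x y)" if xy: "x \<in> V" "y \<in> V" for x y
    proof -
      obtain s where "s \<le> \<sigma> * real (d x y)" "path_of_length T x y s"
        using bspec[OF bspec[OF b'(4) xy(1)] xy(2)] by blast
      then show ?thesis using tdist_le[of x y s] by linarith
    qed
    have lo: "\<sigma> * real (d x y) \<le> (1 + \<eta>) * tdist T x y" if xy: "x \<in> V" "y \<in> V" for x y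
    proof -
      obtain \<phi> where \<phi>: "\<forall>u w. {u, w} \<in> edges T \<longrightarrow> \<bar>\<phi> u - \<phi> w\<bar> \<le> len T {u, w}"
        "\<tau> * real (d x y) \<le> \<bar>pot \<phi> x - pot \<phi> y\<bar>" using bspec[OF bspec[OF b'(5) xy(1)] xy(2)] by blast
      have "\<bar>pot \<phi> x - pot \<phi> y\<bar> \<le> tdist T x y" using \<phi>(1) VT xy by (intro pot_le_tdist) auto
      then have "\<tau> * real (d x y) \<le> tdist T x y" using \<phi>(2) by simp
      then show ?thesis using \<eta> by (simp add: \<tau>_def field_simps)
    qed
    have near: "\<exists>x\<in>V. tdist T p x \<le> \<sigma>" if p: "p \<in> points T" for p
    proof -
      obtain x s where "x \<in> V" "s \<le> \<sigma>" "path_of_length T p x s" using built_near[OF b p] by blast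
      then show ?thesis using tdist_le[of p x s] by (intro bexI[of _ x]) auto
    qed
    have cV: "\<sigma> * (real (card V) - 1) = (\<Sum>e\<in>edges T. \<sigma> * real (pieces \<sigma> e))"
      by (simp add: c sum_distrib_left)
    have "total_length T \<le> \<sigma> * (real (card V) - 1)"
      unfolding cV total_length_def using pieces_ge[OF \<sigma>(1)] by (intro sum_mono)
    moreover have "\<sigma> * (real (card V) - 1) \<le> (1 + \<eta>) * total_length T"
      unfolding cV total_length_def sum_distrib_left using pc by (intro sum_mono)
    ultimately have "discretized \<eta> \<sigma> V d" unfolding discretized_def using tm VT up lo near by blast
    then show ?thesis by blast
  qed
  then show ?thesis using l \<eta> by (intro exI[of _ "\<eta> * l"]) auto
qed

lemma tdist_bounded: assumes ne: "edges T \<noteq> {}" shows "\<exists>B. \<forall>x\<in>points T. \<forall>y\<in>points T. tdist T x y \<le> B"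
proof -
  obtain \<sigma>0 where s0: "\<sigma>0 > 0" "\<forall>\<sigma>. 0 < \<sigma> \<and> \<sigma> < \<sigma>0 \<longrightarrow> (\<exists>V d. discretized 1 \<sigma> V d)"
    using discretize[OF ne, of 1] by auto
  define \<sigma> where "\<sigma> = \<sigma>0 / 2"
  have \<sigma>: "0 < \<sigma>" "\<sigma> < \<sigma>0" using s0 by (auto simp: \<sigma>_def)
  obtain V d where "discretized 1 \<sigma> V d" using s0(2) \<sigma> by blast
  then have V: "tree_metric V d" "V \<subseteq> points T" "\<forall>x\<in>V. \<forall>y\<in>V. tdist T x y \<le> \<sigma> * real (d x y)"
    "\<forall>p\<in>points T. \<exists>x\<in>V. tdist T p x \<le> \<sigma>" unfolding discretized_def by blast+
  interpret tree_metric V d by (rule V(1))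
  define m where "m = Max ((\<lambda>(x, y). d x y) ` (V \<times> V))"
  have m: "d x y \<le> m" if "x \<in> V" "y \<in> V" for x y
    unfolding m_def using that fin by (intro Max_ge) auto
  have "tdist T p q \<le> 2 * \<sigma> + \<sigma> * real m" if pq: "p \<in> points T" "q \<in> points T" for p q
  proof -
    obtain x y where xy: "x \<in> V" "tdist T p x \<le> \<sigma>" "y \<in> V" "tdist T q y \<le> \<sigma>" using V(4) pq by blast
    have "x \<in> points T" "y \<in> points T" using xy V(2) by auto
    then have "tdist T p q \<le> tdist T p x + (tdist T x y + tdist T y q)"
      using tdist_triangle[OF pq(1) \<open>x \<in> points T\<close> pq(2)] tdist_triangle[OF \<open>x \<in> points T\<close> \<open>y \<in> points T\<close> pq(2)] by linarith
    moreover have "tdist T x y \<le> \<sigma> * real m"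
    proof -
      have "tdist T x y \<le> \<sigma> * real (d x y)" using V(3) xy by blast
      also have "\<dots> \<le> \<sigma> * real m" using m[OF xy(1,3)] \<sigma> by (intro mult_left_mono) auto
      finally show ?thesis .
    qed
    ultimately show ?thesis using xy tdist_sym[of y q] by linarith
  qed
  then show ?thesis by blast
qed

lemma tdist_le_diameter:
  assumes ne: "edges T \<noteq> {}" and xy: "x \<in> points T" "y \<in> points T"
  shows "tdist T x y \<le> tdiameter T"
proof -
  obtain B where B: "\<forall>x\<in>points T. \<forall>y\<in>points T. tdist T x y \<le> B" using tdist_bounded[OF ne] by blast
  have "(case (x, y) of (x, y) \<Rightarrow> tdist T x y) \<le> tdiameter T"
    unfolding tdiameter_def using B xy by (intro cSUP_upper bdd_aboveI2[of _ _ B]) auto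
  then show ?thesis by simp
qed

lemma diameter_nonneg: assumes "edges T \<noteq> {}" shows "0 \<le> tdiameter T"
proof -
  obtain x where x: "x \<in> points T" using points_ne by blast
  show ?thesis using tdist_nonneg[OF x x] tdist_le_diameter[OF assms x x] by linarith
qed

text \<open>
  That the radius is at least half of the diameter is the triangle inequality. The converse holds
  in discrete trees up to \<open>1 / 2\<close> by \<open>diameter_center\<close>, and is transferred by discretizations with
  \<open>\<sigma>\<close> tending to 0.
\<close>
theorem radius_half_diameter:
  assumes edges_ne: "edges T \<noteq> {}"
  shows "metric_radius T = tdiameter T / 2"
proof (rule antisym)
  define D where "D = tdiameter T"
  have D0: "0 \<le> D" using diameter_nonneg[OF edges_ne] by (simp add: D_def)
  define ecc where "ecc v = (SUP x\<in>points T. tdist T v x)" for v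
  have bdd: "bdd_above (tdist T v ` points T)" if "v \<in> points T" for v
    using tdist_le_diameter[OF edges_ne that] by (intro bdd_aboveI2) auto
  have ecc_ge: "tdist T v x \<le> ecc v" if "v \<in> points T" "x \<in> points T" for v x
    unfolding ecc_def using that bdd by (intro cSUP_upper)
  have D_le: "D \<le> 2 * ecc v" if v: "v \<in> points T" for v
    unfolding D_def tdiameter_def
  proof (rule cSUP_least)
    fix p assume "p \<in> points T \<times> points T"
    then obtain x y where xy: "p = (x, y)" "x \<in> points T" "y \<in> points T" by blast
    have "tdist T x y \<le> tdist T v x + tdist T v y"
      using tdist_triangle[OF xy(2) v xy(3)] by (simp add: tdist_sym)
    then show "(case p of (x, y) \<Rightarrow> tdist T x y) \<le> 2 * ecc v"
      using ecc_ge[OF v xy(2)] ecc_ge[OF v xy(3)] xy(1) by simp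
  qed (use points_ne in auto)
  show "tdiameter T / 2 \<le> metric_radius T"
    unfolding metric_radius_def ecc_def[symmetric] D_def[symmetric]
    using points_ne D_le by (intro cINF_greatest) (auto simp: field_simps)
  show "metric_radius T \<le> tdiameter T / 2"
  proof (rule field_le_epsilon)
    fix e :: real assume e: "0 < e"
    define \<eta> where "\<eta> = e / (D + 1)"
    have \<eta>: "0 < \<eta>" "\<eta> * D \<le> e" using e D0 by (auto simp: \<eta>_def field_simps)
    obtain \<sigma>0 where s0: "\<sigma>0 > 0" "\<forall>\<sigma>. 0 < \<sigma> \<and> \<sigma> < \<sigma>0 \<longrightarrow> (\<exists>V d. discretized \<eta> \<sigma> V d)"
      using discretize[OF edges_ne \<eta>(1)] by blast
    define \<sigma> where "\<sigma> = min (\<sigma>0 / 2) (e / 3)"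
    have \<sigma>: "0 < \<sigma>" "\<sigma> < \<sigma>0" "3 * \<sigma> \<le> e" using s0 e by (auto simp: \<sigma>_def min_def)
    obtain V d where "discretized \<eta> \<sigma> V d" using s0(2) \<sigma> by blast
    then have V: "tree_metric V d" "V \<subseteq> points T"
      "\<forall>x\<in>V. \<forall>y\<in>V. tdist T x y \<le> \<sigma> * real (d x y) \<and> \<sigma> * real (d x y) \<le> (1 + \<eta>) * tdist T x y"
      "\<forall>p\<in>points T. \<exists>x\<in>V. tdist T p x \<le> \<sigma>" unfolding discretized_def by blast+
    interpret tree_metric V d by (rule V(1))
    have "real (d x y) \<le> (1 + \<eta>) * D / \<sigma>" if "x \<in> V" "y \<in> V" for x y
    proof -
      have "\<sigma> * real (d x y) \<le> (1 + \<eta>) * tdist T x y" using V(3) that by blast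
      also have "\<dots> \<le> (1 + \<eta>) * D"
        unfolding D_def using that V(2) \<eta> by (intro mult_left_mono tdist_le_diameter[OF edges_ne]) auto
      finally show ?thesis using \<sigma> by (simp add: field_simps)
    qed
    from diameter_center[OF order_refl ne this] obtain v where v: "v \<in> V"
      "\<And>z. z \<in> V \<Longrightarrow> real (d z v) \<le> ((1 + \<eta>) * D / \<sigma> + 1) / 2" by blast
    have vT: "v \<in> points T" using v V(2) by blast
    have "ecc v \<le> D / 2 + e" unfolding ecc_def
    proof (rule cSUP_least[OF points_ne])
      fix p assume p: "p \<in> points T"
      obtain x where x: "x \<in> V" "tdist T p x \<le> \<sigma>" using V(4) p by blast
      have xT: "x \<in> points T" using x V(2) by blast
      have "tdist T x v \<le> \<sigma> * real (d x v)" using V(3) x v by blast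
      also have "\<dots> \<le> \<sigma> * (((1 + \<eta>) * D / \<sigma> + 1) / 2)" using v(2)[OF x(1)] \<sigma> by (intro mult_left_mono) auto
      also have "\<dots> = (D + \<eta> * D + \<sigma>) / 2" using \<sigma> by (simp add: field_simps)
      finally have "tdist T p v \<le> \<sigma> + (D + \<eta> * D + \<sigma>) / 2"
        using tdist_triangle[OF p xT vT] x(2) by linarith
      moreover have "\<sigma> + (D + y + \<sigma>) / 2 \<le> D / 2 + e" if "y \<le> e" for y
        using that \<sigma>(3) unfolding add_divide_distrib by linarith
      ultimately show "tdist T v p \<le> D / 2 + e" using \<eta>(2) tdist_sym[of v p] order_trans by metis
    qed
    moreover have "metric_radius T \<le> ecc v" unfolding metric_radius_def ecc_def[symmetric]
    proof (rule cINF_lower[OF _ vT])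
      have "0 \<le> ecc v" if "v \<in> points T" for v using D_le[OF that] D0 by simp
      then show "bdd_below (ecc ` points T)" by (intro bdd_belowI2)
    qed
    ultimately show "metric_radius T \<le> tdiameter T / 2 + e" by (simp add: D_def)
  qed
qed

text \<open>
  Covers with the list of their radii, in place of an extensional function on \<open>{..<m}\<close>.
\<close>
definition covers_list :: "real list \<Rightarrow> bool" where
  "covers_list rs \<longleftrightarrow> (\<exists>v. (\<forall>i<length rs. v i \<in> points T) \<and> points T \<subseteq> (\<Union>i<length rs. tball T (v i) (rs ! i)))"

text \<open>
  A set of diameter \<open>b\<close> in the discrete tree lies in a ball of radius \<open>(b + 1) / 2\<close>, and the
  points of the metric tree are within \<open>\<sigma>\<close> of discrete ones.
\<close>
lemma covers_list_of_covered:
  assumes tm: "tree_metric V d" and VT: "V \<subseteq> points T"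
    and up: "\<forall>x\<in>V. \<forall>y\<in>V. tdist T x y \<le> \<sigma> * real (d x y)" and near: "\<forall>p\<in>points T. \<exists>x\<in>V. tdist T p x \<le> \<sigma>"
    and \<sigma>: "0 < \<sigma>" and cov: "covered d V bs"
  shows "covers_list (map (\<lambda>b. \<sigma> * (b / 2 + 2)) bs)"
proof -
  interpret tree_metric V d by (rule tm)
  obtain A where A: "V \<subseteq> (\<Union>i<length bs. A i)" "\<forall>i<length bs. \<forall>x\<in>A i. \<forall>y\<in>A i. real (d x y) \<le> bs ! i"
    using covered_sets[OF cov] by blast
  have "\<exists>v\<in>V. \<forall>z\<in>A i \<inter> V. real (d z v) \<le> (bs ! i + 1) / 2" if "i < length bs" for i
  proof (cases "A i \<inter> V = {}")
    case True then show ?thesis using ne by auto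
  next
    case False
    then show ?thesis using A(2) that by (intro diameter_center) auto
  qed
  then obtain v where v: "\<And>i. i < length bs \<Longrightarrow> v i \<in> V \<and> (\<forall>z\<in>A i \<inter> V. real (d z (v i)) \<le> (bs ! i + 1) / 2)" by metis
  have "points T \<subseteq> (\<Union>i<length bs. tball T (v i) (\<sigma> * (bs ! i / 2 + 2)))"
  proof
    fix p assume p: "p \<in> points T"
    obtain x where x: "x \<in> V" "tdist T p x \<le> \<sigma>" using near p by blast
    obtain i where i: "i < length bs" "x \<in> A i" using A(1) x(1) by blast
    have vi: "v i \<in> V" "v i \<in> points T" "x \<in> points T" using v[OF i(1)] VT x(1) by auto
    have "tdist T x (v i) \<le> \<sigma> * real (d x (v i))" using up x(1) vi(1) by blast
    also have "\<dots> \<le> \<sigma> * ((bs ! i + 1) / 2)" using v[OF i(1)] i(2) x(1) \<sigma> by (intro mult_left_mono) auto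
    finally have "tdist T p (v i) \<le> \<sigma> + \<sigma> * ((bs ! i + 1) / 2)"
      using tdist_triangle[OF p vi(3,2)] x(2) by linarith
    also have "\<dots> \<le> \<sigma> * (bs ! i / 2 + 2)" using \<sigma> by (simp add: algebra_simps)
    finally show "p \<in> (\<Union>i<length bs. tball T (v i) (\<sigma> * (bs ! i / 2 + 2)))"
      using i p by (auto simp: tball_def)
  qed
  then show ?thesis unfolding covers_list_def using v VT by (intro exI[of _ v]) auto
qed

end

section \<open>Approximately balanced covers of a metric tree\<close>

context metric_tree begin

lemma total_length_pos: "edges T \<noteq> {} \<Longrightarrow> 0 < total_length T"
  unfolding total_length_def using fin_edges len_pos by (intro sum_pos) auto

text \<open>
  For \<open>t\<close> tending to 0 the quotient tends to \<open>L / r\<^sup>2\<close>.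
\<close>
lemma limit_parameter:
  fixes L D r \<tau> :: real
  assumes "0 < r" "0 < \<tau>"
  shows "\<exists>t>0. t < \<tau> / 2 \<and> r \<le> 2 * r - t * D - 4 * t \<and> 4 * (1 + t)\<^sup>2 * L / (2 * r - t * D - 4 * t)\<^sup>2 \<le> L / r\<^sup>2 + \<tau> / 2"
proof -
  have lim: "((\<lambda>t. 4 * (1 + t)\<^sup>2 * L / (2 * r - t * D - 4 * t)\<^sup>2) \<longlongrightarrow> 4 * (1 + 0)\<^sup>2 * L / (2 * r - 0 * D - 4 * 0)\<^sup>2) (at_right 0)"
    using assms(1) by (intro tendsto_intros) auto
  have "4 * (1 + 0)\<^sup>2 * L / (2 * r - 0 * D - 4 * 0)\<^sup>2 < L / r\<^sup>2 + \<tau> / 2"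
    using assms by (simp add: power_mult_distrib)
  then have e1: "eventually (\<lambda>t. 4 * (1 + t)\<^sup>2 * L / (2 * r - t * D - 4 * t)\<^sup>2 < L / r\<^sup>2 + \<tau> / 2) (at_right 0)"
    using order_tendstoD(2)[OF lim] by blast
  have lim2: "((\<lambda>t. 2 * r - t * D - 4 * t) \<longlongrightarrow> 2 * r - 0 * D - 4 * 0) (at_right 0)" by (intro tendsto_intros)
  have e2: "eventually (\<lambda>t. r < 2 * r - t * D - 4 * t) (at_right 0)"
    using order_tendstoD(1)[OF lim2, of r] assms by simp
  have e3: "eventually (\<lambda>t::real. 0 < t \<and> t < \<tau> / 2) (at_right 0)"
    using assms(2) by (intro eventually_at_rightI[of 0 "\<tau> / 2"]) auto
  have "eventually (\<lambda>t. 0 < t \<and> t < \<tau> / 2 \<and> r < 2 * r - t * D - 4 * t \<and> 4 * (1 + t)\<^sup>2 * L / (2 * r - t * D - 4 * t)\<^sup>2 < L / r\<^sup>2 + \<tau> / 2) (at_right 0)"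
    using e1 e2 e3 by eventually_elim simp
  from eventually_happens[OF this] show ?thesis by (auto simp: less_imp_le)
qed

text \<open>
  \<open>balanced_covers\<close> for a fine discretization, translated to the metric tree. Sizes \<open>b\<close> become
  radii \<open>\<sigma> (b / 2 + 2)\<close>, so that densities are multiplied by \<open>2 / \<sigma>\<close>: \<open>2 L / R\<^sup>2\<close>, with the length
  \<open>L\<close> in pieces, becomes about \<open>L / r\<^sup>2\<close>, with the length of the metric tree, as \<open>R\<close> is about
  \<open>2 r / \<sigma>\<close> and the length in pieces is about \<open>1 / \<sigma>\<close> times that of the metric tree. The term
  \<open>\<tau> * real (length rs)\<close> accounts for the summand 2 in the radii, and the additive \<open>\<tau>\<close> in the
  counts for the ends of the interval \<open>(\<alpha>, \<beta>)\<close>.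
\<close>
theorem approximate_covers:
  assumes edges_ne: "edges T \<noteq> {}" and r: "0 < r" "r \<le> total_length T - tdiameter T / 2" and tau: "0 < \<tau>"
  shows "\<exists>Ls. Ls \<noteq> [] \<and> (\<forall>rs\<in>set Ls. rs \<noteq> [] \<and> set rs \<subseteq> {0..r} \<and> covers_list rs
      \<and> sum_list rs \<le> (1 + \<tau>) * total_length T + \<tau> * real (length rs))
    \<and> (\<forall>\<alpha> \<beta>. \<alpha> < \<beta> \<longrightarrow> (\<Sum>rs\<leftarrow>Ls. real (length (filter (\<lambda>x. \<alpha> < x \<and> x < \<beta>) rs)))
        \<le> ((total_length T / r\<^sup>2 + \<tau>) * (\<beta> - \<alpha>) + \<tau>) * real (length Ls))"
proof -
  define L where "L = total_length T"
  define D where "D = tdiameter T"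
  have L0: "0 < L" using total_length_pos[OF edges_ne] by (simp add: L_def)
  have D0: "0 \<le> D" using diameter_nonneg[OF edges_ne] by (simp add: D_def)
  obtain t where t: "0 < t" "t < \<tau> / 2" "r \<le> 2 * r - t * D - 4 * t"
    "4 * (1 + t)\<^sup>2 * L / (2 * r - t * D - 4 * t)\<^sup>2 \<le> L / r\<^sup>2 + \<tau> / 2"
    using limit_parameter[OF r(1) tau] by blast
  obtain \<sigma>0 where s0: "\<sigma>0 > 0" "\<forall>\<sigma>. 0 < \<sigma> \<and> \<sigma> < \<sigma>0 \<longrightarrow> (\<exists>V d. discretized t \<sigma> V d)"
    using discretize[OF edges_ne t(1)] by blast
  define \<sigma> where "\<sigma> = min (\<sigma>0 / 2) t"
  have \<sigma>: "0 < \<sigma>" "\<sigma> < \<sigma>0" "\<sigma> \<le> t" using s0 t by (auto simp: \<sigma>_def min_def)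
  obtain V d where dis: "discretized t \<sigma> V d" using s0(2) \<sigma> by blast
  note dis' = dis[unfolded discretized_def]
  have tm: "tree_metric V d" using dis' by (elim conjE)
  have VT: "V \<subseteq> points T" using dis' by (elim conjE)
  have dd: "\<forall>x\<in>V. \<forall>y\<in>V. tdist T x y \<le> \<sigma> * real (d x y) \<and> \<sigma> * real (d x y) \<le> (1 + t) * tdist T x y" using dis' by (elim conjE)
  have near: "\<forall>p\<in>points T. \<exists>x\<in>V. tdist T p x \<le> \<sigma>" using dis' by (elim conjE)
  have LV1: "L \<le> \<sigma> * (real (card V) - 1)" using dis' unfolding L_def by (elim conjE)
  have LV2: "\<sigma> * (real (card V) - 1) \<le> (1 + t) * L" using dis' unfolding L_def by (elim conjE)
  \<comment> \<open>\<open>4 \<sigma>\<close> leaves room for the summand \<open>2 \<sigma>\<close> in the radii, and \<open>t D\<close> for the error in the diameter;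
    \<open>q\<close> is a lower bound for \<open>p\<close> that does not depend on \<open>\<sigma>\<close>\<close>
  define p where "p = 2 * r - t * D - 4 * \<sigma>"
  define q where "q = 2 * r - t * D - 4 * t"
  define R where "R = p / \<sigma>"
  have qp: "r \<le> q" "q \<le> p" "0 < q" using t(3) \<sigma>(3) r(1) by (auto simp: p_def q_def)
  have R0: "0 < R" using qp \<sigma> by (simp add: R_def)
  have sR: "\<sigma> * R = p" using \<sigma> by (simp add: R_def)
  have diam: "real (d x y) \<le> (1 + t) * D / \<sigma>" if "x \<in> V" "y \<in> V" for x y
  proof -
    have "\<sigma> * real (d x y) \<le> (1 + t) * tdist T x y" using dd that by blast
    also have "\<dots> \<le> (1 + t) * D"
      unfolding D_def using that VT t by (intro mult_left_mono tdist_le_diameter[OF edges_ne]) auto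
    finally show ?thesis using \<sigma> by (simp add: field_simps)
  qed
  have R_le: "R \<le> 2 * (real (card V) - 1) - (1 + t) * D / \<sigma>"
  proof -
    have "\<sigma> * (2 * (real (card V) - 1) - (1 + t) * D / \<sigma>) = 2 * (\<sigma> * (real (card V) - 1)) - (1 + t) * D"
    proof -
      have "\<sigma> * ((1 + t) * D / \<sigma>) = (1 + t) * D" using \<sigma> by simp
      then show ?thesis by (simp only: right_diff_distrib mult.left_commute[of \<sigma> 2])
    qed
    moreover have "p \<le> 2 * L - (1 + t) * D"
      using r(2) \<sigma>(1) by (simp add: p_def L_def D_def algebra_simps)
    ultimately have "\<sigma> * R \<le> \<sigma> * (2 * (real (card V) - 1) - (1 + t) * D / \<sigma>)"
      using LV1 sR by linarith
    then show ?thesis using \<sigma>(1) by (simp only: mult_le_cancel_left_pos)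
  qed
  define a where "a = 2 * (1 + t)\<^sup>2 * L / p"
  have a0: "0 \<le> a" using t L0 qp by (simp add: a_def)
  obtain n0 :: nat where n0: "(2 / r + a + 1) * 2 / \<tau> < real n0" using reals_Archimedean2 by blast
  define n where "n = max 1 n0"
  have n: "1 \<le> n" "(2 / r + a + 1) * 2 / \<tau> < real n" using n0 by (auto simp: n_def)
  \<comment> \<open>small even after summation over the \<open>n\<close> cells\<close>
  define e where "e = 1 / (real n)\<^sup>2"
  have e0: "0 < e" using n by (simp add: e_def)
  have nt: "(2 / r + a + 1) * 2 < \<tau> * real n" using n(2) tau by (simp add: pos_divide_less_eq mult.commute)
  have n_small: "2 / (r * real n) \<le> \<tau> / 2" "a / real n + e \<le> \<tau>"
  proof -
    have "0 < 2 / r" using r(1) by simp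
    have *: "2 / r * 2 \<le> \<tau> * real n" using nt a0 by simp
    have **: "(a + 1) * 2 \<le> \<tau> * real n" using nt \<open>0 < 2 / r\<close> unfolding distrib_right by linarith
    have "2 / (r * real n) = (2 / r * 2) / (2 * real n)" using r n by (simp add: field_simps)
    also have "\<dots> \<le> (\<tau> * real n) / (2 * real n)" using * by (intro divide_right_mono) auto
    finally show "2 / (r * real n) \<le> \<tau> / 2" using n by simp
    have "e \<le> 1 / real n" using n by (simp add: e_def power2_eq_square field_simps)
    then have "a / real n + e \<le> (a + 1) / real n" by (simp add: add_divide_distrib)
    also have "\<dots> \<le> (\<tau> * real n) / real n" using ** a0 by (intro divide_right_mono) auto
    finally show "a / real n + e \<le> \<tau>" using n by simp
  qed
  define sz where "sz k = real k * R / real n" for k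
  have "\<exists>Ks. Ks \<noteq> [] \<and> (\<forall>ks\<in>set Ks. set ks \<subseteq> {1..n} \<and> covered d V (map (\<lambda>k. real k * R / real n) ks)
      \<and> sum_list (map (\<lambda>k. real k * R / real n) ks) \<le> 2 * (real (card V) - 1))
    \<and> (\<forall>k\<in>{1..n}. count_sum Ks k \<le> ((1 + t) * (2 * (real (card V) - 1) / (R * real n)) + e) * real (length Ks))"
    using t(1) by (intro balanced_covers[OF tm _ diam R0 R_le n(1) e0]) auto
  then obtain Ks where Ks: "Ks \<noteq> []" and Ks1: "\<And>ks. ks \<in> set Ks \<Longrightarrow> set ks \<subseteq> {1..n}"
    and Ks2: "\<And>ks. ks \<in> set Ks \<Longrightarrow> covered d V (map sz ks)"
    and Ks3: "\<And>ks. ks \<in> set Ks \<Longrightarrow> sum_list (map sz ks) \<le> 2 * (real (card V) - 1)"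
    and Ks4: "\<And>k. k \<in> {1..n} \<Longrightarrow> count_sum Ks k \<le> ((1 + t) * (2 * (real (card V) - 1) / (R * real n)) + e) * real (length Ks)"
    unfolding sz_def by blast
  define f where "f k = \<sigma> * (sz k / 2 + 2)" for k
  have f_eq: "f k = real k * (p / (2 * real n)) + 2 * \<sigma>" for k
    by (simp add: f_def sz_def sR[symmetric] algebra_simps)
  have per_cell: "count_sum Ks k \<le> (a / real n + e) * real (length Ks)" if "k \<in> {1..n}" for k
  proof -
    have "(1 + t) * (2 * (real (card V) - 1) / (R * real n)) = (1 + t) * (2 * (\<sigma> * (real (card V) - 1))) / (p * real n)"
    proof -
      have "(1 + t) * (2 * (\<sigma> * X)) / (\<sigma> * R * y) = \<sigma> * ((1 + t) * (2 * X)) / (\<sigma> * (R * y))" for X y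
        by (simp only: mult_ac)
      moreover have "\<sigma> * z / (\<sigma> * y) = z / y" for z y
        using \<sigma> by simp
      ultimately show ?thesis by (simp only: sR[symmetric] times_divide_eq_right)
    qed
    also have "\<dots> \<le> (1 + t) * (2 * ((1 + t) * L)) / (p * real n)"
      using LV2 t qp by (intro divide_right_mono mult_left_mono) auto
    also have "\<dots> = a / real n" by (simp add: a_def power2_eq_square field_simps)
    finally have "((1 + t) * (2 * (real (card V) - 1) / (R * real n)) + e) * real (length Ks) \<le> (a / real n + e) * real (length Ks)"
      by (intro mult_right_mono) auto
    then show ?thesis using Ks4[OF that] by linarith
  qed
  define Ls where "Ls = map (map f) Ks"
  have "rs \<noteq> [] \<and> set rs \<subseteq> {0..r} \<and> covers_list rs \<and> sum_list rs \<le> (1 + \<tau>) * L + \<tau> * real (length rs)"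
    if rs: "rs \<in> set Ls" for rs
  proof -
    obtain ks where ks: "ks \<in> set Ks" "rs = map f ks" using rs by (auto simp: Ls_def)
    have "covers_list (map (\<lambda>b. \<sigma> * (b / 2 + 2)) (map sz ks))"
      using dd by (intro covers_list_of_covered[OF tm VT _ near \<sigma>(1) Ks2[OF ks(1)]]) blast
    moreover have rs_eq: "rs = map (\<lambda>b. \<sigma> * (b / 2 + 2)) (map sz ks)" by (simp add: ks(2) f_def)
    ultimately have "covers_list rs" by simp
    moreover have "rs \<noteq> []"
      using Ks2[OF ks(1)] tree_metric.ne[OF tm] ks(2) by (cases ks) auto
    moreover have "set rs \<subseteq> {0..r}"
    proof
      fix x assume "x \<in> set rs"
      then obtain k where k: "k \<in> set ks" "x = f k" using ks(2) by auto
      have kn: "k \<le> n" using Ks1[OF ks(1)] k(1) by auto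
      have "real k * (p / (2 * real n)) \<le> real n * (p / (2 * real n))"
        using kn qp by (intro mult_right_mono) auto
      also have "\<dots> = p / 2" using n by simp
      finally have "f k \<le> p / 2 + 2 * \<sigma>" by (simp add: f_eq)
      moreover have "0 \<le> t * D" using D0 t(1) by simp
      then have "p / 2 + 2 * \<sigma> \<le> r" unfolding p_def diff_divide_distrib by linarith
      ultimately have "f k \<le> r" by linarith
      moreover have "0 \<le> f k" unfolding f_eq using qp \<sigma> by (intro add_nonneg_nonneg mult_nonneg_nonneg) auto
      ultimately show "x \<in> {0..r}" using k(2) by simp
    qed
    moreover have "sum_list rs \<le> (1 + \<tau>) * L + \<tau> * real (length rs)"
    proof -
      have "sum_list (map f xs) = \<sigma> / 2 * sum_list (map sz xs) + 2 * \<sigma> * real (length xs)" for xs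
        by (induction xs) (auto simp: f_def algebra_simps)
      then have "sum_list rs = \<sigma> / 2 * sum_list (map sz ks) + 2 * \<sigma> * real (length ks)" by (simp add: ks(2))
      also have "\<sigma> / 2 * sum_list (map sz ks) \<le> \<sigma> / 2 * (2 * (real (card V) - 1))"
        using Ks3[OF ks(1)] \<sigma> by (intro mult_left_mono) auto
      also have "\<dots> = \<sigma> * (real (card V) - 1)" by simp
      also have "\<dots> \<le> (1 + t) * L" by (rule LV2)
      also have "\<dots> \<le> (1 + \<tau>) * L" using t tau L0 by (intro mult_right_mono) auto
      finally have "sum_list rs \<le> (1 + \<tau>) * L + 2 * \<sigma> * real (length ks)" by simp
      moreover have "2 * \<sigma> * real (length ks) \<le> \<tau> * real (length ks)"
        using \<sigma> t by (intro mult_right_mono) auto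
      ultimately show ?thesis by (simp add: ks(2))
    qed
    ultimately show ?thesis by blast
  qed
  moreover have "(\<Sum>rs\<leftarrow>Ls. real (length (filter (\<lambda>x. \<alpha> < x \<and> x < \<beta>) rs))) \<le> ((L / r\<^sup>2 + \<tau>) * (\<beta> - \<alpha>) + \<tau>) * real (length Ls)"
    if ab: "\<alpha> < \<beta>" for \<alpha> \<beta>
  proof -
    define S where "S = {k \<in> {1..n}. \<alpha> < f k \<and> f k < \<beta>}"
    define wd where "wd = p / (2 * real n)"
    have wd: "0 < wd" using qp n by (simp add: wd_def)
    have "(\<Sum>rs\<leftarrow>Ls. real (length (filter (\<lambda>x. \<alpha> < x \<and> x < \<beta>) rs)))
        = (\<Sum>ks\<leftarrow>Ks. real (length (filter (\<lambda>k. \<alpha> < f k \<and> f k < \<beta>) ks)))"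
      by (simp add: Ls_def o_def filter_map)
    also have "\<dots> = (\<Sum>k\<in>S. count_sum Ks k)" unfolding S_def by (rule sum_filter_count) (rule Ks1)
    also have "\<dots> \<le> (\<Sum>k\<in>S. (a / real n + e) * real (length Ks))"
      using per_cell by (intro sum_mono) (auto simp: S_def)
    also have "\<dots> = real (card S) * ((a / real n + e) * real (length Ks))" by simp
    also have "\<dots> \<le> ((\<beta> - \<alpha>) / wd + 1) * ((a / real n + e) * real (length Ks))"
    proof (rule mult_right_mono)
      show "real (card S) \<le> (\<beta> - \<alpha>) / wd + 1"
      proof (rule card_nat_interval)
        fix i j assume "i \<in> S" "j \<in> S"
        then have "f j - f i < \<beta> - \<alpha>" by (auto simp: S_def)
        then have "(real j - real i) * wd < \<beta> - \<alpha>" by (simp add: f_eq wd_def algebra_simps diff_divide_distrib)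
        then show "real j - real i \<le> (\<beta> - \<alpha>) / wd" using wd by (simp add: pos_le_divide_eq)
      qed (use ab wd in \<open>auto simp: S_def\<close>)
    qed (use a0 e0 n in simp)
    also have "\<dots> = (((a / real n + e) / wd) * (\<beta> - \<alpha>) + (a / real n + e)) * real (length Ks)"
    proof -
      have "(u / wd + 1) * (v * y) = ((v / wd) * u + v) * y" for u v y by (simp add: algebra_simps)
      then show ?thesis .
    qed
    also have "\<dots> \<le> ((L / r\<^sup>2 + \<tau>) * (\<beta> - \<alpha>) + \<tau>) * real (length Ks)"
    proof (intro mult_right_mono add_mono)
      have "(a / real n + e) / wd = 2 * a / p + 2 / (p * real n)"
        using n qp by (simp add: wd_def e_def power2_eq_square field_simps)
      also have "2 * a / p = 4 * (1 + t)\<^sup>2 * L / p\<^sup>2" by (simp add: a_def power2_eq_square)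
      also have "\<dots> \<le> 4 * (1 + t)\<^sup>2 * L / q\<^sup>2"
        using qp L0 by (intro divide_left_mono power_mono mult_pos_pos zero_less_power mult_nonneg_nonneg) auto
      also have "\<dots> \<le> L / r\<^sup>2 + \<tau> / 2" using t(4) by (simp add: q_def)
      also have "2 / (p * real n) \<le> 2 / (r * real n)" using qp r n by (intro divide_left_mono mult_right_mono mult_pos_pos) auto
      also have "\<dots> \<le> \<tau> / 2" by (rule n_small(1))
      finally show "(a / real n + e) / wd \<le> L / r\<^sup>2 + \<tau>" by simp
      show "a / real n + e \<le> \<tau>" by (rule n_small(2))
    qed (use ab in auto)
    finally show ?thesis by (simp add: Ls_def)
  qed
  moreover have "Ls \<noteq> []" using Ks by (simp add: Ls_def)
  ultimately show ?thesis unfolding L_def by (intro exI[of _ Ls]) blast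
qed

end

section \<open>Coding lists of radii by real numbers\<close>

text \<open>
  The point of the Cantor set with the bits \<open>b\<close>. Because of the gaps of the Cantor set, sequences
  with close values have a long common initial part.
\<close>
definition ternary :: "(nat \<Rightarrow> real) \<Rightarrow> real" where
  "ternary b = (\<Sum>k. 2 * b k / 3 ^ Suc k)"

lemma ternary_summable:
  assumes "\<And>k. b k \<in> {0, 1::real}" shows "summable (\<lambda>k. 2 * b k / 3 ^ Suc k)"
proof (rule summable_comparison_test)
  show "summable (\<lambda>k. 2 / 3 * (1 / 3 :: real) ^ k)" by (intro summable_mult summable_geometric) auto
  have "norm (2 * b k / 3 ^ Suc k) \<le> 2 / 3 * (1 / 3) ^ k" for k
    using assms[of k] by (auto simp: power_divide field_simps)
  then show "\<exists>N. \<forall>n\<ge>N. norm (2 * b n / 3 ^ Suc n) \<le> 2 / 3 * (1 / 3) ^ n" by blast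
qed

lemma ternary_tail: "(\<Sum>k. 2 / 3 ^ Suc (k + n) :: real) = 1 / 3 ^ n" "summable (\<lambda>k. 2 / 3 ^ Suc (k + n) :: real)"
proof -
  have *: "(\<lambda>k. 2 / 3 ^ Suc (k + n) :: real) = (\<lambda>k. (2 / 3 ^ Suc n) * (1 / 3) ^ k)"
    by (auto simp: power_add power_divide field_simps)
  show "summable (\<lambda>k. 2 / 3 ^ Suc (k + n) :: real)" unfolding * by (intro summable_mult summable_geometric) auto
  have "(\<Sum>k. (1 / 3 :: real) ^ k) = 1 / (1 - 1 / 3)" by (rule suminf_geometric) simp
  then have "(\<Sum>k. (1 / 3 :: real) ^ k) = 3 / 2" by (simp only:) simp
  then show "(\<Sum>k. 2 / 3 ^ Suc (k + n) :: real) = 1 / 3 ^ n"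
  proof -
    have "(\<Sum>k. (2 / 3 ^ Suc n) * (1 / 3 :: real) ^ k) = (2 / 3 ^ Suc n) * (\<Sum>k. (1 / 3 :: real) ^ k)"
      by (rule suminf_mult) (rule summable_geometric, simp)
    also have "\<dots> = (2 / 3 ^ Suc n) * (3 / 2)" by (simp only: \<open>(\<Sum>k. (1 / 3 :: real) ^ k) = 3 / 2\<close>)
    also have "\<dots> = 1 / 3 ^ n" by simp
    finally show ?thesis unfolding * .
  qed
qed

lemma ternary_bounds:
  assumes b: "\<And>k. b k \<in> {0, 1::real}" shows "0 \<le> ternary b" "ternary b \<le> 1"
proof -
  have n: "0 \<le> 2 * b k / 3 ^ Suc k" "2 * b k / 3 ^ Suc k \<le> 2 / 3 ^ Suc k" for k
    using b[of k] by (auto simp: field_simps)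
  show "0 \<le> ternary b" unfolding ternary_def by (intro suminf_nonneg ternary_summable b n)
  have "ternary b \<le> (\<Sum>k. 2 / 3 ^ Suc (k + 0))" unfolding ternary_def
    using n(2) ternary_tail(2)[of 0] by (intro suminf_le ternary_summable b) auto
  then show "ternary b \<le> 1" using ternary_tail(1)[of 0] by simp
qed

lemma ternary_close:
  assumes b: "\<And>k. b k \<in> {0, 1::real}" and b': "\<And>k. b' k \<in> {0, 1::real}"
    and close: "\<bar>ternary b - ternary b'\<bar> < 1 / 3 ^ n" and k: "k < n"
  shows "b k = b' k"
proof (rule ccontr)
  assume "b k \<noteq> b' k"
  define m where "m = (LEAST k. b k \<noteq> b' k)"
  have "b m \<noteq> b' m" unfolding m_def by (rule LeastI) (rule \<open>b k \<noteq> b' k\<close>)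
  moreover have "m \<le> k" unfolding m_def by (rule Least_le) (rule \<open>b k \<noteq> b' k\<close>)
  ultimately have m: "b m \<noteq> b' m" "m \<le> k" by auto
  have eq: "b j = b' j" if "j < m" for j using not_less_Least[OF that[unfolded m_def]] by simp
  define c where "c j = 2 * (b j - b' j) / 3 ^ Suc j" for j
  have sc: "summable c" and tc: "ternary b - ternary b' = suminf c"
  proof -
    have *: "c = (\<lambda>j. 2 * b j / 3 ^ Suc j - 2 * b' j / 3 ^ Suc j)"
      by (auto simp: c_def diff_divide_distrib right_diff_distrib)
    show "summable c" unfolding * by (intro summable_diff ternary_summable b b')
    show "ternary b - ternary b' = suminf c" unfolding * ternary_def
      by (intro suminf_diff ternary_summable b b')
  qed
  have "suminf c = (\<Sum>j. c (j + Suc m)) + (\<Sum>j<Suc m. c j)" by (rule suminf_split_initial_segment[OF sc])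
  moreover have "(\<Sum>j<Suc m. c j) = c m" using eq by (simp add: c_def)
  moreover have "\<bar>c m\<bar> = 2 / 3 ^ Suc m" using m(1) b[of m] b'[of m] by (auto simp: c_def)
  moreover have "\<bar>\<Sum>j. c (j + Suc m)\<bar> \<le> 1 / 3 ^ Suc m"
  proof -
    have cb: "\<bar>c j\<bar> \<le> 2 / 3 ^ Suc j" for j using b[of j] b'[of j] by (auto simp: c_def field_simps)
    have s: "summable (\<lambda>j. \<bar>c (j + Suc m)\<bar>)"
      by (rule summable_comparison_test'[OF ternary_tail(2)[of "Suc m"], of 0])
        (simp only: real_norm_def abs_idempotent cb)
    have "\<bar>\<Sum>j. c (j + Suc m)\<bar> \<le> (\<Sum>j. \<bar>c (j + Suc m)\<bar>)" by (rule summable_rabs[OF s])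
    also have "\<dots> \<le> (\<Sum>j. 2 / 3 ^ Suc (j + Suc m))"
      by (rule suminf_le[OF cb s ternary_tail(2)])
    finally show ?thesis by (simp only: ternary_tail(1))
  qed
  moreover have "y \<le> \<bar>u + v\<bar>" if "\<bar>v\<bar> = 2 * y" "\<bar>u\<bar> \<le> y" for u v y :: real
    using that by linarith
  from this[of "c m" "1 / 3 ^ Suc m"] have "1 / 3 ^ Suc m \<le> \<bar>(\<Sum>j. c (j + Suc m)) + c m\<bar>"
    if "\<bar>c m\<bar> = 2 / 3 ^ Suc m" "\<bar>\<Sum>j. c (j + Suc m)\<bar> \<le> 1 / 3 ^ Suc m" using that by simp
  ultimately have "1 / 3 ^ Suc m \<le> \<bar>ternary b - ternary b'\<bar>" unfolding tc by metis
  moreover have "1 / 3 ^ n \<le> (1 / 3 ^ Suc m :: real)" using m(2) k by (intro divide_left_mono power_increasing) auto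
  ultimately show False using close by linarith
qed

definition bit :: "real \<Rightarrow> nat \<Rightarrow> int" where "bit u j = \<lfloor>2 ^ Suc j * u\<rfloor> mod 2"

lemma bits_agree:
  assumes u: "0 \<le> u" "u < 1" and u': "0 \<le> u'" "u' < 1" and "\<And>j. j < J \<Longrightarrow> bit u j = bit u' j"
  shows "\<bar>u - u'\<bar> \<le> 1 / 2 ^ J"
proof -
  have "\<lfloor>2 ^ J * u\<rfloor> = \<lfloor>2 ^ J * u'\<rfloor>" using assms(5)
  proof (induction J)
    case 0
    have "\<lfloor>u\<rfloor> = 0" "\<lfloor>u'\<rfloor> = 0" using u u' by (auto simp: floor_eq_iff)
    then show ?case by simp
  next
    case (Suc J)
    have half: "\<lfloor>2 ^ Suc J * x\<rfloor> div 2 = \<lfloor>2 ^ J * x\<rfloor>" for x :: real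
      using floor_divide_real_eq_div[of 2 "2 ^ Suc J * x"] by simp
    have "\<lfloor>2 ^ Suc J * x\<rfloor> = 2 * \<lfloor>2 ^ J * x\<rfloor> + bit x J" for x :: real
      using half[of x] unfolding bit_def by presburger
    then show ?case using Suc.IH Suc.prems by simp
  qed
  then have "\<bar>2 ^ J * u - 2 ^ J * u'\<bar> \<le> 1" by linarith
  then have "2 ^ J * \<bar>u - u'\<bar> \<le> 1" by (simp add: abs_mult right_diff_distrib[symmetric])
  then show ?thesis by (simp add: field_simps)
qed

text \<open>
  The bits of the radii, arranged in a single sequence by the pairing function of the natural
  numbers. Radii are divided by \<open>2 r\<close> to get numbers below 1.
\<close>
definition digit :: "real \<Rightarrow> real list \<Rightarrow> nat \<Rightarrow> real" where
  "digit r rs k = (case prod_decode k of (i, j) \<Rightarrow>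
     if i < length rs then real_of_int (bit (rs ! i / (2 * r)) j) else 0)"

text \<open>
  A list of radii in \<open>[0, r]\<close> is encoded by one real number: its length, and the digits in the
  fractional part. The encoding has a continuous inverse (\<open>code_limit\<close>), which transfers limits
  from the real line to lists. The factor \<open>1 / 2\<close> keeps lists of different length apart.
\<close>
definition code :: "real \<Rightarrow> real list \<Rightarrow> real" where
  "code r rs = real (length rs) + ternary (digit r rs) / 2"

lemma digit_01: "digit r rs k \<in> {0, 1}"
  by (auto simp: digit_def bit_def split: prod.splits)

lemma code_bounds: "real (length rs) \<le> code r rs" "code r rs \<le> real (length rs) + 1 / 2"
  using ternary_bounds[of "digit r rs"] digit_01 by (simp_all add: code_def)

lemma code_close_length: "\<bar>code r rs - code r rs'\<bar> < 1 / 2 \<Longrightarrow> length rs = length rs'"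
  using code_bounds[where rs = rs and r = r] code_bounds[where rs = rs' and r = r] by linarith

lemma code_close:
  assumes r: "0 < r" and rs: "set rs \<subseteq> {0..r}" "set rs' \<subseteq> {0..r}" and len: "length rs = length rs'" "i < length rs"
    and close: "\<bar>code r rs - code r rs'\<bar> < 1 / 3 ^ n / 2" and J: "\<And>j. j < J \<Longrightarrow> prod_encode (i, j) < n"
  shows "\<bar>rs ! i - rs' ! i\<bar> \<le> 2 * r / 2 ^ J"
proof -
  have "\<bar>ternary (digit r rs) - ternary (digit r rs')\<bar> < 1 / 3 ^ n"
    using close len(1) by (simp add: code_def)
  then have dig: "digit r rs (prod_encode (i, j)) = digit r rs' (prod_encode (i, j))" if "j < J" for j
    using ternary_close[of "digit r rs" "digit r rs'" n, OF digit_01 digit_01 _ J[OF that]] by blast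
  have in01: "0 \<le> y / (2 * r)" "y / (2 * r) < 1" if "y \<in> {0..r}" for y using that r by auto
  have mem: "rs ! i \<in> {0..r}" "rs' ! i \<in> {0..r}" using rs len by (auto simp: subset_iff)
  have "\<bar>rs ! i / (2 * r) - rs' ! i / (2 * r)\<bar> \<le> 1 / 2 ^ J"
  proof (rule bits_agree)
    fix j assume "j < J"
    then show "bit (rs ! i / (2 * r)) j = bit (rs' ! i / (2 * r)) j"
      using dig[of j] len by (simp add: digit_def)
  qed (use in01 mem in auto)
  moreover have "\<bar>rs ! i / (2 * r) - rs' ! i / (2 * r)\<bar> = \<bar>rs ! i - rs' ! i\<bar> / (2 * r)"
    using r by (simp add: diff_divide_distrib[symmetric])
  ultimately show ?thesis using r by (simp add: field_simps)
qed

lemma code_precision: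
  fixes r e :: real
  assumes r: "0 < r" and e: "0 < e"
  shows "\<exists>\<delta>>0. \<forall>rs rs'. set rs \<subseteq> {0..r} \<longrightarrow> set rs' \<subseteq> {0..r} \<longrightarrow> length rs = length rs' \<longrightarrow> i < length rs
    \<longrightarrow> \<bar>code r rs - code r rs'\<bar> < \<delta> \<longrightarrow> \<bar>rs ! i - rs' ! i\<bar> < e"
proof -
  obtain J where J: "2 * r / e < 2 ^ J" using real_arch_pow[of 2 "2 * r / e"] by auto
  define n where "n = Suc (Max (insert 0 ((\<lambda>j. prod_encode (i, j)) ` {..<J})))"
  have n: "prod_encode (i, j) < n" if "j < J" for j
    unfolding n_def using that by (auto simp: less_Suc_eq_le intro!: Max_ge)
  have "2 * r / 2 ^ J < e" using J e by (simp add: field_simps)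
  then have "\<bar>rs ! i - rs' ! i\<bar> < e" if "set rs \<subseteq> {0..r}" "set rs' \<subseteq> {0..r}" "length rs = length rs'"
    "i < length rs" "\<bar>code r rs - code r rs'\<bar> < 1 / 3 ^ n / 2" for rs rs'
    using code_close[OF r that(1-5), of J] n by fastforce
  then show ?thesis by (intro exI[of _ "1 / 3 ^ n / 2"]) auto
qed

lemma code_inj:
  assumes r: "0 < r" shows "inj_on (code r) {rs. set rs \<subseteq> {0..r}}"
proof (rule inj_onI)
  fix rs rs' assume s: "rs \<in> {rs. set rs \<subseteq> {0..r}}" "rs' \<in> {rs. set rs \<subseteq> {0..r}}" and c: "code r rs = code r rs'"
  have len: "length rs = length rs'" using code_close_length[of r rs rs'] c by simp
  show "rs = rs'"
  proof (rule nth_equalityI[OF len])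
    fix i assume i: "i < length rs"
    have "\<bar>rs ! i - rs' ! i\<bar> < e" if "0 < e" for e
      using code_precision[OF r that, of i] s len i c by auto
    then have "\<bar>rs ! i - rs' ! i\<bar> \<le> 0" by (meson dense_ge less_imp_le not_le)
    then show "rs ! i = rs' ! i" by simp
  qed
qed

lemma code_limit:
  assumes r: "0 < r" and ls: "\<And>N. set (ls N) \<subseteq> {0..r}" and conv: "convergent (\<lambda>N. code r (ls N))"
  obtains m x where "eventually (\<lambda>N. length (ls N) = m) sequentially"
    "\<And>i. i < m \<Longrightarrow> (\<lambda>N. ls N ! i) \<longlonglongrightarrow> x i"
proof -
  have cauchy: "Cauchy (\<lambda>N. code r (ls N))" using conv by (rule convergent_Cauchy)
  obtain N0 where N0: "\<And>m n. m \<ge> N0 \<Longrightarrow> n \<ge> N0 \<Longrightarrow> \<bar>code r (ls m) - code r (ls n)\<bar> < 1 / 2"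
    using CauchyD[OF cauchy, of "1/2"] by (auto simp: real_norm_def)
  have len: "length (ls N) = length (ls N0)" if "N \<ge> N0" for N
    using N0[OF that order_refl] code_close_length by blast
  have "convergent (\<lambda>N. ls N ! i)" if i: "i < length (ls N0)" for i
  proof (rule Cauchy_convergent, rule metric_CauchyI)
    fix e :: real assume "0 < e"
    from code_precision[OF r this, of i] obtain \<delta> where \<delta>: "\<delta> > 0" "\<And>rs rs'. set rs \<subseteq> {0..r} \<Longrightarrow> set rs' \<subseteq> {0..r} \<Longrightarrow>
      length rs = length rs' \<Longrightarrow> i < length rs \<Longrightarrow> \<bar>code r rs - code r rs'\<bar> < \<delta> \<Longrightarrow> \<bar>rs ! i - rs' ! i\<bar> < e" by blast
    obtain N1 where N1: "\<And>m n. m \<ge> N1 \<Longrightarrow> n \<ge> N1 \<Longrightarrow> \<bar>code r (ls m) - code r (ls n)\<bar> < \<delta>"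
      using CauchyD[OF cauchy \<delta>(1)] by (auto simp: real_norm_def)
    show "\<exists>M. \<forall>m\<ge>M. \<forall>n\<ge>M. dist (ls m ! i) (ls n ! i) < e"
    proof (intro exI allI impI)
      fix m n assume mn: "max N0 N1 \<le> m" "max N0 N1 \<le> n"
      then have l: "length (ls m) = length (ls N0)" "length (ls n) = length (ls N0)" using len[of m] len[of n] by auto
      show "dist (ls m ! i) (ls n ! i) < e"
        unfolding dist_real_def using \<delta>(2)[OF ls[of m] ls[of n]] l i N1[of m n] mn by simp
    qed
  qed
  then have "(\<lambda>N. ls N ! i) \<longlonglongrightarrow> lim (\<lambda>N. ls N ! i)" if "i < length (ls N0)" for i
    using that convergent_LIMSEQ_iff by blast
  moreover have "eventually (\<lambda>N. length (ls N) = length (ls N0)) sequentially"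
    unfolding eventually_sequentially using len by blast
  ultimately show thesis using that[of "length (ls N0)" "\<lambda>i. lim (\<lambda>N. ls N ! i)"] by blast
qed

text \<open>
  A Borel set is covered by countably many closed intervals with disjoint interiors and almost the
  same total length.
\<close>
lemma emeasure_le_lborel:
  fixes N :: "real measure" and c r :: real
  assumes sets: "sets N = sets borel" and c: "0 \<le> c"
    and int: "\<And>a b. a < b \<Longrightarrow> emeasure N {a<..<b} \<le> ennreal (c * (b - a))"
    and B: "B \<in> sets borel" "B \<subseteq> {0..r}"
  shows "emeasure N B \<le> ennreal c * emeasure lborel B"
proof -
  have closed: "emeasure N {a..b} \<le> ennreal (c * (b - a))" if "a \<le> b" for a b
  proof (rule ennreal_le_epsilon)
    fix e :: real assume e: "0 < e"
    define d where "d = e / (2 * c + 1)"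
    have d: "0 < d" "2 * c * d \<le> e" using e c by (auto simp: d_def field_simps)
    have "emeasure N {a..b} \<le> emeasure N {a - d<..<b + d}" using d sets by (intro emeasure_mono) auto
    also have "\<dots> \<le> ennreal (c * (b + d - (a - d)))" using d that by (intro int) auto
    also have "\<dots> \<le> ennreal (c * (b - a) + e)" using d by (intro ennreal_leI) (simp add: algebra_simps)
    also have "\<dots> = ennreal (c * (b - a)) + ennreal e" using c that e by (intro ennreal_plus) auto
    finally show "emeasure N {a..b} \<le> ennreal (c * (b - a)) + ennreal e" .
  qed
  have Bl: "B \<in> lmeasurable"
    by (rule bounded_set_imp_lmeasurable[OF bounded_subset[OF bounded_closed_interval B(2)]]) (use B(1) in simp)
  have lebB: "emeasure lborel B = ennreal (measure lebesgue B)"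
    using emeasure_eq_measure2[OF Bl] B(1) by simp
  show ?thesis
  proof (cases "0 < r")
    case False
    then have "B \<subseteq> {0..0}" using B(2) by auto
    then have "emeasure N B \<le> emeasure N {0..0}" using sets by (intro emeasure_mono) auto
    then show ?thesis using closed[of 0 0] by simp
  next
    case r: True
    show ?thesis
    proof (rule ennreal_le_epsilon)
      fix e :: real assume e: "0 < e"
      define d where "d = e / (c + 1)"
      have d: "0 < d" "c * d \<le> e" using e c by (auto simp: d_def field_simps)
      have Bc: "B \<subseteq> cbox 0 r" using B(2) by simp
      show "emeasure N B \<le> ennreal c * emeasure lborel B + ennreal e"
      proof (rule measurable_outer_intervals_bounded[OF Bl Bc d(1)])
      fix \<D> :: "real set set"
      assume D: "countable \<D>" "\<And>K. K \<in> \<D> \<Longrightarrow> K \<subseteq> cbox 0 r \<and> K \<noteq> {} \<and> (\<exists>c d. K = cbox c d)"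
        "pairwise (\<lambda>A B. interior A \<inter> interior B = {}) \<D>"
        and "\<And>u v. cbox u v \<in> \<D> \<Longrightarrow> \<exists>n. \<forall>i\<in>Basis. v \<bullet> i - u \<bullet> i = (r \<bullet> i - 0 \<bullet> i) / 2 ^ n"
        and "\<And>K. K \<in> \<D> \<Longrightarrow> box 0 r \<noteq> {} \<Longrightarrow> interior K \<noteq> {}"
        and D4: "B \<subseteq> \<Union>\<D>" "\<Union>\<D> \<in> lmeasurable" "measure lebesgue (\<Union>\<D>) \<le> measure lebesgue B + d"
      have K: "emeasure N K \<le> ennreal c * emeasure lborel (interior K)" "K \<in> sets borel" if KD: "K \<in> \<D>" for K
      proof -
        obtain a b where K: "K = cbox a b" "K \<noteq> {}" using D(2)[OF KD] by blast
        then have ab: "K = {a..b}" "a \<le> b" by auto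
        have "interior K = {a<..<b}" by (simp add: ab interior_atLeastAtMost_real)
        then show "emeasure N K \<le> ennreal c * emeasure lborel (interior K)"
          using closed[OF ab(2)] ab c by (simp add: ennreal_mult[symmetric])
        show "K \<in> sets borel" by (simp add: ab)
      qed
      have "emeasure N B \<le> emeasure N (\<Union>\<D>)"
        using D(1) D4(1) K(2) sets by (intro emeasure_mono) (auto intro!: sets.countable_Union)
      also have "\<dots> \<le> (\<integral>\<^sup>+K. emeasure N K \<partial>count_space \<D>)"
      proof -
        have UD: "\<Union>\<D> \<in> sets N" using D(1) K(2) sets by (auto intro!: sets.countable_Union)
        have "emeasure N (\<Union>\<D>) = (\<integral>\<^sup>+x. indicator (\<Union>\<D>) x \<partial>N)" using UD by simp
        also have "\<dots> \<le> (\<integral>\<^sup>+x. \<integral>\<^sup>+K. indicator K x \<partial>count_space \<D> \<partial>N)"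
        proof (rule nn_integral_mono)
          fix x
          show "indicator (\<Union>\<D>) x \<le> (\<integral>\<^sup>+K. indicator K x \<partial>count_space \<D>)"
          proof (cases "x \<in> \<Union>\<D>")
            case True
            then obtain K where "K \<in> \<D>" "x \<in> K" by blast
            then show ?thesis using nn_integral_ge_point[of K \<D> "\<lambda>K. indicator K x"] True by simp
          qed simp
        qed
        also have "\<dots> = (\<integral>\<^sup>+K. \<integral>\<^sup>+x. indicator K x \<partial>N \<partial>count_space \<D>)"
        proof (rule nn_integral_count_space_nn_integral[OF D(1)])
          fix K assume "K \<in> \<D>"
          then have "K \<in> sets N" using K(2) sets by simp
          then show "indicator K \<in> borel_measurable N" by (rule borel_measurable_indicator)
        qed
        also have "\<dots> = (\<integral>\<^sup>+K. emeasure N K \<partial>count_space \<D>)"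
        proof (rule nn_integral_cong)
          fix K assume "K \<in> space (count_space \<D>)"
          then have "K \<in> sets N" using K(2) sets by simp
          then show "integral\<^sup>N N (indicator K) = emeasure N K" by (rule nn_integral_indicator)
        qed
        finally show ?thesis .
      qed
      also have "\<dots> \<le> (\<integral>\<^sup>+K. ennreal c * emeasure lborel (interior K) \<partial>count_space \<D>)"
        using K(1) by (intro nn_integral_mono) simp
      also have "\<dots> = ennreal c * (\<integral>\<^sup>+K. emeasure lborel (interior K) \<partial>count_space \<D>)"
        by (intro nn_integral_cmult) simp
      also have "(\<integral>\<^sup>+K. emeasure lborel (interior K) \<partial>count_space \<D>) = emeasure lborel (\<Union>K\<in>\<D>. interior K)"
        using D(1,3) by (intro emeasure_UN_countable[symmetric]) (auto simp: disjoint_family_on_def pairwise_def)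
      also have "\<dots> \<le> emeasure lebesgue (\<Union>\<D>)"
      proof -
        have "(\<Union>K\<in>\<D>. interior K) \<in> sets borel" by (intro borel_open open_UN) auto
        then have "emeasure lborel (\<Union>K\<in>\<D>. interior K) = emeasure lebesgue (\<Union>K\<in>\<D>. interior K)" by simp
        also have "\<dots> \<le> emeasure lebesgue (\<Union>\<D>)"
          using D4(2) interior_subset by (intro emeasure_mono) (auto intro: fmeasurableD)
        finally show ?thesis .
      qed
      also have "\<dots> = ennreal (measure lebesgue (\<Union>\<D>))" using D4(2) by (rule emeasure_eq_measure2)
      also have "ennreal c * \<dots> \<le> ennreal c * ennreal (measure lebesgue B + d)"
        using D4(3) by (intro mult_left_mono ennreal_leI) auto
      also have "\<dots> = ennreal c * emeasure lborel B + ennreal (c * d)"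
        using d c by (simp add: lebB ennreal_plus ennreal_mult distrib_left)
      also have "\<dots> \<le> ennreal c * emeasure lborel B + ennreal e" using d by (intro add_left_mono ennreal_leI) auto
      finally show "emeasure N B \<le> ennreal c * emeasure lborel B + ennreal e" by (simp add: mult_left_mono)
      qed
    qed
  qed
qed

section \<open>Weak limits of random lists\<close>

lemma borel_measurable_finite_support:
  fixes f :: "real \<Rightarrow> real"
  assumes "finite F"
  shows "(\<lambda>y. if y \<in> F then f y else 0) \<in> borel_measurable borel"
proof -
  have "(\<lambda>y. if y \<in> F then f y else 0) = (\<lambda>y. \<Sum>z\<in>F. f z * indicator {z} y)"
  proof
    fix y
    have "(\<Sum>z\<in>F. f z * indicator {z} y) = (\<Sum>z\<in>F. if z = y then f y else 0)"
      by (intro sum.cong) (auto simp: indicator_def)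
    then show "(if y \<in> F then f y else 0) = (\<Sum>z\<in>F. f z * indicator {z} y)" using assms by simp
  qed
  then show ?thesis by simp
qed

text \<open>
  The \<open>N\<close>-th list of covers, for the error \<open>\<tau> N\<close>, with the uniform distribution on its entries, is
  turned into a distribution \<open>\<mu> N\<close> of codes. The counts for the interval \<open>(-1, r + 1)\<close> bound the
  mean length and hence the mean code, so the distributions are tight. Skorohod's theorem gives
  codes that converge pointwise; decoding them gives lists of eventually constant length \<open>M\<close> whose
  entries converge to \<open>X i\<close>. The property \<open>P\<close> and the bound for the sum pass to the limit
  pointwise. If a limit \<open>X i\<close> lies in the open interval \<open>(\<alpha>, \<beta>)\<close>, then so do the approximating
  entries eventually; hence Fatou's lemma bounds the expected count.
\<close>
theorem limit_measure:
  fixes r c L :: real and P :: "real list \<Rightarrow> bool"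
  assumes r: "0 < r" and c: "0 \<le> c"
    and closed: "\<And>ls l. (\<And>N::nat. P (ls N)) \<Longrightarrow> (\<And>N. length (ls N) = length l)
      \<Longrightarrow> (\<And>i. i < length l \<Longrightarrow> (\<lambda>N. ls N ! i) \<longlonglongrightarrow> l ! i) \<Longrightarrow> P l"
    and approx: "\<And>\<tau>. 0 < \<tau> \<Longrightarrow> \<exists>Ls. Ls \<noteq> [] \<and> (\<forall>rs\<in>set Ls. rs \<noteq> [] \<and> set rs \<subseteq> {0..r} \<and> P rs
        \<and> sum_list rs \<le> (1 + \<tau>) * L + \<tau> * real (length rs))
      \<and> (\<forall>\<alpha> \<beta>. \<alpha> < \<beta> \<longrightarrow> (\<Sum>rs\<leftarrow>Ls. real (length (filter (\<lambda>x. \<alpha> < x \<and> x < \<beta>) rs)))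
          \<le> ((c + \<tau>) * (\<beta> - \<alpha>) + \<tau>) * real (length Ls))"
  shows "\<exists>(\<Omega> :: real measure) (M :: real \<Rightarrow> nat) (X :: nat \<Rightarrow> real \<Rightarrow> real). prob_space \<Omega>
    \<and> M \<in> measurable \<Omega> (count_space UNIV) \<and> (\<forall>i. X i \<in> borel_measurable \<Omega>)
    \<and> (\<forall>\<omega>\<in>space \<Omega>. 1 \<le> M \<omega> \<and> (\<forall>i<M \<omega>. X i \<omega> \<in> {0..r}) \<and> P (map (\<lambda>i. X i \<omega>) [0..<M \<omega>]) \<and> (\<Sum>i<M \<omega>. X i \<omega>) \<le> L)
    \<and> (\<forall>\<alpha> \<beta>. \<alpha> < \<beta> \<longrightarrow> (\<integral>\<^sup>+\<omega>. of_nat (card {i. i < M \<omega> \<and> \<alpha> < X i \<omega> \<and> X i \<omega> < \<beta>}) \<partial>\<Omega>) \<le> ennreal (c * (\<beta> - \<alpha>)))"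
proof -
  define \<tau> where "\<tau> N = 1 / (real N + 1)" for N :: nat
  have \<tau>: "0 < \<tau> N" "\<tau> N \<le> 1" for N by (auto simp: \<tau>_def)
  have \<tau>_lim: "\<tau> \<longlonglongrightarrow> 0" unfolding \<tau>_def using LIMSEQ_inverse_real_of_nat by (simp add: inverse_eq_divide add.commute)
  have "\<forall>N. \<exists>Ls. Ls \<noteq> [] \<and> (\<forall>rs\<in>set Ls. rs \<noteq> [] \<and> set rs \<subseteq> {0..r} \<and> P rs
        \<and> sum_list rs \<le> (1 + \<tau> N) * L + \<tau> N * real (length rs))
      \<and> (\<forall>\<alpha> \<beta>. \<alpha> < \<beta> \<longrightarrow> (\<Sum>rs\<leftarrow>Ls. real (length (filter (\<lambda>x. \<alpha> < x \<and> x < \<beta>) rs)))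
          \<le> ((c + \<tau> N) * (\<beta> - \<alpha>) + \<tau> N) * real (length Ls))" using approx \<tau>(1) by blast
  then obtain Ls where Ls: "\<forall>N. Ls N \<noteq> [] \<and> (\<forall>rs\<in>set (Ls N). rs \<noteq> [] \<and> set rs \<subseteq> {0..r} \<and> P rs
        \<and> sum_list rs \<le> (1 + \<tau> N) * L + \<tau> N * real (length rs))
      \<and> (\<forall>\<alpha> \<beta>. \<alpha> < \<beta> \<longrightarrow> (\<Sum>rs\<leftarrow>Ls N. real (length (filter (\<lambda>x. \<alpha> < x \<and> x < \<beta>) rs)))
          \<le> ((c + \<tau> N) * (\<beta> - \<alpha>) + \<tau> N) * real (length (Ls N)))" by (rule choice[THEN exE])
  have Ls_ne: "Ls N \<noteq> []" for N using Ls by blast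
  have Ls_rs: "rs \<noteq> []" "set rs \<subseteq> {0..r}" "P rs" "sum_list rs \<le> (1 + \<tau> N) * L + \<tau> N * real (length rs)"
    if "rs \<in> set (Ls N)" for N rs using Ls that by blast+
  have Ls_count: "(\<Sum>rs\<leftarrow>Ls N. real (length (filter (\<lambda>x. \<alpha> < x \<and> x < \<beta>) rs)))
          \<le> ((c + \<tau> N) * (\<beta> - \<alpha>) + \<tau> N) * real (length (Ls N))" if "\<alpha> < \<beta>" for N \<alpha> \<beta> using Ls that by blast
  define n where "n N = length (Ls N)" for N
  have n: "0 < n N" "{..<n N} \<noteq> {}" for N using Ls_ne[of N] by (auto simp: n_def)
  define e where "e N i = code r (Ls N ! i)" for N i
  define U where "U N = measure_pmf (pmf_of_set {..<n N})" for N
  define \<mu> where "\<mu> N = distr (U N) borel (e N)" for N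
  have rd: "real_distribution (\<mu> N)" for N
    unfolding \<mu>_def U_def by (rule prob_space.real_distribution_distr[OF prob_space_measure_pmf]) simp
  have list_sum: "sum_list (map f (Ls N)) = (\<Sum>i<n N. f (Ls N ! i))" for f :: "real list \<Rightarrow> real" and N
    by (simp add: n_def sum_list_sum_nth atLeast0LessThan)
  have mem: "Ls N ! i \<in> set (Ls N)" if "i < n N" for N i using that by (simp add: n_def)
  have \<mu>_int: "(\<integral>\<^sup>+y. f y \<partial>\<mu> N) = (\<Sum>i<n N. f (e N i)) / of_nat (n N)" if "f \<in> borel_measurable borel" for f N
    using that n(2) unfolding \<mu>_def U_def by (simp add: nn_integral_distr nn_integral_pmf_of_set)
  have mean: "(\<Sum>i<n N. real (length (Ls N ! i))) \<le> ((c + 1) * (r + 2) + 1) * real (n N)" for N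
  proof -
    have "(\<Sum>i<n N. real (length (Ls N ! i))) = (\<Sum>rs\<leftarrow>Ls N. real (length (filter (\<lambda>x. -1 < x \<and> x < r + 1) rs)))"
      unfolding list_sum
    proof (intro sum.cong refl)
      fix i assume "i \<in> {..<n N}"
      then have "set (Ls N ! i) \<subseteq> {0..r}" using Ls_rs(2)[OF mem] by simp
      then have "filter (\<lambda>x. -1 < x \<and> x < r + 1) (Ls N ! i) = Ls N ! i" by (intro filter_True) force
      then show "real (length (Ls N ! i)) = real (length (filter (\<lambda>x. -1 < x \<and> x < r + 1) (Ls N ! i)))" by simp
    qed
    also have "\<dots> \<le> ((c + \<tau> N) * (r + 1 - (-1)) + \<tau> N) * real (n N)"
      unfolding n_def using r by (intro Ls_count) simp
    also have "\<dots> \<le> ((c + 1) * (r + 2) + 1) * real (n N)"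
      using \<tau>[of N] c r by (intro mult_right_mono add_mono mult_mono) auto
    finally show ?thesis .
  qed
  have "tight \<mu>" unfolding tight_def
  proof (intro conjI allI impI)
    fix \<epsilon> :: real assume eps: "0 < \<epsilon>"
    define K where "K = (c + 1) * (r + 2) + 2"
    have K: "0 < K" using c r by (simp add: K_def add_nonneg_pos)
    define b where "b = 2 * K / \<epsilon>"
    have b: "0 < b" using K eps by (simp add: b_def)
    have "1 - \<epsilon> < measure (\<mu> N) {0<..b}" for N
    proof -
      define B where "B = {i \<in> {..<n N}. b < e N i}"
      have "e N i \<le> real (length (Ls N ! i)) + 1" for i using code_bounds(2)[where r = r and rs = "Ls N ! i"] by (simp add: e_def)
      then have "(\<Sum>i<n N. e N i) \<le> (\<Sum>i<n N. real (length (Ls N ! i)) + 1)" by (intro sum_mono)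
      also have "\<dots> = (\<Sum>i<n N. real (length (Ls N ! i))) + real (n N)" by (simp add: sum.distrib)
      also have "\<dots> \<le> K * real (n N)" using mean[of N] by (simp add: K_def algebra_simps)
      finally have se: "(\<Sum>i<n N. e N i) \<le> K * real (n N)" .
      have epos: "0 < e N i" if "i < n N" for i
        using code_bounds(1)[where r = r and rs = "Ls N ! i"] Ls_rs(1)[OF mem[OF that]] by (cases "Ls N ! i") (auto simp: e_def)
      have "real (card B) * b = (\<Sum>i\<in>B. b)" by simp
      also have "\<dots> \<le> (\<Sum>i\<in>B. e N i)" by (intro sum_mono) (auto simp: B_def)
      also have "\<dots> \<le> (\<Sum>i<n N. e N i)" using epos by (intro sum_mono2) (auto simp: B_def less_imp_le)
      finally have "real (card B) * b \<le> K * real (n N)" using se by simp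
      then have "real (card B) * (2 * K) \<le> \<epsilon> * (K * real (n N))" using eps by (simp add: b_def field_simps)
      then have "real (card B) * 2 \<le> \<epsilon> * real (n N)" using K by (simp add: mult.left_commute[of _ K] mult.assoc[symmetric] mult.commute[of _ K])
      then have cB: "real (card B) < \<epsilon> * real (n N)" using eps n(1)[of N] by (smt (verit) mult_pos_pos of_nat_0_less_iff of_nat_0_le_iff)
      have "{i \<in> {..<n N}. e N i \<in> {0<..b}} = {..<n N} - B" using epos by (auto simp: B_def)
      moreover have "card ({..<n N} - B) = n N - card B" by (subst card_Diff_subset) (auto simp: B_def)
      moreover have "card B \<le> n N" using card_mono[of "{..<n N}" B] by (auto simp: B_def)
      ultimately have "real (card {i \<in> {..<n N}. e N i \<in> {0<..b}}) = real (n N) - real (card B)" by (simp add: of_nat_diff)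
      moreover have "measure (\<mu> N) {0<..b} = real (card {i \<in> {..<n N}. e N i \<in> {0<..b}}) / real (n N)"
      proof -
        have "measure (\<mu> N) {0<..b} = measure (U N) (e N -` {0<..b})"
          unfolding \<mu>_def by (subst measure_distr) (auto simp: U_def)
        also have "\<dots> = real (card ({..<n N} \<inter> e N -` {0<..b})) / real (n N)"
          unfolding U_def using n(2) by (simp add: measure_pmf_of_set)
        also have "{..<n N} \<inter> e N -` {0<..b} = {i \<in> {..<n N}. e N i \<in> {0<..b}}" by auto
        finally show ?thesis .
      qed
      ultimately have me: "measure (\<mu> N) {0<..b} = (real (n N) - real (card B)) / real (n N)" by simp
      have "(1 - \<epsilon>) * real (n N) < real (n N) - real (card B)" using cB by (simp add: left_diff_distrib)
      then show ?thesis unfolding me using n(1)[of N] by (simp add: pos_less_divide_eq)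
    qed
    then show "\<exists>a b. a < b \<and> (\<forall>N. 1 - \<epsilon> < measure (\<mu> N) {a<..b})" using b by blast
  qed (rule rd)
  from tight_imp_convergent_subsubsequence[OF this strict_mono_id] obtain s Ml where
    s: "strict_mono (s :: nat \<Rightarrow> nat)" "real_distribution Ml" "weak_conv_m (\<mu> \<circ> id \<circ> s) Ml" by blast
  have wc: "weak_conv_m (\<lambda>N. \<mu> (s N)) Ml" using s(3) by (simp add: comp_def)
  obtain \<Omega> :: "real measure" and Y Yl where sk: "prob_space \<Omega>" "\<forall>N. Y N \<in> measurable \<Omega> borel"
    "\<forall>N. distr \<Omega> borel (Y N) = \<mu> (s N)" "\<forall>x\<in>space \<Omega>. (\<lambda>N. Y N x) \<longlonglongrightarrow> (Yl x :: real)"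
    using Skorohod[of "\<lambda>N. \<mu> (s N)" Ml, OF rd s(2) wc] by (elim exE conjE)
  interpret prob_space \<Omega> by fact
  have Ym[measurable]: "Y N \<in> borel_measurable \<Omega>" for N using sk(2) by blast
  define F where "F N = e (s N) ` {..<n (s N)}" for N
  have finF: "finite (F N)" for N by (simp add: F_def)
  have F_borel[measurable]: "F N \<in> sets borel" for N using finF by (intro borel_closed finite_imp_closed)
  have AE_F: "AE \<omega> in \<Omega>. Y N \<omega> \<in> F N" for N
  proof -
    have "AE i in U (s N). e (s N) i \<in> F N"
      unfolding U_def AE_measure_pmf_iff using n(2)[of "s N"] by (auto simp: F_def)
    then have "AE y in \<mu> (s N). y \<in> F N" unfolding \<mu>_def by (subst AE_distr_iff) (auto simp: U_def)
    then show ?thesis unfolding sk(3)[rule_format, symmetric] by (subst (asm) AE_distr_iff) auto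
  qed
  define G where "G = {\<omega> \<in> space \<Omega>. \<forall>N. Y N \<omega> \<in> F N}"
  have G_sets[measurable]: "G \<in> sets \<Omega>" unfolding G_def by measurable
  have AE_G: "AE \<omega> in \<Omega>. \<omega> \<in> G"
  proof -
    have "AE \<omega> in \<Omega>. \<forall>N. Y N \<omega> \<in> F N" using AE_F by (simp add: AE_all_countable)
    then show ?thesis by (rule AE_mp) (auto simp: G_def)
  qed
  have "G \<noteq> {}"
  proof
    assume "G = {}"
    then have "AE \<omega> in \<Omega>. False" using AE_G by simp
    then show False by simp
  qed
  then obtain \<omega>0 where \<omega>0: "\<omega>0 \<in> G" by blast
  \<comment> \<open>almost surely all codes \<open>Y N \<omega>\<close> are codes of lists; redirecting the null set of exceptions to one good point \<open>\<omega>0\<close>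
    makes this true everywhere\<close>
  define g where "g \<omega> = (if \<omega> \<in> G then \<omega> else \<omega>0)" for \<omega>
  have gG: "g \<omega> \<in> G" for \<omega> using \<omega>0 by (simp add: g_def)
  have g_meas[measurable]: "g \<in> measurable \<Omega> \<Omega>"
    unfolding g_def using \<omega>0 by (intro measurable_If_set) (auto simp: G_def)
  define Z where "Z N \<omega> = Y N (g \<omega>)" for N \<omega>
  have Zm[measurable]: "Z N \<in> borel_measurable \<Omega>" for N unfolding Z_def by measurable
  have ZF: "Z N \<omega> \<in> F N" for N \<omega> using gG[of \<omega>] by (auto simp: Z_def G_def)
  define dec where "dec y = (SOME rs. set rs \<subseteq> {0..r} \<and> code r rs = y)" for y
  have dec_code: "dec (code r rs) = rs" if "set rs \<subseteq> {0..r}" for rs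
  proof -
    have "set (dec (code r rs)) \<subseteq> {0..r} \<and> code r (dec (code r rs)) = code r rs"
      unfolding dec_def by (rule someI[of _ rs]) (use that in simp)
    then show ?thesis using inj_onD[OF code_inj[OF r]] that by blast
  qed
  define ls where "ls \<omega> N = dec (Z N \<omega>)" for \<omega> N
  have ls_in: "ls \<omega> N \<in> set (Ls (s N))" and ls_code: "code r (ls \<omega> N) = Z N \<omega>" for \<omega> N
  proof -
    obtain i where i: "i < n (s N)" "Z N \<omega> = e (s N) i" using ZF[of N \<omega>] by (auto simp: F_def)
    then have "ls \<omega> N = Ls (s N) ! i" using dec_code[OF Ls_rs(2)[OF mem[OF i(1)]]] by (simp add: ls_def e_def)
    then show "ls \<omega> N \<in> set (Ls (s N))" "code r (ls \<omega> N) = Z N \<omega>" using i mem by (auto simp: e_def)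
  qed
  have conv: "convergent (\<lambda>N. code r (ls \<omega> N))" for \<omega>
  proof -
    have "g \<omega> \<in> space \<Omega>" using gG by (auto simp: G_def)
    then have "(\<lambda>N. Y N (g \<omega>)) \<longlonglongrightarrow> Yl (g \<omega>)" using sk(4) by blast
    then show ?thesis unfolding ls_code Z_def convergent_def by blast
  qed
  define M where "M \<omega> = (THE m. eventually (\<lambda>N. length (ls \<omega> N) = m) sequentially)" for \<omega>
  \<comment> \<open>padding with 0 makes the \<open>i\<close>-th entry a random variable that converges for every \<open>i\<close>\<close>
  define x where "x N i \<omega> = (if i < length (ls \<omega> N) then ls \<omega> N ! i else 0)" for N i \<omega>
  define X where "X i \<omega> = lim (\<lambda>N. x N i \<omega>)" for i \<omega>
  have M_ev: "eventually (\<lambda>N. length (ls \<omega> N) = M \<omega>) sequentially"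
    and X_lim: "i < M \<omega> \<Longrightarrow> (\<lambda>N. ls \<omega> N ! i) \<longlonglongrightarrow> X i \<omega>" and x_lim: "(\<lambda>N. x N i \<omega>) \<longlonglongrightarrow> X i \<omega>" for \<omega> i
  proof -
    have sub: "set (ls \<omega> N) \<subseteq> {0..r}" for N by (rule Ls_rs(2)[OF ls_in])
    obtain m y where my: "eventually (\<lambda>N. length (ls \<omega> N) = m) sequentially"
      "\<And>i. i < m \<Longrightarrow> (\<lambda>N. ls \<omega> N ! i) \<longlonglongrightarrow> y i" by (rule code_limit[where ls = "ls \<omega>", OF r sub conv]) (rule that, assumption, assumption)
    have Mm: "M \<omega> = m" unfolding M_def
    proof (rule the_equality)
      show "eventually (\<lambda>N. length (ls \<omega> N) = m) sequentially" by (rule my(1))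
    next
      fix m' assume "eventually (\<lambda>N. length (ls \<omega> N) = m') sequentially"
      then have "eventually (\<lambda>N. m' = m) sequentially" using my(1) by eventually_elim simp
      then show "m' = m" by simp
    qed
    show "eventually (\<lambda>N. length (ls \<omega> N) = M \<omega>) sequentially" using my(1) Mm by simp
    have xi: "(\<lambda>N. x N i \<omega>) \<longlonglongrightarrow> (if i < m then y i else 0)"
    proof (cases "i < m")
      case True
      have "eventually (\<lambda>N. ls \<omega> N ! i = x N i \<omega>) sequentially"
        using my(1) by eventually_elim (use True in \<open>simp add: x_def\<close>)
      then show ?thesis using my(2)[OF True] True by (simp add: tendsto_cong)
    next
      case False
      have "eventually (\<lambda>N. x N i \<omega> = 0) sequentially"
        using my(1) by eventually_elim (use False in \<open>simp add: x_def\<close>)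
      then show ?thesis using False by (simp add: tendsto_eventually)
    qed
    then have Xi: "X i \<omega> = (if i < m then y i else 0)" unfolding X_def by (rule limI)
    show "(\<lambda>N. x N i \<omega>) \<longlonglongrightarrow> X i \<omega>" using xi Xi by simp
    show "(\<lambda>N. ls \<omega> N ! i) \<longlonglongrightarrow> X i \<omega>" if "i < M \<omega>" using my(2)[of i] that Xi Mm by simp
  qed
  have fin_meas: "(\<lambda>\<omega>. f (ls \<omega> N)) \<in> borel_measurable \<Omega>" for f :: "real list \<Rightarrow> real" and N
  proof -
    have "(\<lambda>\<omega>. (\<lambda>y. if y \<in> F N then f (dec y) else 0) (Z N \<omega>)) \<in> borel_measurable \<Omega>"
      by (rule measurable_compose[OF Zm borel_measurable_finite_support[OF finF]])
    then show ?thesis using ZF by (simp add: ls_def)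
  qed
  have Xm: "X i \<in> borel_measurable \<Omega>" for i
  proof (rule borel_measurable_LIMSEQ_real)
    show "(\<lambda>N. x N i \<omega>) \<longlonglongrightarrow> X i \<omega>" for \<omega> by (rule x_lim)
    show "x N i \<in> borel_measurable \<Omega>" for N
      unfolding x_def[abs_def] using fin_meas[of "\<lambda>l. if i < length l then l ! i else 0" N] by simp
  qed
  have Mrm: "(\<lambda>\<omega>. real (M \<omega>)) \<in> borel_measurable \<Omega>"
  proof (rule borel_measurable_LIMSEQ_real)
    show "(\<lambda>N. real (length (ls \<omega> N))) \<longlonglongrightarrow> real (M \<omega>)" for \<omega>
      using M_ev[of \<omega>] by (intro tendsto_eventually) (auto elim: eventually_mono)
    show "(\<lambda>\<omega>. real (length (ls \<omega> N))) \<in> borel_measurable \<Omega>" for N by (rule fin_meas)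
  qed
  have Mm: "M \<in> measurable \<Omega> (count_space UNIV)"
  proof -
    have "M -` {k} \<inter> space \<Omega> \<in> sets \<Omega>" for k
    proof -
      have "M -` {k} \<inter> space \<Omega> = (\<lambda>\<omega>. real (M \<omega>)) -` {real k} \<inter> space \<Omega>" by auto
      then show ?thesis using measurable_sets[OF Mrm, of "{real k}"] by simp
    qed
    then show ?thesis by (simp add: measurable_count_space_eq2_countable)
  qed
  have pointwise: "1 \<le> M \<omega> \<and> (\<forall>i<M \<omega>. X i \<omega> \<in> {0..r}) \<and> P (map (\<lambda>i. X i \<omega>) [0..<M \<omega>]) \<and> (\<Sum>i<M \<omega>. X i \<omega>) \<le> L" for \<omega>
  proof -
    obtain N0 where N0: "\<And>N. N \<ge> N0 \<Longrightarrow> length (ls \<omega> N) = M \<omega>" using M_ev[of \<omega>] unfolding eventually_sequentially by blast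
    define l where "l N = ls \<omega> (N + N0)" for N
    have len: "length (l N) = M \<omega>" for N using N0 by (simp add: l_def)
    have l_lim: "(\<lambda>N. l N ! i) \<longlonglongrightarrow> X i \<omega>" if "i < M \<omega>" for i
      unfolding l_def using X_lim[OF that] by (rule LIMSEQ_ignore_initial_segment)
    have l_in: "l N \<in> set (Ls (s (N + N0)))" for N unfolding l_def by (rule ls_in)
    have "l 0 \<noteq> []" by (rule Ls_rs(1)[OF l_in])
    then have 1: "1 \<le> M \<omega>" using len[of 0] by (cases "l 0") auto
    have 2: "X i \<omega> \<in> {0..r}" if i: "i < M \<omega>" for i
    proof -
      have m: "l N ! i \<in> {0..r}" for N
      proof -
        have "l N ! i \<in> set (l N)" using i len[of N] by (intro nth_mem) simp
        then show ?thesis using Ls_rs(2)[OF l_in[of N]] by (rule rev_subsetD)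
      qed
      show ?thesis using LIMSEQ_le_const[OF l_lim[OF i], of 0] LIMSEQ_le_const2[OF l_lim[OF i], of r] m by auto
    qed
    have 3: "P (map (\<lambda>i. X i \<omega>) [0..<M \<omega>])"
      by (rule closed[of l]) (use Ls_rs(3)[OF l_in] len l_lim in auto)
    have "(\<Sum>i<M \<omega>. l N ! i) \<le> (1 + \<tau> (s (N + N0))) * L + \<tau> (s (N + N0)) * real (M \<omega>)" for N
      using Ls_rs(4)[OF l_in[of N]] len[of N] by (simp add: sum_list_sum_nth atLeast0LessThan)
    moreover have "(\<lambda>N. \<Sum>i<M \<omega>. l N ! i) \<longlonglongrightarrow> (\<Sum>i<M \<omega>. X i \<omega>)" by (intro tendsto_sum) (use l_lim in auto)
    moreover have ts: "(\<lambda>N. \<tau> (s (N + N0))) \<longlonglongrightarrow> 0"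
      using LIMSEQ_ignore_initial_segment[OF LIMSEQ_subseq_LIMSEQ[OF \<tau>_lim s(1)], of N0] by (simp add: comp_def)
    have "(\<lambda>N. (1 + \<tau> (s (N + N0))) * L + \<tau> (s (N + N0)) * real (M \<omega>)) \<longlonglongrightarrow> (1 + 0) * L + 0 * real (M \<omega>)"
      by (intro tendsto_intros ts)
    ultimately have "(\<Sum>i<M \<omega>. X i \<omega>) \<le> (1 + 0) * L + 0 * real (M \<omega>)" by (intro LIMSEQ_le) auto
    then show ?thesis using 1 2 3 by simp
  qed
  have expect: "(\<integral>\<^sup>+\<omega>. of_nat (card {i. i < M \<omega> \<and> \<alpha> < X i \<omega> \<and> X i \<omega> < \<beta>}) \<partial>\<Omega>) \<le> ennreal (c * (\<beta> - \<alpha>))"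
    if ab: "\<alpha> < \<beta>" for \<alpha> \<beta>
  proof -
    define h where "h rs = real (length (filter (\<lambda>x. \<alpha> < x \<and> x < \<beta>) rs))" for rs
    have "of_nat (card {i. i < M \<omega> \<and> \<alpha> < X i \<omega> \<and> X i \<omega> < \<beta>}) \<le> liminf (\<lambda>N. ennreal (h (ls \<omega> N)))" for \<omega>
    proof (rule Liminf_bounded)
      let ?S = "{i. i < M \<omega> \<and> \<alpha> < X i \<omega> \<and> X i \<omega> < \<beta>}"
      have "eventually (\<lambda>N. \<alpha> < ls \<omega> N ! i \<and> ls \<omega> N ! i < \<beta>) sequentially" if "i \<in> ?S" for i
      proof -
        have l: "(\<lambda>N. ls \<omega> N ! i) \<longlonglongrightarrow> X i \<omega>" using X_lim that by blast
        show ?thesis using order_tendstoD(1)[OF l, of \<alpha>] order_tendstoD(2)[OF l, of \<beta>] that by (auto intro: eventually_conj)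
      qed
      then have "eventually (\<lambda>N. \<forall>i\<in>?S. \<alpha> < ls \<omega> N ! i \<and> ls \<omega> N ! i < \<beta>) sequentially"
        by (intro eventually_ball_finite) auto
      then show "eventually (\<lambda>N. of_nat (card ?S) \<le> ennreal (h (ls \<omega> N))) sequentially"
        using M_ev[of \<omega>]
      proof eventually_elim
        case (elim N)
        have "?S \<subseteq> {i. i < length (ls \<omega> N) \<and> \<alpha> < ls \<omega> N ! i \<and> ls \<omega> N ! i < \<beta>}" using elim by auto
        then have "card ?S \<le> length (filter (\<lambda>x. \<alpha> < x \<and> x < \<beta>) (ls \<omega> N))"
          unfolding length_filter_conv_card by (intro card_mono) auto
        then show ?case by (simp add: h_def ennreal_of_nat_eq_real_of_nat)
      qed
    qed
    then have "(\<integral>\<^sup>+\<omega>. of_nat (card {i. i < M \<omega> \<and> \<alpha> < X i \<omega> \<and> X i \<omega> < \<beta>}) \<partial>\<Omega>) \<le> (\<integral>\<^sup>+\<omega>. liminf (\<lambda>N. ennreal (h (ls \<omega> N))) \<partial>\<Omega>)"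
      by (intro nn_integral_mono)
    also have "\<dots> \<le> liminf (\<lambda>N. \<integral>\<^sup>+\<omega>. ennreal (h (ls \<omega> N)) \<partial>\<Omega>)"
      by (intro nn_integral_liminf) (use fin_meas in measurable)
    also have "\<dots> \<le> liminf (\<lambda>N. ennreal ((c + \<tau> (s N)) * (\<beta> - \<alpha>) + \<tau> (s N)))"
    proof (intro Liminf_mono always_eventually allI)
      fix N
      let ?f = "\<lambda>y. ennreal (if y \<in> F N then h (dec y) else 0)"
      have fm: "?f \<in> borel_measurable borel" using borel_measurable_finite_support[OF finF, of N "\<lambda>y. h (dec y)"] by measurable
      have "(\<integral>\<^sup>+\<omega>. ennreal (h (ls \<omega> N)) \<partial>\<Omega>) = (\<integral>\<^sup>+\<omega>. ?f (Y N \<omega>) \<partial>\<Omega>)"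
        using AE_G
      proof (intro nn_integral_cong_AE, eventually_elim)
        case (elim \<omega>)
        then show ?case using ZF[of N \<omega>] by (simp add: ls_def Z_def g_def)
      qed
      also have "\<dots> = (\<integral>\<^sup>+y. ?f y \<partial>\<mu> (s N))"
        unfolding sk(3)[rule_format, symmetric] by (rule nn_integral_distr[symmetric]) (use fm in auto)
      also have "\<dots> = (\<Sum>i<n (s N). ?f (e (s N) i)) / of_nat (n (s N))" by (rule \<mu>_int[OF fm])
      also have "(\<Sum>i<n (s N). ?f (e (s N) i)) = (\<Sum>i<n (s N). ennreal (h (Ls (s N) ! i)))"
      proof (intro sum.cong refl)
        fix i assume i: "i \<in> {..<n (s N)}"
        then have "e (s N) i \<in> F N" by (auto simp: F_def)
        then show "?f (e (s N) i) = ennreal (h (Ls (s N) ! i))"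
          using dec_code[OF Ls_rs(2)[OF mem]] i by (simp add: e_def)
      qed
      also have "\<dots> = ennreal (\<Sum>rs\<leftarrow>Ls (s N). h rs)" unfolding list_sum by (rule sum_ennreal) (simp add: h_def)
      also have "\<dots> / of_nat (n (s N)) \<le> ennreal (((c + \<tau> (s N)) * (\<beta> - \<alpha>) + \<tau> (s N)) * real (n (s N))) / of_nat (n (s N))"
        using Ls_count[OF ab, of "s N"] unfolding h_def n_def by (intro divide_right_mono_ennreal ennreal_leI)
      also have "\<dots> = ennreal ((c + \<tau> (s N)) * (\<beta> - \<alpha>) + \<tau> (s N))"
        using n(1)[of "s N"] c \<tau>(1)[of "s N"] ab
        by (simp add: ennreal_of_nat_eq_real_of_nat divide_ennreal add_nonneg_nonneg less_imp_le)
      finally show "(\<integral>\<^sup>+\<omega>. ennreal (h (ls \<omega> N)) \<partial>\<Omega>) \<le> ennreal ((c + \<tau> (s N)) * (\<beta> - \<alpha>) + \<tau> (s N))" .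
    qed
    also have "\<dots> = ennreal ((c + 0) * (\<beta> - \<alpha>) + 0)"
    proof (rule lim_imp_Liminf)
      have ts: "(\<lambda>N. \<tau> (s N)) \<longlonglongrightarrow> 0" using LIMSEQ_subseq_LIMSEQ[OF \<tau>_lim s(1)] by (simp add: comp_def)
      show "(\<lambda>N. ennreal ((c + \<tau> (s N)) * (\<beta> - \<alpha>) + \<tau> (s N))) \<longlonglongrightarrow> ennreal ((c + 0) * (\<beta> - \<alpha>) + 0)"
        by (intro tendsto_intros ts)
    qed simp
    finally show ?thesis by simp
  qed
  show ?thesis
    using prob_space_axioms Mm Xm pointwise expect
    by (intro exI[of _ \<Omega>] exI[of _ M] exI[of _ X]) blast
qed

section \<open>Random covers of a metric tree\<close>

context metric_tree begin

text \<open>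
  One of the finitely many closed cells contains infinitely many terms of the sequence, and cells
  are compact.
\<close>
lemma points_seq_compact:
  assumes p: "\<And>N::nat. p N \<in> points T"
  shows "\<exists>s w. strict_mono (s :: nat \<Rightarrow> nat) \<and> w \<in> points T \<and> (\<lambda>N. tdist T (p (s N)) w) \<longlonglongrightarrow> 0"
proof -
  define C where "C = (\<lambda>v. {v}) ` verts T \<union> edges T"
  have finC: "finite C" using fin_verts fin_edges by (simp add: C_def)
  have "\<forall>N. \<exists>c. c \<in> C \<and> p N \<in> cell c"
  proof
    fix N
    show "\<exists>c. c \<in> C \<and> p N \<in> cell c" using p[of N] unfolding points_def C_def by blast
  qed
  then obtain f where f': "\<forall>N. f N \<in> C \<and> p N \<in> cell (f N)" by (rule choice[THEN exE])
  have f: "f N \<in> C \<and> p N \<in> cell (f N)" for N using f' by blast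
  have "finite (range f)" using f finC by (meson finite_subset image_subset_iff)
  from pigeonhole_infinite[OF infinite_UNIV_nat this] obtain N0 where
    inf: "infinite {N \<in> UNIV. f N = f N0}" by blast
  define s where "s = enumerate {N \<in> UNIV. f N = f N0}"
  have s: "strict_mono s" unfolding s_def by (rule strict_mono_enumerate[OF inf])
  have fs: "f (s N) = f N0" for N using enumerate_in_set[OF inf, of N] by (simp add: s_def)
  have ps: "p (s N) \<in> cell (f N0)" for N using f[of "s N"] fs by simp
  consider v where "v \<in> verts T" "f N0 = {v}" | "f N0 \<in> edges T" using f[of N0] by (auto simp: C_def)
  then show ?thesis
  proof cases
    case (1 v)
    then have eq: "p (s N) = ind v" for N using ps by (simp add: cell_singleton)
    have v: "ind v \<in> points T" using 1 by (auto simp: points_def cell_singleton)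
    have "tdist T (ind v) (ind v) = 0" using tdist_le[OF path_refl[OF v]] tdist_nonneg[OF v v] by simp
    then show ?thesis using s v eq by (intro exI[of _ s] exI[of _ "ind v"]) simp
  next
    case 2
    obtain u w where e: "f N0 = {u, w}" "u \<noteq> w" using edgeE[OF 2] by blast
    then have uw: "{u, w} \<in> edges T" using 2 by simp
    have "\<forall>N. \<exists>t\<in>{0..1}. p (s N) = edge_point u w t" using ps cell_pair[OF e(2)] e(1) by auto
    then obtain t where t: "\<And>N. t N \<in> {0..1} \<and> p (s N) = edge_point u w (t N)" by metis
    obtain l s' where l: "l \<in> {0..1}" "strict_mono (s' :: nat \<Rightarrow> nat)" "(t \<circ> s') \<longlonglongrightarrow> l"
      using compact_Icc[of "0::real" 1] t unfolding compact_def by meson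
    have le: "tdist T (p (s (s' N))) (edge_point u w l) \<le> len T {u, w} * \<bar>t (s' N) - l\<bar>" for N
    proof -
      have "path_of_length T (p (s (s' N))) (edge_point u w l) (edge_dist T {u, w} (p (s (s' N))) (edge_point u w l))"
        using ps e l(1) by (intro path_segment[OF uw]) (auto simp: cell_pair)
      then show ?thesis using tdist_le t[of "s' N"] edge_dist_between[OF e(2)] by metis
    qed
    have lp: "edge_point u w l \<in> points T" using l(1) uw cell_pair[OF e(2)] by (auto simp: points_def)
    have "(\<lambda>N. len T {u, w} * \<bar>t (s' N) - l\<bar>) \<longlonglongrightarrow> len T {u, w} * \<bar>l - l\<bar>"
      using l(3) by (intro tendsto_intros) (simp add: comp_def)
    then have lim: "(\<lambda>N. len T {u, w} * \<bar>t (s' N) - l\<bar>) \<longlonglongrightarrow> 0" by simp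
    have "(\<lambda>N. tdist T (p (s (s' N))) (edge_point u w l)) \<longlonglongrightarrow> 0"
      by (rule tendsto_sandwich[OF _ _ tendsto_const lim]) (use le tdist_nonneg[OF p lp] in auto)
    then show ?thesis using strict_mono_o[OF s l(2)] lp by (intro exI[of _ "s \<circ> s'"] exI[of _ "edge_point u w l"]) simp
  qed
qed

lemma points_seq_compact_finite:
  fixes m :: nat and p :: "nat \<Rightarrow> nat \<Rightarrow> 'v \<Rightarrow> real"
  assumes "\<And>N i. i < m \<Longrightarrow> p N i \<in> points T"
  shows "\<exists>s w. strict_mono (s :: nat \<Rightarrow> nat) \<and> (\<forall>i<m. w i \<in> points T \<and> (\<lambda>N. tdist T (p (s N) i) (w i)) \<longlonglongrightarrow> 0)"
  using assms
proof (induction m)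
  case 0 then show ?case using strict_mono_id by blast
next
  case (Suc m)
  then obtain s w where s: "strict_mono (s :: nat \<Rightarrow> nat)"
    "\<And>i. i < m \<Longrightarrow> w i \<in> points T \<and> (\<lambda>N. tdist T (p (s N) i) (w i)) \<longlonglongrightarrow> 0" by (metis less_SucI)
  obtain s' y where y: "strict_mono (s' :: nat \<Rightarrow> nat)" "y \<in> points T" "(\<lambda>N. tdist T (p (s (s' N)) m) y) \<longlonglongrightarrow> 0"
    using points_seq_compact[of "\<lambda>N. p (s N) m"] Suc.prems by auto
  have "(\<lambda>N. tdist T (p (s (s' N)) i) (w i)) \<longlonglongrightarrow> 0" if "i < m" for i
    using LIMSEQ_subseq_LIMSEQ[OF _ y(1), of "\<lambda>N. tdist T (p (s N) i) (w i)"] s(2)[OF that] by (simp add: comp_def)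
  then show ?case using strict_mono_o[OF s(1) y(1)] s(2) y(2,3)
    by (intro exI[of _ "s \<circ> s'"] exI[of _ "w(m := y)"]) (auto simp: less_Suc_eq comp_def)
qed

text \<open>
  Let the centres of the covers converge, along a subsequence. If a point \<open>p\<close> were outside all
  limit balls, it would be outside all balls of a cover that is late in the subsequence.
\<close>
lemma covers_list_closed:
  assumes cov: "\<And>N::nat. covers_list (ls N)" and len: "\<And>N. length (ls N) = length l"
    and lim: "\<And>i. i < length l \<Longrightarrow> (\<lambda>N. ls N ! i) \<longlonglongrightarrow> l ! i"
  shows "covers_list l"
proof -
  have "\<forall>N. \<exists>v. (\<forall>i<length l. v i \<in> points T) \<and> points T \<subseteq> (\<Union>i<length l. tball T (v i) (ls N ! i))"
    using cov len by (simp add: covers_list_def)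
  then obtain v where v: "\<forall>N. (\<forall>i<length l. v N i \<in> points T) \<and> points T \<subseteq> (\<Union>i<length l. tball T (v N i) (ls N ! i))"
    by (rule choice[THEN exE])
  have vp: "v N i \<in> points T" if "i < length l" for N i using v that by blast
  obtain s w where s: "strict_mono (s :: nat \<Rightarrow> nat)"
    "\<And>i. i < length l \<Longrightarrow> w i \<in> points T \<and> (\<lambda>N. tdist T (v (s N) i) (w i)) \<longlonglongrightarrow> 0"
    using points_seq_compact_finite[of "length l" v] vp by blast
  have "points T \<subseteq> (\<Union>i<length l. tball T (w i) (l ! i))"
  proof (rule ccontr)
    assume "\<not> ?thesis"
    then obtain p where p: "p \<in> points T" "\<And>i. i < length l \<Longrightarrow> l ! i < tdist T p (w i)"
      by (force simp: tball_def not_le)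
    have "eventually (\<lambda>N. ls (s N) ! i < tdist T p (v (s N) i)) sequentially" if i: "i < length l" for i
    proof -
      have "(\<lambda>N. ls (s N) ! i + tdist T (v (s N) i) (w i)) \<longlonglongrightarrow> l ! i + 0"
        using LIMSEQ_subseq_LIMSEQ[OF lim[OF i] s(1)] s(2)[OF i] by (intro tendsto_add) (auto simp: comp_def)
      then have "eventually (\<lambda>N. ls (s N) ! i + tdist T (v (s N) i) (w i) < tdist T p (w i)) sequentially"
        using p(2)[OF i] by (intro order_tendstoD(2)) auto
      then show ?thesis
      proof eventually_elim
        case (elim N)
        then show ?case using tdist_triangle[OF p(1) vp[OF i, of "s N"], of "w i"] s(2)[OF i] by linarith
      qed
    qed
    then have "eventually (\<lambda>N. \<forall>i\<in>{..<length l}. ls (s N) ! i < tdist T p (v (s N) i)) sequentially"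
      by (intro eventually_ball_finite) auto
    then obtain N where N: "\<And>i. i < length l \<Longrightarrow> ls (s N) ! i < tdist T p (v (s N) i)"
      using eventually_happens'[OF sequentially_bot] by blast
    obtain i where "i < length l" "p \<in> tball T (v (s N) i) (ls (s N) ! i)" using v p(1) by blast
    then show False using N[of i] by (simp add: tball_def)
  qed
  then show ?thesis unfolding covers_list_def using s(2) by blast
qed

lemma edges_nonempty: assumes "\<nexists>x. points T = {x}" shows "edges T \<noteq> {}"
proof
  assume e: "edges T = {}"
  obtain a where a: "a \<in> verts T" using verts_ne by blast
  have "v = a" if "v \<in> verts T" for v
    using connected[OF a that] by (induction rule: rtranclp_induct) (use e in auto)
  then have "verts T = {a}" using a by blast
  then have "points T = {ind a}" unfolding points_def e by (simp add: cell_singleton)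
  then show False using assms by blast
qed

end

text \<open>
  On the covers with \<open>m\<close> balls the count is a finite sum of indicator functions of coordinates.
\<close>
lemma count_measurable:
  assumes A: "A \<in> sets borel"
  shows "(\<lambda>(m, r). of_nat (card {i. i < m \<and> r i \<in> A}) :: ennreal) \<in> borel_measurable (cover_space G)"
proof -
  define k where "k = (\<lambda>(m :: nat, r :: nat \<Rightarrow> real). card {i. i < m \<and> r i \<in> A})"
  have "k \<in> measurable (cover_space G) (count_space UNIV)"
    unfolding measurable_count_space_eq2_countable
  proof (intro conjI ballI)
    fix j :: nat
    have "Pair m -` (k -` {j} \<inter> covers G) \<in> sets (restrict_space (\<Pi>\<^sub>M i\<in>{..<m}. borel) (covers_of_size G m))" if m: "1 \<le> m" for m
    proof -
      let ?P = "\<Pi>\<^sub>M i\<in>{..<m}. (borel :: real measure)"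
      have "(\<lambda>r. \<Sum>i<m. indicat_real A (r i)) \<in> borel_measurable ?P"
        using A by (intro borel_measurable_sum measurable_compose[OF measurable_component_singleton borel_measurable_indicator]) auto
      then have S: "(\<lambda>r. \<Sum>i<m. indicat_real A (r i)) -` {real j} \<inter> space ?P \<in> sets ?P" by (rule measurable_sets) simp
      have card_eq: "(\<Sum>i<m. indicat_real A (r i)) = real (card {i. i < m \<and> r i \<in> A})" for r
      proof -
        have "(\<Sum>i<m. indicat_real A (r i)) = (\<Sum>i\<in>{i. i < m \<and> r i \<in> A}. 1)"
          by (rule sum.mono_neutral_cong_right) (auto simp: indicator_def)
        then show ?thesis by simp
      qed
      have "Pair m -` (k -` {j} \<inter> covers G) = covers_of_size G m \<inter> ((\<lambda>r. \<Sum>i<m. indicat_real A (r i)) -` {real j} \<inter> space ?P)"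
        using m by (auto simp: k_def covers_def card_eq covers_of_size_def space_PiM)
      then show ?thesis using S by (auto simp: sets_restrict_space)
    qed
    then show "k -` {j} \<inter> space (cover_space G) \<in> sets (cover_space G)"
      by (auto simp: sets_cover_space space_cover_space)
  qed auto
  then have "(\<lambda>x. of_nat (k x) :: ennreal) \<in> borel_measurable (cover_space G)"
    by (rule measurable_compose) simp
  moreover have "(\<lambda>(m, r). of_nat (card {i. i < m \<and> r i \<in> A}) :: ennreal) = (\<lambda>x. of_nat (k x))"
    by (rule ext) (simp add: k_def split: prod.split)
  ultimately show ?thesis by (simp only:)
qed

lemma random_cover_measurable:
  assumes M: "M \<in> measurable \<Omega> (count_space UNIV)" and X: "\<And>i. X i \<in> borel_measurable \<Omega>"
    and cov: "\<And>\<omega>. \<omega> \<in> space \<Omega> \<Longrightarrow> (M \<omega>, \<lambda>i\<in>{..<M \<omega>}. X i \<omega>) \<in> covers G"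
  shows "(\<lambda>\<omega>. (M \<omega>, \<lambda>i\<in>{..<M \<omega>}. X i \<omega>)) \<in> measurable \<Omega> (cover_space G)"
proof (rule measurableI)
  fix A assume A: "A \<in> sets (cover_space G)"
  let ?\<Phi> = "\<lambda>\<omega>. (M \<omega>, \<lambda>i\<in>{..<M \<omega>}. X i \<omega>)"
  have "\<forall>m. \<exists>B. B \<in> sets (\<Pi>\<^sub>M i\<in>{..<m}. (borel :: real measure)) \<and> (1 \<le> m \<longrightarrow> Pair m -` A = covers_of_size G m \<inter> B)"
  proof
    fix m
    show "\<exists>B. B \<in> sets (\<Pi>\<^sub>M i\<in>{..<m}. (borel :: real measure)) \<and> (1 \<le> m \<longrightarrow> Pair m -` A = covers_of_size G m \<inter> B)"
    proof (cases "1 \<le> m")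
      case True
      then show ?thesis using A by (auto simp: sets_cover_space sets_restrict_space image_iff)
    qed (use sets.empty_sets in blast)
  qed
  then obtain B where B: "\<forall>m. B m \<in> sets (\<Pi>\<^sub>M i\<in>{..<m}. (borel :: real measure)) \<and> (1 \<le> m \<longrightarrow> Pair m -` A = covers_of_size G m \<inter> B m)"
    by (rule choice[THEN exE])
  have "?\<Phi> -` A \<inter> space \<Omega> = (\<Union>m\<in>{1..}. (M -` {m} \<inter> space \<Omega>) \<inter> ((\<lambda>\<omega>. \<lambda>i\<in>{..<m}. X i \<omega>) -` B m \<inter> space \<Omega>))"
  proof (intro set_eqI iffI)
    fix \<omega> assume w: "\<omega> \<in> ?\<Phi> -` A \<inter> space \<Omega>"
    then have "1 \<le> M \<omega>" using cov[of \<omega>] by (auto simp: covers_def)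
    moreover have "(\<lambda>i\<in>{..<M \<omega>}. X i \<omega>) \<in> Pair (M \<omega>) -` A" using w by simp
    ultimately show "\<omega> \<in> (\<Union>m\<in>{1..}. (M -` {m} \<inter> space \<Omega>) \<inter> ((\<lambda>\<omega>. \<lambda>i\<in>{..<m}. X i \<omega>) -` B m \<inter> space \<Omega>))"
      using B w by (intro UN_I[of "M \<omega>"]) auto
  next
    fix \<omega> assume "\<omega> \<in> (\<Union>m\<in>{1..}. (M -` {m} \<inter> space \<Omega>) \<inter> ((\<lambda>\<omega>. \<lambda>i\<in>{..<m}. X i \<omega>) -` B m \<inter> space \<Omega>))"
    then have w: "\<omega> \<in> space \<Omega>" "1 \<le> M \<omega>" "(\<lambda>i\<in>{..<M \<omega>}. X i \<omega>) \<in> B (M \<omega>)" by auto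
    have "(\<lambda>i\<in>{..<M \<omega>}. X i \<omega>) \<in> covers_of_size G (M \<omega>)" using cov[OF w(1)] by (simp add: covers_def)
    then have "(\<lambda>i\<in>{..<M \<omega>}. X i \<omega>) \<in> Pair (M \<omega>) -` A" using B w(2,3) by blast
    then show "\<omega> \<in> ?\<Phi> -` A \<inter> space \<Omega>" using w(1) by simp
  qed
  also have "\<dots> \<in> sets \<Omega>"
  proof (rule sets.countable_UN'')
    fix m :: nat
    have "M -` {m} \<inter> space \<Omega> \<in> sets \<Omega>" using M by (rule measurable_sets) simp
    moreover have "(\<lambda>\<omega>. \<lambda>i\<in>{..<m}. X i \<omega>) \<in> measurable \<Omega> (\<Pi>\<^sub>M i\<in>{..<m}. borel)"
      by (intro measurable_restrict X)
    then have "(\<lambda>\<omega>. \<lambda>i\<in>{..<m}. X i \<omega>) -` B m \<inter> space \<Omega> \<in> sets \<Omega>"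
      using B by (intro measurable_sets) auto
    ultimately show "(M -` {m} \<inter> space \<Omega>) \<inter> ((\<lambda>\<omega>. \<lambda>i\<in>{..<m}. X i \<omega>) -` B m \<inter> space \<Omega>) \<in> sets \<Omega>"
      by (rule sets.Int)
  qed simp
  finally show "?\<Phi> -` A \<inter> space \<Omega> \<in> sets \<Omega>" .
qed (use cov in \<open>auto simp: space_cover_space\<close>)

text \<open>
  The expected count is a measure, since sums of nonnegative functions can be integrated term by
  term.
\<close>
lemma random_count_measure:
  fixes M :: "'a \<Rightarrow> nat" and X :: "nat \<Rightarrow> 'a \<Rightarrow> real"
  assumes M: "M \<in> measurable \<Omega> (count_space UNIV)" and X: "\<And>i. X i \<in> borel_measurable \<Omega>"
  shows "\<exists>N :: real measure. sets N = sets borel \<and>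
    (\<forall>B\<in>sets borel. emeasure N B = (\<integral>\<^sup>+\<omega>. of_nat (card {i. i < M \<omega> \<and> X i \<omega> \<in> B}) \<partial>\<Omega>))"
proof -
  define h where "h B \<omega> = (\<Sum>i<M \<omega>. indicator B (X i \<omega>) :: ennreal)" for B \<omega>
  define H where "H B = (\<integral>\<^sup>+\<omega>. h B \<omega> \<partial>\<Omega>)" for B
  have h_card: "h B \<omega> = of_nat (card {i. i < M \<omega> \<and> X i \<omega> \<in> B})" for B \<omega>
  proof -
    have "h B \<omega> = (\<Sum>i\<in>{i. i < M \<omega> \<and> X i \<omega> \<in> B}. 1)"
      unfolding h_def by (rule sum.mono_neutral_cong_right) (auto simp: indicator_def)
    then show ?thesis by simp
  qed
  have h_meas: "h B \<in> borel_measurable \<Omega>" if "B \<in> sets borel" for B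
  proof -
    have "h B \<omega> = (\<Sum>i. (if i < M \<omega> then indicator B (X i \<omega>) else 0))" for \<omega>
      unfolding h_def by (subst suminf_finite[of "{..<M \<omega>}"]) auto
    then have "h B = (\<lambda>\<omega>. \<Sum>i. (if i < M \<omega> then indicator B (X i \<omega>) else 0))" by (rule ext)
    moreover have "(\<lambda>\<omega>. if i < M \<omega> then indicator B (X i \<omega>) else 0 :: ennreal) \<in> borel_measurable \<Omega>" for i
    proof (rule measurable_If)
      show "(\<lambda>\<omega>. indicator B (X i \<omega>) :: ennreal) \<in> borel_measurable \<Omega>"
        by (rule measurable_compose[OF X borel_measurable_indicator[OF that]])
      have "M -` {i<..} \<inter> space \<Omega> \<in> sets \<Omega>" by (rule measurable_sets[OF M]) simp
      moreover have "{\<omega> \<in> space \<Omega>. i < M \<omega>} = M -` {i<..} \<inter> space \<Omega>" by auto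
      ultimately show "{\<omega> \<in> space \<Omega>. i < M \<omega>} \<in> sets \<Omega>" by simp
    qed simp
    ultimately show ?thesis by (simp only:) (rule borel_measurable_suminf_order)
  qed
  define N where "N = measure_of UNIV (sets borel) H"
  have setsN: "sets N = sets (borel :: real measure)"
    unfolding N_def using sets.sigma_sets_eq[of "borel :: real measure"] by (simp add: sets_measure_of)
  have "emeasure N B = H B" if "B \<in> sets borel" for B
  proof (rule emeasure_measure_of[OF N_def])
    show "sets borel \<subseteq> Pow (UNIV :: real set)" by simp
    show "positive (sets N) H" by (simp add: positive_def H_def h_def)
    show "countably_additive (sets N) H"
    proof (rule countably_additiveI)
      fix A :: "nat \<Rightarrow> real set" assume A: "range A \<subseteq> sets N" "disjoint_family A"
      have "(\<Sum>n. H (A n)) = (\<integral>\<^sup>+\<omega>. (\<Sum>n. h (A n) \<omega>) \<partial>\<Omega>)"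
        unfolding H_def using A(1) setsN by (intro nn_integral_suminf[symmetric] h_meas) auto
      also have "\<dots> = H (\<Union> (range A))" unfolding H_def
      proof (rule nn_integral_cong)
        fix \<omega>
        have "(\<Sum>n. h (A n) \<omega>) = (\<Sum>i<M \<omega>. \<Sum>n. indicator (A n) (X i \<omega>))"
          unfolding h_def by (rule suminf_sum) simp
        also have "\<dots> = h (\<Union> (range A)) \<omega>"
          unfolding h_def using suminf_indicator[OF A(2)] by simp
        finally show "(\<Sum>n. h (A n) \<omega>) = h (\<Union> (range A)) \<omega>" .
      qed
      finally show "(\<Sum>n. H (A n)) = H (\<Union> (range A))" .
    qed
    show "B \<in> sets N" using that setsN by simp
  qed
  then show ?thesis using setsN by (intro exI[of _ N]) (simp add: H_def h_card)
qed

theorem theorem5p4: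
  fixes T :: "'v weighted_graph" and L D \<rho> :: real
  assumes "finite_weighted_tree T"
    and nontrivial: "\<nexists>x. points T = {x}"
    and "L = total_length T" and "D = tdiameter T" and "\<rho> = metric_radius T"
  shows "\<rho> = D / 2 \<and>
    (\<forall>r. 0 < r \<and> r \<le> L - \<rho> \<longrightarrow>
      (\<exists>\<nu>. prob_space \<nu> \<and>
           sets \<nu> = sets (restrict_space (cover_space T) (short_covers T)) \<and>
           (\<forall>A\<in>sets borel. A \<subseteq> {0..} \<longrightarrow>
              expected_count \<nu> A
                \<le> emeasure (scale_measure (ennreal (L / r)) (uniform_measure lborel {0..r})) A)))"
proof -
  interpret metric_tree T by unfold_locales (rule assms(1))
  have edges_ne: "edges T \<noteq> {}" by (rule edges_nonempty[OF nontrivial])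
  have \<rho>: "\<rho> = D / 2" using radius_half_diameter[OF edges_ne] assms(4,5) by simp
  have L0: "0 < L" using total_length_pos[OF edges_ne] assms(3) by simp
  have "\<exists>\<nu>. prob_space \<nu> \<and>
           sets \<nu> = sets (restrict_space (cover_space T) (short_covers T)) \<and>
           (\<forall>A\<in>sets borel. A \<subseteq> {0..} \<longrightarrow>
              expected_count \<nu> A
                \<le> emeasure (scale_measure (ennreal (L / r)) (uniform_measure lborel {0..r})) A)"
    if r: "0 < r" "r \<le> L - \<rho>" for r
  proof -
    have r': "r \<le> total_length T - tdiameter T / 2" using r \<rho> assms(3,4) by simp
    define c where "c = L / r\<^sup>2"
    have c0: "0 \<le> c" using L0 by (simp add: c_def)
    have "\<exists>(\<Omega> :: real measure) (M :: real \<Rightarrow> nat) (X :: nat \<Rightarrow> real \<Rightarrow> real). prob_space \<Omega>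
    \<and> M \<in> measurable \<Omega> (count_space UNIV) \<and> (\<forall>i. X i \<in> borel_measurable \<Omega>)
    \<and> (\<forall>\<omega>\<in>space \<Omega>. 1 \<le> M \<omega> \<and> (\<forall>i<M \<omega>. X i \<omega> \<in> {0..r}) \<and> covers_list (map (\<lambda>i. X i \<omega>) [0..<M \<omega>]) \<and> (\<Sum>i<M \<omega>. X i \<omega>) \<le> L)
    \<and> (\<forall>\<alpha> \<beta>. \<alpha> < \<beta> \<longrightarrow> (\<integral>\<^sup>+\<omega>. of_nat (card {i. i < M \<omega> \<and> \<alpha> < X i \<omega> \<and> X i \<omega> < \<beta>}) \<partial>\<Omega>) \<le> ennreal (c * (\<beta> - \<alpha>)))"
    proof (rule limit_measure[OF r(1) c0])
      show "covers_list l" if "\<And>N::nat. covers_list (ls N)" "\<And>N. length (ls N) = length l"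
        "\<And>i. i < length l \<Longrightarrow> (\<lambda>N. ls N ! i) \<longlonglongrightarrow> l ! i" for ls l
        by (rule covers_list_closed[OF that])
    next
      fix \<tau> :: real assume "0 < \<tau>"
      from approximate_covers[OF edges_ne r(1) r' this]
      show "\<exists>Ls. Ls \<noteq> [] \<and> (\<forall>rs\<in>set Ls. rs \<noteq> [] \<and> set rs \<subseteq> {0..r} \<and> covers_list rs
        \<and> sum_list rs \<le> (1 + \<tau>) * L + \<tau> * real (length rs))
      \<and> (\<forall>\<alpha> \<beta>. \<alpha> < \<beta> \<longrightarrow> (\<Sum>rs\<leftarrow>Ls. real (length (filter (\<lambda>x. \<alpha> < x \<and> x < \<beta>) rs)))
          \<le> ((c + \<tau>) * (\<beta> - \<alpha>) + \<tau>) * real (length Ls))"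
        unfolding c_def assms(3) .
    qed
    then obtain \<Omega> :: "real measure" and M and X where P: "prob_space \<Omega>" and M: "M \<in> measurable \<Omega> (count_space UNIV)"
      and X: "\<forall>i. X i \<in> borel_measurable \<Omega>"
      and pw: "\<forall>\<omega>\<in>space \<Omega>. 1 \<le> M \<omega> \<and> (\<forall>i<M \<omega>. X i \<omega> \<in> {0..r}) \<and> covers_list (map (\<lambda>i. X i \<omega>) [0..<M \<omega>]) \<and> (\<Sum>i<M \<omega>. X i \<omega>) \<le> L"
      and ex: "\<forall>\<alpha> \<beta>. \<alpha> < \<beta> \<longrightarrow> (\<integral>\<^sup>+\<omega>. of_nat (card {i. i < M \<omega> \<and> \<alpha> < X i \<omega> \<and> X i \<omega> < \<beta>}) \<partial>\<Omega>) \<le> ennreal (c * (\<beta> - \<alpha>))"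
      by (elim exE conjE)
    interpret prob_space \<Omega> by (rule P)
    define \<Phi> where "\<Phi> \<omega> = (M \<omega>, \<lambda>i\<in>{..<M \<omega>}. X i \<omega>)" for \<omega>
    let ?S = "restrict_space (cover_space T) (short_covers T)"
    have \<Phi>_cov: "\<Phi> \<omega> \<in> covers T" and \<Phi>_short: "\<Phi> \<omega> \<in> short_covers T" if w: "\<omega> \<in> space \<Omega>" for \<omega>
    proof -
      have w': "1 \<le> M \<omega>" "\<And>i. i < M \<omega> \<Longrightarrow> X i \<omega> \<in> {0..r}" "(\<Sum>i<M \<omega>. X i \<omega>) \<le> L"
        "covers_list (map (\<lambda>i. X i \<omega>) [0..<M \<omega>])" using pw w by blast+
      obtain v where v: "\<forall>i<M \<omega>. v i \<in> points T" "points T \<subseteq> (\<Union>i<M \<omega>. tball T (v i) (map (\<lambda>i. X i \<omega>) [0..<M \<omega>] ! i))"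
        using w'(4) unfolding covers_list_def by auto
      have "(\<Union>i<M \<omega>. tball T (v i) (map (\<lambda>i. X i \<omega>) [0..<M \<omega>] ! i)) = (\<Union>i<M \<omega>. tball T (v i) ((\<lambda>i\<in>{..<M \<omega>}. X i \<omega>) i))"
        by (intro SUP_cong refl) simp
      then have "(\<lambda>i\<in>{..<M \<omega>}. X i \<omega>) \<in> covers_of_size T (M \<omega>)"
        unfolding covers_of_size_def using v w'(2) by (auto intro!: exI[of _ v])
      then show "\<Phi> \<omega> \<in> covers T" using w'(1) by (simp add: covers_def \<Phi>_def)
      moreover have "(\<Sum>i<M \<omega>. (\<lambda>i\<in>{..<M \<omega>}. X i \<omega>) i) \<le> total_length T" using w'(3) assms(3) by simp
      ultimately show "\<Phi> \<omega> \<in> short_covers T" by (simp add: short_covers_def \<Phi>_def)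
    qed
    have "\<Phi> \<in> measurable \<Omega> (cover_space T)"
      unfolding \<Phi>_def using \<Phi>_cov X by (intro random_cover_measurable[OF M]) (auto simp: \<Phi>_def)
    then have \<Phi>m: "\<Phi> \<in> measurable \<Omega> ?S" using \<Phi>_short by (intro measurable_restrict_space2) auto
    define \<nu> where "\<nu> = distr \<Omega> ?S \<Phi>"
    have "prob_space \<nu>" unfolding \<nu>_def by (rule prob_space_distr[OF \<Phi>m])
    moreover have "sets \<nu> = sets ?S" by (simp add: \<nu>_def)
    moreover have "expected_count \<nu> A \<le> emeasure (scale_measure (ennreal (L / r)) (uniform_measure lborel {0..r})) A"
      if A: "A \<in> sets borel" for A
    proof -
      define B where "B = {0..r} \<inter> A"
      have B: "B \<in> sets borel" "B \<subseteq> {0..r}" using A by (auto simp: B_def)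
      have X': "X i \<in> borel_measurable \<Omega>" for i using X by (rule spec)
      from random_count_measure[where X = X, OF M X'] obtain N :: "real measure" where N1: "sets N = sets borel" and
        N2: "\<forall>B\<in>sets borel. emeasure N B = (\<integral>\<^sup>+\<omega>. of_nat (card {i. i < M \<omega> \<and> X i \<omega> \<in> B}) \<partial>\<Omega>)"
        by (elim exE conjE)
      have "(\<lambda>(m, r). of_nat (card {i. i < m \<and> r i \<in> A}) :: ennreal) \<in> borel_measurable ?S"
        by (rule measurable_restrict_space1[OF count_measurable[OF A]])
      then have count: "(\<lambda>(m, r). of_nat (card {i. i < m \<and> r i \<in> A}) :: ennreal) \<in> borel_measurable (distr \<Omega> ?S \<Phi>)"
        by (simp only: measurable_distr_eq1)
      have "expected_count \<nu> A = (\<integral>\<^sup>+\<omega>. (case \<Phi> \<omega> of (m, r) \<Rightarrow> of_nat (card {i. i < m \<and> r i \<in> A})) \<partial>\<Omega>)"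
        unfolding expected_count_def \<nu>_def
        by (rule nn_integral_distr[OF \<Phi>m count])
      also have "\<dots> = (\<integral>\<^sup>+\<omega>. of_nat (card {i. i < M \<omega> \<and> X i \<omega> \<in> B}) \<partial>\<Omega>)"
      proof (rule nn_integral_cong)
        fix \<omega> assume "\<omega> \<in> space \<Omega>"
        then have "\<forall>i<M \<omega>. X i \<omega> \<in> {0..r}" using pw by blast
        then have "{i. i < M \<omega> \<and> (\<lambda>i\<in>{..<M \<omega>}. X i \<omega>) i \<in> A} = {i. i < M \<omega> \<and> X i \<omega> \<in> B}" by (auto simp: B_def)
        then show "(case \<Phi> \<omega> of (m, r) \<Rightarrow> (of_nat (card {i. i < m \<and> r i \<in> A}) :: ennreal))
          = of_nat (card {i. i < M \<omega> \<and> X i \<omega> \<in> B})" by (simp add: \<Phi>_def)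
      qed
      also have "\<dots> = emeasure N B" by (rule N2[rule_format, OF B(1), symmetric])
      also have "\<dots> \<le> ennreal c * emeasure lborel B"
      proof (rule emeasure_le_lborel[OF N1 c0 _ B])
        fix a b :: real assume "a < b"
        then show "emeasure N {a<..<b} \<le> ennreal (c * (b - a))" using ex N2 by simp
      qed
      also have "\<dots> = ennreal (L / r) * (emeasure lborel B / ennreal r)"
      proof -
        have "ennreal c = ennreal (L / r) * inverse (ennreal r)"
          using r(1) L0 by (simp add: c_def inverse_ennreal ennreal_mult[symmetric] power2_eq_square divide_inverse mult.assoc)
        then show ?thesis by (simp add: divide_ennreal_def mult_ac)
      qed
      also have "\<dots> = emeasure (scale_measure (ennreal (L / r)) (uniform_measure lborel {0..r})) A"
        using A r(1) by (simp add: B_def)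
      finally show ?thesis .
    qed
    ultimately show ?thesis by blast
  qed
  then show ?thesis using \<rho> by blast
qed

end
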